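(* Let $f\colon M\to N$ be a $C^r_{\mathbb K}$-submersion between $C^r_{\mathbb K}$-manifolds modelled on locally convex topological $\mathbb K$-vector spaces. Then, for each $C^r_{\mathbb K}$-submanifold $S$ of $N$, the preimage $f^{-1}(S)$ is a (not necessarily pure) $C^r_{\mathbb K}$-submanifold of $M$, and $f$ restricts to a $C^r_{\mathbb K}$-submersion $f^{-1}(S)\to S$. Moreover, $T_x(f^{-1}(S))=(T_xf)^{-1}(T_{f(x)}S)$ for each $x\in f^{-1}(S)$. If $S$ has finite codimension $k$ in $N$, then also $f^{-1}(S)$ has codimension $k$ in $M$. If $S$ is a split $C^r_{\mathbb K}$-submanifold of $N$, then $f^{-1}(S)$ is a split $C^r_{\mathbb K}$-submanifold of $M$.
   Context: Conventions: $\mathbb K\in\{\mathbb R,\mathbb C\}$. If $\mathbb K=\mathbb R$, then $r\in\{1,2,\ldots\}\cup\{\infty,\omega\}$; if $\mathbb K=\mathbb C$, then $r=\omega$. All topological spaces and topological vector spaces are Hausdorff. For open subsets of locally convex spaces, $C^r_{\mathbb R}$ with $r\in\mathbb N\cup\{\infty\}$ means: continuous, with iterated directional derivatives $d^{k}f(x;y_1,\ldots,y_k)$ existing for all $k\le r$ and continuous in $(x,y_1,\ldots,y_k)$; $C^\omega_{\mathbb C}$ means complex analytic (continuous and locally given by a convergent series of continuous homogeneous polynomials); $C^\omega_{\mathbb R}$ means real analytic (locally extends to a complex analytic map between the complexifications). A $C^r_{\mathbb K}$-manifold modelled on a locally convex space $E$ is a Hausdorff space with a maximal atlas of charts $\phi\colon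 U_\phi\to V_\phi$ (homeomorphisms from open subsets of the manifold onto open subsets of $E$) with $C^r_{\mathbb K}$ transition maps; such a manifold is called pure. A not necessarily pure $C^r_{\mathbb K}$-manifold is a topological space with open connected components, each component $C$ being given a $C^r_{\mathbb K}$-manifold structure modelled on some locally convex space $F_C$. Submersions: let $M$, $N$ be modelled on $E$, $F$. A $C^r_{\mathbb K}$-map $f\colon M\to N$ is a $C^r_{\mathbb K}$-submersion if for each $x\in M$ there are charts $\phi\colon U_\phi\to V_\phi\subseteq E$ of $M$ with $x\in U_\phi$ and $\psi\colon U_\psi\to V_\psi\subseteq F$ of $N$ with $f(x)\in U_\psi$ such that $f(U_\phi)\subseteq U_\psi$ and $\psi\circ f\circ\phi^{-1}=\pi|_{V_\phi}$ for a continuous linear map $\pi\colon E\to F$ having a continuous linear right inverse. If the manifolds are not necessarily pure, the same local definition is used, with the modelling spaces of the components in question. Submanifolds: let $M$ be a $C^r_{\mathbb K}$-manifold modelled on $E$ and $F\subseteq E$ a closed vector subspace. A subset $N\subseteq M$ is a $C^r_{\mathbb K}$-submanifold modelled on $F$ if each $x\in N$ is in the domain of a chart $\phi\colon U_\phi\to V_\phi\subseteq E$ of $M$ with $\phi(U_\phi\cap N)=V_\phi\cap F$; then $N$ is a $C^r_{\mathbb K}$-manifold with the restricted charts, and $T_xN$ is identified with a vector subspace of $T_xM$. If $\dim_{\mathbb K}(E/F)=k<\infty$, then $N$ has codimension $k$. $N$ is split if $F$ is complemented in $E$ as a topological vector space (i.e. there is a vector subspace $C\subseteq E$ such that addition $F\times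 C\to E$ is an isomorphism of topological vector spaces). A subset $N\subseteq M$ is a not necessarily pure (split) $C^r_{\mathbb K}$-submanifold if all connected components $C$ of $N$ are open in $N$ and each is a (split) $C^r_{\mathbb K}$-submanifold of $M$ modelled on some closed vector subspace $F_C\subseteq E$; it has codimension $k$ if each component has. The word "submanifold" without "not necessarily pure" in the hypothesis on $S$ means a pure one. *)

theory Defs
  imports "HOL-Analysis.Analysis"
begin

section \<open>Scalars and locally convex spaces\<close>

text \<open>
  The ground field is a type \<open>'k\<close> of class \<open>real_or_complex\<close>. The norm of a
  \<open>real_normed_field\<close> is multiplicative, so the only instances up to isometric isomorphism are
  \<open>real\<close> and \<open>complex\<close>.
\<close>

class real_or_complex = real_normed_field +
  assumes real_or_complex:
    "(\<forall>z. \<exists>a. z = a *\<^sub>R 1) \<or>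
     (\<exists>i. i * i = - 1 \<and> (\<forall>z. \<exists>a b. z = a *\<^sub>R 1 + b *\<^sub>R i))"

instance real :: real_or_complex
  by standard simp

instance complex :: real_or_complex
proof
  have "z = Re z *\<^sub>R 1 + Im z *\<^sub>R \<i>" for z
    by (simp add: complex_eq_iff)
  then show "(\<forall>z::complex. \<exists>a. z = a *\<^sub>R 1) \<or>
      (\<exists>i::complex. i * i = - 1 \<and> (\<forall>z. \<exists>a b. z = a *\<^sub>R 1 + b *\<^sub>R i))"
    by (metis i_squared)
qed

definition real_scalars :: "'k::real_or_complex itself \<Rightarrow> bool" where
  "real_scalars _ \<longleftrightarrow> (\<forall>z::'k. z \<in> \<real>)"

locale locally_convex_space = vector_space scale
  for scale :: "'k::real_or_complex \<Rightarrow> 'e::{topological_ab_group_add, t2_space} \<Rightarrow> 'e" +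
  assumes continuous_scale: "continuous_on UNIV (\<lambda>(c, x). scale c x)"
    and convex_neighbourhoods:
      "\<And>U. open U \<Longrightarrow> 0 \<in> U \<Longrightarrow> \<exists>V. open V \<and> 0 \<in> V \<and> V \<subseteq> U \<and>
        (\<forall>x\<in>V. \<forall>y\<in>V. \<forall>a\<in>{0..1}. scale (of_real a) x + scale (of_real (1 - a)) y \<in> V)"

text \<open>
  Modelling spaces are vector subspaces of an ambient locally convex type, with the induced topology;
  the ambient space itself is \<open>UNIV\<close>. A map between subspaces is a function on the ambient
  types of which only the values on the subspace matter.
\<close>

definition continuous_linear_on ::
    "('k \<Rightarrow> 'e \<Rightarrow> 'e) \<Rightarrow> ('k \<Rightarrow> 'f \<Rightarrow> 'f) \<Rightarrow> 'e::{ab_group_add, t2_space} set \<Rightarrow>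
     'f::{ab_group_add, t2_space} set \<Rightarrow> ('e \<Rightarrow> 'f) \<Rightarrow> bool" where
  "continuous_linear_on s t F G p \<longleftrightarrow> p ` F \<subseteq> G \<and> continuous_on F p \<and>
     (\<forall>x\<in>F. \<forall>y\<in>F. p (x + y) = p x + p y) \<and> (\<forall>c. \<forall>x\<in>F. p (s c x) = t c (p x))"

definition complemented ::
    "('k::field \<Rightarrow> 'e \<Rightarrow> 'e) \<Rightarrow> 'e::{ab_group_add, t2_space} set \<Rightarrow> bool" where
  "complemented s F \<longleftrightarrow> (\<exists>C. module.subspace s C \<and>
     homeomorphic_map (top_of_set (F \<times> C)) euclidean (\<lambda>(x, y). x + y))"

text \<open>
  \<open>F\<close> has codimension \<open>k\<close>: the residue classes of some \<open>k\<close> vectors form a basis of the quotient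
  of the ambient space by \<open>F\<close>. The first condition on \<open>B\<close> is linear independence modulo \<open>F\<close>
  (so the classes are distinct), the second says that the classes span.
\<close>

definition has_codim ::
    "('k::field \<Rightarrow> 'e \<Rightarrow> 'e) \<Rightarrow> 'e::ab_group_add set \<Rightarrow> nat \<Rightarrow> bool" where
  "has_codim s F k \<longleftrightarrow> (\<exists>B. finite B \<and> card B = k \<and>
     (\<forall>c. (\<Sum>b\<in>B. s (c b) b) \<in> F \<longrightarrow> (\<forall>b\<in>B. c b = 0)) \<and>
     (\<forall>x. \<exists>c. x - (\<Sum>b\<in>B. s (c b) b) \<in> F))"

section \<open>Differentiable and analytic maps\<close>

datatype regularity = Finite nat | Infinite | Analytic

definition admissible_regularity :: "'k::real_or_complex itself \<Rightarrow> regularity \<Rightarrow> bool" where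
  "admissible_regularity K r \<longleftrightarrow>
     (if real_scalars K then r \<noteq> Finite 0 else r = Analytic)"

definition diff_quot ::
    "('k::real_normed_field \<Rightarrow> 'e \<Rightarrow> 'e) \<Rightarrow> ('k \<Rightarrow> 'f \<Rightarrow> 'f) \<Rightarrow>
     ('e::ab_group_add \<Rightarrow> 'f::ab_group_add) \<Rightarrow> 'e \<Rightarrow> 'e \<Rightarrow> 'k \<Rightarrow> 'f" where
  "diff_quot s t f x v h = t (inverse h) (f (x + s h v) - f x)"

definition dir_deriv ::
    "('k::real_normed_field \<Rightarrow> 'e \<Rightarrow> 'e) \<Rightarrow> ('k \<Rightarrow> 'f \<Rightarrow> 'f) \<Rightarrow>
     ('e::ab_group_add \<Rightarrow> 'f::{ab_group_add, t2_space}) \<Rightarrow> 'e \<Rightarrow> 'e \<Rightarrow> 'f" where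
  "dir_deriv s t f x v = Lim (at 0) (diff_quot s t f x v)"

text \<open>
  \<open>iter_dir_deriv s t k f x y\<close> is the iterated directional derivative of order \<open>k\<close> at \<open>x\<close> in the
  directions \<open>y 0, \<dots>, y (k - 1)\<close>.
\<close>

primrec iter_dir_deriv ::
    "('k::real_normed_field \<Rightarrow> 'e \<Rightarrow> 'e) \<Rightarrow> ('k \<Rightarrow> 'f \<Rightarrow> 'f) \<Rightarrow> nat \<Rightarrow>
     ('e::ab_group_add \<Rightarrow> 'f::{ab_group_add, t2_space}) \<Rightarrow> 'e \<Rightarrow> (nat \<Rightarrow> 'e) \<Rightarrow> 'f" where
  "iter_dir_deriv s t 0 f x y = f x"
| "iter_dir_deriv s t (Suc k) f x y = dir_deriv s t (\<lambda>z. iter_dir_deriv s t k f z y) x (y k)"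

text \<open>
  In the following definitions \<open>U\<close> is a relatively open subset of the subspace \<open>F\<close>, and \<open>f\<close> maps
  \<open>U\<close> into the subspace \<open>G\<close>. The power \<open>F\<^sup>k\<close> is the set \<open>{..<k} \<rightarrow>\<^sub>E F\<close> of extensional functions
  with the topology induced from the product topology on functions.
\<close>

definition Ck_on ::
    "('k::real_normed_field \<Rightarrow> 'e \<Rightarrow> 'e) \<Rightarrow> ('k \<Rightarrow> 'f \<Rightarrow> 'f) \<Rightarrow>
     'e::{ab_group_add, t2_space} set \<Rightarrow> 'f::{ab_group_add, t2_space} set \<Rightarrow> nat \<Rightarrow>
     'e set \<Rightarrow> ('e \<Rightarrow> 'f) \<Rightarrow> bool" where
  "Ck_on s t F G n U f \<longleftrightarrow> f ` U \<subseteq> G \<and>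
     (\<forall>k<n. \<forall>x\<in>U. \<forall>y\<in>{..<Suc k} \<rightarrow>\<^sub>E F. \<exists>D\<in>G.
        (diff_quot s t (\<lambda>z. iter_dir_deriv s t k f z y) x (y k) \<longlongrightarrow> D) (at 0)) \<and>
     (\<forall>k\<le>n. continuous_on (U \<times> ({..<k} \<rightarrow>\<^sub>E F)) (\<lambda>(x, y). iter_dir_deriv s t k f x y))"

definition multilinear_on ::
    "('k \<Rightarrow> 'e \<Rightarrow> 'e) \<Rightarrow> ('k \<Rightarrow> 'f \<Rightarrow> 'f) \<Rightarrow> 'e::ab_group_add set \<Rightarrow> 'f::ab_group_add set \<Rightarrow>
     nat \<Rightarrow> ((nat \<Rightarrow> 'e) \<Rightarrow> 'f) \<Rightarrow> bool" where
  "multilinear_on s t F G n \<beta> \<longleftrightarrow> \<beta> ` ({..<n} \<rightarrow>\<^sub>E F) \<subseteq> G \<and>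
     (\<forall>i<n. \<forall>y\<in>{..<n} \<rightarrow>\<^sub>E F.
        (\<forall>u\<in>F. \<forall>v\<in>F. \<beta> (y(i := u + v)) = \<beta> (y(i := u)) + \<beta> (y(i := v))) \<and>
        (\<forall>c. \<forall>u\<in>F. \<beta> (y(i := s c u)) = t c (\<beta> (y(i := u)))))"

definition homogeneous_polynomial_on ::
    "('k \<Rightarrow> 'e \<Rightarrow> 'e) \<Rightarrow> ('k \<Rightarrow> 'f \<Rightarrow> 'f) \<Rightarrow> 'e::{ab_group_add, t2_space} set \<Rightarrow>
     'f::{ab_group_add, t2_space} set \<Rightarrow> nat \<Rightarrow> ('e \<Rightarrow> 'f) \<Rightarrow> bool" where
  "homogeneous_polynomial_on s t F G n p \<longleftrightarrow>
     (\<exists>\<beta>. multilinear_on s t F G n \<beta> \<and> continuous_on ({..<n} \<rightarrow>\<^sub>E F) \<beta> \<and>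
          (\<forall>v\<in>F. p v = \<beta> (\<lambda>i\<in>{..<n}. v)))"

definition power_series_on ::
    "('k \<Rightarrow> 'e \<Rightarrow> 'e) \<Rightarrow> ('k \<Rightarrow> 'f \<Rightarrow> 'f) \<Rightarrow> 'e::{ab_group_add, t2_space} set \<Rightarrow>
     'f::{ab_group_add, t2_space} set \<Rightarrow> 'e set \<Rightarrow> ('e \<Rightarrow> 'f) \<Rightarrow> bool" where
  "power_series_on s t F G U f \<longleftrightarrow> f ` U \<subseteq> G \<and> continuous_on U f \<and>
     (\<forall>x\<in>U. \<exists>p V. (\<forall>n. homogeneous_polynomial_on s t F G n (p n)) \<and>
        openin (top_of_set F) V \<and> 0 \<in> V \<and>
        (\<forall>v\<in>V. x + v \<in> U \<and> (\<lambda>n. p n v) sums f (x + v)))"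

text \<open>The scalar multiplication on the complexification \<open>E \<oplus> iE\<close> of a real space \<open>E\<close>.\<close>

definition complexified_scale ::
    "('k::real_or_complex \<Rightarrow> 'e \<Rightarrow> 'e) \<Rightarrow> complex \<Rightarrow> 'e::ab_group_add \<times> 'e \<Rightarrow> 'e \<times> 'e" where
  "complexified_scale s z = (\<lambda>(x, y).
     (s (of_real (Re z)) x - s (of_real (Im z)) y,
      s (of_real (Re z)) y + s (of_real (Im z)) x))"

definition real_analytic_on ::
    "('k::real_or_complex \<Rightarrow> 'e \<Rightarrow> 'e) \<Rightarrow> ('k \<Rightarrow> 'f \<Rightarrow> 'f) \<Rightarrow>
     'e::{ab_group_add, t2_space} set \<Rightarrow> 'f::{ab_group_add, t2_space} set \<Rightarrow>
     'e set \<Rightarrow> ('e \<Rightarrow> 'f) \<Rightarrow> bool" where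
  "real_analytic_on s t F G U f \<longleftrightarrow> f ` U \<subseteq> G \<and>
     (\<forall>x\<in>U. \<exists>W g. openin (top_of_set (F \<times> F)) W \<and> (x, 0) \<in> W \<and>
        power_series_on (complexified_scale s) (complexified_scale t) (F \<times> F) (G \<times> G) W g \<and>
        (\<forall>u. (u, 0) \<in> W \<longrightarrow> u \<in> U \<and> g (u, 0) = (f u, 0)))"

definition Cr_on ::
    "regularity \<Rightarrow> ('k::real_or_complex \<Rightarrow> 'e \<Rightarrow> 'e) \<Rightarrow> ('k \<Rightarrow> 'f \<Rightarrow> 'f) \<Rightarrow>
     'e::{ab_group_add, t2_space} set \<Rightarrow> 'f::{ab_group_add, t2_space} set \<Rightarrow>
     'e set \<Rightarrow> ('e \<Rightarrow> 'f) \<Rightarrow> bool" where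
  "Cr_on r s t F G U f \<longleftrightarrow>
     (case r of
        Finite n \<Rightarrow> Ck_on s t F G n U f
      | Infinite \<Rightarrow> (\<forall>n. Ck_on s t F G n U f)
      | Analytic \<Rightarrow>
          if real_scalars TYPE('k) then real_analytic_on s t F G U f
          else power_series_on s t F G U f)"

section \<open>Manifolds\<close>

text \<open>
  Each chart records its own modelling space, so that the charts of a manifold that is not
  necessarily pure can be collected in one set. Only the values of \<open>chart_map\<close> on \<open>chart_dom\<close>
  matter.
\<close>

datatype ('m, 'e) chart =
  Chart (chart_model: "'e set") (chart_dom: "'m set") (chart_map: "'m \<Rightarrow> 'e")

definition chart_image :: "('m, 'e) chart \<Rightarrow> 'e set" where
  "chart_image c = chart_map c ` chart_dom c"

definition chart_inv :: "('m, 'e) chart \<Rightarrow> 'e \<Rightarrow> 'm" where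
  "chart_inv c = inv_into (chart_dom c) (chart_map c)"

definition is_chart :: "'e::t2_space set \<Rightarrow> 'm topology \<Rightarrow> ('m, 'e) chart \<Rightarrow> bool" where
  "is_chart F X c \<longleftrightarrow> chart_model c = F \<and> openin X (chart_dom c) \<and>
     openin (top_of_set F) (chart_image c) \<and>
     homeomorphic_map (subtopology X (chart_dom c)) (top_of_set (chart_image c)) (chart_map c)"

text \<open>The map \<open>f\<close> read in the charts \<open>c\<close> and \<open>d\<close> (a transition map for \<open>f = id\<close>).\<close>

definition local_rep ::
    "('m, 'e) chart \<Rightarrow> ('n, 'f) chart \<Rightarrow> ('m \<Rightarrow> 'n) \<Rightarrow> 'e \<Rightarrow> 'f" where
  "local_rep c d f = chart_map d \<circ> f \<circ> chart_inv c"

definition Cr_in_charts ::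
    "regularity \<Rightarrow> ('k::real_or_complex \<Rightarrow> 'e \<Rightarrow> 'e) \<Rightarrow> ('k \<Rightarrow> 'f \<Rightarrow> 'f) \<Rightarrow>
     ('m, 'e::{ab_group_add, t2_space}) chart \<Rightarrow> ('n, 'f::{ab_group_add, t2_space}) chart \<Rightarrow>
     ('m \<Rightarrow> 'n) \<Rightarrow> bool" where
  "Cr_in_charts r s t c d f \<longleftrightarrow>
     Cr_on r s t (chart_model c) (chart_model d)
       (chart_map c ` (chart_dom c \<inter> f -` chart_dom d)) (local_rep c d f)"

definition compatible ::
    "regularity \<Rightarrow> ('k::real_or_complex \<Rightarrow> 'e \<Rightarrow> 'e) \<Rightarrow>
     ('m, 'e::{ab_group_add, t2_space}) chart \<Rightarrow> ('m, 'e) chart \<Rightarrow> bool" where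
  "compatible r s c d \<longleftrightarrow> Cr_in_charts r s s c d id \<and> Cr_in_charts r s s d c id"

text \<open>All charts modelled on \<open>F\<close> that are compatible with the charts in \<open>A\<close>.\<close>

definition maximal_atlas ::
    "regularity \<Rightarrow> ('k::real_or_complex \<Rightarrow> 'e \<Rightarrow> 'e) \<Rightarrow> 'e::{ab_group_add, t2_space} set \<Rightarrow>
     'm topology \<Rightarrow> ('m, 'e) chart set \<Rightarrow> ('m, 'e) chart set" where
  "maximal_atlas r s F X A = {c. is_chart F X c \<and> (\<forall>d\<in>A. compatible r s c d)}"

text \<open>
  The equation \<open>A = maximal_atlas r s F X A\<close> says that the elements of \<open>A\<close> are pairwise
  compatible charts and that \<open>A\<close> is maximal with this property.
\<close>

definition manifold ::
    "regularity \<Rightarrow> ('k::real_or_complex \<Rightarrow> 'e \<Rightarrow> 'e) \<Rightarrow> 'e::{ab_group_add, t2_space} set \<Rightarrow>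
     'm topology \<Rightarrow> ('m, 'e) chart set \<Rightarrow> bool" where
  "manifold r s F X A \<longleftrightarrow> module.subspace s F \<and> Hausdorff_space X \<and>
     (\<Union>c\<in>A. chart_dom c) = topspace X \<and> A = maximal_atlas r s F X A"

definition Cr_map ::
    "regularity \<Rightarrow>
     ('k::real_or_complex \<Rightarrow> 'e \<Rightarrow> 'e) \<Rightarrow> 'm topology \<Rightarrow> ('m, 'e::{ab_group_add, t2_space}) chart set \<Rightarrow>
     ('k \<Rightarrow> 'f \<Rightarrow> 'f) \<Rightarrow> 'n topology \<Rightarrow> ('n, 'f::{ab_group_add, t2_space}) chart set \<Rightarrow>
     ('m \<Rightarrow> 'n) \<Rightarrow> bool" where
  "Cr_map r s X A t Y B f \<longleftrightarrow>
     continuous_map X Y f \<and> (\<forall>c\<in>A. \<forall>d\<in>B. Cr_in_charts r s t c d f)"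

definition submersion ::
    "regularity \<Rightarrow>
     ('k::real_or_complex \<Rightarrow> 'e \<Rightarrow> 'e) \<Rightarrow> 'm topology \<Rightarrow> ('m, 'e::{ab_group_add, t2_space}) chart set \<Rightarrow>
     ('k \<Rightarrow> 'f \<Rightarrow> 'f) \<Rightarrow> 'n topology \<Rightarrow> ('n, 'f::{ab_group_add, t2_space}) chart set \<Rightarrow>
     ('m \<Rightarrow> 'n) \<Rightarrow> bool" where
  "submersion r s X A t Y B f \<longleftrightarrow> Cr_map r s X A t Y B f \<and>
     (\<forall>x\<in>topspace X. \<exists>c\<in>A. \<exists>d\<in>B. x \<in> chart_dom c \<and> f x \<in> chart_dom d \<and>
        f ` chart_dom c \<subseteq> chart_dom d \<and>
        (\<exists>\<pi> \<sigma>. continuous_linear_on s t (chart_model c) (chart_model d) \<pi> \<and>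
               continuous_linear_on t s (chart_model d) (chart_model c) \<sigma> \<and>
               (\<forall>w\<in>chart_model d. \<pi> (\<sigma> w) = w) \<and>
               (\<forall>v\<in>chart_image c. local_rep c d f v = \<pi> v)))"

section \<open>Tangent spaces\<close>

text \<open>
  A tangent vector at \<open>x\<close> is an equivalence class of pairs of a chart around \<open>x\<close> and a vector of
  its modelling space, where vectors are related by the differentials of the transition maps.
\<close>

definition tangent_rep :: "('m, 'e) chart set \<Rightarrow> 'm \<Rightarrow> (('m, 'e) chart \<times> 'e) set" where
  "tangent_rep A x = (SIGMA c:{c \<in> A. x \<in> chart_dom c}. chart_model c)"

definition tangent_rel ::
    "('k::real_normed_field \<Rightarrow> 'e \<Rightarrow> 'e) \<Rightarrow> ('m, 'e::{ab_group_add, t2_space}) chart set \<Rightarrow> 'm \<Rightarrow>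
     (('m, 'e) chart \<times> 'e) rel" where
  "tangent_rel s A x =
     {((c, v), (d, w)). (c, v) \<in> tangent_rep A x \<and> (d, w) \<in> tangent_rep A x \<and>
        w = dir_deriv s s (local_rep c d id) (chart_map c x) v}"

definition tangent_space ::
    "('k::real_normed_field \<Rightarrow> 'e \<Rightarrow> 'e) \<Rightarrow> ('m, 'e::{ab_group_add, t2_space}) chart set \<Rightarrow> 'm \<Rightarrow>
     (('m, 'e) chart \<times> 'e) set set" where
  "tangent_space s A x = tangent_rep A x // tangent_rel s A x"

definition tangent_map ::
    "('k::real_normed_field \<Rightarrow> 'e \<Rightarrow> 'e) \<Rightarrow> ('k \<Rightarrow> 'f \<Rightarrow> 'f) \<Rightarrow>
     ('n, 'f::{ab_group_add, t2_space}) chart set \<Rightarrow> ('m \<Rightarrow> 'n) \<Rightarrow> 'm \<Rightarrow>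
     (('m, 'e::{ab_group_add, t2_space}) chart \<times> 'e) set \<Rightarrow> (('n, 'f) chart \<times> 'f) set" where
  "tangent_map s t B f x \<tau> =
     {(d, w). (d, w) \<in> tangent_rep B (f x) \<and>
        (\<exists>(c, v)\<in>\<tau>. w = dir_deriv s t (local_rep c d f) (chart_map c x) v)}"

section \<open>Submanifolds\<close>

text \<open>\<open>A\<close> is the maximal atlas of the ambient manifold with underlying space \<open>X\<close>.\<close>

definition submanifold ::
    "('k::real_or_complex \<Rightarrow> 'e \<Rightarrow> 'e) \<Rightarrow> 'm topology \<Rightarrow> ('m, 'e::{ab_group_add, t2_space}) chart set \<Rightarrow>
     'e set \<Rightarrow> 'm set \<Rightarrow> bool" where
  "submanifold s X A F N \<longleftrightarrow> N \<subseteq> topspace X \<and> module.subspace s F \<and> closed F \<and>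
     (\<forall>x\<in>N. \<exists>c\<in>A. x \<in> chart_dom c \<and>
        chart_map c ` (chart_dom c \<inter> N) = chart_image c \<inter> F)"

definition restricted_charts ::
    "('m, 'e) chart set \<Rightarrow> 'e set \<Rightarrow> 'm set \<Rightarrow> ('m, 'e) chart set" where
  "restricted_charts A F N =
     {Chart F (chart_dom c \<inter> N) (chart_map c) | c.
        c \<in> A \<and> chart_map c ` (chart_dom c \<inter> N) = chart_image c \<inter> F}"

definition submanifold_atlas ::
    "regularity \<Rightarrow> ('k::real_or_complex \<Rightarrow> 'e \<Rightarrow> 'e) \<Rightarrow> 'm topology \<Rightarrow>
     ('m, 'e::{ab_group_add, t2_space}) chart set \<Rightarrow> 'e set \<Rightarrow> 'm set \<Rightarrow> ('m, 'e) chart set" where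
  "submanifold_atlas r s X A F N =
     maximal_atlas r s F (subtopology X N) (restricted_charts A F N)"

text \<open>
  Not necessarily pure submanifolds: \<open>\<Phi> C\<close> is the modelling space of the connected component \<open>C\<close>.
\<close>

definition np_submanifold ::
    "('k::real_or_complex \<Rightarrow> 'e \<Rightarrow> 'e) \<Rightarrow> 'm topology \<Rightarrow> ('m, 'e::{ab_group_add, t2_space}) chart set \<Rightarrow>
     ('m set \<Rightarrow> 'e set) \<Rightarrow> 'm set \<Rightarrow> bool" where
  "np_submanifold s X A \<Phi> N \<longleftrightarrow> N \<subseteq> topspace X \<and>
     (\<forall>C\<in>connected_components_of (subtopology X N).
        openin (subtopology X N) C \<and> submanifold s X A (\<Phi> C) C)"

definition np_submanifold_atlas ::
    "regularity \<Rightarrow> ('k::real_or_complex \<Rightarrow> 'e \<Rightarrow> 'e) \<Rightarrow> 'm topology \<Rightarrow>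
     ('m, 'e::{ab_group_add, t2_space}) chart set \<Rightarrow> ('m set \<Rightarrow> 'e set) \<Rightarrow> 'm set \<Rightarrow>
     ('m, 'e) chart set" where
  "np_submanifold_atlas r s X A \<Phi> N =
     (\<Union>C\<in>connected_components_of (subtopology X N). submanifold_atlas r s X A (\<Phi> C) C)"

text \<open>
  The tangent space at \<open>x\<close> of a submanifold with atlas \<open>A'\<close>, as a subset of the tangent space of the
  ambient manifold with atlas \<open>A\<close>: the image under the tangent map of the inclusion.
\<close>

definition embedded_tangent_space ::
    "('k::real_normed_field \<Rightarrow> 'e \<Rightarrow> 'e) \<Rightarrow> ('m, 'e::{ab_group_add, t2_space}) chart set \<Rightarrow>
     ('m, 'e) chart set \<Rightarrow> 'm \<Rightarrow> (('m, 'e) chart \<times> 'e) set set" where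
  "embedded_tangent_space s A A' x = tangent_map s s A id x ` tangent_space s A' x"

end

theory Submission
  imports Defs
begin

text \<open>
  A chart of \<open>M\<close> in which \<open>f\<close> is a projection \<open>\<pi>\<close> can be corrected along a section \<open>\<sigma>\<close> of \<open>\<pi>\<close>, so that
  \<open>f\<close> becomes \<open>\<pi>\<close> with respect to a chart of \<open>N\<close> that straightens \<open>S\<close> to \<open>G\<close>. It then straightens the
  preimage of \<open>S\<close> to \<open>\<pi>\<^sup>-\<^sup>1(G)\<close>, from which the local assertions can be read off. Different
  charts may give different subspaces \<open>\<pi>\<^sup>-\<^sup>1(G)\<close>, but near a common point they differ by a linear
  automorphism, the differential of the transition map; so one subspace serves a whole component.
  The differentiability classes require the chain rule, which for analytic maps is the composition
  of power series in spaces that need not be complete: the coefficients of the composite are finite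
  sums, and convergence follows from Cauchy estimates on one-dimensional discs.
\<close>

text \<open>The correction along \<open>\<sigma>\<close> is inverted by the same formula with the
  two charts of \<open>N\<close> exchanged, so no inverse function theorem enters; for general
  locally convex spaces there is none. Closedness of the modelling subspaces is the other essential
  input. Derivatives and power series coefficients are limits of combinations of values, so they
  stay in a closed subspace, and transition maps restrict to maps of the same class. In the real
  analytic case this is also required of the complex extension, whose values are known on real
  points only; polynomials in one real parameter bridge that gap. The chain rule rests on difference
  quotients whose base point and direction move together, controlled in each continuous seminorm by
  a mean value estimate. The Cauchy estimates use finite averages instead of integrals. They are
  stated over \<open>complex\<close>, and other complex scalar types are reached through a
  surjective ring homomorphism. Components of the preimage are open because seminorm balls in the
  model space are connected, and connectedness then spreads one model space over a
  component.\<close>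

instance prod :: (topological_monoid_add, topological_monoid_add) topological_monoid_add
proof
  fix a b :: "'a \<times> 'b"
  have "((\<lambda>x. (fst (fst x) + fst (snd x), snd (fst x) + snd (snd x))) \<longlongrightarrow>
      (fst a + fst b, snd a + snd b)) (nhds a \<times>\<^sub>F nhds b)"
    by (intro tendsto_Pair tendsto_add tendsto_fst tendsto_snd filterlim_fst filterlim_snd)
  then show "((\<lambda>x. fst x + snd x) \<longlongrightarrow> a + b) (nhds a \<times>\<^sub>F nhds b)"
    by (simp add: plus_prod_def)
qed

instance prod :: (topological_group_add, topological_group_add) topological_group_add
proof
  fix a :: "'a \<times> 'b"
  have "((\<lambda>x. (- fst x, - snd x)) \<longlongrightarrow> (- fst a, - snd a)) (nhds a)"
    by (intro tendsto_Pair tendsto_minus tendsto_fst tendsto_snd filterlim_ident)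
  then show "(uminus \<longlongrightarrow> - a) (nhds a)"
    by (simp add: uminus_prod_def[abs_def])
qed

text \<open>Complexifications are carried by pairs, so the product type has to belong to the class
  required of modelling spaces.\<close>

instance prod :: (topological_ab_group_add, topological_ab_group_add) topological_ab_group_add ..

section \<open>Continuous seminorms\<close>

definition cont_seminorm ::
    "('k::real_normed_field \<Rightarrow> 'e \<Rightarrow> 'e) \<Rightarrow> ('e::{ab_group_add, t2_space} \<Rightarrow> real) \<Rightarrow> bool" where
  "cont_seminorm s q \<longleftrightarrow> (\<forall>x y. q (x + y) \<le> q x + q y) \<and> (\<forall>c x. q (s c x) = norm c * q x) \<and>
     continuous_on UNIV q"

lemma cont_seminorm_triangle: "cont_seminorm s q \<Longrightarrow> q (x + y) \<le> q x + q y"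
  and cont_seminorm_scale: "cont_seminorm s q \<Longrightarrow> q (s c x) = norm c * q x"
  and cont_seminorm_continuous: "cont_seminorm s q \<Longrightarrow> continuous_on UNIV q"
  by (simp_all add: cont_seminorm_def)

lemma cont_seminorm_tendsto:
  assumes "cont_seminorm s q" "(f \<longlongrightarrow> l) Fl"
  shows "((\<lambda>i. q (f i)) \<longlongrightarrow> q l) Fl"
  using continuous_on_tendsto_compose[OF cont_seminorm_continuous[OF assms(1)] assms(2)] by simp

context locally_convex_space
begin

lemma tendsto_scale:
  assumes "(c \<longlongrightarrow> c0) Fl" "(x \<longlongrightarrow> x0) Fl"
  shows "((\<lambda>i. scale (c i) (x i)) \<longlongrightarrow> scale c0 x0) Fl"
  using continuous_on_tendsto_compose[OF continuous_scale tendsto_Pair[OF assms]] by simp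

lemma continuous_on_scale:
  assumes "continuous_on S c" "continuous_on S x"
  shows "continuous_on S (\<lambda>i. scale (c i) (x i))"
  using continuous_on_compose2[OF continuous_scale continuous_on_Pair[OF assms]] by simp

lemma seminorm_0: "cont_seminorm scale q \<Longrightarrow> q 0 = 0"
  using cont_seminorm_scale[of scale q 0 0] by simp

lemma seminorm_minus: "cont_seminorm scale q \<Longrightarrow> q (- x) = q x"
  using cont_seminorm_scale[of scale q "-1" x] by simp

lemma seminorm_minus_commute: "cont_seminorm scale q \<Longrightarrow> q (x - y) = q (y - x)"
  using seminorm_minus[of q "x - y"] by simp

lemma seminorm_nonneg: "cont_seminorm scale q \<Longrightarrow> 0 \<le> q x"
  using cont_seminorm_triangle[of scale q x "- x"] seminorm_minus[of q x] seminorm_0[of q] by simp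

lemma seminorm_diff: "cont_seminorm scale q \<Longrightarrow> q (x - y) \<le> q x + q y"
  using cont_seminorm_triangle[of scale q x "- y"] seminorm_minus[of q y] by simp

lemma seminorm_triangle3: "cont_seminorm scale q \<Longrightarrow> q (x - z) \<le> q (x - y) + q (y - z)"
  using cont_seminorm_triangle[of scale q "x - y" "y - z"] by simp

lemma seminorm_sum: "cont_seminorm scale q \<Longrightarrow> q (sum f A) \<le> (\<Sum>i\<in>A. q (f i))"
proof (induction A rule: infinite_finite_induct)
  case (insert x F)
  then show ?case using cont_seminorm_triangle[of scale q "f x" "sum f F"] by force
qed (auto simp: seminorm_0)

text \<open>The seminorm is the gauge of the balanced core of a convex neighbourhood. The core need
  not be open, but it contains a multiple of an open neighbourhood of 0; this makes the gauge finite
  and continuous.\<close>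

lemma seminorm_in_open:
  assumes "open U" "0 \<in> U"
  obtains q where "cont_seminorm scale q" "{x. q x < 1} \<subseteq> U"
proof -
  obtain V where V: "open V" "0 \<in> V" "V \<subseteq> U" and
    conv: "\<And>x y a. x \<in> V \<Longrightarrow> y \<in> V \<Longrightarrow> a \<in> {0..1} \<Longrightarrow>
      scale (of_real a) x + scale (of_real (1 - a)) y \<in> V"
    using convex_neighbourhoods[OF assms] by meson
  \<comment> \<open>The largest balanced subset of \<open>V\<close>; it inherits convexity because
    scalar multiplication commutes with convex combinations.\<close>
  define B where "B = {x. \<forall>c. norm c \<le> 1 \<longrightarrow> scale c x \<in> V}"
  have BV: "B \<subseteq> V" unfolding B_def using scale_one norm_one by (metis (mono_tags, lifting) mem_Collect_eq order_refl subsetI)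
  have B0: "0 \<in> B" using V by (simp add: B_def)
  have Bbal: "scale c x \<in> B" if "x \<in> B" "norm c \<le> 1" for c x
    using that by (auto simp: B_def norm_mult mult_le_one)
  have Bconv: "scale (of_real a) x + scale (of_real (1 - a)) y \<in> B"
    if "x \<in> B" "y \<in> B" "0 \<le> a" "a \<le> 1" for x y a
    unfolding B_def
  proof (safe)
    fix c :: 'k assume "norm c \<le> 1"
    then have "scale (of_real a) (scale c x) + scale (of_real (1 - a)) (scale c y) \<in> V"
      using that by (intro conv) (auto simp: B_def)
    moreover have "scale (of_real a) (scale c x) + scale (of_real (1 - a)) (scale c y)
        = scale c (scale (of_real a) x + scale (of_real (1 - a)) y)"
      by (simp add: scale_right_distrib mult.commute)
    ultimately show "scale c (scale (of_real a) x + scale (of_real (1 - a)) y) \<in> V" by simp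
  qed
  \<comment> \<open>Joint continuity at \<open>(0, 0)\<close> yields a disc of radius
    \<open>d\<close> that multiplies an open \<open>W\<close> into \<open>V\<close>. Hence
    \<open>d / 2\<close> times \<open>W\<close> lies in the balanced core.\<close>
  have "open ((\<lambda>(c, x). scale c x) -` V)"
    using continuous_scale V(1) by (simp add: continuous_on_open_vimage)
  moreover have "(0, 0) \<in> (\<lambda>(c, x). scale c x) -` V" using V by simp
  ultimately obtain C W where CW: "open C" "open W" "0 \<in> C" "0 \<in> W" "C \<times> W \<subseteq> (\<lambda>(c, x). scale c x) -` V"
    by (smt (verit, ccfv_SIG) open_prod_elim SigmaD1 SigmaD2)
  obtain d where d: "d > 0" "ball 0 d \<subseteq> C" using CW openE by blast
  have WB: "scale (of_real (d / 2)) x \<in> B" if "x \<in> W" for x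
  proof -
    have "scale (c * of_real (d / 2)) x \<in> V" if "norm c \<le> 1" for c
    proof -
      have "norm (c * of_real (d / 2)) < d"
        using that d(1) mult_right_mono[OF that, of "d/2"]
        by (simp add: norm_mult norm_divide)
      then have "c * of_real (d / 2) \<in> C" using d by (auto simp: subset_iff)
      then show ?thesis using CW(5) \<open>x \<in> W\<close> by auto
    qed
    then show ?thesis by (simp add: B_def)
  qed
  define T where "T x = {t. t > 0 \<and> scale (of_real (inverse t)) x \<in> B}" for x
  define q where "q x = Inf (T x)" for x
  have bdd: "bdd_below (T x)" for x by (rule bdd_belowI[of _ 0]) (simp add: T_def)
  have Tne: "T x \<noteq> {}" for x
  proof -
    have "((\<lambda>n. scale (of_real (inverse (real n))) x) \<longlongrightarrow> scale (of_real 0) x) sequentially"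
      by (intro tendsto_scale tendsto_of_real lim_inverse_n tendsto_const)
    then have "eventually (\<lambda>n. scale (of_real (inverse (real n))) x \<in> W) sequentially"
      by (rule topological_tendstoD) (use CW in auto)
    then obtain n where n: "n > 0" "scale (of_real (inverse (real n))) x \<in> W"
      using eventually_happens'[OF _ eventually_conj[OF _ eventually_gt_at_top[of 0]]]
      by (metis (no_types, lifting) sequentially_bot)
    have "scale (of_real (d / 2)) (scale (of_real (inverse (real n))) x) \<in> B" using n WB by blast
    then have "real n * 2 / d \<in> T x"
      using n d by (simp add: T_def inverse_eq_divide mult.commute)
    then show ?thesis by blast
  qed
  \<comment> \<open>As \<open>B\<close> is balanced, \<open>T x\<close> is an up-set in the positive
    reals. Thus every number above the infimum belongs to it.\<close>
  have Tup: "t' \<in> T x" if "t \<in> T x" "t \<le> t'" for t t' x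
  proof -
    have t: "t > 0" "scale (of_real (inverse t)) x \<in> B" using that by (auto simp: T_def)
    have "scale (of_real (t / t')) (scale (of_real (inverse t)) x) \<in> B"
      by (rule Bbal) (use t that in \<open>auto simp: norm_divide\<close>)
    then show ?thesis using t that by (auto simp: T_def inverse_eq_divide)
  qed
  have q0: "q x \<ge> 0" for x unfolding q_def by (rule cInf_greatest[OF Tne]) (simp add: T_def)
  have qT: "t \<in> T x" if "q x < t" for t x
    using that Tup unfolding q_def by (meson cInf_less_iff[OF Tne bdd] less_imp_le)
  have Tq: "q x \<le> t" if "t \<in> T x" for t x
    using that unfolding q_def by (intro cInf_lower bdd)
  \<comment> \<open>The convex combination of \<open>x / t\<close> and \<open>y / t'\<close> with
    weights \<open>t / (t + t')\<close> and \<open>t' / (t + t')\<close> is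
    \<open>(x + y) / (t + t')\<close>.\<close>
  have Tadd: "t + t' \<in> T (x + y)" if "t \<in> T x" "t' \<in> T y" for t t' x y
  proof -
    have t: "t > 0" "t' > 0" using that by (auto simp: T_def)
    have "scale (of_real (t/(t+t'))) (scale (of_real (inverse t)) x) +
      scale (of_real (1 - t/(t+t'))) (scale (of_real (inverse t')) y) \<in> B"
      by (rule Bconv) (use that t in \<open>auto simp: T_def divide_simps\<close>)
    moreover have "1 - t/(t+t') = t'/(t+t')" using t by (simp add: field_simps)
    moreover have "scale (of_real (t/(t+t'))) (scale (of_real (inverse t)) x)
       = scale (of_real (inverse (t + t'))) x"
      using t by (simp flip: of_real_mult add: inverse_eq_divide)
    moreover have "scale (of_real (t'/(t+t'))) (scale (of_real (inverse t')) y)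
       = scale (of_real (inverse (t + t'))) y"
      using t by (simp flip: of_real_mult add: inverse_eq_divide)
    ultimately have "scale (of_real (inverse (t + t'))) x + scale (of_real (inverse (t + t'))) y \<in> B"
      by (simp only:)
    then show ?thesis using t by (simp add: T_def scale_right_distrib)
  qed
  have sub: "q (x + y) \<le> q x + q y" for x y
  proof (rule field_le_epsilon)
    fix e :: real assume e: "e > 0"
    have "q x + e/2 \<in> T x" "q y + e/2 \<in> T y" using e by (auto intro!: qT)
    from Tq[OF Tadd[OF this]] show "q (x + y) \<le> q x + q y + e" by simp
  qed
  have Tsc: "norm c * t \<in> T (scale c x)" if "t \<in> T x" "c \<noteq> 0" for c t x
  proof -
    have t: "t > 0" "scale (of_real (inverse t)) x \<in> B" using that by (auto simp: T_def)
    have "scale (c / of_real (norm c)) (scale (of_real (inverse t)) x) \<in> B"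
      by (rule Bbal) (use t that in \<open>auto simp: norm_divide\<close>)
    moreover have "c / of_real (norm c) * of_real (inverse t) = of_real (inverse (norm c * t)) * c"
      by (simp add: field_simps)
    ultimately show ?thesis using t that by (simp add: T_def)
  qed
  have sc1: "q (scale c x) \<le> norm c * q x" if "c \<noteq> 0" for c x
  proof (rule field_le_epsilon)
    fix e :: real assume e: "e > 0"
    have "q x + e / norm c \<in> T x" using e that by (auto intro!: qT)
    from Tq[OF Tsc[OF this that]] show "q (scale c x) \<le> norm c * q x + e"
      using that by (simp add: distrib_left)
  qed
  have q00: "q 0 = 0"
  proof -
    have "e \<in> T 0" if "e > 0" for e using that B0 by (simp add: T_def)
    then have "q 0 \<le> 0 + e" if "e > 0" for e using that Tq by simp
    then have "q 0 \<le> 0" by (rule field_le_epsilon)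
    then show ?thesis using q0[of 0] by simp
  qed
  have sc: "q (scale c x) = norm c * q x" for c x
  proof (cases "c = 0")
    case False
    have "q x = q (scale (inverse c) (scale c x))" using False by simp
    also have "\<dots> \<le> norm (inverse c) * q (scale c x)" using False by (intro sc1) simp
    finally have "norm c * q x \<le> norm c * (inverse (norm c) * q (scale c x))"
      by (intro mult_left_mono) (auto simp: norm_inverse)
    also have "\<dots> = q (scale c x)" using False by simp
    finally have "norm c * q x \<le> q (scale c x)" .
    then show ?thesis using sc1[OF False, of x] by simp
  qed (simp add: q00)
  have cont: "continuous_on UNIV q"
  proof (clarsimp simp: continuous_on_def)
    fix x
    show "(q \<longlongrightarrow> q x) (at x)"
    proof (rule tendstoI)
      fix e :: real assume e: "e > 0"
      \<comment> \<open>Chosen so that \<open>(d / 2) / c = 1 / (e / 2)\<close>: if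
        \<open>(y - x) / c\<close> lies in \<open>W\<close>, then \<open>(y - x) / (e / 2)\<close>
        lies in \<open>B\<close>, that is, \<open>q (y - x) \<le> e / 2\<close>.\<close>
      define c where "c = e * d / 4"
      have "((\<lambda>y. scale (of_real (inverse c)) (y - x)) \<longlongrightarrow> scale (of_real (inverse c)) (x - x)) (at x)"
        by (intro tendsto_intros tendsto_scale)
      then have "eventually (\<lambda>y. scale (of_real (inverse c)) (y - x) \<in> W) (at x)"
        by (rule topological_tendstoD) (use CW in auto)
      then show "eventually (\<lambda>y. dist (q y) (q x) < e) (at x)"
      proof eventually_elim
        case (elim y)
        have "scale (of_real (d / 2)) (scale (of_real (inverse c)) (y - x)) \<in> B" by (rule WB[OF elim])
        moreover have "d / 2 * inverse c = inverse (e / 2)" using e d by (simp add: c_def field_simps)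
        then have "(of_real (d / 2) * of_real (inverse c) :: 'k) = of_real (inverse (e/2))"
          by (metis of_real_mult)
        ultimately have "e / 2 \<in> T (y - x)" using e by (simp add: T_def)
        then have 1: "q (y - x) \<le> e / 2" by (rule Tq)
        then have 2: "q (x - y) \<le> e / 2" using sc[of "-1" "y - x"] by simp
        have "q y \<le> q x + q (y - x)" "q x \<le> q y + q (x - y)"
          using sub[of x "y - x"] sub[of y "x - y"] by auto
        then show ?case using 1 2 e by (auto simp: dist_real_def)
      qed
    qed
  qed
  have "x \<in> U" if "q x < 1" for x
  proof -
    have "x \<in> B" using qT[OF that] by (simp add: T_def)
    then show ?thesis using BV V by blast
  qed
  then show ?thesis using that[of q] sub sc cont by (auto simp: cont_seminorm_def)
qed

lemma open_seminorm_ball: "cont_seminorm scale q \<Longrightarrow> open {x. q x < r}"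
  by (intro open_Collect_less cont_seminorm_continuous[of scale q] continuous_on_const)

lemma tendsto_seminormI:
  assumes "\<And>q. cont_seminorm scale q \<Longrightarrow> ((\<lambda>i. q (f i - l)) \<longlongrightarrow> 0) Fl"
  shows "(f \<longlongrightarrow> l) Fl"
proof (rule topological_tendstoI)
  fix S assume S: "open S" "l \<in> S"
  have "open ((\<lambda>x. l + x) -` S)"
    using S(1) by (intro open_vimage continuous_intros)
  then obtain q where q: "cont_seminorm scale q" "{x. q x < 1} \<subseteq> (\<lambda>x. l + x) -` S"
    by (rule seminorm_in_open) (use S(2) in auto)
  have "eventually (\<lambda>i. q (f i - l) < 1) Fl"
    using order_tendstoD(2)[OF assms[OF q(1)]] by simp
  then show "eventually (\<lambda>i. f i \<in> S) Fl"
    by eventually_elim (use q(2) in force)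
qed

lemma tendsto_seminormD:
  assumes "(f \<longlongrightarrow> l) Fl" "cont_seminorm scale q"
  shows "((\<lambda>i. q (f i - l)) \<longlongrightarrow> 0) Fl"
  using cont_seminorm_tendsto[OF assms(2) tendsto_diff[OF assms(1) tendsto_const[of l]]]
    seminorm_0[OF assms(2)] by simp

lemma tendsto_seminormD_less:
  assumes "(f \<longlongrightarrow> l) Fl" "cont_seminorm scale q" "0 < e"
  shows "eventually (\<lambda>i. q (f i - l) < e) Fl"
  using order_tendstoD(2)[OF tendsto_seminormD[OF assms(1,2)] assms(3)] .

lemma seminorm_nhd:
  assumes "open U" "x \<in> U"
  obtains q where "cont_seminorm scale q" "{y. q (y - x) < 1} \<subseteq> U"
proof -
  have "open ((\<lambda>y. x + y) -` U)"
    using assms(1) by (intro open_vimage continuous_intros)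
  then obtain q where q: "cont_seminorm scale q" "{y. q y < 1} \<subseteq> (\<lambda>y. x + y) -` U"
    by (rule seminorm_in_open) (use assms(2) in auto)
  show ?thesis by (rule that[OF q(1)]) (use q(2) in force)
qed

lemma seminorm_rel_nhd:
  assumes "openin (top_of_set F) U" "x \<in> U"
  obtains q where "cont_seminorm scale q" "{y \<in> F. q (y - x) < 1} \<subseteq> U"
proof -
  obtain T where T: "open T" "U = F \<inter> T" using assms(1) by (auto simp: openin_open)
  obtain q where "cont_seminorm scale q" "{y. q (y - x) < 1} \<subseteq> T"
    using seminorm_nhd[OF T(1)] assms(2) T(2) by blast
  then show ?thesis using that[of q] T by auto
qed

end

section \<open>Differential calculus in locally convex spaces\<close>

lemma tendsto_funI:
  fixes f :: "'i \<Rightarrow> 'a \<Rightarrow> 'b::topological_space"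
  assumes "\<And>j. ((\<lambda>i. f i j) \<longlongrightarrow> l j) Fl"
  shows "(f \<longlongrightarrow> l) Fl"
  using assms limitin_componentwise[of "\<lambda>_. euclidean :: 'b topology" UNIV f l Fl]
  by (simp add: limitin_canonical_iff euclidean_product_topology)

text \<open>At each parameter the derivative bound gives an increment estimate with constant
  \<open>M + e\<close> on short intervals around it. Such estimates add up over adjacent intervals,
  so the bisection principle extends them to \<open>[0, 1]\<close>. Neither integrals nor continuous
  functionals are involved.\<close>

lemma (in locally_convex_space) seminorm_mean_value:
  fixes \<gamma> :: "real \<Rightarrow> 'e"
  assumes q: "cont_seminorm scale q"
    and d: "\<And>\<tau>. 0 \<le> \<tau> \<Longrightarrow> \<tau> \<le> 1 \<Longrightarrow>
      \<exists>D. q D \<le> M \<and> ((\<lambda>\<eta>. scale (of_real (inverse \<eta>)) (\<gamma> (\<tau> + \<eta>) - \<gamma> \<tau>)) \<longlongrightarrow> D) (at 0)"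
  shows "q (\<gamma> 1 - \<gamma> 0) \<le> M"
proof (rule field_le_epsilon)
  fix e :: real assume e: "0 < e"
  have "q (\<gamma> 1 - \<gamma> 0) \<le> (M + e) * (1 - 0)"
  proof (rule Bolzano[where P = "\<lambda>a b. q (\<gamma> b - \<gamma> a) \<le> (M + e) * (b - a)"])
    fix a b c :: real
    assume "q (\<gamma> b - \<gamma> a) \<le> (M + e) * (b - a)" "q (\<gamma> c - \<gamma> b) \<le> (M + e) * (c - b)"
    then show "q (\<gamma> c - \<gamma> a) \<le> (M + e) * (c - a)"
      using seminorm_triangle3[OF q, of "\<gamma> c" "\<gamma> a" "\<gamma> b"] by (simp add: algebra_simps)
  next
    fix x :: real assume "0 \<le> x" "x \<le> 1"
    then obtain D where D: "q D \<le> M"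
      "((\<lambda>\<eta>. scale (of_real (inverse \<eta>)) (\<gamma> (x + \<eta>) - \<gamma> x)) \<longlongrightarrow> D) (at 0)" using d by blast
    obtain \<delta> where \<delta>: "\<delta> > 0" "\<And>\<eta>. \<eta> \<noteq> 0 \<Longrightarrow> \<bar>\<eta>\<bar> < \<delta> \<Longrightarrow>
       q (scale (of_real (inverse \<eta>)) (\<gamma> (x + \<eta>) - \<gamma> x) - D) < e"
      using tendsto_seminormD_less[OF D(2) q e] unfolding eventually_at by (auto simp: dist_real_def)
    have *: "q (\<gamma> (x + \<eta>) - \<gamma> x) \<le> (M + e) * \<bar>\<eta>\<bar>" if "\<bar>\<eta>\<bar> < \<delta>" for \<eta>
    proof (cases "\<eta> = 0")
      case False
      let ?v = "scale (of_real (inverse \<eta>)) (\<gamma> (x + \<eta>) - \<gamma> x)"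
      have "q ?v \<le> M + e"
        using cont_seminorm_triangle[OF q, of D "?v - D"] \<delta>(2)[OF False that] D(1) by simp
      moreover have "q ?v = q (\<gamma> (x + \<eta>) - \<gamma> x) / \<bar>\<eta>\<bar>"
        using False by (simp add: cont_seminorm_scale[OF q] norm_inverse divide_inverse_commute)
      ultimately show ?thesis using False by (simp add: divide_le_eq)
    qed (simp add: seminorm_0[OF q])
    \<comment> \<open>The derivative at \<open>x\<close> only compares with the value at
      \<open>x\<close>, so an interval around \<open>x\<close> is split there into two.\<close>
    show "\<exists>d>0. \<forall>a b. a \<le> x \<and> x \<le> b \<and> b - a < d \<longrightarrow> q (\<gamma> b - \<gamma> a) \<le> (M + e) * (b - a)"
    proof (intro exI[of _ \<delta>] conjI allI impI \<delta>(1))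
      fix a b assume ab: "a \<le> x \<and> x \<le> b \<and> b - a < \<delta>"
      have "q (\<gamma> b - \<gamma> x) \<le> (M + e) * (b - x)" using *[of "b - x"] ab by auto
      moreover have "q (\<gamma> x - \<gamma> a) \<le> (M + e) * (x - a)"
        using *[of "a - x"] ab seminorm_minus_commute[OF q, of "\<gamma> x"] by auto
      ultimately show "q (\<gamma> b - \<gamma> a) \<le> (M + e) * (b - a)"
        using seminorm_triangle3[OF q, of "\<gamma> b" "\<gamma> a" "\<gamma> x"] by (simp add: algebra_simps)
    qed
  qed simp
  then show "q (\<gamma> 1 - \<gamma> 0) \<le> M + e" by simp
qed

text \<open>Base point \<open>a\<close>, parameter \<open>p\<close> and direction \<open>u\<close>
  may all vary with \<open>h\<close>. On the segment from \<open>a\<close> to \<open>a + h u\<close>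
  the derivative is uniformly close to its limit value, and the mean value estimate turns this into
  an estimate of the quotient. The parameter is there to carry the remaining directions when
  \<open>\<Phi>\<close> is itself a higher derivative.\<close>

lemma strict_derivative:
  fixes s :: "'k::real_or_complex \<Rightarrow> 'e::{topological_ab_group_add, t2_space} \<Rightarrow> 'e"
    and t :: "'k \<Rightarrow> 'f::{topological_ab_group_add, t2_space} \<Rightarrow> 'f"
    and \<Phi> :: "'e \<Rightarrow> 'p::topological_space \<Rightarrow> 'f"
  assumes s: "locally_convex_space s" and t: "locally_convex_space t"
    and F: "module.subspace s F" and U: "openin (top_of_set F) U"
    and der: "\<And>x p u. x \<in> U \<Longrightarrow> p \<in> P \<Longrightarrow> u \<in> F \<Longrightarrow>
      (diff_quot s t (\<lambda>x. \<Phi> x p) x u \<longlongrightarrow> D x p u) (at 0)"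
    and cont: "continuous_on (U \<times> P \<times> F) (\<lambda>(x, p, u). D x p u)"
    and x0: "x0 \<in> U" "p0 \<in> P" "u0 \<in> F"
    and lim: "(h \<longlongrightarrow> 0) Fl" "(a \<longlongrightarrow> x0) Fl" "(p \<longlongrightarrow> p0) Fl" "(u \<longlongrightarrow> u0) Fl"
    and ev: "eventually (\<lambda>i. h i \<noteq> 0 \<and> a i \<in> F \<and> p i \<in> P \<and> u i \<in> F) Fl"
  shows "((\<lambda>i. t (inverse (h i)) (\<Phi> (a i + s (h i) (u i)) (p i) - \<Phi> (a i) (p i)))
    \<longlongrightarrow> D x0 p0 u0) Fl"
proof -
  interpret E: locally_convex_space s by fact
  interpret T: locally_convex_space t by fact
  show ?thesis
  proof (rule T.tendsto_seminormI, rule tendstoI)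
    fix q and e' :: real assume q: "cont_seminorm t q" and "0 < e'"
    define e where "e = e' / 2"
    have e: "0 < e" "e < e'" using \<open>0 < e'\<close> by (auto simp: e_def)
    have op: "open {y. q (y - D x0 p0 u0) < e}"
      by (intro open_Collect_less continuous_on_compose2[OF cont_seminorm_continuous[OF q]] continuous_intros) auto
    have mem: "(x0, p0, u0) \<in> U \<times> P \<times> F" using x0 by simp
    have val: "(case (x0, p0, u0) of (x, p, u) \<Rightarrow> D x p u) \<in> {y. q (y - D x0 p0 u0) < e}"
      using e by (simp add: T.seminorm_0[OF q])
    obtain A where A: "open A" "(x0, p0, u0) \<in> A"
      "\<forall>z\<in>U \<times> P \<times> F. z \<in> A \<longrightarrow> (case z of (x, p, u) \<Rightarrow> D x p u) \<in> {y. q (y - D x0 p0 u0) < e}"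
      using cont[unfolded continuous_on_topological, THEN bspec, OF mem, THEN spec, THEN mp, OF op, THEN mp, OF val]
      by (elim exE conjE)
    obtain A1 B where A1: "open A1" "open B" "x0 \<in> A1" "(p0, u0) \<in> B" "A1 \<times> B \<subseteq> A"
      by (rule open_prod_elim[OF A(1,2)]) blast
    obtain A2 A3 where A2: "open A2" "open A3" "p0 \<in> A2" "u0 \<in> A3" "A2 \<times> A3 \<subseteq> B"
      by (rule open_prod_elim[OF A1(2,4)]) blast
    have DA: "q (D x p u - D x0 p0 u0) < e"
      if "x \<in> U" "p \<in> P" "u \<in> F" "x \<in> A1" "p \<in> A2" "u \<in> A3" for x p u
      using A(3) A1(5) A2(5) that by (auto simp: subset_iff)
    obtain W where W: "open W" "U = F \<inter> W" using U by (auto simp: openin_open)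
    \<comment> \<open>Half of the unit ball is reserved for \<open>a i - x0\<close> and half for the
      increment, so that the whole segment stays where the derivative is controlled.\<close>
    obtain q1 where q1: "cont_seminorm s q1" "{y. q1 (y - x0) < 1} \<subseteq> A1 \<inter> W"
      using E.seminorm_nhd[of "A1 \<inter> W" x0] W A1 x0 by (auto simp: open_Int)
    have "((\<lambda>i. s (h i) (u i)) \<longlongrightarrow> s 0 u0) Fl" by (intro E.tendsto_scale lim)
    then have su: "((\<lambda>i. s (h i) (u i)) \<longlongrightarrow> 0) Fl" by simp
    show "eventually (\<lambda>i. dist (q (t (inverse (h i)) (\<Phi> (a i + s (h i) (u i)) (p i) - \<Phi> (a i) (p i)) - D x0 p0 u0)) 0 < e') Fl"
      using ev topological_tendstoD[OF lim(3) A2(1,3)] topological_tendstoD[OF lim(4) A2(2,4)]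
        E.tendsto_seminormD_less[OF lim(2) q1(1), of "1/2", simplified]
        E.tendsto_seminormD_less[OF su q1(1), of "1/2", simplified]
    proof eventually_elim
      case (elim i)
      define y where "y \<tau> = a i + s (of_real \<tau> * h i) (u i)" for \<tau> :: real
      have yU: "y \<tau> \<in> U \<and> y \<tau> \<in> A1" if "0 \<le> \<tau>" "\<tau> \<le> 1" for \<tau>
      proof -
        have "q1 (y \<tau> - x0) \<le> q1 (a i - x0) + q1 (s (of_real \<tau>) (s (h i) (u i)))"
          using cont_seminorm_triangle[OF q1(1), of "a i - x0" "s (of_real \<tau> * h i) (u i)"]
          by (simp add: y_def algebra_simps)
        also have "q1 (s (of_real \<tau>) (s (h i) (u i))) \<le> q1 (s (h i) (u i))"
          unfolding cont_seminorm_scale[OF q1(1)] using that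
          by (intro mult_left_le_one_le mult_nonneg_nonneg E.seminorm_nonneg[OF q1(1)]) auto
        finally have "q1 (y \<tau> - x0) < 1" using elim by simp
        moreover have "y \<tau> \<in> F" unfolding y_def
          using elim F by (intro E.subspace_add E.subspace_scale) auto
        ultimately show ?thesis using q1(2) W by auto
      qed
      define D0 where "D0 = D x0 p0 u0"
      \<comment> \<open>Subtracting the linear path with velocity \<open>D0\<close> makes the
        derivative of \<open>\<gamma>\<close> the small difference \<open>D - D0\<close>, while
        \<open>\<gamma> 1 - \<gamma> 0\<close> is the difference quotient minus its expected
        limit.\<close>
      define \<gamma> where "\<gamma> \<tau> = t (inverse (h i)) (\<Phi> (y \<tau>) (p i)) - t (of_real \<tau>) D0" for \<tau>
      have "q (\<gamma> 1 - \<gamma> 0) \<le> e"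
      proof (rule T.seminorm_mean_value[OF q])
        fix \<tau> :: real assume \<tau>: "0 \<le> \<tau>" "\<tau> \<le> 1"
        have fl: "filterlim (\<lambda>\<eta>. of_real \<eta> * h i :: 'k) (at 0) (at 0)"
        proof (rule filterlim_atI)
          have "((\<lambda>\<eta>. of_real \<eta> * h i :: 'k) \<longlongrightarrow> of_real 0 * h i) (at 0)"
            by (intro tendsto_intros)
          then show "((\<lambda>\<eta>. of_real \<eta> * h i :: 'k) \<longlongrightarrow> 0) (at 0)" by simp
          show "eventually (\<lambda>\<eta>. of_real \<eta> * h i \<noteq> (0::'k)) (at 0)"
            using elim by (auto simp: eventually_at_filter)
        qed
        have "((\<lambda>\<eta>. diff_quot s t (\<lambda>x. \<Phi> x (p i)) (y \<tau>) (u i) (of_real \<eta> * h i)) \<longlongrightarrow> D (y \<tau>) (p i) (u i)) (at 0)"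
          by (rule filterlim_compose[OF der fl]) (use elim yU[OF \<tau>] in auto)
        then have 1: "((\<lambda>\<eta>. diff_quot s t (\<lambda>x. \<Phi> x (p i)) (y \<tau>) (u i) (of_real \<eta> * h i) - D0) \<longlongrightarrow> D (y \<tau>) (p i) (u i) - D0) (at 0)"
          by (intro tendsto_intros)
        have eq: "diff_quot s t (\<lambda>x. \<Phi> x (p i)) (y \<tau>) (u i) (of_real \<eta> * h i) - D0
           = t (of_real (inverse \<eta>)) (\<gamma> (\<tau> + \<eta>) - \<gamma> \<tau>)" if "\<eta> \<noteq> 0" for \<eta>
        proof -
          have "y \<tau> + s (of_real \<eta> * h i) (u i) = y (\<tau> + \<eta>)"
            by (simp add: y_def algebra_simps flip: E.scale_left_distrib)
          then show ?thesis using that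
            by (simp add: diff_quot_def \<gamma>_def T.scale_right_diff_distrib T.scale_left_distrib
                T.scale_right_distrib mult.commute)
        qed
        have "((\<lambda>\<eta>. t (of_real (inverse \<eta>)) (\<gamma> (\<tau> + \<eta>) - \<gamma> \<tau>)) \<longlongrightarrow> D (y \<tau>) (p i) (u i) - D0) (at 0)"
          by (rule Lim_transform_eventually[OF 1]) (use eq in \<open>auto simp: eventually_at_filter\<close>)
        moreover have "q (D (y \<tau>) (p i) (u i) - D0) \<le> e"
          unfolding D0_def using elim yU[OF \<tau>] by (intro less_imp_le DA) auto
        ultimately show "\<exists>D. q D \<le> e \<and>
          ((\<lambda>\<eta>. t (of_real (inverse \<eta>)) (\<gamma> (\<tau> + \<eta>) - \<gamma> \<tau>)) \<longlongrightarrow> D) (at 0)" by blast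
      qed
      moreover have "\<gamma> 1 - \<gamma> 0 = t (inverse (h i)) (\<Phi> (a i + s (h i) (u i)) (p i) - \<Phi> (a i) (p i)) - D x0 p0 u0"
        by (simp add: \<gamma>_def y_def D0_def T.scale_right_diff_distrib)
      ultimately show ?case using e T.seminorm_nonneg[OF q] by (simp add: dist_real_def)
    qed
  qed
qed

text \<open>The step \<open>h (u + v)\<close> is made in two stages. The second stage starts from
  the moving point \<open>x + h u\<close>, so its quotient converges by strict
  differentiability.\<close>

lemma deriv_add:
  fixes s :: "'k::real_or_complex \<Rightarrow> 'e::{topological_ab_group_add, t2_space} \<Rightarrow> 'e"
    and t :: "'k \<Rightarrow> 'f::{topological_ab_group_add, t2_space} \<Rightarrow> 'f"
  assumes s: "locally_convex_space s" and t: "locally_convex_space t"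
    and F: "module.subspace s F" and U: "openin (top_of_set F) U"
    and der: "\<And>x u. x \<in> U \<Longrightarrow> u \<in> F \<Longrightarrow> (diff_quot s t f x u \<longlongrightarrow> D x u) (at 0)"
    and cont: "continuous_on (U \<times> F) (\<lambda>(x, u). D x u)"
    and x: "x \<in> U" "u \<in> F" "v \<in> F"
  shows "D x (u + v) = D x u + D x v"
proof -
  interpret E: locally_convex_space s by fact
  interpret T: locally_convex_space t by fact
  have "((\<lambda>h. s h u) \<longlongrightarrow> s 0 u) (at 0)" by (intro E.tendsto_scale tendsto_intros)
  then have "((\<lambda>h. x + s h u) \<longlongrightarrow> x + s 0 u) (at 0)" by (intro tendsto_intros)
  then have lim: "((\<lambda>h. x + s h u) \<longlongrightarrow> x) (at 0)" by simp
  have xF: "x \<in> F" using x U openin_imp_subset by blast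
  have lF: "x + s h u \<in> F" for h using xF x F by (intro E.subspace_add E.subspace_scale) auto
  have cont': "continuous_on (U \<times> {0::real} \<times> F) (\<lambda>z. (\<lambda>(x, u). D x u) (fst z, snd (snd z)))"
    by (rule continuous_on_compose2[OF cont]) (auto intro!: continuous_intros)
  \<comment> \<open>No parameter occurs here; the parameter set is a single point.\<close>
  have "((\<lambda>h. t (inverse h) (f ((x + s h u) + s h v) - f (x + s h u))) \<longlongrightarrow> D x v) (at 0)"
    by (rule strict_derivative[OF s t F U, where \<Phi> = "\<lambda>x p. f x" and D = "\<lambda>x p u. D x u" and
          P = "{0::real}" and ?p0.0 = "0" and p = "\<lambda>_. 0" and h = "\<lambda>h. h"])
      (use x der cont' xF lF F in \<open>auto intro!: lim tendsto_intros E.subspace_add E.subspace_scale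
         simp: case_prod_unfold eventually_at_filter\<close>)
  moreover have "(diff_quot s t f x u \<longlongrightarrow> D x u) (at 0)" using x der by blast
  ultimately have "((\<lambda>h. diff_quot s t f x u h + t (inverse h) (f ((x + s h u) + s h v) - f (x + s h u)))
      \<longlongrightarrow> D x u + D x v) (at 0)" by (intro tendsto_add)
  moreover have "(\<lambda>h. diff_quot s t f x u h + t (inverse h) (f ((x + s h u) + s h v) - f (x + s h u)))
     = diff_quot s t f x (u + v)"
    by (simp add: diff_quot_def fun_eq_iff E.scale_right_distrib add.assoc flip: T.scale_right_distrib)
  ultimately have "(diff_quot s t f x (u + v) \<longlongrightarrow> D x u + D x v) (at 0)" by simp
  moreover have "(diff_quot s t f x (u + v) \<longlongrightarrow> D x (u + v)) (at 0)"
    using x F by (intro der E.subspace_add) auto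
  ultimately show ?thesis using tendsto_unique[OF at_neq_bot] by blast
qed

lemma diff_quot_scale:
  assumes s: "locally_convex_space s" and t: "locally_convex_space t"
    and der: "(diff_quot s t f x u \<longlongrightarrow> D) (at 0)"
  shows "(diff_quot s t f x (s c u) \<longlongrightarrow> t c D) (at 0)"
proof -
  interpret E: locally_convex_space s by fact
  interpret T: locally_convex_space t by fact
  show ?thesis
  proof (cases "c = 0")
    case True
    then show ?thesis by (simp add: diff_quot_def[abs_def])
  next
    case False
    have "filterlim (\<lambda>h. h * c) (at 0) (at 0)"
    proof (rule filterlim_atI)
      have "((\<lambda>h. h * c) \<longlongrightarrow> 0 * c) (at 0)" by (intro tendsto_intros)
      then show "((\<lambda>h. h * c) \<longlongrightarrow> 0) (at 0)" by simp
      show "eventually (\<lambda>h. h * c \<noteq> 0) (at 0)" using False by (auto simp: eventually_at_filter)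
    qed
    from filterlim_compose[OF der this]
    have "((\<lambda>h. t c (diff_quot s t f x u (h * c))) \<longlongrightarrow> t c D) (at 0)"
      by (intro T.tendsto_scale tendsto_intros)
    moreover have "t c (diff_quot s t f x u (h * c)) = diff_quot s t f x (s c u) h" for h
      using False by (simp add: diff_quot_def)
    ultimately show ?thesis by simp
  qed
qed

lemma dir_deriv_eq: "(diff_quot s t f x v \<longlongrightarrow> D) (at 0) \<Longrightarrow> dir_deriv s t f x v = D"
  unfolding dir_deriv_def by (intro tendsto_Lim at_neq_bot)

text \<open>The definition of class \<open>C^k\<close> speaks of extensional tuples of directions.
  This allows arbitrary sequences instead, of which only an initial segment is read.\<close>

lemma iter_dir_deriv_cong_dirs:
  "(\<And>i. i < k \<Longrightarrow> y i = y' i) \<Longrightarrow> iter_dir_deriv s t k f x y = iter_dir_deriv s t k f x y'"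
proof (induction k arbitrary: x)
  case (Suc k)
  then have "(\<lambda>z. iter_dir_deriv s t k f z y) = (\<lambda>z. iter_dir_deriv s t k f z y')" by auto
  then show ?case using Suc.prems by simp
qed simp

lemma eventually_in_open_line:
  assumes s: "locally_convex_space s" and F: "module.subspace s F"
    and U: "openin (top_of_set F) U" and x: "x \<in> U" "v \<in> F"
  shows "eventually (\<lambda>h. x + s h v \<in> U) (at 0)"
proof -
  interpret E: locally_convex_space s by fact
  obtain W where W: "open W" "U = F \<inter> W" using U by (auto simp: openin_open)
  have "((\<lambda>h. s h v) \<longlongrightarrow> s 0 v) (at 0)" by (intro E.tendsto_scale tendsto_intros)
  then have "((\<lambda>h. x + s h v) \<longlongrightarrow> x + s 0 v) (at 0)" by (intro tendsto_intros)
  then have "eventually (\<lambda>h. x + s h v \<in> W) (at 0)"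
    by (rule topological_tendstoD) (use x W in auto)
  then show ?thesis
    by eventually_elim (use x W F in \<open>auto intro!: E.subspace_add E.subspace_scale\<close>)
qed

lemma tendsto_diff_quot_cong:
  assumes "eventually (\<lambda>h. f (x + s h v) = g (x + s h v)) (at 0)" "f x = g x"
  shows "(diff_quot s t f x v \<longlongrightarrow> D) (at 0) \<longleftrightarrow> (diff_quot s t g x v \<longlongrightarrow> D) (at 0)"
  by (rule tendsto_cong) (use assms in \<open>auto simp: diff_quot_def elim: eventually_mono\<close>)

lemma dir_deriv_cong:
  assumes "eventually (\<lambda>h. f (x + s h v) = g (x + s h v)) (at 0)" "f x = g x"
  shows "dir_deriv s t f x v = dir_deriv s t g x v"
  unfolding dir_deriv_def Topological_Spaces.Lim_def tendsto_diff_quot_cong[of f x s _ g, OF assms] ..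

subsection \<open>Finite order of differentiability\<close>

lemma Ck_on_deriv:
  fixes s :: "'k::real_or_complex \<Rightarrow> _"
  assumes f: "Ck_on s t F G n U f" and k: "k < n" and x: "x \<in> U" and y: "\<And>i. i \<le> k \<Longrightarrow> y i \<in> F"
  shows "(diff_quot s t (\<lambda>z. iter_dir_deriv s t k f z y) x (y k) \<longlongrightarrow> iter_dir_deriv s t (Suc k) f x y) (at 0)"
    and "iter_dir_deriv s t (Suc k) f x y \<in> G"
proof -
  define y' where "y' = restrict y {..<Suc k}"
  have y': "y' \<in> {..<Suc k} \<rightarrow>\<^sub>E F" using y by (auto simp: y'_def less_Suc_eq_le)
  have eq: "(\<lambda>z. iter_dir_deriv s t k f z y') = (\<lambda>z. iter_dir_deriv s t k f z y)" "y' k = y k"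
    by (auto simp: y'_def intro!: iter_dir_deriv_cong_dirs)
  obtain D where D: "D \<in> G"
    "(diff_quot s t (\<lambda>z. iter_dir_deriv s t k f z y') x (y' k) \<longlongrightarrow> D) (at 0)"
    using f k x y' unfolding Ck_on_def by meson
  then have D': "(diff_quot s t (\<lambda>z. iter_dir_deriv s t k f z y) x (y k) \<longlongrightarrow> D) (at 0)" by (simp add: eq)
  moreover have "iter_dir_deriv s t (Suc k) f x y = D" using dir_deriv_eq[OF D'] by simp
  ultimately show "(diff_quot s t (\<lambda>z. iter_dir_deriv s t k f z y) x (y k) \<longlongrightarrow> iter_dir_deriv s t (Suc k) f x y) (at 0)"
    and "iter_dir_deriv s t (Suc k) f x y \<in> G" using D(1) by simp_all
qed

lemma Ck_on_iter_mem:
  fixes s :: "'k::real_or_complex \<Rightarrow> _"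
  assumes f: "Ck_on s t F G n U f" and k: "k \<le> n" and x: "x \<in> U" and y: "\<And>i. i < k \<Longrightarrow> y i \<in> F"
  shows "iter_dir_deriv s t k f x y \<in> G"
proof (cases k)
  case 0
  then show ?thesis using f x by (auto simp: Ck_on_def)
next
  case (Suc j)
  then show ?thesis using Ck_on_deriv(2)[OF f, of j x y] k x y by auto
qed

text \<open>Convergence of the relevant directions suffices: after restriction to
  \<open>{..<k}\<close> the tuples converge in the product topology, where joint continuity is
  assumed.\<close>

lemma Ck_on_tendsto:
  assumes f: "Ck_on s t F G n U f" and k: "k \<le> n"
    and X: "(X \<longlongrightarrow> x) Fl" "x \<in> U" "eventually (\<lambda>i. X i \<in> U) Fl"
    and W: "\<And>j. j < k \<Longrightarrow> ((\<lambda>i. W i j) \<longlongrightarrow> w j) Fl" "\<And>j. j < k \<Longrightarrow> w j \<in> F"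
      "\<And>j. j < k \<Longrightarrow> eventually (\<lambda>i. W i j \<in> F) Fl"
  shows "((\<lambda>i. iter_dir_deriv s t k f (X i) (W i)) \<longlongrightarrow> iter_dir_deriv s t k f x w) Fl"
proof -
  have cont: "continuous_on (U \<times> ({..<k} \<rightarrow>\<^sub>E F)) (\<lambda>(x, y). iter_dir_deriv s t k f x y)"
    using f k unfolding Ck_on_def by blast
  have evW: "eventually (\<lambda>i. \<forall>j\<in>{..<k}. W i j \<in> F) Fl"
    using W(3) by (intro eventually_ball_finite) auto
  have "((\<lambda>i. restrict (W i) {..<k}) \<longlongrightarrow> restrict w {..<k}) Fl"
    using W(1) by (intro tendsto_funI) (simp add: restrict_def)
  then have "((\<lambda>i. (X i, restrict (W i) {..<k})) \<longlongrightarrow> (x, restrict w {..<k})) Fl"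
    by (intro tendsto_Pair X(1))
  then have "((\<lambda>i. (\<lambda>(x, y). iter_dir_deriv s t k f x y) (X i, restrict (W i) {..<k})) \<longlongrightarrow>
      (\<lambda>(x, y). iter_dir_deriv s t k f x y) (x, restrict w {..<k})) Fl"
    by (rule continuous_on_tendsto_compose[OF cont])
      (use X W(2) evW in \<open>auto elim: eventually_elim2 intro: restrict_PiE_iff[THEN iffD2]\<close>)
  moreover have "iter_dir_deriv s t k f z (restrict y {..<k}) = iter_dir_deriv s t k f z y" for z y
    by (intro iter_dir_deriv_cong_dirs) auto
  ultimately show ?thesis by simp
qed

lemma Ck_on_continuous:
  assumes f: "Ck_on s t F G n U f" and k: "k \<le> n"
    and X: "continuous_on S X" "X ` S \<subseteq> U"
    and W: "\<And>j. j < k \<Longrightarrow> continuous_on S (\<lambda>i. W i j)" "\<And>i j. i \<in> S \<Longrightarrow> j < k \<Longrightarrow> W i j \<in> F"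
  shows "continuous_on S (\<lambda>i. iter_dir_deriv s t k f (X i) (W i))"
  unfolding continuous_on_def
proof
  fix i assume i: "i \<in> S"
  have ev: "eventually (\<lambda>i. i \<in> S) (at i within S)" by (simp add: eventually_at_topological) blast
  show "((\<lambda>i. iter_dir_deriv s t k f (X i) (W i)) \<longlongrightarrow> iter_dir_deriv s t k f (X i) (W i)) (at i within S)"
  proof (rule Ck_on_tendsto[OF f k])
    show "eventually (\<lambda>i. X i \<in> U) (at i within S)" using ev by (rule eventually_mono) (use X(2) in blast)
    show "eventually (\<lambda>i. W i j \<in> F) (at i within S)" if "j < k" for j
      using ev by (rule eventually_mono) (use W(2) that in blast)
    show "(X \<longlongrightarrow> X i) (at i within S)" using X(1) i unfolding continuous_on_def by blast
    show "X i \<in> U" using X(2) i by blast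
    show "((\<lambda>i. W i j) \<longlongrightarrow> W i j) (at i within S)" if "j < k" for j
      using W(1)[OF that] i unfolding continuous_on_def by blast
    show "W i j \<in> F" if "j < k" for j using W(2) i that by blast
  qed
qed

lemma Ck_onI:
  assumes "f ` U \<subseteq> G"
    and "\<And>k x y. k < n \<Longrightarrow> x \<in> U \<Longrightarrow> (\<And>i. i \<le> k \<Longrightarrow> y i \<in> F) \<Longrightarrow>
        \<exists>D\<in>G. (diff_quot s t (\<lambda>z. iter_dir_deriv s t k f z y) x (y k) \<longlongrightarrow> D) (at 0)"
    and "\<And>k. k \<le> n \<Longrightarrow> continuous_on (U \<times> ({..<k} \<rightarrow>\<^sub>E F)) (\<lambda>z. iter_dir_deriv s t k f (fst z) (snd z))"
  shows "Ck_on s t F G n U f"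
  unfolding Ck_on_def
proof (intro conjI allI impI ballI)
  fix k x y assume "k < n" "x \<in> U" and y: "y \<in> {..<Suc k} \<rightarrow>\<^sub>E F"
  have "y i \<in> F" if "i \<le> k" for i using PiE_mem[OF y, of i] that by simp
  then show "\<exists>D\<in>G. (diff_quot s t (\<lambda>z. iter_dir_deriv s t k f z y) x (y k) \<longlongrightarrow> D) (at 0)"
    using assms(2) \<open>k < n\<close> \<open>x \<in> U\<close> by blast
next
  fix k assume "k \<le> n"
  from assms(3)[OF this] show "continuous_on (U \<times> ({..<k} \<rightarrow>\<^sub>E F)) (\<lambda>(x, y). iter_dir_deriv s t k f x y)"
    by (simp add: case_prod_unfold)
qed (rule assms(1))

lemma continuous_on_PiE_component:
  "j < k \<Longrightarrow> continuous_on (U \<times> ({..<k} \<rightarrow>\<^sub>E F)) (\<lambda>z. snd z j)"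
  by (rule continuous_on_product_then_coordinatewise) (intro continuous_on_snd continuous_on_id)

lemma continuous_on_if_const:
  "(P \<Longrightarrow> continuous_on S f) \<Longrightarrow> (\<not> P \<Longrightarrow> continuous_on S g) \<Longrightarrow> continuous_on S (\<lambda>x. if P then f x else g x)"
  by (cases P) auto

text \<open>In the newest direction this is linearity of a continuous derivative. In an older
  direction the identity holds for the derivative of order \<open>k\<close> at all points of
  \<open>U\<close>, hence for its difference quotients and their limits.\<close>

lemma Ck_on_iter_linear:
  fixes s :: "'k::real_or_complex \<Rightarrow> 'e::{topological_ab_group_add, t2_space} \<Rightarrow> 'e"
    and t :: "'k \<Rightarrow> 'f::{topological_ab_group_add, t2_space} \<Rightarrow> 'f"
  assumes s: "locally_convex_space s" and t: "locally_convex_space t"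
    and F: "module.subspace s F" and U: "openin (top_of_set F) U"
    and f: "Ck_on s t F G n U f" and k: "k \<le> n" and "x \<in> U" "i < k" "\<And>j. j < k \<Longrightarrow> y j \<in> F"
    and uv: "u \<in> F" "v \<in> F"
  shows "iter_dir_deriv s t k f x (y(i := u + v)) =
      iter_dir_deriv s t k f x (y(i := u)) + iter_dir_deriv s t k f x (y(i := v))" (is ?A)
    and "iter_dir_deriv s t k f x (y(i := s c u)) = t c (iter_dir_deriv s t k f x (y(i := u)))" (is ?B)
proof -
  interpret E: locally_convex_space s by fact
  interpret T: locally_convex_space t by fact
  have mem: "u + v \<in> F" "s c u \<in> F" using uv F by (auto intro: E.subspace_add E.subspace_scale)
  have "?A \<and> ?B" using assms(6-9)
  proof (induction k arbitrary: x)
    case (Suc k)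
    have kn: "k < n" using Suc.prems by simp
    note d = Ck_on_deriv(1)[OF f kn]
    have xF: "x \<in> F" using Suc.prems U openin_imp_subset by blast
    show ?case
    proof (cases "i = k")
      case True
      let ?g = "\<lambda>z. iter_dir_deriv s t k f z y"
      have g: "iter_dir_deriv s t k f z (y(k := w)) = ?g z" for z w by (intro iter_dir_deriv_cong_dirs) auto
      have der: "(diff_quot s t ?g z w \<longlongrightarrow> iter_dir_deriv s t (Suc k) f z (y(k := w))) (at 0)" if "z \<in> U" "w \<in> F" for z w
        using d[of z "y(k := w)"] that Suc.prems by (auto simp: g)
      have "continuous_on (U \<times> F) (\<lambda>p. iter_dir_deriv s t (Suc k) f (fst p) (y(k := snd p)))"
        by (rule Ck_on_continuous[OF f]) (use Suc.prems in \<open>auto simp: fun_upd_def intro!: continuous_intros continuous_on_if_const\<close>)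
      then have cont: "continuous_on (U \<times> F) (\<lambda>(z, w). iter_dir_deriv s t (Suc k) f z (y(k := w)))"
        by (simp add: case_prod_unfold)
      have A: "iter_dir_deriv s t (Suc k) f x (y(k := u + v)) =
          iter_dir_deriv s t (Suc k) f x (y(k := u)) + iter_dir_deriv s t (Suc k) f x (y(k := v))"
        by (rule deriv_add[OF s t F U der cont]) (use Suc.prems uv in auto)
      have B: "iter_dir_deriv s t (Suc k) f x (y(k := s c u)) = t c (iter_dir_deriv s t (Suc k) f x (y(k := u)))"
        using tendsto_unique[OF at_neq_bot der[of x "s c u"] diff_quot_scale[OF s t der[of x u]]]
          Suc.prems uv mem by auto
      show ?thesis using A B True by blast
    next
      case False
      then have ik: "i < k" using Suc.prems by simp
      have IH: "iter_dir_deriv s t k f z (y(i := u + v)) =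
         iter_dir_deriv s t k f z (y(i := u)) + iter_dir_deriv s t k f z (y(i := v))"
         "iter_dir_deriv s t k f z (y(i := s c u)) = t c (iter_dir_deriv s t k f z (y(i := u)))"
        if "z \<in> U" for z
        using Suc.IH[OF _ that ik] Suc.prems(1,4) by (simp_all only: Suc_leD less_SucI simp_thms True_implies_equals)
      have yk: "(y(i := w)) k = y k" for w using False by auto
      have dd: "(diff_quot s t (\<lambda>z. iter_dir_deriv s t k f z (y(i := w))) x (y k) \<longlongrightarrow>
          iter_dir_deriv s t (Suc k) f x (y(i := w))) (at 0)" if "w \<in> F" for w
        using d[of x "y(i := w)"] that Suc.prems unfolding yk by auto
      have ev: "eventually (\<lambda>h. x + s h (y k) \<in> U) (at 0)"
        by (rule eventually_in_open_line[OF s F U]) (use Suc.prems in auto)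
      have "((\<lambda>h. diff_quot s t (\<lambda>z. iter_dir_deriv s t k f z (y(i := u))) x (y k) h +
           diff_quot s t (\<lambda>z. iter_dir_deriv s t k f z (y(i := v))) x (y k) h) \<longlongrightarrow>
          iter_dir_deriv s t (Suc k) f x (y(i := u)) + iter_dir_deriv s t (Suc k) f x (y(i := v))) (at 0)"
        by (intro tendsto_add dd uv)
      then have 1: "(diff_quot s t (\<lambda>z. iter_dir_deriv s t k f z (y(i := u + v))) x (y k) \<longlongrightarrow>
          iter_dir_deriv s t (Suc k) f x (y(i := u)) + iter_dir_deriv s t (Suc k) f x (y(i := v))) (at 0)"
        by (rule Lim_transform_eventually)
          (use ev IH Suc.prems(2) in \<open>auto simp: diff_quot_def algebra_simps simp flip: T.scale_right_distrib elim!: eventually_mono\<close>)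
      have "((\<lambda>h. t c (diff_quot s t (\<lambda>z. iter_dir_deriv s t k f z (y(i := u))) x (y k) h)) \<longlongrightarrow>
          t c (iter_dir_deriv s t (Suc k) f x (y(i := u)))) (at 0)"
        by (intro T.tendsto_scale tendsto_const dd uv)
      then have 2: "(diff_quot s t (\<lambda>z. iter_dir_deriv s t k f z (y(i := s c u))) x (y k) \<longlongrightarrow>
          t c (iter_dir_deriv s t (Suc k) f x (y(i := u)))) (at 0)"
        by (rule Lim_transform_eventually)
          (use ev IH Suc.prems(2) in \<open>auto simp: diff_quot_def T.scale_right_diff_distrib mult.commute elim!: eventually_mono\<close>)
      show ?thesis
        using tendsto_unique[OF at_neq_bot dd[OF mem(1)] 1] tendsto_unique[OF at_neq_bot dd[OF mem(2)] 2] by blast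
    qed
  qed simp
  then show ?A ?B by blast+
qed

lemma continuous_on_locally:
  assumes "\<And>x. x \<in> S \<Longrightarrow> \<exists>T. open T \<and> x \<in> T \<and> continuous_on (S \<inter> T) f"
  shows "continuous_on S f"
  unfolding continuous_on_def
proof
  fix x assume x: "x \<in> S"
  obtain T where T: "open T" "x \<in> T" "continuous_on (S \<inter> T) f" using assms[OF x] by blast
  have "at x within S = at x within (S \<inter> T)"
    by (rule at_within_nhd[OF T(2,1)]) blast
  then show "(f \<longlongrightarrow> f x) (at x within S)"
    using T(2,3) x unfolding continuous_on_def by auto
qed

text \<open>A way to guess all iterated derivatives at once: any family \<open>L\<close> that starts
  with \<open>f\<close> and whose members differentiate into one another consists of the iterated
  derivatives. Difference quotients at \<open>x\<close> only see \<open>U\<close> for small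
  increments, so agreement on \<open>U\<close> passes on to the next order.\<close>

lemma Ck_on_formula:
  fixes s :: "'k::real_or_complex \<Rightarrow> 'e::{topological_ab_group_add, t2_space} \<Rightarrow> 'e"
    and t :: "'k \<Rightarrow> 'f::{topological_ab_group_add, t2_space} \<Rightarrow> 'f"
  assumes s: "locally_convex_space s" and F: "module.subspace s F" and U: "openin (top_of_set F) U"
    and L0: "\<And>x y. x \<in> U \<Longrightarrow> L 0 x y = f x"
    and LS: "\<And>k x y. k < n \<Longrightarrow> x \<in> U \<Longrightarrow> (\<And>i. i \<le> k \<Longrightarrow> y i \<in> F) \<Longrightarrow>
      (diff_quot s t (\<lambda>z. L k z y) x (y k) \<longlongrightarrow> L (Suc k) x y) (at 0)"
    and mem: "\<And>k x y. k \<le> n \<Longrightarrow> x \<in> U \<Longrightarrow> (\<And>i. i < k \<Longrightarrow> y i \<in> F) \<Longrightarrow> L k x y \<in> G"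
    and cont: "\<And>k. k \<le> n \<Longrightarrow> continuous_on (U \<times> ({..<k} \<rightarrow>\<^sub>E F)) (\<lambda>z. L k (fst z) (snd z))"
  shows "Ck_on s t F G n U f"
    and "\<And>k x y. k \<le> n \<Longrightarrow> x \<in> U \<Longrightarrow> (\<And>i. i < k \<Longrightarrow> y i \<in> F) \<Longrightarrow> iter_dir_deriv s t k f x y = L k x y"
proof -
  have der: "(diff_quot s t (\<lambda>z. iter_dir_deriv s t k f z y) x (y k) \<longlongrightarrow> L (Suc k) x y) (at 0)"
    if eq: "\<And>z. z \<in> U \<Longrightarrow> iter_dir_deriv s t k f z y = L k z y"
      and "k < n" "x \<in> U" and y: "\<And>i. i \<le> k \<Longrightarrow> y i \<in> F" for k x y
  proof -
    have "eventually (\<lambda>h. x + s h (y k) \<in> U) (at 0)"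
      using eventually_in_open_line[OF s F U \<open>x \<in> U\<close>] y by blast
    then have "eventually (\<lambda>h. iter_dir_deriv s t k f (x + s h (y k)) y = L k (x + s h (y k)) y) (at 0)"
      by (rule eventually_mono) (rule eq)
    from tendsto_diff_quot_cong[of "\<lambda>z. iter_dir_deriv s t k f z y" x s "y k" "\<lambda>z. L k z y", OF this eq[OF \<open>x \<in> U\<close>]]
    show ?thesis by (rule iffD2) (rule LS[of k x y, OF \<open>k < n\<close> \<open>x \<in> U\<close> y])
  qed
  show eq: "iter_dir_deriv s t k f x y = L k x y"
    if "k \<le> n" "x \<in> U" "\<And>i. i < k \<Longrightarrow> y i \<in> F" for k x y
    using that
  proof (induction k arbitrary: x)
    case 0
    then show ?case using L0 by simp
  next
    case (Suc k)
    have "(diff_quot s t (\<lambda>z. iter_dir_deriv s t k f z y) x (y k) \<longlongrightarrow> L (Suc k) x y) (at 0)"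
    proof (rule der)
      show "iter_dir_deriv s t k f z y = L k z y" if "z \<in> U" for z
        using Suc.IH[OF _ that] Suc.prems(1,3) by simp
    qed (use Suc.prems in \<open>auto simp: less_Suc_eq_le\<close>)
    from dir_deriv_eq[OF this] show ?case by simp
  qed
  show "Ck_on s t F G n U f"
  proof (rule Ck_onI)
    show "f ` U \<subseteq> G"
    proof
      fix w assume "w \<in> f ` U"
      then obtain x where "x \<in> U" "w = f x" by blast
      then show "w \<in> G" using mem[of 0 x] L0[of x] by simp
    qed
    show "\<exists>D\<in>G. (diff_quot s t (\<lambda>z. iter_dir_deriv s t k f z y) x (y k) \<longlongrightarrow> D) (at 0)"
      if "k < n" "x \<in> U" and y: "\<And>i. i \<le> k \<Longrightarrow> y i \<in> F" for k x y
    proof (intro bexI)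
      show "L (Suc k) x y \<in> G" using mem[of "Suc k" x y] that by (simp add: less_Suc_eq_le)
      show "(diff_quot s t (\<lambda>z. iter_dir_deriv s t k f z y) x (y k) \<longlongrightarrow> L (Suc k) x y) (at 0)"
      proof (rule der[OF _ that(1,2) y])
        show "iter_dir_deriv s t k f z y = L k z y" if "z \<in> U" for z
          by (rule eq) (use \<open>k < n\<close> that y in simp_all)
      qed
    qed
    show "continuous_on (U \<times> ({..<k} \<rightarrow>\<^sub>E F)) (\<lambda>z. iter_dir_deriv s t k f (fst z) (snd z))" if "k \<le> n" for k
    proof (rule continuous_on_eq[OF cont[OF that]])
      fix z assume z: "z \<in> U \<times> ({..<k} \<rightarrow>\<^sub>E F)"
      have zU: "fst z \<in> U" and zP: "snd z \<in> {..<k} \<rightarrow>\<^sub>E F" using z by (simp_all add: mem_Times_iff)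
      have "snd z i \<in> F" if "i < k" for i using PiE_mem[OF zP, of i] that by simp
      from eq[of k "fst z" "snd z", OF that zU this]
      show "L k (fst z) (snd z) = iter_dir_deriv s t k f (fst z) (snd z)" by simp
    qed
  qed
qed

section \<open>Stability of class C^k: locality, restriction to subspaces, linear maps, sums\<close>

lemma Ck_on_cong:
  fixes s :: "'k::real_or_complex \<Rightarrow> 'e::{topological_ab_group_add, t2_space} \<Rightarrow> 'e"
    and t :: "'k \<Rightarrow> 'f::{topological_ab_group_add, t2_space} \<Rightarrow> 'f"
  assumes s: "locally_convex_space s" and F: "module.subspace s F" and U: "openin (top_of_set F) U"
    and f: "Ck_on s t F G n U f" and eq: "\<And>x. x \<in> U \<Longrightarrow> f x = g x"
  shows "Ck_on s t F G n U g"
proof (rule Ck_on_formula(1)[OF s F U, where L = "\<lambda>k. iter_dir_deriv s t k f"])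
  show "continuous_on (U \<times> ({..<k} \<rightarrow>\<^sub>E F)) (\<lambda>z. iter_dir_deriv s t k f (fst z) (snd z))" if "k \<le> n" for k
    using f that unfolding Ck_on_def by (simp add: case_prod_unfold)
  show "(diff_quot s t (\<lambda>z. iter_dir_deriv s t k f z y) x (y k) \<longlongrightarrow> iter_dir_deriv s t (Suc k) f x y) (at 0)"
    if "k < n" "x \<in> U" "\<And>i. i \<le> k \<Longrightarrow> y i \<in> F" for k x y
    using that by (rule Ck_on_deriv(1)[OF f])
  show "iter_dir_deriv s t k f x y \<in> G" if "k \<le> n" "x \<in> U" "\<And>i. i < k \<Longrightarrow> y i \<in> F" for k x y
    using that by (rule Ck_on_iter_mem[OF f])
qed (simp add: eq)

lemma Ck_on_subset:
  assumes f: "Ck_on s t F G n U f" and "U' \<subseteq> U"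
  shows "Ck_on s t F G n U' f"
  unfolding Ck_on_def
proof (intro conjI allI impI ballI)
  show "f ` U' \<subseteq> G" using assms unfolding Ck_on_def by blast
  show "\<exists>D\<in>G. (diff_quot s t (\<lambda>z. iter_dir_deriv s t k f z y) x (y k) \<longlongrightarrow> D) (at 0)"
    if "k < n" "x \<in> U'" "y \<in> {..<Suc k} \<rightarrow>\<^sub>E F" for k x y
    using that assms unfolding Ck_on_def by blast
  show "continuous_on (U' \<times> ({..<k} \<rightarrow>\<^sub>E F)) (\<lambda>(x, y). iter_dir_deriv s t k f x y)" if "k \<le> n" for k
  proof (rule continuous_on_subset)
    show "continuous_on (U \<times> ({..<k} \<rightarrow>\<^sub>E F)) (\<lambda>(x, y). iter_dir_deriv s t k f x y)"
      using f that unfolding Ck_on_def by blast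
  qed (use assms in blast)
qed

lemma Ck_on_locally:
  assumes loc: "\<And>x. x \<in> U \<Longrightarrow> \<exists>U'. openin (top_of_set F) U' \<and> x \<in> U' \<and> U' \<subseteq> U \<and> Ck_on s t F G n U' f"
    and U: "U \<subseteq> F"
  shows "Ck_on s t F G n U f"
  unfolding Ck_on_def
proof (intro conjI allI impI ballI)
  show "f ` U \<subseteq> G" using loc unfolding Ck_on_def by blast
  show "\<exists>D\<in>G. (diff_quot s t (\<lambda>z. iter_dir_deriv s t k f z y) x (y k) \<longlongrightarrow> D) (at 0)"
    if k: "k < n" "x \<in> U" "y \<in> {..<Suc k} \<rightarrow>\<^sub>E F" for k x y
  proof -
    obtain U' where "x \<in> U'" "Ck_on s t F G n U' f" using loc[OF k(2)] by blast
    then show ?thesis using k unfolding Ck_on_def by blast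
  qed
  show "continuous_on (U \<times> ({..<k} \<rightarrow>\<^sub>E F)) (\<lambda>(x, y). iter_dir_deriv s t k f x y)" if k: "k \<le> n" for k
  proof (rule continuous_on_locally)
    fix z assume z: "z \<in> U \<times> ({..<k} \<rightarrow>\<^sub>E F)"
    then obtain U' where U': "openin (top_of_set F) U'" "fst z \<in> U'" "U' \<subseteq> U" "Ck_on s t F G n U' f"
      using loc[of "fst z"] by auto
    obtain T where T: "open T" "U' = F \<inter> T" using U'(1) by (auto simp: openin_open)
    have "continuous_on (U' \<times> ({..<k} \<rightarrow>\<^sub>E F)) (\<lambda>(x, y). iter_dir_deriv s t k f x y)"
      using U'(4) k unfolding Ck_on_def by blast
    then have "continuous_on ((U \<times> ({..<k} \<rightarrow>\<^sub>E F)) \<inter> (T \<times> UNIV)) (\<lambda>(x, y). iter_dir_deriv s t k f x y)"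
      by (rule continuous_on_subset) (use T U in auto)
    then show "\<exists>T. open T \<and> z \<in> T \<and> continuous_on ((U \<times> ({..<k} \<rightarrow>\<^sub>E F)) \<inter> T) (\<lambda>(x, y). iter_dir_deriv s t k f x y)"
      by (intro exI[of _ "T \<times> UNIV"]) (use T U' in \<open>auto simp: open_Times mem_Times_iff\<close>)
  qed
qed

text \<open>For base point and directions in \<open>F'\<close> all difference quotients lie in
  \<open>G'\<close>, and \<open>G'\<close> is closed; so every iterated derivative has values in
  \<open>G'\<close>.\<close>

lemma Ck_on_restrict_subspace:
  fixes s :: "'k::real_or_complex \<Rightarrow> 'e::{topological_ab_group_add, t2_space} \<Rightarrow> 'e"
    and t :: "'k \<Rightarrow> 'f::{topological_ab_group_add, t2_space} \<Rightarrow> 'f"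
  assumes s: "locally_convex_space s" and t: "locally_convex_space t"
    and F: "module.subspace s F" and U: "openin (top_of_set F) U"
    and f: "Ck_on s t F G n U f" and F': "module.subspace s F'" "F' \<subseteq> F"
    and G': "module.subspace t G'" "closed G'" and im: "f ` (U \<inter> F') \<subseteq> G'"
  shows "Ck_on s t F' G' n (U \<inter> F') f"
proof -
  interpret E: locally_convex_space s by fact
  interpret T: locally_convex_space t by fact
  have U': "openin (top_of_set F') (U \<inter> F')" using U F'(2) by (auto simp: openin_open)
  have lim: "(diff_quot s t (\<lambda>z. iter_dir_deriv s t k f z y) x (y k) \<longlongrightarrow> iter_dir_deriv s t (Suc k) f x y) (at 0)"
    if "k < n" "x \<in> U \<inter> F'" "\<And>i. i \<le> k \<Longrightarrow> y i \<in> F'" for k x y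
    by (rule Ck_on_deriv(1)[OF f]) (use that F' in auto)
  have mem: "iter_dir_deriv s t k f x y \<in> G'"
    if "k \<le> n" "x \<in> U \<inter> F'" "\<And>i. i < k \<Longrightarrow> y i \<in> F'" for k x y
    using that
  proof (induction k arbitrary: x)
    case 0
    then show ?case using im by auto
  next
    case (Suc k)
    have m: "iter_dir_deriv s t k f z y \<in> G'" if "z \<in> U \<inter> F'" for z
      using Suc.IH[OF _ that] Suc.prems(1,3) by simp
    show ?case
    proof (rule Lim_in_closed_set[OF G'(2) _ at_neq_bot])
      show "(diff_quot s t (\<lambda>z. iter_dir_deriv s t k f z y) x (y k) \<longlongrightarrow> iter_dir_deriv s t (Suc k) f x y) (at 0)"
        using Suc.prems by (intro lim) auto
      have "eventually (\<lambda>h. x + s h (y k) \<in> U \<inter> F') (at 0)"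
        by (rule eventually_in_open_line[OF s F'(1) U']) (use Suc.prems in auto)
      then show "eventually (\<lambda>h. diff_quot s t (\<lambda>z. iter_dir_deriv s t k f z y) x (y k) h \<in> G') (at 0)"
        unfolding diff_quot_def
        by (rule eventually_mono) (intro T.subspace_scale[OF G'(1)] T.subspace_diff[OF G'(1)] m, auto simp: Suc.prems(2)[simplified])
    qed
  qed
  show ?thesis
  proof (rule Ck_onI)
    show "\<exists>D\<in>G'. (diff_quot s t (\<lambda>z. iter_dir_deriv s t k f z y) x (y k) \<longlongrightarrow> D) (at 0)"
      if "k < n" "x \<in> U \<inter> F'" "\<And>i. i \<le> k \<Longrightarrow> y i \<in> F'" for k x y
      using lim[OF that] mem[of "Suc k" x y] that by (auto simp: less_Suc_eq_le intro!: bexI[of _ "iter_dir_deriv s t (Suc k) f x y"])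
    show "continuous_on ((U \<inter> F') \<times> ({..<k} \<rightarrow>\<^sub>E F')) (\<lambda>z. iter_dir_deriv s t k f (fst z) (snd z))" if "k \<le> n" for k
    proof (rule continuous_on_subset)
      show "continuous_on (U \<times> ({..<k} \<rightarrow>\<^sub>E F)) (\<lambda>z. iter_dir_deriv s t k f (fst z) (snd z))"
        using f that unfolding Ck_on_def by (simp add: case_prod_unfold)
      have "({..<k} \<rightarrow>\<^sub>E F') \<subseteq> ({..<k} \<rightarrow>\<^sub>E F)" by (rule PiE_mono) (rule F'(2))
      then show "(U \<inter> F') \<times> ({..<k} \<rightarrow>\<^sub>E F') \<subseteq> U \<times> ({..<k} \<rightarrow>\<^sub>E F)" by blast
    qed
  qed (rule im)
qed

lemma Ck_on_linear:
  fixes s :: "'k::real_or_complex \<Rightarrow> 'e::{topological_ab_group_add, t2_space} \<Rightarrow> 'e"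
    and t :: "'k \<Rightarrow> 'f::{topological_ab_group_add, t2_space} \<Rightarrow> 'f"
  assumes s: "locally_convex_space s" and t: "locally_convex_space t"
    and F: "module.subspace s F" and U: "openin (top_of_set F) U" and G: "module.subspace t G"
    and p: "continuous_linear_on s t F G p"
  shows "Ck_on s t F G n U p"
proof -
  interpret E: locally_convex_space s by fact
  interpret T: locally_convex_space t by fact
  have UF: "U \<subseteq> F" using U openin_imp_subset by blast
  have pF: "p x \<in> G" if "x \<in> F" for x using p that by (auto simp: continuous_linear_on_def)
  have padd: "p (x + y) = p x + p y" if "x \<in> F" "y \<in> F" for x y using p that by (auto simp: continuous_linear_on_def)
  have psc: "p (s c x) = t c (p x)" if "x \<in> F" for c x using p that by (auto simp: continuous_linear_on_def)
  have pc: "continuous_on F p" using p by (simp add: continuous_linear_on_def)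
  show ?thesis
  \<comment> \<open>The first derivative of a linear map does not depend on the base point, so all
    further derivatives vanish.\<close>
  proof (rule Ck_on_formula(1)[OF s F U, where L = "\<lambda>k x y. if k = 0 then p x else if k = 1 then p (y 0) else 0"])
    fix k x and y :: "nat \<Rightarrow> 'e" assume k: "k < n" and x: "x \<in> U" and y: "\<And>i. i \<le> k \<Longrightarrow> y i \<in> F"
    show "(diff_quot s t (\<lambda>z. if k = 0 then p z else if k = 1 then p (y 0) else 0) x (y k) \<longlongrightarrow>
        (if Suc k = 0 then p x else if Suc k = 1 then p (y 0) else 0)) (at 0)"
    proof (cases "k = 0")
      case True
      have "diff_quot s t p x (y 0) h = p (y 0)" if "h \<noteq> 0" for h
        using that x y[of 0] UF by (simp add: diff_quot_def padd psc E.subspace_scale[OF F] subset_iff)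
      then have "eventually (\<lambda>h. p (y 0) = diff_quot s t p x (y 0) h) (at 0)"
        by (simp add: eventually_at_filter)
      from Lim_transform_eventually[OF tendsto_const this] show ?thesis using True by simp
    qed (simp add: diff_quot_def[abs_def])
  next
    fix k assume "k \<le> n"
    have 1: "continuous_on (U \<times> ({..<k} \<rightarrow>\<^sub>E F)) (\<lambda>z. p (fst z))"
      by (rule continuous_on_compose2[OF pc]) (use UF in \<open>auto intro!: continuous_intros\<close>)
    have 2: "continuous_on (U \<times> ({..<k} \<rightarrow>\<^sub>E F)) (\<lambda>z. p (snd z 0))" if "k = 1"
    proof (rule continuous_on_compose2[OF pc])
      show "continuous_on (U \<times> ({..<k} \<rightarrow>\<^sub>E F)) (\<lambda>z. snd z 0)"
        using that by (intro continuous_on_PiE_component) simp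
      show "(\<lambda>z. snd z 0) ` (U \<times> ({..<k} \<rightarrow>\<^sub>E F)) \<subseteq> F" using that by (force simp: PiE_iff)
    qed
    show "continuous_on (U \<times> ({..<k} \<rightarrow>\<^sub>E F))
       (\<lambda>z. if k = 0 then p (fst z) else if k = 1 then p (snd z 0) else 0)"
      using 1 2 by (intro continuous_on_if_const) auto
  qed (use UF pF T.subspace_0[OF G] in auto)
qed

lemma Ck_on_add:
  fixes s :: "'k::real_or_complex \<Rightarrow> 'e::{topological_ab_group_add, t2_space} \<Rightarrow> 'e"
    and t :: "'k \<Rightarrow> 'f::{topological_ab_group_add, t2_space} \<Rightarrow> 'f"
  assumes s: "locally_convex_space s" and t: "locally_convex_space t"
    and F: "module.subspace s F" and U: "openin (top_of_set F) U" and G: "module.subspace t G"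
    and f: "Ck_on s t F G n U f" and g: "Ck_on s t F G n U g"
  shows "Ck_on s t F G n U (\<lambda>x. f x + g x)"
proof -
  interpret E: locally_convex_space s by fact
  interpret T: locally_convex_space t by fact
  show ?thesis
  proof (rule Ck_on_formula(1)[OF s F U, where L = "\<lambda>k x y. iter_dir_deriv s t k f x y + iter_dir_deriv s t k g x y"])
    fix k x and y :: "nat \<Rightarrow> 'e" assume k: "k < n" and x: "x \<in> U" and y: "\<And>i. i \<le> k \<Longrightarrow> y i \<in> F"
    have "(\<lambda>h. diff_quot s t (\<lambda>z. iter_dir_deriv s t k f z y) x (y k) h + diff_quot s t (\<lambda>z. iter_dir_deriv s t k g z y) x (y k) h)
       = diff_quot s t (\<lambda>z. iter_dir_deriv s t k f z y + iter_dir_deriv s t k g z y) x (y k)"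
      by (simp add: diff_quot_def fun_eq_iff algebra_simps flip: T.scale_right_distrib)
    then show "(diff_quot s t (\<lambda>z. iter_dir_deriv s t k f z y + iter_dir_deriv s t k g z y) x (y k) \<longlongrightarrow>
        iter_dir_deriv s t (Suc k) f x y + iter_dir_deriv s t (Suc k) g x y) (at 0)"
      using tendsto_add[OF Ck_on_deriv(1)[OF f k x, of y, OF y] Ck_on_deriv(1)[OF g k x, of y, OF y]] by simp
  next
    fix k assume "k \<le> n"
    then show "continuous_on (U \<times> ({..<k} \<rightarrow>\<^sub>E F))
       (\<lambda>z. iter_dir_deriv s t k f (fst z) (snd z) + iter_dir_deriv s t k g (fst z) (snd z))"
      using f g unfolding Ck_on_def by (intro continuous_on_add) (simp_all add: case_prod_unfold)
  next
    fix k x and y :: "nat \<Rightarrow> 'e" assume "k \<le> n" "x \<in> U" "\<And>i. i < k \<Longrightarrow> y i \<in> F"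
    then show "iter_dir_deriv s t k f x y + iter_dir_deriv s t k g x y \<in> G"
      by (intro T.subspace_add[OF G] Ck_on_iter_mem[OF f] Ck_on_iter_mem[OF g])
  qed simp
qed

subsection \<open>The chain rule of arbitrary order\<close>

text \<open>
  A derivative of order \<open>k\<close> of \<open>f \<circ> g\<close> is a sum over the partitions of \<open>{..<k}\<close> (Faa di Bruno).
  A partition is a list of blocks, and a new index either opens a new last block or is appended to
  an existing block.
\<close>

fun partitions :: "nat \<Rightarrow> nat list list list" where
  "partitions 0 = [[]]"
| "partitions (Suc k) =
    concat (map (\<lambda>\<tau>. (\<tau> @ [[k]]) # map (\<lambda>j. \<tau>[j := \<tau> ! j @ [k]]) [0..<length \<tau>]) (partitions k))"

text \<open>The bounds on lengths keep the orders of the derivatives of \<open>f\<close> and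
  \<open>g\<close> at most \<open>k\<close>; the bound on entries ensures that only the directions
  with index below \<open>k\<close> are used.\<close>

lemma partitions_bounds:
  "\<tau> \<in> set (partitions k) \<Longrightarrow> length \<tau> \<le> k \<and> (\<forall>b\<in>set \<tau>. length b \<le> k \<and> (\<forall>l\<in>set b. l < k))"
proof (induction k arbitrary: \<tau>)
  case (Suc k)
  then obtain \<sigma> where \<sigma>: "\<sigma> \<in> set (partitions k)"
    and "\<tau> \<in> set ((\<sigma> @ [[k]]) # map (\<lambda>j. \<sigma>[j := \<sigma> ! j @ [k]]) [0..<length \<sigma>])"
    unfolding partitions.simps set_concat set_map by blast
  then consider "\<tau> = \<sigma> @ [[k]]" | j where "j < length \<sigma>" "\<tau> = \<sigma>[j := \<sigma> ! j @ [k]]" by auto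
  then show ?case
  proof cases
    case 1
    then show ?thesis using Suc.IH[OF \<sigma>] by (auto simp: less_Suc_eq le_Suc_eq)
  next
    case 2
    have "\<sigma> ! j \<in> set \<sigma>" using 2 by simp
    then have \<sigma>j: "length (\<sigma> ! j) \<le> k" "\<forall>l\<in>set (\<sigma> ! j). l < k" using Suc.IH[OF \<sigma>] by blast+
    have "length b \<le> Suc k \<and> (\<forall>l\<in>set b. l < Suc k)" if "b \<in> set \<tau>" for b
    proof -
      have "b \<in> set \<sigma> \<or> b = \<sigma> ! j @ [k]"
        using that set_update_subset_insert[of \<sigma> j "\<sigma> ! j @ [k]"] 2(2) by auto
      then show ?thesis using Suc.IH[OF \<sigma>] \<sigma>j by (auto simp: less_Suc_eq le_Suc_eq)
    qed
    then show ?thesis using Suc.IH[OF \<sigma>] 2 by simp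
  qed
qed simp

text \<open>The Faa di Bruno summand of one partition. Blocks and their entries are kept in a fixed
  order, so that symmetry of higher derivatives is never called upon.\<close>

definition chain_term where
  "chain_term s t u f g \<tau> x y = iter_dir_deriv t u (length \<tau>) f (g x)
     (\<lambda>j. iter_dir_deriv s t (length (\<tau> ! j)) g x (\<lambda>l. y (\<tau> ! j ! l)))"

text \<open>The product rule, by telescoping: passing from \<open>W0\<close> to \<open>W h\<close>
  one slot at a time, each step is a single increment in one slot, to which linearity applies.
  Continuity of the multilinear map appears as \<open>lim\<close>, a closure property under the
  limits that occur.\<close>

lemma multilinear_deriv:
  fixes t :: "'k::real_or_complex \<Rightarrow> 'f::{topological_ab_group_add, t2_space} \<Rightarrow> 'f"
    and u :: "'k \<Rightarrow> 'h::{topological_ab_group_add, t2_space} \<Rightarrow> 'h"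
    and \<beta> :: "(nat \<Rightarrow> 'f) \<Rightarrow> 'h"
  assumes t: "locally_convex_space t" and u: "locally_convex_space u" and G: "module.subspace t G"
    and cong: "\<And>y y'. (\<And>j. j < m \<Longrightarrow> y j = y' j) \<Longrightarrow> \<beta> y = \<beta> y'"
    and add: "\<And>y i a b. i < m \<Longrightarrow> (\<And>j. j < m \<Longrightarrow> y j \<in> G) \<Longrightarrow> a \<in> G \<Longrightarrow> b \<in> G \<Longrightarrow>
        \<beta> (y(i := a + b)) = \<beta> (y(i := a)) + \<beta> (y(i := b))"
    and scale: "\<And>y i c a. i < m \<Longrightarrow> (\<And>j. j < m \<Longrightarrow> y j \<in> G) \<Longrightarrow> a \<in> G \<Longrightarrow>
        \<beta> (y(i := t c a)) = u c (\<beta> (y(i := a)))"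
    and lim: "\<And>W w. (\<And>j. j < m \<Longrightarrow> ((\<lambda>h. W h j) \<longlongrightarrow> w j) (at (0::'k))) \<Longrightarrow>
        (\<And>j. j < m \<Longrightarrow> w j \<in> G) \<Longrightarrow> (\<And>j. j < m \<Longrightarrow> eventually (\<lambda>h. W h j \<in> G) (at 0)) \<Longrightarrow>
        ((\<lambda>h. \<beta> (W h)) \<longlongrightarrow> \<beta> w) (at 0)"
    and W: "\<And>j. j < m \<Longrightarrow> ((\<lambda>h. t (inverse h) (W h j - W0 j)) \<longlongrightarrow> W' j) (at 0)"
      "\<And>j. j < m \<Longrightarrow> ((\<lambda>h. W h j) \<longlongrightarrow> W0 j) (at 0)"
      "\<And>j. j < m \<Longrightarrow> eventually (\<lambda>h. W h j \<in> G) (at 0)"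
      "\<And>j. j < m \<Longrightarrow> W0 j \<in> G" "\<And>j. j < m \<Longrightarrow> W' j \<in> G"
  shows "((\<lambda>h. u (inverse h) (\<beta> (W h) - \<beta> W0)) \<longlongrightarrow> (\<Sum>j<m. \<beta> (W0(j := W' j)))) (at 0)"
proof -
  interpret T: locally_convex_space t by fact
  interpret H: locally_convex_space u by fact
  \<comment> \<open>Slots below \<open>j\<close> have already been moved to \<open>W h\<close>, the
    others are still at \<open>W0\<close>.\<close>
  define Z where "Z h j i = (if i < j then W h i else W0 i)" for h :: 'k and j i :: nat
  define q where "q h j = t (inverse h) (W h j - W0 j)" for h j
  have ev: "eventually (\<lambda>h. \<forall>j\<in>{..<m}. W h j \<in> G) (at 0)"
    using W(3) by (intro eventually_ball_finite) auto
  have "((\<lambda>h. \<Sum>j<m. \<beta> ((Z h j)(j := q h j))) \<longlongrightarrow> (\<Sum>j<m. \<beta> (W0(j := W' j)))) (at 0)"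
  proof (rule tendsto_sum, rule lim)
    fix j i assume j: "j \<in> {..<m}" and i: "i < m"
    show "((\<lambda>h. ((Z h j)(j := q h j)) i) \<longlongrightarrow> (W0(j := W' j)) i) (at 0)"
      using W(1)[OF i] W(2)[OF i] by (cases "i = j"; cases "i < j") (simp_all add: Z_def q_def)
    show "(W0(j := W' j)) i \<in> G" using W(4,5) i j by simp
    show "eventually (\<lambda>h. ((Z h j)(j := q h j)) i \<in> G) (at 0)"
      using W(3)[OF i]
      by (rule eventually_mono)
        (use W(4)[OF i] i in \<open>auto simp: Z_def q_def intro!: T.subspace_scale[OF G] T.subspace_diff[OF G]\<close>)
  qed
  then show ?thesis
  proof (rule Lim_transform_eventually)
    show "eventually (\<lambda>h. (\<Sum>j<m. \<beta> ((Z h j)(j := q h j))) = u (inverse h) (\<beta> (W h) - \<beta> W0)) (at 0)"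
      using ev
    proof (rule eventually_mono)
      fix h assume h: "\<forall>j\<in>{..<m}. W h j \<in> G"
      have ZG: "Z h j i \<in> G" if "i < m" for i j using h W(4) that by (simp add: Z_def)
      have "u (inverse h) (\<beta> (Z h (Suc j)) - \<beta> (Z h j)) = \<beta> ((Z h j)(j := q h j))" if j: "j < m" for j
      proof -
        have d: "W h j - W0 j \<in> G" using h W(4) j by (intro T.subspace_diff[OF G]) auto
        have "\<beta> (Z h (Suc j)) = \<beta> ((Z h j)(j := (W h j - W0 j) + W0 j))"
          by (rule cong) (auto simp: Z_def)
        also have "\<dots> = \<beta> ((Z h j)(j := W h j - W0 j)) + \<beta> ((Z h j)(j := W0 j))"
          by (rule add[OF j ZG d W(4)[OF j]])
        also have "\<beta> ((Z h j)(j := W0 j)) = \<beta> (Z h j)" by (rule cong) (auto simp: Z_def)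
        finally have "\<beta> (Z h (Suc j)) - \<beta> (Z h j) = \<beta> ((Z h j)(j := W h j - W0 j))"
          by (simp only: add_diff_cancel_right')
        then show ?thesis using scale[of j "Z h j" "W h j - W0 j" "inverse h", OF j ZG d]
          by (simp only: q_def)
      qed
      then have "(\<Sum>j<m. \<beta> ((Z h j)(j := q h j))) = (\<Sum>j<m. u (inverse h) (\<beta> (Z h (Suc j)) - \<beta> (Z h j)))"
        by simp
      also have "\<dots> = u (inverse h) (\<beta> (Z h m) - \<beta> (Z h 0))"
        by (simp only: H.scale_sum_right[symmetric] sum_lessThan_telescope[of "\<lambda>j. \<beta> (Z h j)" m])
      also have "\<beta> (Z h m) = \<beta> (W h)" by (rule cong) (simp add: Z_def)
      also have "\<beta> (Z h 0) = \<beta> W0" by (rule cong) (simp add: Z_def)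
      finally show "(\<Sum>j<m. \<beta> ((Z h j)(j := q h j))) = u (inverse h) (\<beta> (W h) - \<beta> W0)" .
    qed
  qed
qed

lemma tendsto_sum_list:
  fixes f :: "'i \<Rightarrow> 'a \<Rightarrow> 'b::topological_comm_monoid_add"
  assumes "\<And>a. a \<in> set xs \<Longrightarrow> ((\<lambda>i. f i a) \<longlongrightarrow> l a) Fl"
  shows "((\<lambda>i. \<Sum>a\<leftarrow>xs. f i a) \<longlongrightarrow> (\<Sum>a\<leftarrow>xs. l a)) Fl"
  using assms by (induction xs) (auto intro!: tendsto_add)

lemma continuous_on_sum_list:
  fixes f :: "'i::topological_space \<Rightarrow> 'a \<Rightarrow> 'b::topological_comm_monoid_add"
  assumes "\<And>a. a \<in> set xs \<Longrightarrow> continuous_on S (\<lambda>i. f i a)"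
  shows "continuous_on S (\<lambda>i. \<Sum>a\<leftarrow>xs. f i a)"
  using assms by (induction xs) (auto intro!: continuous_on_add)

lemma sum_list_concat_map: "(\<Sum>x\<leftarrow>concat (map c xs). h x) = (\<Sum>x\<leftarrow>xs. \<Sum>y\<leftarrow>c x. h y)"
  by (induction xs) auto

lemma diff_quot_sum_list:
  assumes t: "locally_convex_space t"
  shows "diff_quot s t (\<lambda>z. \<Sum>a\<leftarrow>xs. f a z) x v = (\<lambda>h. \<Sum>a\<leftarrow>xs. diff_quot s t (f a) x v h)"
proof -
  interpret T: locally_convex_space t by fact
  show ?thesis
  proof (rule ext)
    fix h
    show "diff_quot s t (\<lambda>z. \<Sum>a\<leftarrow>xs. f a z) x v h = (\<Sum>a\<leftarrow>xs. diff_quot s t (f a) x v h)"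
      by (induction xs) (simp_all add: diff_quot_def T.scale_right_distrib T.scale_right_diff_distrib)
  qed
qed

context
  fixes s :: "'k::real_or_complex \<Rightarrow> 'e::{topological_ab_group_add, t2_space} \<Rightarrow> 'e"
    and t :: "'k \<Rightarrow> 'f::{topological_ab_group_add, t2_space} \<Rightarrow> 'f"
    and u :: "'k \<Rightarrow> 'h::{topological_ab_group_add, t2_space} \<Rightarrow> 'h"
    and F :: "'e set" and G :: "'f set" and H :: "'h set" and U V f g n
  assumes s: "locally_convex_space s" and t: "locally_convex_space t" and u: "locally_convex_space u"
    and F: "module.subspace s F" and G: "module.subspace t G" and H: "module.subspace u H"
    and U: "openin (top_of_set F) U" and V: "openin (top_of_set G) V"
    and f: "Ck_on t u G H n V f" and g: "Ck_on s t F G n U g" and gUV: "g ` U \<subseteq> V"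
begin

interpretation E: locally_convex_space s by (rule s)
interpretation T: locally_convex_space t by (rule t)
interpretation H: locally_convex_space u by (rule u)

lemma chain_term_inner:
  assumes k: "k \<le> n" and \<tau>: "\<tau> \<in> set (partitions k)" and j: "j < length \<tau>"
    and x: "x \<in> U" and y: "\<And>i. i < k \<Longrightarrow> y i \<in> F"
  shows "length (\<tau> ! j) \<le> k" "l < length (\<tau> ! j) \<Longrightarrow> \<tau> ! j ! l < k"
    "iter_dir_deriv s t (length (\<tau> ! j)) g x (\<lambda>l. y (\<tau> ! j ! l)) \<in> G"
proof -
  have "\<tau> ! j \<in> set \<tau>" using j by simp
  then have b: "length (\<tau> ! j) \<le> k" "\<forall>l\<in>set (\<tau> ! j). l < k" using partitions_bounds[OF \<tau>] by blast+
  then show "length (\<tau> ! j) \<le> k" "l < length (\<tau> ! j) \<Longrightarrow> \<tau> ! j ! l < k" by simp_all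
  show "iter_dir_deriv s t (length (\<tau> ! j)) g x (\<lambda>l. y (\<tau> ! j ! l)) \<in> G"
    by (rule Ck_on_iter_mem[OF g _ x]) (use b k in \<open>auto intro!: y\<close>)
qed

lemma chain_term_mem:
  assumes k: "k \<le> n" and \<tau>: "\<tau> \<in> set (partitions k)"
    and x: "x \<in> U" and y: "\<And>i. i < k \<Longrightarrow> y i \<in> F"
  shows "chain_term s t u f g \<tau> x y \<in> H"
  unfolding chain_term_def
proof (rule Ck_on_iter_mem[OF f])
  show "length \<tau> \<le> n" using partitions_bounds[OF \<tau>] k by simp
  show "g x \<in> V" using x gUV by blast
  show "iter_dir_deriv s t (length (\<tau> ! j)) g x (\<lambda>l. y (\<tau> ! j ! l)) \<in> G" if "j < length \<tau>" for j
    by (rule chain_term_inner(3)[OF k \<tau> that x]) (rule y)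
qed

lemma chain_term_continuous:
  assumes k: "k \<le> n" and \<tau>: "\<tau> \<in> set (partitions k)"
  shows "continuous_on (U \<times> ({..<k} \<rightarrow>\<^sub>E F)) (\<lambda>z. chain_term s t u f g \<tau> (fst z) (snd z))"
  unfolding chain_term_def
proof (rule Ck_on_continuous[OF f])
  let ?S = "U \<times> ({..<k} \<rightarrow>\<^sub>E F)"
  have yF: "snd z i \<in> F" if "z \<in> ?S" "i < k" for z i
    using PiE_mem[of "snd z" "{..<k}" "\<lambda>_. F" i] that by (simp add: mem_Times_iff)
  show "length \<tau> \<le> n" using partitions_bounds[OF \<tau>] k by simp
  have "continuous_on ?S (\<lambda>z. iter_dir_deriv s t 0 g (fst z) (\<lambda>_. 0))"
    by (rule Ck_on_continuous[OF g]) (auto intro!: continuous_intros)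
  then show "continuous_on ?S (\<lambda>z. g (fst z))" by simp
  show "(\<lambda>z. g (fst z)) ` ?S \<subseteq> V" using gUV by auto
  show "iter_dir_deriv s t (length (\<tau> ! j)) g (fst z) (\<lambda>l. snd z (\<tau> ! j ! l)) \<in> G" if "z \<in> ?S" "j < length \<tau>" for z j
    by (rule chain_term_inner(3)[OF k \<tau> that(2)]) (use that(1) yF[OF that(1)] in \<open>simp_all add: mem_Times_iff\<close>)
  show "continuous_on ?S (\<lambda>z. iter_dir_deriv s t (length (\<tau> ! j)) g (fst z) (\<lambda>l. snd z (\<tau> ! j ! l)))"
    if j: "j < length \<tau>" for j
  proof (rule Ck_on_continuous[OF g])
    have "\<tau> ! j \<in> set \<tau>" using j by simp
    then have b: "length (\<tau> ! j) \<le> k" "\<forall>l\<in>set (\<tau> ! j). l < k" using partitions_bounds[OF \<tau>] by blast+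
    then show "length (\<tau> ! j) \<le> n" using k by simp
    have lk: "\<tau> ! j ! l < k" if "l < length (\<tau> ! j)" for l using b that by simp
    show "continuous_on ?S (\<lambda>z. snd z (\<tau> ! j ! l))" if "l < length (\<tau> ! j)" for l
      by (rule continuous_on_PiE_component[OF lk[OF that]])
    show "snd z (\<tau> ! j ! l) \<in> F" if "z \<in> ?S" "l < length (\<tau> ! j)" for z l
      using yF[OF that(1) lk[OF that(2)]] .
  qed (auto intro!: continuous_intros)
qed

text \<open>A summand depends on \<open>x\<close> in two ways. Moving the base point
  \<open>g x\<close> of the derivative of \<open>f\<close> opens a new block; moving the directions,
  which are derivatives of \<open>g\<close>, appends the new index to an existing block. The
  increment is split accordingly.\<close>

lemma chain_term_deriv:
  assumes k: "k < n" and \<tau>: "\<tau> \<in> set (partitions k)" and x: "x \<in> U" and y: "\<And>i. i \<le> k \<Longrightarrow> y i \<in> F"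
  shows "(diff_quot s u (\<lambda>z. chain_term s t u f g \<tau> z y) x (y k) \<longlongrightarrow>
    (\<Sum>\<sigma>\<leftarrow>(\<tau> @ [[k]]) # map (\<lambda>j. \<tau>[j := \<tau> ! j @ [k]]) [0..<length \<tau>]. chain_term s t u f g \<sigma> x y)) (at 0)"
proof -
  define m where "m = length \<tau>"
  define L where "L j = length (\<tau> ! j)" for j
  define v where "v = y k"
  define W where "W z j = iter_dir_deriv s t (L j) g z (\<lambda>l. y (\<tau> ! j ! l))" for z j
  define W' where "W' j = iter_dir_deriv s t (Suc (L j)) g x (\<lambda>l. y ((\<tau> ! j @ [k]) ! l))" for j
  define X where "X h = x + s h v" for h
  have mk: "m \<le> k" using partitions_bounds[OF \<tau>] by (simp add: m_def)
  have Lk: "L j \<le> k" "\<And>l. l < L j \<Longrightarrow> \<tau> ! j ! l < k" if "j < m" for j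
  proof -
    have "\<tau> ! j \<in> set \<tau>" using that by (simp add: m_def)
    then have b: "length (\<tau> ! j) \<le> k" "\<forall>l\<in>set (\<tau> ! j). l < k" using partitions_bounds[OF \<tau>] by blast+
    then show "L j \<le> k" "\<And>l. l < L j \<Longrightarrow> \<tau> ! j ! l < k" by (auto simp: L_def)
  qed
  have vF: "v \<in> F" using y by (simp add: v_def)
  have gx: "g x \<in> V" using x gUV by blast
  have GV: "V \<subseteq> G" using V openin_imp_subset by blast
  have evU: "eventually (\<lambda>h. X h \<in> U) (at 0)"
    unfolding X_def by (rule eventually_in_open_line[OF s F U x vF])
  have Xlim: "(X \<longlongrightarrow> x) (at 0)"
  proof -
    have "((\<lambda>h. x + s h v) \<longlongrightarrow> x + s 0 v) (at 0)" by (intro tendsto_intros E.tendsto_scale)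
    then show ?thesis by (simp add: X_def[abs_def])
  qed
  have yl: "y ((\<tau> ! j @ [k]) ! l) \<in> F" if "j < m" "l \<le> L j" for j l
    using Lk(2)[OF that(1), of l] that by (auto simp: nth_append L_def intro!: y)
  have yl': "y (\<tau> ! j ! l) \<in> F" if "j < m" "l < L j" for j l
    using Lk(2)[OF that] by (auto intro!: y)
  have W_eq: "iter_dir_deriv s t (L j) g z (\<lambda>l. y ((\<tau> ! j @ [k]) ! l)) = W z j" for z j
    unfolding W_def by (rule iter_dir_deriv_cong_dirs) (simp add: nth_append L_def)
  have Wder: "(diff_quot s t (\<lambda>z. W z j) x v \<longlongrightarrow> W' j) (at 0)" "W' j \<in> G" if j: "j < m" for j
  proof -
    have Ln: "L j < n" using Lk(1)[OF j] k by simp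
    let ?y = "\<lambda>l. y ((\<tau> ! j @ [k]) ! l)"
    have d: "(diff_quot s t (\<lambda>z. iter_dir_deriv s t (L j) g z ?y) x (?y (L j)) \<longlongrightarrow> iter_dir_deriv s t (Suc (L j)) g x ?y) (at 0)"
        "iter_dir_deriv s t (Suc (L j)) g x ?y \<in> G"
      by (rule Ck_on_deriv[OF g Ln x, where y = ?y], rule yl[OF j], assumption)+
    have yk: "?y (L j) = v" by (simp add: L_def v_def)
    show "(diff_quot s t (\<lambda>z. W z j) x v \<longlongrightarrow> W' j) (at 0)"
      using d(1) unfolding W_eq yk by (simp only: W'_def)
    show "W' j \<in> G" using d(2) by (simp only: W'_def)
  qed
  have Wmem: "W z j \<in> G" if "j < m" "z \<in> U" for z j
    unfolding W_def
    by (rule Ck_on_iter_mem[OF g _ that(2)]) (use Lk(1)[OF that(1)] k yl'[OF that(1)] in simp_all)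
  have Wlim: "((\<lambda>h. W (X h) j) \<longlongrightarrow> W x j) (at 0)" if "j < m" for j
    unfolding W_def
    by (rule Ck_on_tendsto[OF g _ Xlim x evU]) (use Lk(1)[OF that] k yl'[OF that] in simp_all)
  have Wev: "eventually (\<lambda>h. W (X h) j \<in> G) (at 0)" if "j < m" for j
    using evU by (rule eventually_mono) (rule Wmem[OF that])
  have evW: "eventually (\<lambda>h. \<forall>j\<in>{..<m}. W (X h) j \<in> G) (at 0)"
    using Wev by (intro eventually_ball_finite) auto
  have chainW: "chain_term s t u f g \<tau> z y = iter_dir_deriv t u m f (g z) (W z)" for z
    unfolding chain_term_def W_def m_def L_def ..

  \<comment> \<open>The directions at the moved point serve as the parameter of the strict
    derivative; they are made extensional to lie in the parameter set
    \<open>{..<m} \<rightarrow>\<^sub>E G\<close>.\<close>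
  define p where "p h = restrict (W (X h)) {..<m}" for h
  define u0 where "u0 = iter_dir_deriv s t (Suc 0) g x (\<lambda>_. v)"
  have n0: "0 < n" "m < n" using k mk by simp_all
  have gder: "(diff_quot s t g x v \<longlongrightarrow> u0) (at 0)" "u0 \<in> G"
    using Ck_on_deriv[OF g n0(1) x, of "\<lambda>_. v"] vF by (simp_all add: u0_def)
  \<comment> \<open>The direction is the difference quotient of \<open>g\<close>, which varies with
    \<open>h\<close>; \<open>h\<close> times it leads from \<open>g x\<close> exactly to
    \<open>g (x + h v)\<close>.\<close>
  have first: "((\<lambda>h. u (inverse h) (iter_dir_deriv t u m f (g x + t h (diff_quot s t g x v h)) (p h) -
      iter_dir_deriv t u m f (g x) (p h))) \<longlongrightarrow>
      iter_dir_deriv t u (Suc m) f (g x) ((restrict (W x) {..<m})(m := u0))) (at 0)"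
  proof (rule strict_derivative[OF t u G V, where \<Phi> = "iter_dir_deriv t u m f" and
        D = "\<lambda>z p w. iter_dir_deriv t u (Suc m) f z (p(m := w))" and P = "{..<m} \<rightarrow>\<^sub>E G" and
        p = p and a = "\<lambda>_. g x" and h = "\<lambda>h. h" and u = "diff_quot s t g x v" and ?p0.0 = "restrict (W x) {..<m}"])
    fix z p w assume z: "z \<in> V" and p: "p \<in> {..<m} \<rightarrow>\<^sub>E G" and w: "w \<in> G"
    have pG: "(p(m := w)) i \<in> G" if "i \<le> m" for i
      using w PiE_mem[OF p, of i] that by (cases "i = m") auto
    have eq: "iter_dir_deriv t u m f z' (p(m := w)) = iter_dir_deriv t u m f z' p" for z'
      by (rule iter_dir_deriv_cong_dirs) simp
    show "(diff_quot t u (\<lambda>x. iter_dir_deriv t u m f x p) z w \<longlongrightarrow>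
        iter_dir_deriv t u (Suc m) f z (p(m := w))) (at 0)"
      using Ck_on_deriv(1)[OF f n0(2) z, of "p(m := w)", OF pG] by (simp only: eq fun_upd_same)
  next
    have "continuous_on (V \<times> ({..<m} \<rightarrow>\<^sub>E G) \<times> G)
       (\<lambda>z. iter_dir_deriv t u (Suc m) f (fst z) ((fst (snd z))(m := snd (snd z))))"
    proof (rule Ck_on_continuous[OF f])
      show "continuous_on (V \<times> ({..<m} \<rightarrow>\<^sub>E G) \<times> G) (\<lambda>z. ((fst (snd z))(m := snd (snd z))) j)" for j
      proof (cases "j = m")
        case False
        have "continuous_on (V \<times> ({..<m} \<rightarrow>\<^sub>E G) \<times> G) (\<lambda>z. fst (snd z) j)"
          by (rule continuous_on_product_then_coordinatewise) (intro continuous_intros)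
        then show ?thesis using False by simp
      qed (simp add: continuous_on_snd continuous_on_id)
      show "((fst (snd z))(m := snd (snd z))) j \<in> G"
        if z: "z \<in> V \<times> ({..<m} \<rightarrow>\<^sub>E G) \<times> G" and "j < Suc m" for z j
      proof (cases "j = m")
        case False
        have "fst (snd z) \<in> {..<m} \<rightarrow>\<^sub>E G" using z by (simp add: mem_Times_iff)
        from PiE_mem[OF this, of j] show ?thesis using False that(2) by simp
      qed (use z in \<open>simp add: mem_Times_iff\<close>)
    qed (use n0 in \<open>auto intro!: continuous_intros\<close>)
    then show "continuous_on (V \<times> ({..<m} \<rightarrow>\<^sub>E G) \<times> G)
       (\<lambda>(z, p, w). iter_dir_deriv t u (Suc m) f z (p(m := w)))"
      by (simp only: case_prod_unfold)
  next
    show "restrict (W x) {..<m} \<in> {..<m} \<rightarrow>\<^sub>E G" using Wmem[OF _ x] by simp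
    show "(p \<longlongrightarrow> restrict (W x) {..<m}) (at 0)"
      unfolding p_def
    proof (rule tendsto_funI)
      show "((\<lambda>h. restrict (W (X h)) {..<m} j) \<longlongrightarrow> restrict (W x) {..<m} j) (at 0)" for j
        using Wlim[of j] by (cases "j < m") simp_all
    qed
    have gev: "eventually (\<lambda>h. diff_quot s t g x v h \<in> G) (at 0)"
      using evU
    proof (rule eventually_mono)
      fix h assume "X h \<in> U"
      then have "g (X h) \<in> G" using gUV GV by blast
      then show "diff_quot s t g x v h \<in> G" unfolding diff_quot_def X_def
        using gx GV by (intro T.subspace_scale[OF G] T.subspace_diff[OF G]) auto
    qed
    have "eventually (\<lambda>h::'k. h \<noteq> 0) (at 0)" by (simp add: eventually_at_filter)
    with gev evW show "eventually (\<lambda>h. h \<noteq> 0 \<and> g x \<in> G \<and> p h \<in> {..<m} \<rightarrow>\<^sub>E G \<and> diff_quot s t g x v h \<in> G) (at 0)"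
      by eventually_elim (use gx GV in \<open>auto simp: p_def\<close>)
  qed (use gx gder in \<open>auto intro: tendsto_intros\<close>)

  \<comment> \<open>The base point is now fixed at \<open>g x\<close>, and only the directions move:
    the product rule applies to the multilinear derivative of order \<open>m\<close>.\<close>
  have second: "((\<lambda>h. u (inverse h) (iter_dir_deriv t u m f (g x) (W (X h)) - iter_dir_deriv t u m f (g x) (W x))) \<longlongrightarrow>
      (\<Sum>j<m. iter_dir_deriv t u m f (g x) ((W x)(j := W' j)))) (at 0)"
  proof (rule multilinear_deriv[OF t u G, where W = "\<lambda>h. W (X h)"])
    show "iter_dir_deriv t u m f (g x) y = iter_dir_deriv t u m f (g x) y'" if "\<And>j. j < m \<Longrightarrow> y j = y' j" for y y'
      using that by (rule iter_dir_deriv_cong_dirs)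
    have mn: "m \<le> n" using n0 by simp
    show "iter_dir_deriv t u m f (g x) (y(i := a + b)) =
        iter_dir_deriv t u m f (g x) (y(i := a)) + iter_dir_deriv t u m f (g x) (y(i := b))"
      if "i < m" "\<And>j. j < m \<Longrightarrow> y j \<in> G" "a \<in> G" "b \<in> G" for y i a b
      by (rule Ck_on_iter_linear(1)[OF t u G V f mn gx that(1) _ that(3,4)]) (rule that(2))
    show "iter_dir_deriv t u m f (g x) (y(i := t c a)) = u c (iter_dir_deriv t u m f (g x) (y(i := a)))"
      if "i < m" "\<And>j. j < m \<Longrightarrow> y j \<in> G" "a \<in> G" for y i c a
      by (rule Ck_on_iter_linear(2)[OF t u G V f mn gx that(1) _ that(3,3)]) (rule that(2))
    show "((\<lambda>h. iter_dir_deriv t u m f (g x) (W h)) \<longlongrightarrow> iter_dir_deriv t u m f (g x) w) (at 0)"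
      if "\<And>j. j < m \<Longrightarrow> ((\<lambda>h. W h j) \<longlongrightarrow> w j) (at (0::'k))" "\<And>j. j < m \<Longrightarrow> w j \<in> G"
        "\<And>j. j < m \<Longrightarrow> eventually (\<lambda>h. W h j \<in> G) (at 0)" for W w
      by (rule Ck_on_tendsto[OF f mn tendsto_const gx]) (use that gx in simp_all)
    show "((\<lambda>h. t (inverse h) (W (X h) j - W x j)) \<longlongrightarrow> W' j) (at 0)" if "j < m" for j
      using Wder(1)[OF that] by (simp add: diff_quot_def[abs_def] X_def)
  qed (use Wlim Wev Wmem[OF _ x] Wder(2) in simp_all)

  have "((\<lambda>h. u (inverse h) (iter_dir_deriv t u m f (g x + t h (diff_quot s t g x v h)) (p h) -
      iter_dir_deriv t u m f (g x) (p h)) +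
      u (inverse h) (iter_dir_deriv t u m f (g x) (W (X h)) - iter_dir_deriv t u m f (g x) (W x))) \<longlongrightarrow>
      iter_dir_deriv t u (Suc m) f (g x) ((restrict (W x) {..<m})(m := u0)) +
      (\<Sum>j<m. iter_dir_deriv t u m f (g x) ((W x)(j := W' j)))) (at 0)"
    by (rule tendsto_add[OF first second])
  moreover have "u (inverse h) (iter_dir_deriv t u m f (g x + t h (diff_quot s t g x v h)) (p h) -
      iter_dir_deriv t u m f (g x) (p h)) +
      u (inverse h) (iter_dir_deriv t u m f (g x) (W (X h)) - iter_dir_deriv t u m f (g x) (W x))
      = diff_quot s u (\<lambda>z. chain_term s t u f g \<tau> z y) x (y k) h" if "h \<noteq> 0" for h
  proof -
    have 1: "g x + t h (diff_quot s t g x v h) = g (X h)" using that by (simp add: diff_quot_def X_def)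
    have 2: "iter_dir_deriv t u m f z (p h) = iter_dir_deriv t u m f z (W (X h))" for z
      by (rule iter_dir_deriv_cong_dirs) (simp add: p_def)
    show ?thesis unfolding 1 2 unfolding diff_quot_def chainW X_def[symmetric] v_def[symmetric]
      by (simp flip: H.scale_right_distrib)
  qed
  then have "eventually (\<lambda>h. u (inverse h) (iter_dir_deriv t u m f (g x + t h (diff_quot s t g x v h)) (p h) -
      iter_dir_deriv t u m f (g x) (p h)) +
      u (inverse h) (iter_dir_deriv t u m f (g x) (W (X h)) - iter_dir_deriv t u m f (g x) (W x))
      = diff_quot s u (\<lambda>z. chain_term s t u f g \<tau> z y) x (y k) h) (at 0)"
    by (simp add: eventually_at_filter)
  ultimately have lim: "(diff_quot s u (\<lambda>z. chain_term s t u f g \<tau> z y) x (y k) \<longlongrightarrow>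
      iter_dir_deriv t u (Suc m) f (g x) ((restrict (W x) {..<m})(m := u0)) +
      (\<Sum>j<m. iter_dir_deriv t u m f (g x) ((W x)(j := W' j)))) (at 0)"
    by (rule Lim_transform_eventually)
  have A: "chain_term s t u f g (\<tau> @ [[k]]) x y = iter_dir_deriv t u (Suc m) f (g x) ((restrict (W x) {..<m})(m := u0))"
  proof -
    have "length (\<tau> @ [[k]]) = Suc m" by (simp add: m_def)
    moreover have "iter_dir_deriv s t (length ((\<tau> @ [[k]]) ! j)) g x (\<lambda>l. y ((\<tau> @ [[k]]) ! j ! l)) =
        ((restrict (W x) {..<m})(m := u0)) j" if "j < Suc m" for j
    proof (cases "j = m")
      case True
      then show ?thesis by (simp add: m_def u0_def v_def)
    next
      case False
      then have "(\<tau> @ [[k]]) ! j = \<tau> ! j" "j < m" using that by (simp_all add: nth_append m_def)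
      then show ?thesis using False by (simp add: W_def L_def)
    qed
    ultimately show ?thesis unfolding chain_term_def
      by (simp only:) (rule iter_dir_deriv_cong_dirs, simp only:)
  qed
  have B: "chain_term s t u f g (\<tau>[j := \<tau> ! j @ [k]]) x y = iter_dir_deriv t u m f (g x) ((W x)(j := W' j))" if "j < m" for j
  proof -
    have "length (\<tau>[j := \<tau> ! j @ [k]]) = m" by (simp add: m_def)
    moreover have "iter_dir_deriv s t (length (\<tau>[j := \<tau> ! j @ [k]] ! i)) g x (\<lambda>l. y (\<tau>[j := \<tau> ! j @ [k]] ! i ! l)) =
        ((W x)(j := W' j)) i" if "i < m" for i
    proof (cases "i = j")
      case True
      then show ?thesis using that by (simp add: m_def W'_def L_def)
    next
      case False
      then show ?thesis by (simp add: W_def L_def)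
    qed
    ultimately show ?thesis unfolding chain_term_def
      by (simp only:) (rule iter_dir_deriv_cong_dirs, simp only:)
  qed
  have "(\<Sum>\<sigma>\<leftarrow>(\<tau> @ [[k]]) # map (\<lambda>j. \<tau>[j := \<tau> ! j @ [k]]) [0..<length \<tau>]. chain_term s t u f g \<sigma> x y) =
     chain_term s t u f g (\<tau> @ [[k]]) x y + (\<Sum>j<m. chain_term s t u f g (\<tau>[j := \<tau> ! j @ [k]]) x y)"
    by (simp add: interv_sum_list_conv_sum_set_nat m_def o_def lessThan_atLeast0)
  also have "(\<Sum>j<m. chain_term s t u f g (\<tau>[j := \<tau> ! j @ [k]]) x y) = (\<Sum>j<m. iter_dir_deriv t u m f (g x) ((W x)(j := W' j)))"
    by (rule sum.cong[OF refl], rule B) simp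
  finally show ?thesis using lim A by (simp only:)
qed

lemma Ck_on_compose_formula:
  shows "Ck_on s u F H n U (\<lambda>x. f (g x))"
    and "\<And>k x y. k \<le> n \<Longrightarrow> x \<in> U \<Longrightarrow> (\<And>i. i < k \<Longrightarrow> y i \<in> F) \<Longrightarrow>
      iter_dir_deriv s u k (\<lambda>x. f (g x)) x y = (\<Sum>\<tau>\<leftarrow>partitions k. chain_term s t u f g \<tau> x y)"
proof -
  let ?L = "\<lambda>k x y. \<Sum>\<tau>\<leftarrow>partitions k. chain_term s t u f g \<tau> x y"
  have 0: "?L 0 x y = f (g x)" for x y by (simp add: chain_term_def)
  have S: "(diff_quot s u (\<lambda>z. ?L k z y) x (y k) \<longlongrightarrow> ?L (Suc k) x y) (at 0)"
    if "k < n" "x \<in> U" "\<And>i. i \<le> k \<Longrightarrow> y i \<in> F" for k x y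
    unfolding diff_quot_sum_list[OF u] partitions.simps sum_list_concat_map
    by (rule tendsto_sum_list) (rule chain_term_deriv[OF that(1) _ that(2)], assumption, rule that(3))
  have mem: "?L k x y \<in> H" if "k \<le> n" "x \<in> U" "\<And>i. i < k \<Longrightarrow> y i \<in> F" for k x y
  proof -
    have "chain_term s t u f g \<tau> x y \<in> H" if "\<tau> \<in> set (partitions k)" for \<tau>
      by (rule chain_term_mem[OF \<open>k \<le> n\<close> that \<open>x \<in> U\<close>]) (rule \<open>\<And>i. i < k \<Longrightarrow> y i \<in> F\<close>)
    then have "set xs \<subseteq> set (partitions k) \<Longrightarrow> (\<Sum>\<tau>\<leftarrow>xs. chain_term s t u f g \<tau> x y) \<in> H" for xs
      by (induction xs) (auto intro: H.subspace_add[OF H] H.subspace_0[OF H])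
    then show ?thesis by blast
  qed
  have cont: "continuous_on (U \<times> ({..<k} \<rightarrow>\<^sub>E F)) (\<lambda>z. ?L k (fst z) (snd z))" if "k \<le> n" for k
    by (rule continuous_on_sum_list) (rule chain_term_continuous[OF that])
  show "Ck_on s u F H n U (\<lambda>x. f (g x))"
    by (rule Ck_on_formula(1)[OF s F U, where L = ?L]) (rule 0, fact S, fact mem, fact cont)
  show "iter_dir_deriv s u k (\<lambda>x. f (g x)) x y = ?L k x y"
    if "k \<le> n" "x \<in> U" "\<And>i. i < k \<Longrightarrow> y i \<in> F" for k x y
    by (rule Ck_on_formula(2)[OF s F U, where L = ?L and n = n and G = H])
      (rule 0, fact S, fact mem, fact cont, fact that(1), fact that(2), fact that(3))
qed

lemma Ck_on_compose: "Ck_on s u F H n U (\<lambda>x. f (g x))"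
  by (rule Ck_on_compose_formula(1))

text \<open>The only partition of a single index is \<open>[[0]]\<close>, whose summand is the
  composite of the two differentials.\<close>

lemma Ck_on_chain_rule:
  assumes "0 < n" "x \<in> U" "v \<in> F"
  shows "dir_deriv s u (\<lambda>x. f (g x)) x v = dir_deriv t u f (g x) (dir_deriv s t g x v)"
  using Ck_on_compose_formula(2)[of 1 x "\<lambda>_. v"] assms by (simp add: chain_term_def)

end

section \<open>Homogeneous polynomials\<close>

lemma multilinear_on_mem:
  "multilinear_on s t F G n \<beta> \<Longrightarrow> y \<in> {..<n} \<rightarrow>\<^sub>E F \<Longrightarrow> \<beta> y \<in> G"
  unfolding multilinear_on_def by blast

lemma multilinear_on_add:
  "multilinear_on s t F G n \<beta> \<Longrightarrow> y \<in> {..<n} \<rightarrow>\<^sub>E F \<Longrightarrow> i < n \<Longrightarrow> u \<in> F \<Longrightarrow> v \<in> F \<Longrightarrow>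
    \<beta> (y(i := u + v)) = \<beta> (y(i := u)) + \<beta> (y(i := v))"
  unfolding multilinear_on_def by blast

lemma multilinear_on_scale:
  "multilinear_on s t F G n \<beta> \<Longrightarrow> y \<in> {..<n} \<rightarrow>\<^sub>E F \<Longrightarrow> i < n \<Longrightarrow> u \<in> F \<Longrightarrow>
    \<beta> (y(i := s c u)) = t c (\<beta> (y(i := u)))"
  unfolding multilinear_on_def by blast

lemma fun_upd_PiE: "y \<in> {..<n} \<rightarrow>\<^sub>E F \<Longrightarrow> i < n \<Longrightarrow> u \<in> F \<Longrightarrow> y(i := u) \<in> {..<n} \<rightarrow>\<^sub>E F"
  by (auto simp: PiE_iff extensional_def)

lemma restrict_PiE_lessThan: "(\<And>j. j < n \<Longrightarrow> y j \<in> F) \<Longrightarrow> (\<lambda>j\<in>{..<n}. y j) \<in> {..<n} \<rightarrow>\<^sub>E F"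
  by simp

context
  fixes s :: "'k::real_or_complex \<Rightarrow> 'e::{topological_ab_group_add, t2_space} \<Rightarrow> 'e"
    and t :: "'k \<Rightarrow> 'f::{topological_ab_group_add, t2_space} \<Rightarrow> 'f"
    and F :: "'e set" and G :: "'f set" and n :: nat and \<beta> :: "(nat \<Rightarrow> 'e) \<Rightarrow> 'f"
  assumes s: "locally_convex_space s" and t: "locally_convex_space t"
    and F: "module.subspace s F" and \<beta>: "multilinear_on s t F G n \<beta>"
begin

interpretation E: locally_convex_space s by (rule s)
interpretation T: locally_convex_space t by (rule t)

lemma multilinear_on_sum:
  assumes y: "y \<in> {..<n} \<rightarrow>\<^sub>E F" and i: "i < n" and A: "finite A" and c: "\<And>a. a \<in> A \<Longrightarrow> c a \<in> F"
  shows "\<beta> (y(i := \<Sum>a\<in>A. c a)) = (\<Sum>a\<in>A. \<beta> (y(i := c a)))"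
  using A c
proof (induction A rule: finite_induct)
  case empty
  have "\<beta> (y(i := s 0 0)) = t 0 (\<beta> (y(i := 0)))"
    by (rule multilinear_on_scale[OF \<beta> y i]) (rule E.subspace_0[OF F])
  then show ?case by (simp only: sum.empty E.scale_zero_right T.scale_zero_left)
next
  case (insert a A)
  have "(\<Sum>a\<in>A. c a) \<in> F" using insert.prems by (intro E.subspace_sum[OF F]) simp
  then have "\<beta> (y(i := c a + (\<Sum>a\<in>A. c a))) = \<beta> (y(i := c a)) + \<beta> (y(i := \<Sum>a\<in>A. c a))"
    using insert.prems by (intro multilinear_on_add[OF \<beta> y i]) auto
  moreover have "\<beta> (y(i := \<Sum>a\<in>A. c a)) = (\<Sum>a\<in>A. \<beta> (y(i := c a)))"
    by (rule insert.IH) (simp add: insert.prems)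
  ultimately show ?case by (simp only: sum.insert[OF insert.hyps])
qed

text \<open>The multinomial expansion, indexed by the functions that choose a summand for each
  slot.\<close>

lemma multilinear_expand:
  assumes A: "finite A" and w: "\<And>i j. i < n \<Longrightarrow> j \<in> A \<Longrightarrow> w i j \<in> F"
  shows "\<beta> (\<lambda>i\<in>{..<n}. \<Sum>j\<in>A. w i j) = (\<Sum>\<phi>\<in>{..<n} \<rightarrow>\<^sub>E A. \<beta> (\<lambda>i\<in>{..<n}. w i (\<phi> i)))"
proof -
  \<comment> \<open>Generalized for the induction: only the first \<open>m\<close> slots hold sums,
    and \<open>z\<close> occupies the rest.\<close>
  have "\<beta> (\<lambda>i\<in>{..<n}. if i < m then \<Sum>j\<in>A. w i j else z i) =
      (\<Sum>\<phi>\<in>{..<m} \<rightarrow>\<^sub>E A. \<beta> (\<lambda>i\<in>{..<n}. if i < m then w i (\<phi> i) else z i))"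
    if "m \<le> n" "\<And>i. i < n \<Longrightarrow> z i \<in> F" for m z
    using that
  proof (induction m arbitrary: z)
    case 0
    then show ?case by simp
  next
    case (Suc m)
    have mn: "m < n" using Suc.prems by simp
    have S: "(\<Sum>j\<in>A. w i j) \<in> F" if "i < n" for i
      using w[OF that] by (intro E.subspace_sum[OF F])
    have "\<beta> (\<lambda>i\<in>{..<n}. if i < Suc m then \<Sum>j\<in>A. w i j else z i)
        = \<beta> (\<lambda>i\<in>{..<n}. if i < m then \<Sum>j\<in>A. w i j else (z(m := \<Sum>j\<in>A. w m j)) i)"
      by (rule arg_cong[where f = \<beta>]) (auto simp: fun_eq_iff less_Suc_eq)
    also have "\<dots> = (\<Sum>\<phi>\<in>{..<m} \<rightarrow>\<^sub>E A. \<beta> (\<lambda>i\<in>{..<n}. if i < m then w i (\<phi> i) else (z(m := \<Sum>j\<in>A. w m j)) i))"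
      by (rule Suc.IH) (use Suc.prems(2) S mn in \<open>simp_all\<close>)
    also have "\<dots> = (\<Sum>\<phi>\<in>{..<m} \<rightarrow>\<^sub>E A. \<Sum>j\<in>A. \<beta> (\<lambda>i\<in>{..<n}. if i < Suc m then w i ((\<phi>(m := j)) i) else z i))"
    proof (rule sum.cong[OF refl])
      fix \<phi> assume \<phi>: "\<phi> \<in> {..<m} \<rightarrow>\<^sub>E A"
      let ?y = "\<lambda>i\<in>{..<n}. if i < m then w i (\<phi> i) else z i"
      have y: "?y \<in> {..<n} \<rightarrow>\<^sub>E F"
      proof (rule restrict_PiE_lessThan)
        fix i assume "i < n"
        then show "(if i < m then w i (\<phi> i) else z i) \<in> F"
          using w[of i "\<phi> i"] PiE_mem[OF \<phi>, of i] Suc.prems(2)[of i] by simp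
      qed
      have "\<beta> (\<lambda>i\<in>{..<n}. if i < m then w i (\<phi> i) else (z(m := \<Sum>j\<in>A. w m j)) i) = \<beta> (?y(m := \<Sum>j\<in>A. w m j))"
        using mn by (intro arg_cong[where f = \<beta>]) (auto simp: fun_eq_iff)
      also have "\<dots> = (\<Sum>j\<in>A. \<beta> (?y(m := w m j)))"
        by (rule multilinear_on_sum[OF y mn A]) (rule w[OF mn])
      also have "\<dots> = (\<Sum>j\<in>A. \<beta> (\<lambda>i\<in>{..<n}. if i < Suc m then w i ((\<phi>(m := j)) i) else z i))"
        using mn by (intro sum.cong refl arg_cong[where f = \<beta>]) (auto simp: fun_eq_iff less_Suc_eq)
      finally show "\<beta> (\<lambda>i\<in>{..<n}. if i < m then w i (\<phi> i) else (z(m := \<Sum>j\<in>A. w m j)) i) = \<dots>" .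
    qed
    \<comment> \<open>A choice for \<open>m + 1\<close> slots is a choice \<open>\<phi>\<close> for
      \<open>m\<close> slots together with the choice \<open>j\<close> for the last one.\<close>
    also have "\<dots> = (\<Sum>(j, \<phi>)\<in>A \<times> ({..<m} \<rightarrow>\<^sub>E A). \<beta> (\<lambda>i\<in>{..<n}. if i < Suc m then w i ((\<phi>(m := j)) i) else z i))"
      by (subst sum.swap) (simp add: sum.cartesian_product)
    also have "\<dots> = (\<Sum>\<phi>\<in>{..<Suc m} \<rightarrow>\<^sub>E A. \<beta> (\<lambda>i\<in>{..<n}. if i < Suc m then w i (\<phi> i) else z i))"
      unfolding lessThan_Suc PiE_insert_eq
      by (subst sum.reindex[OF inj_combinator]) (simp_all add: case_prod_unfold o_def)
    finally show ?case .
  qed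
  from this[of n "\<lambda>_. 0"] have "\<beta> (\<lambda>i\<in>{..<n}. if i < n then \<Sum>j\<in>A. w i j else 0) =
      (\<Sum>\<phi>\<in>{..<n} \<rightarrow>\<^sub>E A. \<beta> (\<lambda>i\<in>{..<n}. if i < n then w i (\<phi> i) else 0))"
    using E.subspace_0[OF F] by simp
  moreover have "(\<lambda>i\<in>{..<n}. if i < n then z i else 0) = (\<lambda>i\<in>{..<n}. z i)" for z :: "nat \<Rightarrow> 'e"
    by (auto simp: fun_eq_iff)
  ultimately show ?thesis by simp
qed

lemma multilinear_scale_all:
  assumes y: "\<And>i. i < n \<Longrightarrow> y i \<in> F"
  shows "\<beta> (\<lambda>i\<in>{..<n}. s (c i) (y i)) = t (\<Prod>i<n. c i) (\<beta> (\<lambda>i\<in>{..<n}. y i))"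
proof -
  have "\<beta> (\<lambda>i\<in>{..<n}. if i < m then s (c i) (y i) else y i) = t (\<Prod>i<m. c i) (\<beta> (\<lambda>i\<in>{..<n}. y i))" if "m \<le> n" for m
    using that
  proof (induction m)
    case (Suc m)
    then have mn: "m < n" by simp
    let ?y = "\<lambda>i\<in>{..<n}. if i < m then s (c i) (y i) else y i"
    have Y: "?y \<in> {..<n} \<rightarrow>\<^sub>E F"
      by (rule restrict_PiE_lessThan) (simp add: y E.subspace_scale[OF F])
    have "\<beta> (\<lambda>i\<in>{..<n}. if i < Suc m then s (c i) (y i) else y i) = \<beta> (?y(m := s (c m) (y m)))"
      using mn by (intro arg_cong[where f = \<beta>]) (auto simp: fun_eq_iff less_Suc_eq)
    also have "\<dots> = t (c m) (\<beta> (?y(m := y m)))" by (rule multilinear_on_scale[OF \<beta> Y mn y[OF mn]])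
    also have "?y(m := y m) = ?y" using mn by (auto simp: fun_eq_iff)
    finally show ?case using Suc by (simp add: mult.commute)
  qed simp
  from this[of n] show ?thesis
    by (simp cong: restrict_cong)
qed

end

lemma homogeneous_polynomial_onE:
  assumes "homogeneous_polynomial_on s t F G n p"
  obtains \<beta> where "multilinear_on s t F G n \<beta>" "continuous_on ({..<n} \<rightarrow>\<^sub>E F) \<beta>"
    "\<And>v. v \<in> F \<Longrightarrow> p v = \<beta> (\<lambda>i\<in>{..<n}. v)"
  using assms unfolding homogeneous_polynomial_on_def by blast

lemma homogeneous_polynomial_mem:
  assumes "homogeneous_polynomial_on s t F G n p" "v \<in> F"
  shows "p v \<in> G"
proof -
  obtain \<beta> where \<beta>: "multilinear_on s t F G n \<beta>" "\<And>v. v \<in> F \<Longrightarrow> p v = \<beta> (\<lambda>i\<in>{..<n}. v)"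
    by (rule homogeneous_polynomial_onE[OF assms(1)]) blast
  show ?thesis using multilinear_on_mem[OF \<beta>(1), of "\<lambda>i\<in>{..<n}. v"] \<beta>(2) assms(2) by simp
qed

lemma homogeneous_polynomial_continuous:
  assumes "homogeneous_polynomial_on s t F G n p"
  shows "continuous_on F p"
proof -
  obtain \<beta> where \<beta>: "continuous_on ({..<n} \<rightarrow>\<^sub>E F) \<beta>" "\<And>v. v \<in> F \<Longrightarrow> p v = \<beta> (\<lambda>i\<in>{..<n}. v)"
    by (rule homogeneous_polynomial_onE[OF assms(1)]) blast
  have "continuous_on F (\<lambda>v. \<beta> (\<lambda>i\<in>{..<n}. v))"
  proof (rule continuous_on_compose2[OF \<beta>(1)])
    show "continuous_on F (\<lambda>v. \<lambda>i\<in>{..<n}. v)"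
      by (rule continuous_on_coordinatewise_then_product) (simp add: restrict_def continuous_on_if_const)
  qed (intro image_subsetI restrict_PiE_lessThan)
  then show ?thesis by (rule continuous_on_eq) (simp add: \<beta>(2))
qed

lemma homogeneous_polynomial_scale:
  assumes s: "locally_convex_space s" and t: "locally_convex_space t" and F: "module.subspace s F"
    and p: "homogeneous_polynomial_on s t F G n p" and v: "v \<in> F"
  shows "p (s c v) = t (c ^ n) (p v)"
proof -
  interpret E: locally_convex_space s by fact
  obtain \<beta> where \<beta>: "multilinear_on s t F G n \<beta>" "\<And>v. v \<in> F \<Longrightarrow> p v = \<beta> (\<lambda>i\<in>{..<n}. v)"
    by (rule homogeneous_polynomial_onE[OF p]) blast
  show ?thesis
    using multilinear_scale_all[OF s t F \<beta>(1), of "\<lambda>_. v" "\<lambda>_. c"] \<beta>(2) v E.subspace_scale[OF F v]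
    by simp
qed

lemma homogeneous_polynomial_one_add:
  assumes s: "locally_convex_space s" and F: "module.subspace s F"
    and p: "homogeneous_polynomial_on s t F G 1 p" and v: "v \<in> F" "w \<in> F"
  shows "p (v + w) = p v + p w"
proof -
  interpret E: locally_convex_space s by fact
  obtain \<beta> where \<beta>: "multilinear_on s t F G 1 \<beta>" "\<And>v. v \<in> F \<Longrightarrow> p v = \<beta> (\<lambda>i\<in>{..<1}. v)"
    by (rule homogeneous_polynomial_onE[OF p]) blast
  have *: "(\<lambda>i\<in>{..<1::nat}. v)(0 := u) = (\<lambda>i\<in>{..<1}. u)" for u :: 'b by (auto simp: fun_eq_iff)
  show ?thesis
    using multilinear_on_add[OF \<beta>(1) _ _ v, of "\<lambda>i\<in>{..<1}. v" 0] \<beta>(2) v E.subspace_add[OF F v]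
    unfolding * by simp
qed

section \<open>Power series in one variable\<close>

lemma geometric_tail_le:
  fixes \<theta> :: real
  assumes "0 \<le> \<theta>" "\<theta> < 1"
  shows "(\<Sum>i\<in>{N..<M}. \<theta> ^ i) \<le> \<theta> ^ N / (1 - \<theta>)"
proof (cases "N \<le> M")
  case True
  have "(\<Sum>i\<in>{N..<M}. \<theta> ^ i) = \<theta> ^ N * (\<Sum>i<M - N. \<theta> ^ i)"
    using True sum.shift_bounds_nat_ivl[of "\<lambda>i. \<theta> ^ i" 0 N "M - N"]
    by (simp add: sum_distrib_left power_add atLeast0LessThan mult.commute)
  also have "(\<Sum>i<M - N. \<theta> ^ i) \<le> 1 / (1 - \<theta>)"
    using sum_le_suminf[of "\<lambda>i. \<theta> ^ i" "{..<M-N}"] assms by (simp add: summable_geometric suminf_geometric)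
  then have "\<theta> ^ N * (\<Sum>i<M - N. \<theta> ^ i) \<le> \<theta> ^ N * (1 / (1 - \<theta>))"
    using assms by (intro mult_left_mono) auto
  finally show ?thesis by simp
next
  case False
  then show ?thesis using assms by simp
qed

context locally_convex_space
begin

text \<open>The terms of a convergent series tend to 0, hence are bounded in every seminorm. Without
  completeness such bounds do not yield convergence in return; convergence always has to be supplied
  separately.\<close>

lemma power_series_coeff_bound:
  assumes q: "cont_seminorm scale q" and a: "(\<lambda>n. scale (c ^ n) (a n)) sums l"
  obtains C where "0 \<le> C" "\<And>n. q (a n) * norm c ^ n \<le> C"
proof -
  have "(\<lambda>n. (\<Sum>i<Suc n. scale (c ^ i) (a i)) - (\<Sum>i<n. scale (c ^ i) (a i))) \<longlonglongrightarrow> l - l"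
    using a unfolding sums_def by (intro tendsto_diff LIMSEQ_Suc)
  then have "(\<lambda>n. scale (c ^ n) (a n)) \<longlonglongrightarrow> 0" by simp
  from cont_seminorm_tendsto[OF q this] have "(\<lambda>n. q (a n) * norm c ^ n) \<longlonglongrightarrow> 0"
    by (simp add: cont_seminorm_scale[OF q] seminorm_0[OF q] norm_power mult.commute)
  then have "Bseq (\<lambda>n. q (a n) * norm c ^ n)" using convergentI convergent_imp_Bseq by blast
  then obtain C where "0 < C" "\<And>n. norm (q (a n) * norm c ^ n) \<le> C" by (auto simp: Bseq_def)
  then show ?thesis using that[of C] by (auto simp: abs_le_iff)
qed

text \<open>With \<open>q (a n) \<rho>^n \<le> C\<close> the terms at \<open>z\<close> are dominated
  by \<open>C \<theta>^n\<close>, and the sum \<open>l\<close>, known to exist, inherits the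
  geometric bound on the tail.\<close>

lemma power_series_tail:
  assumes q: "cont_seminorm scale q" and C: "\<And>n. q (a n) * \<rho> ^ n \<le> C" and \<rho>: "0 < \<rho>"
    and z: "norm z \<le> \<theta> * \<rho>" and \<theta>: "0 \<le> \<theta>" "\<theta> < 1"
    and l: "(\<lambda>n. scale (z ^ n) (a n)) sums l"
  shows "q (l - (\<Sum>n<N. scale (z ^ n) (a n))) \<le> C * \<theta> ^ N / (1 - \<theta>)"
proof -
  have C0: "0 \<le> C" using C[of 0] seminorm_nonneg[OF q, of "a 0"] by simp
  have tm: "q (scale (z ^ n) (a n)) \<le> C * \<theta> ^ n" for n
  proof -
    have "q (scale (z ^ n) (a n)) = norm z ^ n * q (a n)"
      by (simp add: cont_seminorm_scale[OF q] norm_power)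
    also have "\<dots> \<le> (\<theta> * \<rho>) ^ n * q (a n)"
      by (intro mult_right_mono power_mono z seminorm_nonneg[OF q]) simp
    also have "\<dots> = (q (a n) * \<rho> ^ n) * \<theta> ^ n" by (simp add: power_mult_distrib)
    also have "\<dots> \<le> C * \<theta> ^ n" using \<theta> by (intro mult_right_mono C) simp
    finally show ?thesis .
  qed
  let ?S = "\<lambda>M. \<Sum>n<M. scale (z ^ n) (a n)"
  have "(\<lambda>M. q (?S M - ?S N)) \<longlonglongrightarrow> q (l - ?S N)"
    using l unfolding sums_def by (intro cont_seminorm_tendsto[OF q] tendsto_intros)
  moreover have "\<exists>M0. \<forall>M\<ge>M0. q (?S M - ?S N) \<le> C * \<theta> ^ N / (1 - \<theta>)"
  proof (intro exI[of _ N] allI impI)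
    fix M assume "N \<le> M"
    then have "?S M - ?S N = (\<Sum>n\<in>{N..<M}. scale (z ^ n) (a n))"
      by (simp add: lessThan_atLeast0 sum_diff_nat_ivl)
    also have "q \<dots> \<le> (\<Sum>n\<in>{N..<M}. q (scale (z ^ n) (a n)))" by (rule seminorm_sum[OF q])
    also have "\<dots> \<le> (\<Sum>n\<in>{N..<M}. C * \<theta> ^ n)" by (intro sum_mono tm)
    also have "\<dots> = C * (\<Sum>n\<in>{N..<M}. \<theta> ^ n)" by (simp add: sum_distrib_left)
    also have "\<dots> \<le> C * (\<theta> ^ N / (1 - \<theta>))" by (intro mult_left_mono geometric_tail_le \<theta> C0)
    finally show "q (?S M - ?S N) \<le> C * \<theta> ^ N / (1 - \<theta>)" by simp
  qed
  ultimately show ?thesis by (rule LIMSEQ_le_const2)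
qed

text \<open>The remainder after \<open>n + 1\<close> terms is of size \<open>|z|^(n+1)\<close>, so
  dividing by \<open>z^n\<close> leaves \<open>a n\<close> in the limit. The filter is any one below
  \<open>at 0\<close>, in order to let \<open>z\<close> tend to 0 through real values only.\<close>

lemma power_series_coeff_tendsto:
  assumes Fl: "Fl \<le> at 0" and \<rho>: "0 < \<rho>"
    and h: "\<And>z. norm z \<le> \<rho> \<Longrightarrow> (\<lambda>n. scale (z ^ n) (a n)) sums h z"
  shows "((\<lambda>z. scale (inverse (z ^ n)) (h z - (\<Sum>i<n. scale (z ^ i) (a i)))) \<longlongrightarrow> a n) Fl"
proof -
  let ?g = "\<lambda>z. scale (inverse (z ^ n)) (h z - (\<Sum>i<n. scale (z ^ i) (a i)))"
  have ev0: "eventually (\<lambda>z. z \<noteq> 0) Fl"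
    using Fl by (rule filter_leD) (simp add: eventually_at_filter)
  have evr: "eventually (\<lambda>z. norm z < \<rho> / 2) Fl"
    using Fl by (rule filter_leD) (use \<rho> in \<open>auto simp: eventually_at intro!: exI[of _ "\<rho> / 2"]\<close>)
  have z0: "((\<lambda>z. norm z) \<longlongrightarrow> 0) Fl"
  proof -
    have "((\<lambda>z::'k. z) \<longlongrightarrow> 0) (at 0)" by (rule tendsto_ident_at)
    from tendsto_mono[OF Fl tendsto_norm[OF this]] show ?thesis by simp
  qed
  show "(?g \<longlongrightarrow> a n) Fl"
  proof (rule tendsto_seminormI)
    fix q assume q: "cont_seminorm scale q"
    have "norm (of_real \<rho> :: 'k) \<le> \<rho>" using \<rho> by simp
    from h[OF this] obtain C where C: "0 \<le> C" "\<And>n. q (a n) * norm (of_real \<rho> :: 'k) ^ n \<le> C"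
      by (rule power_series_coeff_bound[OF q]) blast
    have C': "q (a n) * \<rho> ^ n \<le> C" for n using C(2)[of n] \<rho> by simp
    have bound: "q (?g z - a n) \<le> 2 * C / \<rho> ^ Suc n * norm z" if z: "z \<noteq> 0" "norm z < \<rho> / 2" for z
    proof -
      define \<theta> where "\<theta> = norm z / \<rho>"
      have \<theta>: "\<theta> \<le> 1/2" "0 \<le> \<theta>" "norm z = \<theta> * \<rho>" using z \<rho> by (simp_all add: \<theta>_def field_simps)
      have "?g z - a n = scale (inverse (z ^ n)) (h z - (\<Sum>i<Suc n. scale (z ^ i) (a i)))"
        using z by (simp add: scale_right_diff_distrib scale_right_distrib)
      then have "q (?g z - a n) = inverse (norm z ^ n) * q (h z - (\<Sum>i<Suc n. scale (z ^ i) (a i)))"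
        by (simp only: cont_seminorm_scale[OF q] norm_inverse norm_power)
      also have "q (h z - (\<Sum>i<Suc n. scale (z ^ i) (a i))) \<le> C * \<theta> ^ Suc n / (1 - \<theta>)"
        by (rule power_series_tail[OF q C' \<rho>]) (use z \<rho> \<theta>(1,2) in \<open>auto simp: \<theta>(3)[symmetric] intro: h\<close>)
      \<comment> \<open>The restriction \<open>|z| < \<rho> / 2\<close> gives
        \<open>\<theta> \<le> 1/2\<close>, whence the factor 2 in the bound.\<close>
      also have "\<dots> \<le> C * \<theta> ^ Suc n / (1/2)"
      proof (rule divide_left_mono)
        show "0 \<le> C * \<theta> ^ Suc n" by (intro mult_nonneg_nonneg zero_le_power \<theta> C(1))
      qed (use \<theta>(1) in auto)
      finally have "q (?g z - a n) \<le> inverse (norm z ^ n) * (C * \<theta> ^ Suc n / (1/2))"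
        using z by (simp add: mult_left_mono)
      also have "\<dots> = 2 * C / \<rho> ^ Suc n * norm z"
        using z by (simp add: \<theta>_def power_divide field_simps)
      finally show ?thesis .
    qed
    have "((\<lambda>z. 2 * C / \<rho> ^ Suc n * norm z) \<longlongrightarrow> 2 * C / \<rho> ^ Suc n * 0) Fl"
      by (intro tendsto_mult tendsto_const z0)
    then have lim0: "((\<lambda>z. 2 * C / \<rho> ^ Suc n * norm z) \<longlongrightarrow> 0) Fl" by simp
    show "((\<lambda>z. q (?g z - a n)) \<longlongrightarrow> 0) Fl"
    proof (rule tendsto_sandwich[OF _ _ tendsto_const lim0])
      show "eventually (\<lambda>z. 0 \<le> q (?g z - a n)) Fl" by (simp add: seminorm_nonneg[OF q])
      show "eventually (\<lambda>z. q (?g z - a n) \<le> 2 * C / \<rho> ^ Suc n * norm z) Fl"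
        using ev0 evr by eventually_elim (rule bound)
    qed
  qed
qed

text \<open>
  Coefficients are recovered from the values by successive limits, so they stay in a closed
  subspace that contains the values.
\<close>

lemma power_series_coeff_closed:
  assumes G: "subspace G" "closed G" and Fl: "Fl \<noteq> bot" "Fl \<le> at 0" and \<rho>: "0 < \<rho>"
    and h: "\<And>z. norm z \<le> \<rho> \<Longrightarrow> (\<lambda>n. scale (z ^ n) (a n)) sums h z"
    and hG: "eventually (\<lambda>z. h z \<in> G) Fl"
  shows "a n \<in> G"
proof (induction n rule: less_induct)
  case (less n)
  let ?g = "\<lambda>z. scale (inverse (z ^ n)) (h z - (\<Sum>i<n. scale (z ^ i) (a i)))"
  have lim: "(?g \<longlongrightarrow> a n) Fl" by (rule power_series_coeff_tendsto[OF Fl(2) \<rho> h])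
  show ?case
  proof (rule Lim_in_closed_set[OF G(2) _ Fl(1) lim])
    show "eventually (\<lambda>z. ?g z \<in> G) Fl"
      using hG
    proof (rule eventually_mono)
      fix z assume "h z \<in> G"
      then show "?g z \<in> G"
        by (intro subspace_scale[OF G(1)] subspace_diff[OF G(1)] subspace_sum[OF G(1)] less) auto
    qed
  qed
qed

end

text \<open>A geometric sum over the powers of an \<open>L\<close>-th root of unity. The root
  differs from 1 because \<open>d\<close> is nonzero and too small to be a multiple of
  \<open>L\<close>.\<close>

lemma sum_cis_roots:
  fixes d :: int
  assumes "d \<noteq> 0" "\<bar>d\<bar> < int L"
  shows "(\<Sum>j<L. cis (2 * pi * real j * real_of_int d / real L)) = 0"
proof -
  let ?x = "2 * pi * real_of_int d / real L"
  have L: "0 < L" using assms by simp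
  have ne: "cis ?x \<noteq> 1"
  proof
    assume "cis ?x = 1"
    then have "cos ?x = 1" by (metis cis.simps(1) one_complex.simps(1))
    then obtain k :: int where "?x = of_int k * 2 * pi" by (auto simp: cos_one_2pi_int)
    then have "real_of_int d = real_of_int k * real L" using L by (simp add: field_simps)
    then have dk: "d = k * int L" by (metis of_int_eq_iff of_int_mult of_int_of_nat_eq)
    then have "k \<noteq> 0" using assms by auto
    then have "1 * int L \<le> \<bar>k\<bar> * int L" by (intro mult_right_mono) auto
    then have "int L \<le> \<bar>d\<bar>" using dk by (simp add: abs_mult)
    then show False using assms by simp
  qed
  have "(\<Sum>j<L. cis (2 * pi * real j * real_of_int d / real L)) = (\<Sum>j<L. cis ?x ^ j)"
    by (intro sum.cong refl) (simp add: Complex.DeMoivre mult_ac)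
  also have "\<dots> = (cis ?x ^ L - 1) / (cis ?x - 1)" by (rule geometric_sum[OF ne])
  also have "cis ?x ^ L = cis (2 * pi * real_of_int d)" using L by (simp add: Complex.DeMoivre)
  also have "\<dots> = 1" by (rule cis_multiple_2pi) simp
  finally show ?thesis by simp
qed

text \<open>Averaging over roots of unity replaces the Cauchy integral.\<close>

lemma cauchy_estimate_polynomial:
  fixes t :: "complex \<Rightarrow> 'f::{topological_ab_group_add, t2_space} \<Rightarrow> 'f"
  assumes t: "locally_convex_space t" and q: "cont_seminorm t q" and r: "0 < r" and n: "n \<le> D"
    and K: "\<And>z. cmod z = r \<Longrightarrow> q (\<Sum>m\<le>D. t (z ^ m) (a m)) \<le> K"
  shows "q (a n) * r ^ n \<le> K"
proof -
  interpret T: locally_convex_space t by fact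
  \<comment> \<open>More sample points than the degree: two distinct exponents in
    \<open>{0..D}\<close> differ by less than \<open>L\<close>, so the averaging can tell them
    apart.\<close>
  define L where "L = Suc D"
  define \<omega> where "\<omega> j = of_real r * cis (2 * pi * real j / real L)" for j
  \<comment> \<open>Weights of modulus 1 that cancel the phase of \<open>\<omega> j ^ n\<close>; the
    weighted sum over \<open>j\<close> keeps the coefficient \<open>a n\<close> and kills all
    others.\<close>
  define \<mu> where "\<mu> j = cis (- (2 * pi * real j * real n / real L))" for j
  have L: "0 < L" by (simp add: L_def)
  have root: "(\<Sum>j<L. \<mu> j * \<omega> j ^ m) = (if m = n then of_real (real L * r ^ n) else 0)" if "m \<le> D" for m
  proof -
    have "\<mu> j * \<omega> j ^ m = of_real (r ^ m) * cis (2 * pi * real j * real_of_int (int m - int n) / real L)" for j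
    proof -
      have "\<mu> j * \<omega> j ^ m = of_real (r ^ m) *
          (cis (- (2 * pi * real j * real n / real L)) * cis (real m * (2 * pi * real j / real L)))"
        by (simp add: \<mu>_def \<omega>_def power_mult_distrib Complex.DeMoivre)
      also have "cis (- (2 * pi * real j * real n / real L)) * cis (real m * (2 * pi * real j / real L)) =
          cis (- (2 * pi * real j * real n / real L) + real m * (2 * pi * real j / real L))"
        by (rule cis_mult)
      also have "- (2 * pi * real j * real n / real L) + real m * (2 * pi * real j / real L) =
          2 * pi * real j * real_of_int (int m - int n) / real L"
        using L by (simp add: field_simps)
      finally show ?thesis .
    qed
    then have "(\<Sum>j<L. \<mu> j * \<omega> j ^ m) =
        of_real (r ^ m) * (\<Sum>j<L. cis (2 * pi * real j * real_of_int (int m - int n) / real L))"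
      by (simp add: sum_distrib_left)
    also have "\<dots> = (if m = n then of_real (real L * r ^ n) else 0)"
    proof (cases "m = n")
      case False
      then have "(\<Sum>j<L. cis (2 * pi * real j * real_of_int (int m - int n) / real L)) = 0"
        using that n by (intro sum_cis_roots) (auto simp: L_def)
      then show ?thesis using False by simp
    qed simp
    finally show ?thesis .
  qed
  have "(\<Sum>j<L. t (\<mu> j) (\<Sum>m\<le>D. t (\<omega> j ^ m) (a m))) = (\<Sum>m\<le>D. t (\<Sum>j<L. \<mu> j * \<omega> j ^ m) (a m))"
    by (simp add: T.scale_sum_right T.scale_sum_left) (rule sum.swap)
  also have "\<dots> = (\<Sum>m\<le>D. if m = n then t (of_real (real L * r ^ n)) (a n) else 0)"
    by (intro sum.cong refl) (simp add: root)
  also have "\<dots> = t (of_real (real L * r ^ n)) (a n)" using n by (simp add: sum.delta)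
  finally have "real L * (q (a n) * r ^ n) = q (\<Sum>j<L. t (\<mu> j) (\<Sum>m\<le>D. t (\<omega> j ^ m) (a m)))"
    using r by (simp add: cont_seminorm_scale[OF q] norm_mult norm_power)
  also have "\<dots> \<le> (\<Sum>j<L. q (t (\<mu> j) (\<Sum>m\<le>D. t (\<omega> j ^ m) (a m))))" by (rule T.seminorm_sum[OF q])
  also have "\<dots> \<le> (\<Sum>j<L. K)"
    using r by (intro sum_mono) (simp add: cont_seminorm_scale[OF q] K \<mu>_def \<omega>_def norm_mult)
  also have "\<dots> = real L * K" by simp
  finally show ?thesis using L by simp
qed

text \<open>The estimate for polynomials is applied to long partial sums. As the series converges on
  a disc of radius \<open>R > 1\<close>, the tails on the unit circle are below any given
  \<open>e\<close>.\<close>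

lemma cauchy_estimate_series:
  fixes t :: "complex \<Rightarrow> 'f::{topological_ab_group_add, t2_space} \<Rightarrow> 'f"
  assumes t: "locally_convex_space t" and q: "cont_seminorm t q" and R: "1 < R"
    and h: "\<And>z. cmod z \<le> R \<Longrightarrow> (\<lambda>m. t (z ^ m) (b m)) sums h z"
    and K: "\<And>z. cmod z = 1 \<Longrightarrow> q (h z) \<le> K"
  shows "q (b m) \<le> K"
proof (rule field_le_epsilon)
  interpret T: locally_convex_space t by fact
  fix e :: real assume e: "0 < e"
  have "cmod (of_real R) \<le> R" using R by simp
  from h[OF this] obtain C where C: "0 \<le> C" "\<And>n. q (b n) * cmod (of_real R) ^ n \<le> C"
    by (rule T.power_series_coeff_bound[OF q]) blast
  have C': "q (b n) * R ^ n \<le> C" for n using C(2)[of n] R by simp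
  let ?\<theta> = "1 / R"
  have \<theta>: "0 \<le> ?\<theta>" "?\<theta> < 1" using R by simp_all
  have "(\<lambda>N. C * ?\<theta> ^ N / (1 - ?\<theta>)) \<longlonglongrightarrow> C * 0 / (1 - ?\<theta>)"
    using \<theta> by (intro tendsto_intros LIMSEQ_power_zero) auto
  then have "eventually (\<lambda>N. C * ?\<theta> ^ N / (1 - ?\<theta>) < e) sequentially"
    using order_tendstoD(2)[of _ 0 _ e] e by simp
  then obtain N0 where N0: "\<And>N. N \<ge> N0 \<Longrightarrow> C * ?\<theta> ^ N / (1 - ?\<theta>) < e"
    unfolding eventually_sequentially by blast
  \<comment> \<open>The degree must exceed \<open>N0\<close> for the tail to be small and must reach
    \<open>m\<close> for the coefficient to occur.\<close>
  define D where "D = N0 + m"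
  have "q (b m) * 1 ^ m \<le> K + e"
  proof (rule cauchy_estimate_polynomial[OF t q])
    show "m \<le> D" by (simp add: D_def)
    fix z :: complex assume z: "cmod z = 1"
    have "q (h z - (\<Sum>n<Suc D. t (z ^ n) (b n))) \<le> C * ?\<theta> ^ Suc D / (1 - ?\<theta>)"
      by (rule T.power_series_tail[OF q C']) (use R z \<theta> in \<open>auto intro!: h\<close>)
    also have "\<dots> < e" by (rule N0) (simp add: D_def)
    finally have "q (h z - (\<Sum>n<Suc D. t (z ^ n) (b n))) < e" .
    then show "q (\<Sum>n\<le>D. t (z ^ n) (b n)) \<le> K + e"
      using T.seminorm_diff[OF q, of "h z" "h z - (\<Sum>n\<le>D. t (z ^ n) (b n))"] K[OF z]
      by (simp only: lessThan_Suc_atMost diff_diff_eq2 add_diff_cancel_left')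
  qed simp
  then show "q (b m) \<le> K + e" by simp
qed

section \<open>Composition of power series\<close>

lemma homogeneous_polynomial_sum:
  assumes t: "locally_convex_space t" and G: "module.subspace t G"
    and p: "\<And>i. i \<in> I \<Longrightarrow> homogeneous_polynomial_on s t F G n (p i)"
  shows "homogeneous_polynomial_on s t F G n (\<lambda>v. \<Sum>i\<in>I. p i v)"
proof -
  interpret T: locally_convex_space t by fact
  have "\<forall>i\<in>I. \<exists>\<beta>. multilinear_on s t F G n \<beta> \<and> continuous_on ({..<n} \<rightarrow>\<^sub>E F) \<beta> \<and>
      (\<forall>v\<in>F. p i v = \<beta> (\<lambda>i\<in>{..<n}. v))"
    using p unfolding homogeneous_polynomial_on_def by blast
  then obtain \<beta> where \<beta>: "\<forall>i\<in>I. multilinear_on s t F G n (\<beta> i) \<and> continuous_on ({..<n} \<rightarrow>\<^sub>E F) (\<beta> i) \<and>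
      (\<forall>v\<in>F. p i v = \<beta> i (\<lambda>i\<in>{..<n}. v))"
    by (rule bchoice[THEN exE])
  have "multilinear_on s t F G n (\<lambda>y. \<Sum>i\<in>I. \<beta> i y)"
    unfolding multilinear_on_def
  proof (intro conjI allI impI ballI image_subsetI)
    show "(\<Sum>i\<in>I. \<beta> i y) \<in> G" if "y \<in> {..<n} \<rightarrow>\<^sub>E F" for y
    proof (rule T.subspace_sum[OF G])
      show "\<beta> i y \<in> G" if "i \<in> I" for i
        using \<beta>[THEN bspec, OF that] multilinear_on_mem[OF _ \<open>y \<in> {..<n} \<rightarrow>\<^sub>E F\<close>] by blast
    qed
    fix k y assume k: "k < n" and y: "y \<in> {..<n} \<rightarrow>\<^sub>E F"
    show "(\<Sum>i\<in>I. \<beta> i (y(k := u + v))) = (\<Sum>i\<in>I. \<beta> i (y(k := u))) + (\<Sum>i\<in>I. \<beta> i (y(k := v)))"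
      if "u \<in> F" "v \<in> F" for u v
      unfolding sum.distrib[symmetric]
    proof (rule sum.cong[OF refl])
      fix i assume "i \<in> I"
      then have "multilinear_on s t F G n (\<beta> i)" using \<beta> by blast
      from multilinear_on_add[OF this y k that]
      show "\<beta> i (y(k := u + v)) = \<beta> i (y(k := u)) + \<beta> i (y(k := v))" .
    qed
    show "(\<Sum>i\<in>I. \<beta> i (y(k := s c u))) = t c (\<Sum>i\<in>I. \<beta> i (y(k := u)))" if "u \<in> F" for c u
      unfolding T.scale_sum_right
    proof (rule sum.cong[OF refl])
      fix i assume "i \<in> I"
      then have "multilinear_on s t F G n (\<beta> i)" using \<beta> by blast
      from multilinear_on_scale[OF this y k that]
      show "\<beta> i (y(k := s c u)) = t c (\<beta> i (y(k := u)))" .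
    qed
  qed
  moreover have "continuous_on ({..<n} \<rightarrow>\<^sub>E F) (\<lambda>y. \<Sum>i\<in>I. \<beta> i y)"
    using \<beta> by (intro continuous_on_sum) blast
  moreover have "\<forall>v\<in>F. (\<Sum>i\<in>I. p i v) = (\<Sum>i\<in>I. \<beta> i (\<lambda>i\<in>{..<n}. v))"
    using \<beta> by (intro ballI sum.cong refl) blast
  ultimately show ?thesis unfolding homogeneous_polynomial_on_def by blast
qed

section \<open>Substitution of polynomials into multilinear maps\<close>

lemma block_index_exists:
  fixes i :: "nat \<Rightarrow> nat"
  assumes "a < (\<Sum>j<m. i j)"
  obtains j l where "j < m" "l < i j" "a = (\<Sum>j'<j. i j') + l"
  using assms
proof (induction m arbitrary: thesis)
  case (Suc m)
  show ?case
  proof (cases "a < (\<Sum>j<m. i j)")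
    case True
    obtain j l where "j < m" "l < i j" "a = (\<Sum>j'<j. i j') + l" by (rule Suc.IH[OF _ True]) blast
    then show ?thesis using Suc.prems(1)[of j l] by simp
  next
    case False
    then show ?thesis using Suc.prems(1)[of m "a - (\<Sum>j<m. i j)"] Suc.prems(2) by simp
  qed
qed simp

lemma block_end_le: "j < j' \<Longrightarrow> (\<Sum>k<j. i k) + i j \<le> (\<Sum>k<j'. i k)" for i :: "nat \<Rightarrow> nat"
  using sum_mono2[of "{..<j'}" "{..<Suc j}" i] by auto

lemma block_index_unique:
  fixes i :: "nat \<Rightarrow> nat"
  assumes "l < i j" "l' < i j'" "(\<Sum>k<j. i k) + l = (\<Sum>k<j'. i k) + l'"
  shows "j = j' \<and> l = l'"
proof -
  have "\<not> j < j'" "\<not> j' < j"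
    using block_end_le[of j j' i] block_end_le[of j' j i] assms by linarith+
  then have "j = j'" by simp
  then show ?thesis using assms(3) by simp
qed

text \<open>The arguments are cut into consecutive blocks of lengths \<open>i j\<close>, and the
  multilinear form of \<open>q j\<close> is fed with block \<open>j\<close>. Each position belongs
  to exactly one block, so a change of one argument affects one slot of \<open>\<beta>\<close>,
  where linearity of both forms combines.\<close>

lemma homogeneous_polynomial_block:
  fixes s :: "'k::real_or_complex \<Rightarrow> 'e::{topological_ab_group_add, t2_space} \<Rightarrow> 'e"
    and t :: "'k \<Rightarrow> 'f::{topological_ab_group_add, t2_space} \<Rightarrow> 'f"
    and u :: "'k \<Rightarrow> 'h::{topological_ab_group_add, t2_space} \<Rightarrow> 'h"
  assumes \<beta>: "multilinear_on t u G H m \<beta>" "continuous_on ({..<m} \<rightarrow>\<^sub>E G) \<beta>"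
    and q: "\<And>j. j < m \<Longrightarrow> homogeneous_polynomial_on s t F G (i j) (q j)"
    and n: "(\<Sum>j<m. i j) = n"
  shows "homogeneous_polynomial_on s u F H n (\<lambda>v. \<beta> (\<lambda>j\<in>{..<m}. q j v))"
proof -
  have "\<forall>j\<in>{..<m}. \<exists>\<gamma>. multilinear_on s t F G (i j) \<gamma> \<and> continuous_on ({..<i j} \<rightarrow>\<^sub>E F) \<gamma> \<and>
      (\<forall>v\<in>F. q j v = \<gamma> (\<lambda>l\<in>{..<i j}. v))"
    using q unfolding homogeneous_polynomial_on_def by blast
  then obtain \<gamma> where \<gamma>': "\<forall>j\<in>{..<m}. multilinear_on s t F G (i j) (\<gamma> j) \<and>
      continuous_on ({..<i j} \<rightarrow>\<^sub>E F) (\<gamma> j) \<and> (\<forall>v\<in>F. q j v = \<gamma> j (\<lambda>l\<in>{..<i j}. v))"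
    by (rule bchoice[THEN exE])
  have \<gamma>: "multilinear_on s t F G (i j) (\<gamma> j)" "continuous_on ({..<i j} \<rightarrow>\<^sub>E F) (\<gamma> j)"
    "\<And>v. v \<in> F \<Longrightarrow> q j v = \<gamma> j (\<lambda>l\<in>{..<i j}. v)" if "j < m" for j
    using \<gamma>'[THEN bspec, of j] that by auto
  \<comment> \<open>\<open>o' j\<close> is the position at which block \<open>j\<close> starts,
    \<open>I j\<close> extracts that block, and \<open>B\<close> is the resulting form in
    \<open>n\<close> arguments.\<close>
  define o' where "o' j = (\<Sum>k<j. i k)" for j
  define I where "I j y = (\<lambda>l\<in>{..<i j}. y (o' j + l))" for j and y :: "nat \<Rightarrow> 'e"
  define B where "B y = \<beta> (\<lambda>j\<in>{..<m}. \<gamma> j (I j y))" for y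
  have on: "o' j + l < n" if "j < m" "l < i j" for j l
    using block_end_le[OF that(1), of i] that n by (simp add: o'_def)
  have I: "I j y \<in> {..<i j} \<rightarrow>\<^sub>E F" if "y \<in> {..<n} \<rightarrow>\<^sub>E F" "j < m" for y j
    unfolding I_def
    by (rule restrict_PiE_lessThan) (use PiE_mem[OF that(1)] on[OF that(2)] in simp)
  have Y: "(\<lambda>j\<in>{..<m}. \<gamma> j (I j y)) \<in> {..<m} \<rightarrow>\<^sub>E G" if "y \<in> {..<n} \<rightarrow>\<^sub>E F" for y
  proof (rule restrict_PiE_lessThan)
    show "\<gamma> j (I j y) \<in> G" if "j < m" for j
      by (rule multilinear_on_mem[OF \<gamma>(1)[OF that] I[OF \<open>y \<in> {..<n} \<rightarrow>\<^sub>E F\<close> that]])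
  qed
  have upd: "B (y(a := w)) = \<beta> ((\<lambda>j\<in>{..<m}. \<gamma> j (I j y))(j0 := \<gamma> j0 ((I j0 y)(l0 := w))))"
    if j0: "j0 < m" and l0: "l0 < i j0" and a: "a = o' j0 + l0" for y a w j0 l0
  proof -
    have "I j (y(a := w)) = (if j = j0 then (I j0 y)(l0 := w) else I j y)" for j
    proof -
      have "(o' j + l = a) = (j = j0 \<and> l = l0)" if "l < i j" for l
        using block_index_unique[of l i j l0 j0, OF that l0] a by (auto simp: o'_def)
      then show ?thesis using l0 by (auto simp: I_def fun_eq_iff)
    qed
    note I_upd = this
    have "(\<lambda>j\<in>{..<m}. \<gamma> j (I j (y(a := w)))) = (\<lambda>j\<in>{..<m}. \<gamma> j (I j y))(j0 := \<gamma> j0 ((I j0 y)(l0 := w)))"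
    proof (rule ext)
      fix j
      show "(\<lambda>j\<in>{..<m}. \<gamma> j (I j (y(a := w)))) j = ((\<lambda>j\<in>{..<m}. \<gamma> j (I j y))(j0 := \<gamma> j0 ((I j0 y)(l0 := w)))) j"
        using j0 I_upd[of j] by (cases "j = j0") simp_all
    qed
    then show ?thesis unfolding B_def by (rule arg_cong)
  qed
  have "multilinear_on s u F H n B"
    unfolding multilinear_on_def
  proof (intro conjI allI impI ballI image_subsetI)
    show "B y \<in> H" if "y \<in> {..<n} \<rightarrow>\<^sub>E F" for y
      unfolding B_def by (rule multilinear_on_mem[OF \<beta>(1) Y[OF that]])
    fix a y assume "a < n" and y: "y \<in> {..<n} \<rightarrow>\<^sub>E F"
    then have "a < (\<Sum>j<m. i j)" using n by simp
    then obtain j0 l0 where j0: "j0 < m" and l0: "l0 < i j0" and a: "a = o' j0 + l0"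
      unfolding o'_def by (rule block_index_exists)
    have mem: "\<gamma> j0 ((I j0 y)(l0 := w)) \<in> G" if "w \<in> F" for w
      by (rule multilinear_on_mem[OF \<gamma>(1)[OF j0] fun_upd_PiE[OF I[OF y j0] l0 that]])
    note up = upd[OF j0 l0 a]
    show "B (y(a := v + w)) = B (y(a := v)) + B (y(a := w))" if "v \<in> F" "w \<in> F" for v w
      unfolding up multilinear_on_add[OF \<gamma>(1)[OF j0] I[OF y j0] l0 that]
      by (rule multilinear_on_add[OF \<beta>(1) Y[OF y] j0 mem[OF that(1)] mem[OF that(2)]])
    show "B (y(a := s c v)) = u c (B (y(a := v)))" if "v \<in> F" for c v
      unfolding up multilinear_on_scale[OF \<gamma>(1)[OF j0] I[OF y j0] l0 that]
      by (rule multilinear_on_scale[OF \<beta>(1) Y[OF y] j0 mem[OF that]])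
  qed
  moreover have "continuous_on ({..<n} \<rightarrow>\<^sub>E F) B"
    unfolding B_def
  proof (rule continuous_on_compose2[OF \<beta>(2)])
    show "continuous_on ({..<n} \<rightarrow>\<^sub>E F) (\<lambda>y. \<lambda>j\<in>{..<m}. \<gamma> j (I j y))"
    proof (rule continuous_on_coordinatewise_then_product)
      fix j
      show "continuous_on ({..<n} \<rightarrow>\<^sub>E F) (\<lambda>y. (\<lambda>j\<in>{..<m}. \<gamma> j (I j y)) j)"
      proof (cases "j < m")
        case True
        have "continuous_on ({..<n} \<rightarrow>\<^sub>E F) (\<lambda>y. \<gamma> j (I j y))"
        proof (rule continuous_on_compose2[OF \<gamma>(2)[OF True]])
          show "continuous_on ({..<n} \<rightarrow>\<^sub>E F) (I j)"
            unfolding I_def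
          proof (rule continuous_on_coordinatewise_then_product)
            fix l
            show "continuous_on ({..<n} \<rightarrow>\<^sub>E F) (\<lambda>y. (\<lambda>l\<in>{..<i j}. y (o' j + l)) l)"
              unfolding restrict_def
              by (rule continuous_on_if_const)
                (rule continuous_on_subset[OF continuous_on_product_coordinates], simp_all)
          qed
          show "I j ` ({..<n} \<rightarrow>\<^sub>E F) \<subseteq> {..<i j} \<rightarrow>\<^sub>E F" using I[OF _ True] by (rule image_subsetI)
        qed
        then show ?thesis using True by simp
      qed simp
    qed
    show "(\<lambda>y. \<lambda>j\<in>{..<m}. \<gamma> j (I j y)) ` ({..<n} \<rightarrow>\<^sub>E F) \<subseteq> {..<m} \<rightarrow>\<^sub>E G" using Y by (rule image_subsetI)
  qed
  moreover have "\<forall>v\<in>F. \<beta> (\<lambda>j\<in>{..<m}. q j v) = B (\<lambda>i\<in>{..<n}. v)"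
  proof
    fix v assume v: "v \<in> F"
    have "q j v = \<gamma> j (I j (\<lambda>i\<in>{..<n}. v))" if "j < m" for j
    proof -
      have "I j (\<lambda>i\<in>{..<n}. v) = (\<lambda>l\<in>{..<i j}. v)"
        using on[OF that] by (auto simp: I_def fun_eq_iff)
      then show ?thesis using \<gamma>(3)[OF that v] by (simp only:)
    qed
    then show "\<beta> (\<lambda>j\<in>{..<m}. q j v) = B (\<lambda>i\<in>{..<n}. v)"
      unfolding B_def by (intro arg_cong[where f = \<beta>] restrict_ext) simp
  qed
  ultimately show ?thesis unfolding homogeneous_polynomial_on_def by blast
qed

text \<open>Ordered compositions of \<open>n\<close> into \<open>m\<close> parts. Parts begin at 1
  because the constant term of the inner series is removed beforehand; the bound \<open>N\<close>
  corresponds to using the partial sum of degree \<open>N\<close>.\<close>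

definition compositions :: "nat \<Rightarrow> nat \<Rightarrow> nat \<Rightarrow> (nat \<Rightarrow> nat) set" where
  "compositions N m n = {i \<in> {..<m} \<rightarrow>\<^sub>E {1..N}. (\<Sum>j<m. i j) = n}"

text \<open>A part cannot exceed the total. Hence the coefficient of degree \<open>n\<close> no
  longer changes once the inner series has been cut at a degree \<open>N \<ge> n\<close>.\<close>

lemma compositions_stable:
  assumes "n \<le> N"
  shows "compositions N m n = compositions n m n"
proof -
  have "i j \<in> {1..n}" if "i \<in> {..<m} \<rightarrow>\<^sub>E {1..N}" "(\<Sum>j<m. i j) = n" "j < m" for i :: "nat \<Rightarrow> nat" and j
    using PiE_mem[OF that(1), of j] that(2,3) member_le_sum[of j "{..<m}" i] by auto
  then have "i \<in> {..<m} \<rightarrow>\<^sub>E {1..n}" if "i \<in> {..<m} \<rightarrow>\<^sub>E {1..N}" "(\<Sum>j<m. i j) = n" for i :: "nat \<Rightarrow> nat"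
    using that by (intro PiE_I) (auto intro: PiE_arb)
  moreover have "{..<m} \<rightarrow>\<^sub>E {1..n} \<subseteq> {..<m} \<rightarrow>\<^sub>E {1..N}" using assms by (intro PiE_mono) auto
  ultimately show ?thesis unfolding compositions_def by blast
qed

text \<open>All parts are at least 1. Only finitely many outer degrees \<open>m\<close> therefore
  contribute to a given total degree, which makes the coefficients of the composite finite
  sums.\<close>

lemma compositions_empty_less:
  assumes "n < m"
  shows "compositions N m n = {}"
proof -
  have "m \<le> (\<Sum>j<m. i j)" if i: "i \<in> {..<m} \<rightarrow>\<^sub>E {1..N}" for i :: "nat \<Rightarrow> nat"
  proof -
    have "1 \<le> i j" if "j < m" for j using PiE_mem[OF i, of j] that by simp
    then have "(\<Sum>j<m. 1) \<le> (\<Sum>j<m. i j)" by (intro sum_mono) simp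
    then show ?thesis by simp
  qed
  then have "i \<notin> compositions N m n" for i
    using assms unfolding compositions_def by (metis (mono_tags, lifting) mem_Collect_eq not_less)
  then show ?thesis by blast
qed

lemma sum_composition_le:
  fixes i :: "nat \<Rightarrow> nat"
  assumes "i \<in> {..<m} \<rightarrow>\<^sub>E {1..N}"
  shows "(\<Sum>j<m. i j) \<le> m * N"
proof -
  have "i j \<le> N" if "j < m" for j using PiE_mem[OF assms, of j] that by simp
  then have "(\<Sum>j<m. i j) \<le> (\<Sum>j<m. N)" by (intro sum_mono) simp
  then show ?thesis by simp
qed

text \<open>
  The scalar case of the composition theorem: \<open>w z = \<Sum> z\<^sup>i a\<^sub>i\<close> is substituted into
  \<open>f = \<Sum> p\<^sub>m\<close>. The partial sums \<open>w\<^sub>N\<close> of \<open>w\<close> are polynomials in \<open>z\<close>, and Cauchy's estimates bound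
  the coefficients of \<open>p\<^sub>m \<circ> w\<^sub>N\<close> uniformly in \<open>N\<close>. The bound on \<open>f\<close> needed for this comes from
  sequential compactness of discs, which avoids any completeness of the spaces.
\<close>

lemma compose_power_series:
  fixes t :: "complex \<Rightarrow> 'f::{topological_ab_group_add, t2_space} \<Rightarrow> 'f"
    and u :: "complex \<Rightarrow> 'h::{topological_ab_group_add, t2_space} \<Rightarrow> 'h"
  assumes t: "locally_convex_space t" and u: "locally_convex_space u" and G: "module.subspace t G"
    and \<beta>: "\<And>m. multilinear_on t u G H m (\<beta> m)"
    and p: "\<And>m. homogeneous_polynomial_on t u G H m (p m)" "\<And>m v. v \<in> G \<Longrightarrow> p m v = \<beta> m (\<lambda>i\<in>{..<m}. v)"
    and q0: "cont_seminorm t q0"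
    and f: "\<And>v. v \<in> G \<Longrightarrow> q0 v < 1 \<Longrightarrow> (\<lambda>m. p m v) sums f v"
      "continuous_on {v \<in> G. q0 v < 1} f"
    and a: "a 0 = 0" "\<And>i. a i \<in> G"
    and w: "\<And>z. cmod z \<le> 2 \<Longrightarrow> (\<lambda>i. t (z ^ i) (a i)) sums w z" "continuous_on (cball 0 2) w"
      "\<And>z. cmod z \<le> 2 \<Longrightarrow> w z \<in> G" "\<And>z. cmod z \<le> 2 \<Longrightarrow> q0 (w z) < 1/6"
  shows "(\<lambda>n. \<Sum>m\<le>n. \<Sum>i\<in>compositions n m n. \<beta> m (\<lambda>j\<in>{..<m}. a (i j))) sums f (w 1)"
proof -
  interpret T: locally_convex_space t by fact
  interpret H: locally_convex_space u by fact
  define wN where "wN N z = (\<Sum>i\<in>{1..N}. t (z ^ i) (a i))" for N z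
  define c where "c N m n = (\<Sum>i\<in>compositions N m n. \<beta> m (\<lambda>j\<in>{..<m}. a (i j)))" for N m n
  have wNG: "wN N z \<in> G" for N z
    unfolding wN_def by (intro T.subspace_sum[OF G] T.subspace_scale[OF G] a(2))
  have wN_eq: "wN N z = (\<Sum>i<Suc N. t (z ^ i) (a i))" for N z
  proof -
    have "{..<Suc N} = insert 0 {1..N}" by auto
    then show ?thesis by (simp add: wN_def a(1))
  qed
  \<comment> \<open>On the disc of radius \<open>3/2\<close> inside the disc of radius 2 the ratio
    of the majorant is \<open>3/4\<close>.\<close>
  have unif: "\<exists>N0. \<forall>N\<ge>N0. \<forall>z. cmod z \<le> 3/2 \<longrightarrow> q (w z - wN N z) < e"
    if q: "cont_seminorm t q" and e: "0 < e" for q e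
  proof -
    have "(\<lambda>i. t (2 ^ i) (a i)) sums w 2" by (rule w(1)) simp
    then obtain C where C: "0 \<le> C" "\<And>n. q (a n) * cmod 2 ^ n \<le> C"
      by (rule T.power_series_coeff_bound[OF q]) blast
    have C': "q (a n) * 2 ^ n \<le> C" for n using C(2)[of n] by simp
    have lim: "(\<lambda>N. C * (3/4) ^ Suc N / (1 - 3/4)) \<longlonglongrightarrow> C * 0 / (1 - 3/4)"
      by (intro tendsto_intros LIMSEQ_Suc[of "\<lambda>n. (3/4)^n"] LIMSEQ_power_zero) auto
    have "C * 0 / (1 - 3/4) < e" using e by simp
    from order_tendstoD(2)[OF lim this]
    have "eventually (\<lambda>N. C * (3/4) ^ Suc N / (1 - 3/4) < e) sequentially" .
    then obtain N0 where N0: "\<And>N. N \<ge> N0 \<Longrightarrow> C * (3/4) ^ Suc N / (1 - 3/4) < e"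
      unfolding eventually_sequentially by blast
    have "q (w z - wN N z) < e" if "N \<ge> N0" "cmod z \<le> 3/2" for N z
    proof -
      have "q (w z - (\<Sum>i<Suc N. t (z ^ i) (a i))) \<le> C * (3/4) ^ Suc N / (1 - 3/4)"
        by (rule T.power_series_tail[OF q C']) (use that in \<open>auto intro!: w(1)\<close>)
      then show ?thesis using N0[OF that(1)] unfolding wN_eq by linarith
    qed
    then show ?thesis by blast
  qed
  obtain N0 where N0: "\<And>N z. N \<ge> N0 \<Longrightarrow> cmod z \<le> 3/2 \<Longrightarrow> q0 (w z - wN N z) < 1/6"
    using unif[OF q0, of "1/6"] by auto
  \<comment> \<open>The two bounds \<open>1/6\<close> add up to \<open>1/3\<close>. This leaves room
    for a further factor of modulus up to 3 before the ball \<open>q0 < 1\<close>, where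
    \<open>f\<close> is expanded, is left.\<close>
  have q0wN: "q0 (wN N z) < 1/3" if "N \<ge> N0" "cmod z \<le> 3/2" for N z
  proof -
    have "q0 (wN N z) \<le> q0 (w z) + q0 (w z - wN N z)"
      using T.seminorm_diff[OF q0, of "w z" "w z - wN N z"] by simp
    moreover have "q0 (w z) < 1/6" by (rule w(4)) (use that(2) in simp)
    ultimately show ?thesis using N0[OF that] by linarith
  qed
  \<comment> \<open>If no bound existed, there would be \<open>N\<close>, \<open>z\<close>,
    \<open>\<zeta>\<close> with \<open>N \<ge> N0 + k\<close> and value above \<open>k\<close> for
    each \<open>k\<close>. Along a subsequence \<open>z\<close> and \<open>\<zeta>\<close> converge
    in compact discs and \<open>w\<^sub>N z\<close> tends to \<open>w z0\<close>, so continuity of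
    \<open>f\<close> keeps the values bounded, a contradiction.\<close>
  have bounded: "\<exists>K N1. N0 \<le> N1 \<and> (\<forall>N z \<zeta>. N1 \<le> N \<longrightarrow> cmod z \<le> 3/2 \<longrightarrow> cmod \<zeta> \<le> 1 \<longrightarrow>
      q (f (t (2 * \<zeta>) (wN N z))) \<le> K)" if q: "cont_seminorm u q" for q
  proof (rule ccontr)
    assume neg: "\<not> ?thesis"
    have "\<forall>k::nat. \<exists>x. case x of (N, z, \<zeta>) \<Rightarrow> N0 + k \<le> N \<and> cmod z \<le> 3/2 \<and> cmod \<zeta> \<le> 1 \<and>
        real k < q (f (t (2 * \<zeta>) (wN N z)))"
    proof
      fix k :: nat
      have "\<not> (\<forall>N z \<zeta>. N0 + k \<le> N \<longrightarrow> cmod z \<le> 3/2 \<longrightarrow> cmod \<zeta> \<le> 1 \<longrightarrow> q (f (t (2 * \<zeta>) (wN N z))) \<le> real k)"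
        using neg le_add1 by blast
      then obtain N z \<zeta> where "N0 + k \<le> N" "cmod z \<le> 3/2" "cmod \<zeta> \<le> 1" "real k < q (f (t (2 * \<zeta>) (wN N z)))"
        by (auto simp: not_le)
      then show "\<exists>x. case x of (N, z, \<zeta>) \<Rightarrow> N0 + k \<le> N \<and> cmod z \<le> 3/2 \<and> cmod \<zeta> \<le> 1 \<and>
        real k < q (f (t (2 * \<zeta>) (wN N z)))" by (intro exI[of _ "(N, z, \<zeta>)"]) simp
    qed
    from choice[OF this] obtain X where X: "\<forall>k. case X k of (N, z, \<zeta>) \<Rightarrow> N0 + k \<le> N \<and> cmod z \<le> 3/2 \<and> cmod \<zeta> \<le> 1 \<and>
        real k < q (f (t (2 * \<zeta>) (wN N z)))" by (rule exE)
    define N where "N k = fst (X k)" for k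
    define z where "z k = fst (snd (X k))" for k
    define \<zeta> where "\<zeta> k = snd (snd (X k))" for k
    have Xk: "N0 + k \<le> N k" "cmod (z k) \<le> 3/2" "cmod (\<zeta> k) \<le> 1" "real k < q (f (t (2 * \<zeta> k) (wN (N k) (z k))))" for k
      using X[THEN spec, of k] by (simp_all add: N_def z_def \<zeta>_def case_prod_unfold)
    have "compact (cball (0::complex) (3/2) \<times> cball (0::complex) 1)" by (intro compact_Times compact_cball)
    moreover have "\<forall>k. (z k, \<zeta> k) \<in> cball 0 (3/2) \<times> cball 0 1" using Xk(2,3) by simp
    ultimately obtain l r where l: "l \<in> cball 0 (3/2) \<times> cball 0 1" and r: "strict_mono r"
      and lim: "((\<lambda>k. (z k, \<zeta> k)) \<circ> r) \<longlonglongrightarrow> l" by (rule seq_compactE[OF compact_imp_seq_compact]) blast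
    define z0 where "z0 = fst l"
    define \<zeta>0 where "\<zeta>0 = snd l"
    have l': "cmod z0 \<le> 3/2" "cmod \<zeta>0 \<le> 1" using l by (auto simp: z0_def \<zeta>0_def)
    have lz: "(\<lambda>k. z (r k)) \<longlonglongrightarrow> z0" using tendsto_fst[OF lim] by (simp add: o_def z0_def)
    have l\<zeta>: "(\<lambda>k. \<zeta> (r k)) \<longlonglongrightarrow> \<zeta>0" using tendsto_snd[OF lim] by (simp add: o_def \<zeta>0_def)
    have cw: "(\<lambda>k. w (z (r k))) \<longlonglongrightarrow> w z0"
    proof (rule continuous_on_tendsto_compose[OF w(2) lz])
      show "z0 \<in> cball 0 2" using l' by simp
      show "eventually (\<lambda>k. z (r k) \<in> cball 0 2) sequentially"
      proof (rule always_eventually, rule allI)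
        show "z (r k) \<in> cball 0 2" for k using Xk(2)[of "r k"] by simp
      qed
    qed
    \<comment> \<open>Uniform convergence of the partial sums on the smaller disc is combined with
      continuity of \<open>w\<close> at \<open>z0\<close>.\<close>
    have lw: "(\<lambda>k. wN (N (r k)) (z (r k))) \<longlonglongrightarrow> w z0"
    proof (rule T.tendsto_seminormI, rule tendstoI)
      fix q' and e :: real assume q': "cont_seminorm t q'" and e: "0 < e"
      obtain N2 where N2: "\<forall>N\<ge>N2. \<forall>z. cmod z \<le> 3/2 \<longrightarrow> q' (w z - wN N z) < e / 2"
        using unif[OF q', of "e/2"] e by auto
      show "eventually (\<lambda>k. dist (q' (wN (N (r k)) (z (r k)) - w z0)) 0 < e) sequentially"
        using T.tendsto_seminormD_less[OF cw q', of "e/2", simplified, OF e] eventually_ge_at_top[of N2]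
      proof eventually_elim
        case (elim k)
        have "N2 \<le> N (r k)" using elim(2) seq_suble[OF r, of k] Xk(1)[of "r k"] by linarith
        then have "q' (w (z (r k)) - wN (N (r k)) (z (r k))) < e / 2" using N2 Xk(2) by blast
        then have "q' (wN (N (r k)) (z (r k)) - w (z (r k))) < e / 2"
          by (simp only: T.seminorm_minus_commute[OF q', of "wN (N (r k)) (z (r k))"])
        then have "q' (wN (N (r k)) (z (r k)) - w z0) < e"
          using T.seminorm_triangle3[OF q', of "wN (N (r k)) (z (r k))" "w z0" "w (z (r k))"] elim(1) by linarith
        then show ?case using T.seminorm_nonneg[OF q', of "wN (N (r k)) (z (r k)) - w z0"] by (simp add: dist_real_def)
      qed
    qed
    have lt: "(\<lambda>k. t (2 * \<zeta> (r k)) (wN (N (r k)) (z (r k)))) \<longlonglongrightarrow> t (2 * \<zeta>0) (w z0)"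
      by (intro T.tendsto_scale tendsto_intros l\<zeta> lw)
    have q2: "q0 (t (2 * x) y) < 1" if "cmod x \<le> 1" "q0 y < 1/3" for x y
    proof -
      have "q0 (t (2 * x) y) = 2 * (cmod x * q0 y)" by (simp add: cont_seminorm_scale[OF q0] norm_mult)
      also have "cmod x * q0 y \<le> q0 y" using that(1) by (intro mult_left_le_one_le T.seminorm_nonneg[OF q0]) auto
      finally show ?thesis using that(2) by linarith
    qed
    have "(\<lambda>k. f (t (2 * \<zeta> (r k)) (wN (N (r k)) (z (r k))))) \<longlonglongrightarrow> f (t (2 * \<zeta>0) (w z0))"
    proof (rule continuous_on_tendsto_compose[OF f(2) lt])
      have "q0 (w z0) < 1/6" "w z0 \<in> G" by (rule w(3,4), use l' in simp)+
      then show "t (2 * \<zeta>0) (w z0) \<in> {v \<in> G. q0 v < 1}"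
        using q2[OF l'(2), of "w z0"] T.subspace_scale[OF G] by simp
      show "eventually (\<lambda>k. t (2 * \<zeta> (r k)) (wN (N (r k)) (z (r k))) \<in> {v \<in> G. q0 v < 1}) sequentially"
      proof (rule always_eventually, rule allI)
        fix k
        have "N0 \<le> N (r k)" using Xk(1)[of "r k"] by simp
        then have "q0 (wN (N (r k)) (z (r k))) < 1/3" by (rule q0wN) (rule Xk(2))
        then show "t (2 * \<zeta> (r k)) (wN (N (r k)) (z (r k))) \<in> {v \<in> G. q0 v < 1}"
          using q2[OF Xk(3)] T.subspace_scale[OF G wNG] by simp
      qed
    qed
    from cont_seminorm_tendsto[OF q this]
    have "eventually (\<lambda>k. q (f (t (2 * \<zeta> (r k)) (wN (N (r k)) (z (r k))))) < q (f (t (2 * \<zeta>0) (w z0))) + 1) sequentially"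
      by (rule order_tendstoD(2)) simp
    moreover have "eventually (\<lambda>k. q (f (t (2 * \<zeta>0) (w z0))) + 1 \<le> real k) sequentially"
      using filterlim_real_sequentially unfolding filterlim_at_top by blast
    ultimately have "eventually (\<lambda>k. False) sequentially"
    proof eventually_elim
      case (elim k)
      have "real k \<le> real (r k)" using seq_suble[OF r, of k] by simp
      then show ?case using elim Xk(4)[of "r k"] by linarith
    qed
    then show False by simp
  qed
  \<comment> \<open>The multinomial expansion, with the choices grouped by the total degree in
    \<open>z\<close>. Any \<open>D \<ge> m * N\<close> bounds these degrees.\<close>
  have expand: "p m (wN N z) = (\<Sum>n\<le>D. u (z ^ n) (c N m n))" if D: "m * N \<le> D" for m N z D
  proof -
    let ?P = "{..<m} \<rightarrow>\<^sub>E {1..N}"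
    have finP: "finite ?P" by (intro finite_PiE) auto
    have "p m (wN N z) = \<beta> m (\<lambda>j\<in>{..<m}. \<Sum>i\<in>{1..N}. t (z ^ i) (a i))"
      unfolding p(2)[OF wNG] by (simp add: wN_def)
    also have "\<dots> = (\<Sum>\<phi>\<in>?P. \<beta> m (\<lambda>j\<in>{..<m}. t (z ^ \<phi> j) (a (\<phi> j))))"
      by (rule multilinear_expand[OF t u G \<beta>]) (auto intro: T.subspace_scale[OF G] a(2))
    also have "\<dots> = (\<Sum>\<phi>\<in>?P. u (z ^ (\<Sum>j<m. \<phi> j)) (\<beta> m (\<lambda>j\<in>{..<m}. a (\<phi> j))))"
    proof (rule sum.cong[OF refl])
      show "\<beta> m (\<lambda>j\<in>{..<m}. t (z ^ \<phi> j) (a (\<phi> j))) = u (z ^ (\<Sum>j<m. \<phi> j)) (\<beta> m (\<lambda>j\<in>{..<m}. a (\<phi> j)))" for \<phi>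
        unfolding power_sum by (rule multilinear_scale_all[OF t u G \<beta>]) (rule a(2))
    qed
    also have "\<dots> = (\<Sum>n\<le>D. \<Sum>\<phi>\<in>{\<phi>. \<phi> \<in> ?P \<and> (\<Sum>j<m. \<phi> j) = n}. u (z ^ (\<Sum>j<m. \<phi> j)) (\<beta> m (\<lambda>j\<in>{..<m}. a (\<phi> j))))"
      by (rule sum.group[symmetric, OF finP]) (use sum_composition_le[of _ m N] D in \<open>auto intro: order_trans\<close>)
    also have "\<dots> = (\<Sum>n\<le>D. u (z ^ n) (c N m n))"
      unfolding c_def compositions_def H.scale_sum_right by (intro sum.cong refl) auto
    finally show ?thesis .
  qed
  define rr where "rr n = (\<Sum>m\<le>n. c n m n)" for n
  have c_stable: "c N m n = c n m n" if "n \<le> N" for N m n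
    unfolding c_def compositions_stable[OF that] ..
  have c_zero: "c N m n = 0" if "n < m" for N m n
    unfolding c_def compositions_empty_less[OF that] by simp
  \<comment> \<open>Up to degree \<open>N\<close> the polynomial in \<open>w\<^sub>N\<close> already
    has the final coefficients, provided that enough outer degrees are summed.\<close>
  have rr_eq: "rr n = (\<Sum>m<L. c N m n)" if "n \<le> N" "n < L" for n N L
  proof -
    have "(\<Sum>m<L. c N m n) = (\<Sum>m\<le>n. c N m n)"
      by (rule sum.mono_neutral_right) (use that c_zero in auto)
    then show ?thesis by (simp add: rr_def c_stable[OF that(1)])
  qed
  have "(\<lambda>N. \<Sum>n\<le>N. rr n) \<longlonglongrightarrow> f (w 1)"
  proof (rule H.tendsto_seminormI)
    fix q assume q: "cont_seminorm u q"
    obtain K N1 where N1: "N0 \<le> N1" and K: "\<And>N z \<zeta>. N1 \<le> N \<Longrightarrow> cmod z \<le> 3/2 \<Longrightarrow> cmod \<zeta> \<le> 1 \<Longrightarrow>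
      q (f (t (2 * \<zeta>) (wN N z))) \<le> K" using bounded[OF q] by blast
    have K0: "0 \<le> K" using K[of N1 0 0] H.seminorm_nonneg[OF q, of "f (t (2 * 0) (wN N1 0))"] by simp
    \<comment> \<open>Cauchy's estimate in the variable \<open>\<zeta>\<close> for the series of
      \<open>f\<close> at \<open>2 \<zeta> w\<^sub>N(z)\<close>. It converges for
      \<open>|\<zeta>| \<le> 3/2\<close> because \<open>3 * 1/3 = 1\<close>. The factor 2 in front
      of \<open>\<zeta>\<close> is what produces the decay \<open>1 / 2^m\<close>.\<close>
    have step1: "q (p m (wN N z)) \<le> K / 2 ^ m" if N: "N1 \<le> N" and z: "cmod z \<le> 3/2" for N z m
    proof -
      have NN0: "N0 \<le> N" using N N1 by simp
      have "q (p m (t 2 (wN N z))) \<le> K"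
      proof (rule cauchy_estimate_series[OF u q, where R = "3/2" and b = "\<lambda>m. p m (t 2 (wN N z))" and
            h = "\<lambda>\<zeta>. f (t (2 * \<zeta>) (wN N z))"])
        fix \<zeta> :: complex assume \<zeta>: "cmod \<zeta> \<le> 3/2"
        have "q0 (t (2 * \<zeta>) (wN N z)) = 2 * (cmod \<zeta> * q0 (wN N z))" by (simp add: cont_seminorm_scale[OF q0] norm_mult)
        also have "cmod \<zeta> * q0 (wN N z) \<le> 3/2 * q0 (wN N z)"
          by (intro mult_right_mono \<zeta> T.seminorm_nonneg[OF q0])
        finally have "q0 (t (2 * \<zeta>) (wN N z)) < 1" using q0wN[OF NN0 z] by linarith
        then have "(\<lambda>m. p m (t (2 * \<zeta>) (wN N z))) sums f (t (2 * \<zeta>) (wN N z))"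
          by (intro f(1) T.subspace_scale[OF G wNG])
        moreover have "p m (t (2 * \<zeta>) (wN N z)) = u (\<zeta> ^ m) (p m (t 2 (wN N z)))" for m
          using homogeneous_polynomial_scale[OF t u G p(1) T.subspace_scale[OF G wNG], of m \<zeta> 2 N z]
          by (simp add: mult.commute)
        ultimately show "(\<lambda>m. u (\<zeta> ^ m) (p m (t 2 (wN N z)))) sums f (t (2 * \<zeta>) (wN N z))" by simp
      next
        fix \<zeta> :: complex assume "cmod \<zeta> = 1"
        then show "q (f (t (2 * \<zeta>) (wN N z))) \<le> K" by (intro K N z) simp
      qed simp
      then show ?thesis
        using homogeneous_polynomial_scale[OF t u G p(1) wNG, of m 2 N z]
        by (simp add: cont_seminorm_scale[OF q] norm_power field_simps)
    qed
    \<comment> \<open>Cauchy's estimate in \<open>z\<close> on the circle of radius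
      \<open>3/2\<close> for the polynomial \<open>p\<^sub>m \<circ> w\<^sub>N\<close>; the result
      decays geometrically in both degrees.\<close>
    have step2: "q (c N m n) \<le> K * (1/2) ^ m * (2/3) ^ n" if N: "N1 \<le> N" and n: "n \<le> D" and D: "m * N \<le> D" for N m n D
    proof -
      have "q (c N m n) * (3/2) ^ n \<le> K / 2 ^ m"
      proof (rule cauchy_estimate_polynomial[OF u q _ n])
        fix z :: complex assume "cmod z = 3/2"
        then show "q (\<Sum>n\<le>D. u (z ^ n) (c N m n)) \<le> K / 2 ^ m"
          using step1[OF N, of z m] unfolding expand[OF D] by simp
      qed simp
      then show ?thesis by (simp add: field_simps power_divide)
    qed
    \<comment> \<open>The coefficients of degree at most \<open>N\<close> agree, so only the degrees
      above \<open>N\<close> remain. Summing \<open>(1/2)^m\<close> contributes 2 and summing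
      \<open>(2/3)^n\<close> contributes 3 to the constant 6.\<close>
    have step3: "q (f (wN N 1) - (\<Sum>n\<le>N. rr n)) \<le> 6 * K * (2/3) ^ Suc N" if N: "N1 \<le> N" for N
    proof -
      have N0N: "N0 \<le> N" using N N1 by simp
      have "(\<lambda>m. p m (wN N 1)) sums f (wN N 1)"
        by (rule f(1)[OF wNG]) (use q0wN[OF N0N, of 1] in simp)
      then have "(\<lambda>L. q ((\<Sum>m<L. p m (wN N 1)) - (\<Sum>n\<le>N. rr n))) \<longlonglongrightarrow> q (f (wN N 1) - (\<Sum>n\<le>N. rr n))"
        unfolding sums_def by (intro cont_seminorm_tendsto[OF q] tendsto_intros)
      moreover have "\<exists>L0. \<forall>L\<ge>L0. q ((\<Sum>m<L. p m (wN N 1)) - (\<Sum>n\<le>N. rr n)) \<le> 6 * K * (2/3) ^ Suc N"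
      proof (intro exI[of _ "Suc N"] allI impI)
        fix L assume L: "Suc N \<le> L"
        \<comment> \<open>Bounds \<open>m * N\<close> for all \<open>m < L\<close>, and is at least
          \<open>N\<close>, so that the range of degrees can be cut after \<open>N\<close>.\<close>
        define D where "D = L * N + N"
        have mD: "m * N \<le> D" if "m < L" for m
          using mult_right_mono[of m L N] that by (simp add: D_def trans_le_add1)
        have "(\<Sum>m<L. p m (wN N 1)) = (\<Sum>m<L. \<Sum>n\<le>D. c N m n)"
          by (intro sum.cong refl) (simp add: expand[OF mD])
        also have "\<dots> = (\<Sum>n\<le>D. \<Sum>m<L. c N m n)" by (rule sum.swap)
        also have "{..D} = {..N} \<union> {Suc N..<Suc D}" by (auto simp: D_def)
        also have "(\<Sum>n\<in>{..N} \<union> {Suc N..<Suc D}. \<Sum>m<L. c N m n) =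
            (\<Sum>n\<le>N. \<Sum>m<L. c N m n) + (\<Sum>n\<in>{Suc N..<Suc D}. \<Sum>m<L. c N m n)"
          by (intro sum.union_disjoint) auto
        also have "(\<Sum>n\<le>N. \<Sum>m<L. c N m n) = (\<Sum>n\<le>N. rr n)"
          using L by (intro sum.cong refl rr_eq[symmetric]) auto
        finally have "(\<Sum>m<L. p m (wN N 1)) - (\<Sum>n\<le>N. rr n) = (\<Sum>n\<in>{Suc N..<Suc D}. \<Sum>m<L. c N m n)" by simp
        also have "q \<dots> \<le> (\<Sum>n\<in>{Suc N..<Suc D}. q (\<Sum>m<L. c N m n))" by (rule H.seminorm_sum[OF q])
        also have "\<dots> \<le> (\<Sum>n\<in>{Suc N..<Suc D}. \<Sum>m<L. q (c N m n))" by (intro sum_mono H.seminorm_sum[OF q])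
        also have "\<dots> \<le> (\<Sum>n\<in>{Suc N..<Suc D}. \<Sum>m<L. K * (1/2) ^ m * (2/3) ^ n)"
          by (intro sum_mono step2[OF N, of _ D] mD) auto
        also have "\<dots> = (\<Sum>n\<in>{Suc N..<Suc D}. K * (2/3) ^ n * (\<Sum>m\<in>{0..<L}. (1/2) ^ m))"
          by (simp add: sum_distrib_left lessThan_atLeast0 mult_ac)
        also have "\<dots> \<le> (\<Sum>n\<in>{Suc N..<Suc D}. K * (2/3) ^ n * 2)"
          using geometric_tail_le[of "1/2" 0 L] K0 by (intro sum_mono mult_left_mono) auto
        also have "\<dots> = 2 * K * (\<Sum>n\<in>{Suc N..<Suc D}. (2/3) ^ n)"
          unfolding sum_distrib_left by (intro sum.cong refl) simp
        also have "\<dots> \<le> 2 * K * ((2/3) ^ Suc N / (1 - 2/3))"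
          using K0 by (intro mult_left_mono geometric_tail_le) auto
        finally show "q ((\<Sum>m<L. p m (wN N 1)) - (\<Sum>n\<le>N. rr n)) \<le> 6 * K * (2/3) ^ Suc N" by simp
      qed
      ultimately show ?thesis by (rule LIMSEQ_le_const2)
    qed
    have wlim: "(\<lambda>N. wN N 1) \<longlonglongrightarrow> w 1"
      using w(1)[of 1] unfolding sums_def wN_eq by (intro LIMSEQ_Suc) simp
    have flim: "(\<lambda>N. f (wN N 1)) \<longlonglongrightarrow> f (w 1)"
    proof (rule continuous_on_tendsto_compose[OF f(2) wlim])
      show "w 1 \<in> {v \<in> G. q0 v < 1}" using w(3)[of 1] w(4)[of 1] by simp
      show "eventually (\<lambda>N. wN N 1 \<in> {v \<in> G. q0 v < 1}) sequentially"
        using eventually_ge_at_top[of N0]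
      proof eventually_elim
        case (elim N)
        then show ?case using q0wN[of N 1] wNG by simp
      qed
    qed
    have "(\<lambda>N. 6 * K * (2/3) ^ Suc N + q (f (wN N 1) - f (w 1))) \<longlonglongrightarrow> 6 * K * 0 + 0"
      by (intro tendsto_add tendsto_mult tendsto_const LIMSEQ_Suc[of "\<lambda>n. (2/3)^n"] LIMSEQ_power_zero
          H.tendsto_seminormD[OF flim q]) auto
    then have up: "(\<lambda>N. 6 * K * (2/3) ^ Suc N + q (f (wN N 1) - f (w 1))) \<longlonglongrightarrow> 0" by simp
    show "(\<lambda>N. q ((\<Sum>n\<le>N. rr n) - f (w 1))) \<longlonglongrightarrow> 0"
    proof (rule tendsto_sandwich[OF _ _ tendsto_const up])
      show "eventually (\<lambda>N. 0 \<le> q ((\<Sum>n\<le>N. rr n) - f (w 1))) sequentially"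
        by (simp add: H.seminorm_nonneg[OF q])
      show "eventually (\<lambda>N. q ((\<Sum>n\<le>N. rr n) - f (w 1)) \<le> 6 * K * (2/3) ^ Suc N + q (f (wN N 1) - f (w 1))) sequentially"
        using eventually_ge_at_top[of N1]
      proof eventually_elim
        case (elim N)
        have "q ((\<Sum>n\<le>N. rr n) - f (w 1)) \<le> q ((\<Sum>n\<le>N. rr n) - f (wN N 1)) + q (f (wN N 1) - f (w 1))"
          by (rule H.seminorm_triangle3[OF q])
        also have "q ((\<Sum>n\<le>N. rr n) - f (wN N 1)) = q (f (wN N 1) - (\<Sum>n\<le>N. rr n))"
          by (rule H.seminorm_minus_commute[OF q])
        finally show ?case using step3[OF elim] by linarith
      qed
    qed
  qed
  then have "(\<lambda>n. rr n) sums f (w 1)" unfolding sums_def_le .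
  then show ?thesis by (simp only: rr_def c_def)
qed

section \<open>Power series expansions at a single point\<close>

definition expansion_at where
  "expansion_at s t F G f x p V \<longleftrightarrow> (\<forall>n. homogeneous_polynomial_on s t F G n (p n)) \<and>
     openin (top_of_set F) V \<and> 0 \<in> V \<and> (\<forall>v\<in>V. (\<lambda>n. p n v) sums f (x + v))"

lemma expansion_atD:
  assumes "expansion_at s t F G f x p V"
  shows "homogeneous_polynomial_on s t F G n (p n)" "openin (top_of_set F) V" "0 \<in> V"
    "v \<in> V \<Longrightarrow> (\<lambda>n. p n v) sums f (x + v)"
  using assms unfolding expansion_at_def by blast+

lemma power_series_on_iff:
  "power_series_on s t F G U f \<longleftrightarrow> f ` U \<subseteq> G \<and> continuous_on U f \<and>
    (\<forall>x\<in>U. \<exists>p V. expansion_at s t F G f x p V \<and> (\<forall>v\<in>V. x + v \<in> U))"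
proof -
  have "(\<forall>v\<in>V. x + v \<in> U \<and> (\<lambda>n. p n v) sums f (x + v)) \<longleftrightarrow>
      (\<forall>v\<in>V. (\<lambda>n. p n v) sums f (x + v)) \<and> (\<forall>v\<in>V. x + v \<in> U)" for V x p
    by blast
  then show ?thesis unfolding power_series_on_def expansion_at_def by (simp only: conj_assoc)
qed

lemma power_series_onD:
  assumes "power_series_on s t F G U f"
  shows "f ` U \<subseteq> G" "continuous_on U f"
    "x \<in> U \<Longrightarrow> \<exists>p V. expansion_at s t F G f x p V \<and> (\<forall>v\<in>V. x + v \<in> U)"
  using assms unfolding power_series_on_iff by blast+

lemma power_series_onI:
  assumes "f ` U \<subseteq> G" "continuous_on U f"
    "\<And>x. x \<in> U \<Longrightarrow> \<exists>p V. expansion_at s t F G f x p V \<and> (\<forall>v\<in>V. x + v \<in> U)"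
  shows "power_series_on s t F G U f"
  unfolding power_series_on_iff using assms by blast

lemma expansion_at_subset:
  "expansion_at s t F G f x p V \<Longrightarrow> openin (top_of_set F) V' \<Longrightarrow> 0 \<in> V' \<Longrightarrow> V' \<subseteq> V \<Longrightarrow>
    expansion_at s t F G f x p V'"
  unfolding expansion_at_def by blast

lemma expansion_at_cong:
  "expansion_at s t F G f x p V \<Longrightarrow> (\<And>v. v \<in> V \<Longrightarrow> f (x + v) = g (x + v)) \<Longrightarrow> expansion_at s t F G g x p V"
  unfolding expansion_at_def by simp

context
  fixes s :: "'k::real_or_complex \<Rightarrow> 'e::{topological_ab_group_add, t2_space} \<Rightarrow> 'e"
    and t :: "'k \<Rightarrow> 'f::{topological_ab_group_add, t2_space} \<Rightarrow> 'f"
    and F :: "'e set" and G :: "'f set"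
  assumes s: "locally_convex_space s" and t: "locally_convex_space t"
    and F: "module.subspace s F" and G: "module.subspace t G"
begin

interpretation E: locally_convex_space s by (rule s)
interpretation T: locally_convex_space t by (rule t)

lemma openin_translate:
  assumes "openin (top_of_set F) U" "x \<in> F"
  shows "openin (top_of_set F) {v \<in> F. x + v \<in> U}"
proof -
  obtain W where W: "open W" "U = F \<inter> W" using assms(1) by (auto simp: openin_open)
  have "open ((\<lambda>v. x + v) -` W)" using W(1) by (intro open_vimage continuous_intros)
  moreover have "{v \<in> F. x + v \<in> U} = F \<inter> ((\<lambda>v. x + v) -` W)"
    using W(2) assms(2) E.subspace_add[OF F] by auto
  ultimately show ?thesis by (auto simp: openin_open)
qed

text \<open>On a line through \<open>x\<close>, homogeneity turns the expansion into a power series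
  in one scalar variable, to which the one-variable results apply.\<close>

lemma expansion_at_line:
  assumes e: "expansion_at s t F G f x p V" and v: "v \<in> F"
  obtains \<rho> where "0 < \<rho>" "\<And>z. norm z \<le> \<rho> \<Longrightarrow> s z v \<in> V"
    "\<And>z. norm z \<le> \<rho> \<Longrightarrow> (\<lambda>n. t (z ^ n) (p n v)) sums f (x + s z v)"
proof -
  obtain q where q: "cont_seminorm s q" "{y \<in> F. q (y - 0) < 1} \<subseteq> V"
    by (rule E.seminorm_rel_nhd[OF expansion_atD(2,3)[OF e]]) blast
  \<comment> \<open>The summand 1 guards against \<open>q v = 0\<close> and makes
    \<open>\<rho> * q v\<close> strictly less than 1.\<close>
  define \<rho> where "\<rho> = 1 / (q v + 1)"
  have qv: "0 \<le> q v" by (rule E.seminorm_nonneg[OF q(1)])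
  have \<rho>: "0 < \<rho>" "\<rho> * q v < 1" using qv by (simp_all add: \<rho>_def field_simps)
  have zV: "s z v \<in> V" if "norm z \<le> \<rho>" for z
  proof -
    have "q (s z v) = norm z * q v" by (rule cont_seminorm_scale[OF q(1)])
    also have "\<dots> \<le> \<rho> * q v" using that qv by (rule mult_right_mono)
    finally have "q (s z v - 0) < 1" using \<rho>(2) by simp
    then show ?thesis using q(2) E.subspace_scale[OF F v] by blast
  qed
  have "(\<lambda>n. t (z ^ n) (p n v)) sums f (x + s z v)" if "norm z \<le> \<rho>" for z
    using expansion_atD(4)[OF e zV[OF that]]
    by (simp only: homogeneous_polynomial_scale[OF s t F expansion_atD(1)[OF e] v])
  then show ?thesis using that \<rho>(1) zV by blast
qed

lemma expansion_at_0:
  assumes e: "expansion_at s t F G f x p V" and v: "v \<in> F"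
  shows "p 0 v = f x"
proof -
  obtain \<rho> where \<rho>: "0 < \<rho>" "\<And>z. norm z \<le> \<rho> \<Longrightarrow> (\<lambda>n. t (z ^ n) (p n v)) sums f (x + s z v)"
    by (rule expansion_at_line[OF e v]) blast
  have "(\<lambda>n. t (0 ^ n) (p n v)) sums f x" using \<rho>(2)[of 0] \<rho>(1) by simp
  moreover have "(\<lambda>n. t (0 ^ n) (p n v)) = (\<lambda>n. if n = 0 then p 0 v else 0)" by (auto simp: fun_eq_iff)
  moreover have "(\<lambda>n. if n = 0 then p 0 v else 0) sums p 0 v" by (rule sums_single)
  ultimately show ?thesis using sums_unique2 by metis
qed

text \<open>The coefficient limit of order 1 is precisely the limit of the difference quotient, once
  the constant term is identified with \<open>f x\<close>.\<close>

lemma expansion_at_deriv: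
  assumes e: "expansion_at s t F G f x p V" and v: "v \<in> F"
  shows "(diff_quot s t f x v \<longlongrightarrow> p 1 v) (at 0)"
proof -
  obtain \<rho> where \<rho>: "0 < \<rho>" "\<And>z. norm z \<le> \<rho> \<Longrightarrow> (\<lambda>n. t (z ^ n) (p n v)) sums f (x + s z v)"
    by (rule expansion_at_line[OF e v]) blast
  have "((\<lambda>z. t (inverse (z ^ 1)) (f (x + s z v) - (\<Sum>i<1. t (z ^ i) (p i v)))) \<longlongrightarrow> p 1 v) (at 0)"
    by (rule T.power_series_coeff_tendsto[OF order_refl \<rho>])
  then show ?thesis by (simp add: diff_quot_def[abs_def] expansion_at_0[OF e v])
qed

lemma expansion_at_coeff_closed:
  assumes e: "expansion_at s t F G f x p V" and v: "v \<in> F" and G': "module.subspace t G'" "closed G'"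
    and Fl: "Fl \<noteq> bot" "Fl \<le> at 0" and ev: "eventually (\<lambda>z. f (x + s z v) \<in> G') Fl"
  shows "p n v \<in> G'"
proof -
  obtain \<rho> where \<rho>: "0 < \<rho>" "\<And>z. norm z \<le> \<rho> \<Longrightarrow> (\<lambda>n. t (z ^ n) (p n v)) sums f (x + s z v)"
    by (rule expansion_at_line[OF e v]) blast
  show ?thesis by (rule T.power_series_coeff_closed[OF G' Fl \<rho> ev])
qed

text \<open>
  Polarization: the multilinear map that belongs to a polynomial can be replaced by a combination of
  values of the polynomial.
\<close>

lemma homogeneous_polynomial_restrict:
  assumes p: "homogeneous_polynomial_on s t F G n p"
    and F': "module.subspace s F'" "F' \<subseteq> F" and G': "module.subspace t G'" and im: "p ` F' \<subseteq> G'"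
  shows "homogeneous_polynomial_on s t F' G' n p"
proof -
  obtain \<beta> where \<beta>: "multilinear_on s t F G n \<beta>" "continuous_on ({..<n} \<rightarrow>\<^sub>E F) \<beta>"
    "\<And>v. v \<in> F \<Longrightarrow> p v = \<beta> (\<lambda>i\<in>{..<n}. v)"
    by (rule homogeneous_polynomial_onE[OF p]) blast
  \<comment> \<open>All ways of filling the \<open>n\<close> slots with the given vectors; the
    surjective ones, collected in \<open>Q\<close>, are the permutations.\<close>
  define P where "P = ({..<n} \<rightarrow>\<^sub>E {..<n})"
  define Q where "Q = {\<phi> \<in> P. \<phi> ` {..<n} = {..<n}}"
  have finP: "finite P" unfolding P_def by (intro finite_PiE) auto
  have finQ: "finite Q" unfolding Q_def using finP by simp
  have "(\<lambda>i\<in>{..<n}. i) \<in> Q" by (auto simp: Q_def P_def)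
  then have "card Q \<noteq> 0" using finQ by auto
  then have Q0: "(of_nat (card Q) :: 'k) \<noteq> 0" by simp
  \<comment> \<open>The unnormalized symmetrization of \<open>\<beta>\<close>. The form
    \<open>\<beta>\<close> itself may well leave \<open>G'\<close> on vectors of \<open>F'\<close>;
    the symmetrization cannot, since it is determined by the values of \<open>p\<close>.\<close>
  define B where "B y = (\<Sum>\<phi>\<in>Q. \<beta> (\<lambda>i\<in>{..<n}. y (\<phi> i)))" for y
  have \<phi>n: "\<phi> i < n" if "\<phi> \<in> P" "i < n" for \<phi> i using PiE_mem[of \<phi> "{..<n}" "\<lambda>_. {..<n}" i] that by (simp add: P_def)
  have mem: "(\<lambda>i\<in>{..<n}. y (\<phi> i)) \<in> {..<n} \<rightarrow>\<^sub>E F" if "\<phi> \<in> P" "y \<in> {..<n} \<rightarrow>\<^sub>E F" for \<phi> y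
    by (rule restrict_PiE_lessThan) (use PiE_mem[OF that(2)] \<phi>n[OF that(1)] in simp)
  \<comment> \<open>Inclusion and exclusion over the sets \<open>S\<close> of vectors:
    \<open>p\<close> of a partial sum counts the fillings that use vectors from \<open>S\<close>
    only, and the alternating sum isolates those that use all of them.\<close>
  have polar: "B y = (\<Sum>S\<in>Pow {..<n}. t (\<Prod>j\<in>{..<n} - S. - 1) (p (\<Sum>j\<in>S. y j)))" if y: "\<And>j. j < n \<Longrightarrow> y j \<in> F" for y
  proof -
    define b where "b \<phi> = \<beta> (\<lambda>i\<in>{..<n}. y (\<phi> i))" for \<phi>
    \<comment> \<open>With this factor the product over the complement of \<open>S\<close> is the
      sign if the image of \<open>\<phi>\<close> lies in \<open>S\<close> and 0 otherwise, so sign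
      and condition become one product.\<close>
    define g where "g \<phi> j = (if j \<in> \<phi> ` {..<n} then 0 else - 1 :: 'k)" for \<phi> :: "nat \<Rightarrow> nat" and j
    have pS: "p (\<Sum>j\<in>S. y j) = (\<Sum>\<phi>\<in>P. if \<phi> ` {..<n} \<subseteq> S then b \<phi> else 0)" if S: "S \<in> Pow {..<n}" for S
    proof -
      have fS: "finite S" using S finite_subset by auto
      have yS: "y j \<in> F" if "j \<in> S" for j using y S that by auto
      then have "p (\<Sum>j\<in>S. y j) = \<beta> (\<lambda>i\<in>{..<n}. \<Sum>j\<in>S. y j)"
        by (intro \<beta>(3) E.subspace_sum[OF F])
      also have "\<dots> = (\<Sum>\<phi>\<in>{..<n} \<rightarrow>\<^sub>E S. b \<phi>)"
        unfolding b_def by (rule multilinear_expand[OF s t F \<beta>(1) fS]) (rule yS)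
      also have "{..<n} \<rightarrow>\<^sub>E S = {\<phi> \<in> P. \<phi> ` {..<n} \<subseteq> S}"
        using S by (auto simp: P_def PiE_iff extensional_def)
      also have "(\<Sum>\<phi>\<in>{\<phi> \<in> P. \<phi> ` {..<n} \<subseteq> S}. b \<phi>) = (\<Sum>\<phi>\<in>P. if \<phi> ` {..<n} \<subseteq> S then b \<phi> else 0)"
        by (rule sum.inter_filter[OF finP])
      finally show ?thesis .
    qed
    have sign: "(if \<phi> ` {..<n} \<subseteq> S then \<Prod>j\<in>{..<n} - S. - 1 else 0) = (\<Prod>j\<in>{..<n} - S. g \<phi> j)"
      if "\<phi> \<in> P" for \<phi> S
    proof (cases "\<phi> ` {..<n} \<subseteq> S")
      case True
      then have "(\<Prod>j\<in>{..<n} - S. - 1) = (\<Prod>j\<in>{..<n} - S. g \<phi> j)"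
        by (intro prod.cong refl) (auto simp: g_def)
      then show ?thesis using True by (simp only: if_True)
    next
      case False
      then obtain i where "i < n" "\<phi> i \<notin> S" by auto
      then have "(\<Prod>j\<in>{..<n} - S. g \<phi> j) = 0"
        using \<phi>n[OF that] by (intro prod_zero) (auto simp: g_def)
      then show ?thesis using False by simp
    qed
    have "(\<Sum>S\<in>Pow {..<n}. t (\<Prod>j\<in>{..<n} - S. - 1) (p (\<Sum>j\<in>S. y j)))
        = (\<Sum>S\<in>Pow {..<n}. \<Sum>\<phi>\<in>P. t (\<Prod>j\<in>{..<n} - S. g \<phi> j) (b \<phi>))"
    proof (rule sum.cong[OF refl])
      fix S assume S: "S \<in> Pow {..<n}"
      show "t (\<Prod>j\<in>{..<n} - S. - 1) (p (\<Sum>j\<in>S. y j)) = (\<Sum>\<phi>\<in>P. t (\<Prod>j\<in>{..<n} - S. g \<phi> j) (b \<phi>))"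
        unfolding pS[OF S] T.scale_sum_right
      proof (rule sum.cong[OF refl])
        fix \<phi> assume "\<phi> \<in> P"
        from sign[OF this, of S] show "t (\<Prod>j\<in>{..<n} - S. - 1) (if \<phi> ` {..<n} \<subseteq> S then b \<phi> else 0) =
            t (\<Prod>j\<in>{..<n} - S. g \<phi> j) (b \<phi>)"
          by (cases "\<phi> ` {..<n} \<subseteq> S") (simp_all add: eq_commute[of 0])
      qed
    qed
    also have "\<dots> = (\<Sum>\<phi>\<in>P. t (\<Sum>S\<in>Pow {..<n}. \<Prod>j\<in>{..<n} - S. g \<phi> j) (b \<phi>))"
      by (subst sum.swap) (simp add: T.scale_sum_left)
    also have "\<dots> = (\<Sum>\<phi>\<in>P. if \<phi> ` {..<n} = {..<n} then b \<phi> else 0)"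
    proof (rule sum.cong[OF refl])
      fix \<phi> assume \<phi>: "\<phi> \<in> P"
      \<comment> \<open>Expansion of a product of binomials; a factor vanishes for each index that
        \<open>\<phi>\<close> misses.\<close>
      have "(\<Sum>S\<in>Pow {..<n}. \<Prod>j\<in>{..<n} - S. g \<phi> j) = (\<Prod>j<n. 1 + g \<phi> j)"
        using prod_add[of "{..<n}" "\<lambda>_. 1" "g \<phi>"] by simp
      also have "\<dots> = (if \<phi> ` {..<n} = {..<n} then 1 else 0)"
      proof (cases "\<phi> ` {..<n} = {..<n}")
        case True
        then show ?thesis by (simp add: g_def)
      next
        case False
        then obtain j where "j < n" "j \<notin> \<phi> ` {..<n}" using \<phi>n[OF \<phi>] by auto
        then have "(\<Prod>j<n. 1 + g \<phi> j) = 0" by (intro prod_zero) (auto simp: g_def)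
        then show ?thesis using False by simp
      qed
      finally show "t (\<Sum>S\<in>Pow {..<n}. \<Prod>j\<in>{..<n} - S. g \<phi> j) (b \<phi>) = (if \<phi> ` {..<n} = {..<n} then b \<phi> else 0)"
        by simp
    qed
    also have "\<dots> = B y" unfolding B_def Q_def b_def by (rule sum.inter_filter[OF finP, symmetric])
    finally show ?thesis ..
  qed
  have F'F: "y \<in> {..<n} \<rightarrow>\<^sub>E F" if "y \<in> {..<n} \<rightarrow>\<^sub>E F'" for y
    using that PiE_mono[of "{..<n}" "\<lambda>_. F'" "\<lambda>_. F"] F'(2) by blast
  have Bmem: "B y \<in> G'" if "y \<in> {..<n} \<rightarrow>\<^sub>E F'" for y
  proof -
    have yF': "y j \<in> F'" if "j < n" for j using PiE_mem[OF \<open>y \<in> {..<n} \<rightarrow>\<^sub>E F'\<close>, of j] that by simp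
    have "B y = (\<Sum>S\<in>Pow {..<n}. t (\<Prod>j\<in>{..<n} - S. - 1) (p (\<Sum>j\<in>S. y j)))"
      by (rule polar) (use yF' F'(2) in blast)
    also have "\<dots> \<in> G'"
    proof (intro T.subspace_sum[OF G'] T.subspace_scale[OF G'])
      fix S assume "S \<in> Pow {..<n}"
      then have "(\<Sum>j\<in>S. y j) \<in> F'" using yF' by (intro E.subspace_sum[OF F'(1)]) auto
      then show "p (\<Sum>j\<in>S. y j) \<in> G'" using im by blast
    qed
    finally show ?thesis .
  qed
  \<comment> \<open>A permutation places the vector with index \<open>a\<close> into exactly one
    slot \<open>k\<close>, so changing that vector is an update of one slot, whatever the new value
    is.\<close>
  have upd: "\<exists>k<n. (\<lambda>i\<in>{..<n}. (y(a := u)) (\<phi> i)) = (\<lambda>i\<in>{..<n}. y (\<phi> i))(k := u) \<and> (\<forall>u. (\<lambda>i\<in>{..<n}. (y(a := u)) (\<phi> i)) = (\<lambda>i\<in>{..<n}. y (\<phi> i))(k := u))"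
    if "\<phi> \<in> Q" "a < n" for \<phi> a u and y :: "nat \<Rightarrow> 'e"
  proof -
    have im: "\<phi> ` {..<n} = {..<n}" using that(1) by (simp add: Q_def)
    then have inj: "inj_on \<phi> {..<n}" by (intro eq_card_imp_inj_on) simp_all
    have "a \<in> \<phi> ` {..<n}" using im that(2) by simp
    then obtain k where k: "k < n" "\<phi> k = a" by auto
    have "(\<phi> i = a) = (i = k)" if "i < n" for i using inj_onD[OF inj, of i k] that k by auto
    then have "(\<lambda>i\<in>{..<n}. (y(a := u)) (\<phi> i)) = (\<lambda>i\<in>{..<n}. y (\<phi> i))(k := u)" for u
      using k(1) by (auto simp: fun_eq_iff)
    then show ?thesis using k(1) by blast
  qed
  \<comment> \<open>On the diagonal each permutation contributes \<open>p v\<close>; dividing by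
    their number gives back \<open>p v\<close>. This uses characteristic 0.\<close>
  let ?c = "inverse (of_nat (card Q)) :: 'k"
  have "multilinear_on s t F' G' n (\<lambda>y. t ?c (B y))"
    unfolding multilinear_on_def
  proof (intro conjI allI impI ballI image_subsetI)
    show "t ?c (B y) \<in> G'" if "y \<in> {..<n} \<rightarrow>\<^sub>E F'" for y by (rule T.subspace_scale[OF G' Bmem[OF that]])
    fix a y assume a: "a < n" and y: "y \<in> {..<n} \<rightarrow>\<^sub>E F'"
    show "t ?c (B (y(a := u + v))) = t ?c (B (y(a := u))) + t ?c (B (y(a := v)))" if uv: "u \<in> F'" "v \<in> F'" for u v
      unfolding T.scale_right_distrib[symmetric] B_def sum.distrib[symmetric]
    proof (intro arg_cong[where f = "t ?c"] sum.cong refl)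
      fix \<phi> assume \<phi>: "\<phi> \<in> Q"
      obtain k where k: "k < n" "\<And>u. (\<lambda>i\<in>{..<n}. (y(a := u)) (\<phi> i)) = (\<lambda>i\<in>{..<n}. y (\<phi> i))(k := u)"
        using upd[OF \<phi> a, of y u] by blast
      have \<phi>P: "\<phi> \<in> P" using \<phi> by (simp add: Q_def)
      show "\<beta> (\<lambda>i\<in>{..<n}. (y(a := u + v)) (\<phi> i)) = \<beta> (\<lambda>i\<in>{..<n}. (y(a := u)) (\<phi> i)) + \<beta> (\<lambda>i\<in>{..<n}. (y(a := v)) (\<phi> i))"
        unfolding k(2) by (rule multilinear_on_add[OF \<beta>(1) mem[OF \<phi>P F'F[OF y]] k(1)]) (use uv F'(2) in blast)+
    qed
    show "t ?c (B (y(a := s d u))) = t d (t ?c (B (y(a := u))))" if u: "u \<in> F'" for d u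
      unfolding T.scale_left_commute[of d] B_def T.scale_sum_right[of d]
    proof (intro arg_cong[where f = "t ?c"] sum.cong refl)
      fix \<phi> assume \<phi>: "\<phi> \<in> Q"
      obtain k where k: "k < n" "\<And>u. (\<lambda>i\<in>{..<n}. (y(a := u)) (\<phi> i)) = (\<lambda>i\<in>{..<n}. y (\<phi> i))(k := u)"
        using upd[OF \<phi> a, of y u] by blast
      have \<phi>P: "\<phi> \<in> P" using \<phi> by (simp add: Q_def)
      show "\<beta> (\<lambda>i\<in>{..<n}. (y(a := s d u)) (\<phi> i)) = t d (\<beta> (\<lambda>i\<in>{..<n}. (y(a := u)) (\<phi> i)))"
        unfolding k(2) by (rule multilinear_on_scale[OF \<beta>(1) mem[OF \<phi>P F'F[OF y]] k(1)]) (use u F'(2) in blast)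
    qed
  qed
  moreover have "continuous_on ({..<n} \<rightarrow>\<^sub>E F') (\<lambda>y. t ?c (B y))"
    unfolding B_def
  proof (intro T.continuous_on_scale continuous_on_const continuous_on_sum)
    fix \<phi> assume "\<phi> \<in> Q"
    then have \<phi>P: "\<phi> \<in> P" by (simp add: Q_def)
    show "continuous_on ({..<n} \<rightarrow>\<^sub>E F') (\<lambda>y. \<beta> (\<lambda>i\<in>{..<n}. y (\<phi> i)))"
    proof (rule continuous_on_compose2[OF \<beta>(2)])
      show "continuous_on ({..<n} \<rightarrow>\<^sub>E F') (\<lambda>y. \<lambda>i\<in>{..<n}. y (\<phi> i))"
      proof (rule continuous_on_coordinatewise_then_product)
        show "continuous_on ({..<n} \<rightarrow>\<^sub>E F') (\<lambda>y. (\<lambda>i\<in>{..<n}. y (\<phi> i)) i)" for i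
          unfolding restrict_def
          by (rule continuous_on_if_const)
            (rule continuous_on_subset[OF continuous_on_product_coordinates], simp_all)
      qed
      show "(\<lambda>y. \<lambda>i\<in>{..<n}. y (\<phi> i)) ` ({..<n} \<rightarrow>\<^sub>E F') \<subseteq> {..<n} \<rightarrow>\<^sub>E F"
        by (rule image_subsetI) (rule mem[OF \<phi>P F'F])
    qed
  qed
  moreover have "\<forall>v\<in>F'. p v = t ?c (B (\<lambda>i\<in>{..<n}. v))"
  proof
    fix v assume "v \<in> F'"
    then have v: "v \<in> F" using F'(2) by blast
    have "B (\<lambda>i\<in>{..<n}. v) = (\<Sum>\<phi>\<in>Q. p v)"
      unfolding B_def \<beta>(3)[OF v]
    proof (intro sum.cong refl arg_cong[where f = \<beta>] restrict_ext)
      fix \<phi> i assume "\<phi> \<in> Q" "i \<in> {..<n}"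
      then show "(\<lambda>i\<in>{..<n}. v) (\<phi> i) = v" using \<phi>n[of \<phi> i] by (simp add: Q_def)
    qed
    also have "\<dots> = t (of_nat (card Q)) (p v)"
      using T.scale_sum_left[of "\<lambda>_. 1" Q "p v"] by simp
    finally show "p v = t ?c (B (\<lambda>i\<in>{..<n}. v))" using Q0 by simp
  qed
  ultimately show ?thesis unfolding homogeneous_polynomial_on_def by blast
qed

text \<open>Along lines in \<open>F'\<close> the values lie in the closed subspace
  \<open>G'\<close>, hence so do the coefficients. Polarization then provides multilinear forms with
  values in \<open>G'\<close> as well.\<close>

lemma power_series_on_restrict_subspace:
  assumes U: "openin (top_of_set F) U" and f: "power_series_on s t F G U f"
    and F': "module.subspace s F'" "F' \<subseteq> F" and G': "module.subspace t G'" "closed G'"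
    and im: "f ` (U \<inter> F') \<subseteq> G'"
  shows "power_series_on s t F' G' (U \<inter> F') f"
proof (rule power_series_onI)
  have U': "openin (top_of_set F') (U \<inter> F')" using U F'(2) by (auto simp: openin_open)
  show "f ` (U \<inter> F') \<subseteq> G'" by (rule im)
  show "continuous_on (U \<inter> F') f" by (rule continuous_on_subset[OF power_series_onD(2)[OF f]]) blast
  fix x assume x: "x \<in> U \<inter> F'"
  then obtain p V where e: "expansion_at s t F G f x p V" and V: "\<forall>v\<in>V. x + v \<in> U"
    using power_series_onD(3)[OF f, of x] by blast
  have "p n v \<in> G'" if v: "v \<in> F'" for n v
  proof (rule expansion_at_coeff_closed[OF e _ G' at_neq_bot order_refl])
    have "eventually (\<lambda>z. x + s z v \<in> U \<inter> F') (at 0)" by (rule eventually_in_open_line[OF s F'(1) U' x v])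
    then show "eventually (\<lambda>z. f (x + s z v) \<in> G') (at 0)" by (rule eventually_mono) (use im in blast)
  qed (use v F' in blast)
  then have "expansion_at s t F' G' f x p (V \<inter> F')"
    unfolding expansion_at_def
  proof (intro conjI allI ballI)
    show "homogeneous_polynomial_on s t F' G' n (p n)" for n
      by (rule homogeneous_polynomial_restrict[OF expansion_atD(1)[OF e] F' G'(1)]) (use \<open>\<And>v n. v \<in> F' \<Longrightarrow> p n v \<in> G'\<close> in blast)
    show "openin (top_of_set F') (V \<inter> F')" using expansion_atD(2)[OF e] F'(2) by (auto simp: openin_open)
    show "0 \<in> V \<inter> F'" using expansion_atD(3)[OF e] E.subspace_0[OF F'(1)] by blast
    show "(\<lambda>n. p n v) sums f (x + v)" if "v \<in> V \<inter> F'" for v using expansion_atD(4)[OF e] that by blast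
  qed
  moreover have "\<forall>v\<in>V \<inter> F'. x + v \<in> U \<inter> F'" using V x E.subspace_add[OF F'(1)] by blast
  ultimately show "\<exists>p V. expansion_at s t F' G' f x p V \<and> (\<forall>v\<in>V. x + v \<in> U \<inter> F')" by blast
qed

lemma power_series_on_subset:
  assumes U: "openin (top_of_set F) U'" "U' \<subseteq> U" and f: "power_series_on s t F G U f"
  shows "power_series_on s t F G U' f"
proof (rule power_series_onI)
  show "f ` U' \<subseteq> G" using power_series_onD(1)[OF f] U(2) by blast
  show "continuous_on U' f" by (rule continuous_on_subset[OF power_series_onD(2)[OF f] U(2)])
  fix x assume x: "x \<in> U'"
  then obtain p V where e: "expansion_at s t F G f x p V"
    using power_series_onD(3)[OF f, of x] U(2) by blast
  have xF: "x \<in> F" using U(1) x openin_imp_subset by blast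
  have "expansion_at s t F G f x p (V \<inter> {v \<in> F. x + v \<in> U'})"
    by (rule expansion_at_subset[OF e openin_Int[OF expansion_atD(2)[OF e] openin_translate[OF U(1) xF]]])
      (use x expansion_atD(3)[OF e] E.subspace_0[OF F] in auto)
  then show "\<exists>p V. expansion_at s t F G f x p V \<and> (\<forall>v\<in>V. x + v \<in> U')" by blast
qed

lemma power_series_on_locally:
  assumes loc: "\<And>x. x \<in> U \<Longrightarrow> \<exists>U'. openin (top_of_set F) U' \<and> x \<in> U' \<and> U' \<subseteq> U \<and> power_series_on s t F G U' f"
    and UF: "U \<subseteq> F"
  shows "power_series_on s t F G U f"
proof (rule power_series_onI)
  show "f ` U \<subseteq> G" using loc power_series_onD(1) by blast
  show "continuous_on U f"
  proof (rule continuous_on_locally)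
    fix x assume "x \<in> U"
    then obtain U' where U': "openin (top_of_set F) U'" "x \<in> U'" "U' \<subseteq> U" "power_series_on s t F G U' f" using loc by blast
    obtain W where W: "open W" "U' = F \<inter> W" using U'(1) by (auto simp: openin_open)
    have "continuous_on (U \<inter> W) f"
      by (rule continuous_on_subset[OF power_series_onD(2)[OF U'(4)]]) (use W UF in blast)
    then show "\<exists>T. open T \<and> x \<in> T \<and> continuous_on (U \<inter> T) f" using W U'(2) by blast
  qed
  fix x assume "x \<in> U"
  then obtain U' where U': "x \<in> U'" "U' \<subseteq> U" "power_series_on s t F G U' f" using loc by blast
  then show "\<exists>p V. expansion_at s t F G f x p V \<and> (\<forall>v\<in>V. x + v \<in> U)"
    using power_series_onD(3)[OF U'(3,1)] by blast
qed

lemma power_series_on_cong: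
  assumes f: "power_series_on s t F G U f" and eq: "\<And>x. x \<in> U \<Longrightarrow> f x = g x"
  shows "power_series_on s t F G U g"
proof (rule power_series_onI)
  show "g ` U \<subseteq> G" using power_series_onD(1)[OF f] eq by auto
  show "continuous_on U g" using power_series_onD(2)[OF f] eq by (simp cong: continuous_on_cong)
  fix x assume "x \<in> U"
  then obtain p V where e: "expansion_at s t F G f x p V" and V: "\<forall>v\<in>V. x + v \<in> U"
    using power_series_onD(3)[OF f, of x] by blast
  have "expansion_at s t F G g x p V" by (rule expansion_at_cong[OF e]) (use V eq in blast)
  then show "\<exists>p V. expansion_at s t F G g x p V \<and> (\<forall>v\<in>V. x + v \<in> U)" using V by blast
qed

lemma power_series_on_add:
  assumes f: "power_series_on s t F G U f" and g: "power_series_on s t F G U g"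
  shows "power_series_on s t F G U (\<lambda>x. f x + g x)"
proof (rule power_series_onI)
  show "(\<lambda>x. f x + g x) ` U \<subseteq> G"
    using power_series_onD(1)[OF f] power_series_onD(1)[OF g] T.subspace_add[OF G] by blast
  show "continuous_on U (\<lambda>x. f x + g x)"
    by (intro continuous_on_add power_series_onD(2)[OF f] power_series_onD(2)[OF g])
  fix x assume "x \<in> U"
  then obtain p V p' V' where e: "expansion_at s t F G f x p V" "\<forall>v\<in>V. x + v \<in> U"
    and e': "expansion_at s t F G g x p' V'"
    using power_series_onD(3)[OF f, of x] power_series_onD(3)[OF g, of x] by blast
  have "expansion_at s t F G (\<lambda>x. f x + g x) x (\<lambda>n v. p n v + p' n v) (V \<inter> V')"
    unfolding expansion_at_def
  proof (intro conjI allI ballI)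
    have "homogeneous_polynomial_on s t F G n (\<lambda>v. \<Sum>i\<in>{True, False}. if i then p n v else p' n v)" for n
    proof (rule homogeneous_polynomial_sum[OF t G])
      show "homogeneous_polynomial_on s t F G n (\<lambda>v. if i then p n v else p' n v)" for i
        by (cases i) (simp_all add: expansion_atD(1)[OF e(1)] expansion_atD(1)[OF e'])
    qed
    then show "homogeneous_polynomial_on s t F G n (\<lambda>v. p n v + p' n v)" for n by simp
    show "openin (top_of_set F) (V \<inter> V')" by (intro openin_Int expansion_atD(2)[OF e(1)] expansion_atD(2)[OF e'])
    show "0 \<in> V \<inter> V'" using expansion_atD(3)[OF e(1)] expansion_atD(3)[OF e'] by blast
    show "(\<lambda>n. p n v + p' n v) sums (f (x + v) + g (x + v))" if "v \<in> V \<inter> V'" for v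
      using that by (intro sums_add expansion_atD(4)[OF e(1)] expansion_atD(4)[OF e']) auto
  qed
  then show "\<exists>p V. expansion_at s t F G (\<lambda>x. f x + g x) x p V \<and> (\<forall>v\<in>V. x + v \<in> U)" using e(2) by blast
qed

lemma power_series_on_linear:
  assumes L: "continuous_linear_on s t F G L" and U: "openin (top_of_set F) U"
  shows "power_series_on s t F G U L"
proof (rule power_series_onI)
  have UF: "U \<subseteq> F" using U openin_imp_subset by blast
  have Lm: "L v \<in> G" if "v \<in> F" for v using L that by (auto simp: continuous_linear_on_def)
  have Lc: "continuous_on F L" using L by (simp add: continuous_linear_on_def)
  show "L ` U \<subseteq> G" using Lm UF by blast
  show "continuous_on U L" using Lc UF by (rule continuous_on_subset)
  fix x assume x: "x \<in> U"
  define p where "p n v = (if n = 0 then L x else if n = 1 then L v else 0)" for n :: nat and v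
  have "homogeneous_polynomial_on s t F G n (p n)" for n
  proof -
    consider "n = 0" | "n = 1" | "n \<noteq> 0" "n \<noteq> 1" by blast
    then show ?thesis
    proof cases
      case 1
      then show ?thesis unfolding homogeneous_polynomial_on_def multilinear_on_def
        using Lm x UF by (intro exI[of _ "\<lambda>_. L x"]) (auto simp: p_def)
    next
      case 2
      have "continuous_on ({..<1::nat} \<rightarrow>\<^sub>E F) (\<lambda>y. L (y 0))"
      proof (rule continuous_on_compose2[OF Lc])
        show "continuous_on ({..<1::nat} \<rightarrow>\<^sub>E F) (\<lambda>y. y (0::nat))"
          by (rule continuous_on_subset[OF continuous_on_product_coordinates]) simp
        show "(\<lambda>y. y (0::nat)) ` ({..<1} \<rightarrow>\<^sub>E F) \<subseteq> F" by (auto simp: PiE_iff)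
      qed
      moreover have "multilinear_on s t F G 1 (\<lambda>y. L (y 0))"
        using L Lm by (auto simp: multilinear_on_def continuous_linear_on_def PiE_iff)
      ultimately show ?thesis unfolding homogeneous_polynomial_on_def
        using 2 by (intro exI[of _ "\<lambda>y. L (y 0)"]) (simp add: p_def)
    next
      case 3
      then show ?thesis unfolding homogeneous_polynomial_on_def multilinear_on_def
        using T.subspace_0[OF G] by (intro exI[of _ "\<lambda>_. 0"]) (auto simp: p_def)
    qed
  qed
  moreover have "(\<lambda>n. p n v) sums L (x + v)" if "v \<in> F" for v
  proof -
    have "(\<lambda>n. p n v) sums (\<Sum>n\<in>{0, 1}. p n v)" by (rule sums_finite) (auto simp: p_def)
    moreover have "L (x + v) = L x + L v" using L x UF that by (auto simp: continuous_linear_on_def)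
    ultimately show ?thesis by (simp add: p_def)
  qed
  ultimately have "expansion_at s t F G L x p {v \<in> F. x + v \<in> U}"
    unfolding expansion_at_def using openin_translate[OF U, of x] x UF E.subspace_0[OF F] by auto
  then show "\<exists>p V. expansion_at s t F G L x p V \<and> (\<forall>v\<in>V. x + v \<in> U)" by blast
qed

end

lemma compositions_one: "compositions 1 1 1 = {\<lambda>j\<in>{..<1}. 1}"
proof -
  have "i = (\<lambda>j\<in>{..<1}. 1)" if "i \<in> {..<1} \<rightarrow>\<^sub>E {1..1}" for i :: "nat \<Rightarrow> nat"
    using that by (intro PiE_ext[OF that, of "\<lambda>j\<in>{..<1}. 1"]) auto
  then show ?thesis unfolding compositions_def by auto
qed

lemma sums_subtract_first:
  fixes a :: "nat \<Rightarrow> 'a::{topological_ab_group_add, t2_space}"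
  assumes "a sums l"
  shows "(\<lambda>n. if n = 0 then 0 else a n) sums (l - a 0)"
proof -
  have "(\<lambda>n. a n + (if n = 0 then - a 0 else 0)) sums (l + - a 0)"
    by (rule sums_add[OF assms sums_single])
  moreover have "(\<lambda>n. a n + (if n = 0 then - a 0 else 0)) = (\<lambda>n. if n = 0 then 0 else a n)" by auto
  ultimately show ?thesis by simp
qed

text \<open>For fixed \<open>v\<close>, the function \<open>z \<mapsto> g (x + z v) - g x\<close> is
  a scalar power series without constant term, and the scalar composition theorem is evaluated at
  \<open>z = 1\<close>. The coefficients are the same expressions for all \<open>v\<close> and are
  homogeneous polynomials by substitution into blocks. The last conclusion is the chain rule at
  first order.\<close>

lemma expansion_at_compose:
  fixes s :: "complex \<Rightarrow> 'e::{topological_ab_group_add, t2_space} \<Rightarrow> 'e"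
    and t :: "complex \<Rightarrow> 'f::{topological_ab_group_add, t2_space} \<Rightarrow> 'f"
    and u :: "complex \<Rightarrow> 'h::{topological_ab_group_add, t2_space} \<Rightarrow> 'h"
  assumes s: "locally_convex_space s" and t: "locally_convex_space t" and u: "locally_convex_space u"
    and F: "module.subspace s F" and G: "module.subspace t G" and H: "module.subspace u H"
    and U: "openin (top_of_set F) U" and V: "openin (top_of_set G) V"
    and g: "continuous_on U g" and f: "continuous_on V f" and gUV: "g ` U \<subseteq> V" and x: "x \<in> U"
    and eg: "expansion_at s t F G g x p Vg" and ef: "expansion_at t u G H f (g x) p' Vf"
  obtains r W where "expansion_at s u F H (\<lambda>x. f (g x)) x r W" "\<And>v. v \<in> W \<Longrightarrow> x + v \<in> U"
    "\<And>v. v \<in> F \<Longrightarrow> r 1 v = p' 1 (p 1 v)"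
proof -
  interpret E: locally_convex_space s by fact
  interpret T: locally_convex_space t by fact
  interpret H: locally_convex_space u by fact
  have xF: "x \<in> F" using x U openin_imp_subset by blast
  have gxG: "g x \<in> G" using x gUV V openin_imp_subset by blast
  define y0 where "y0 = g x"
  obtain q0 where q0: "cont_seminorm t q0" "{v \<in> G. q0 (v - 0) < 1} \<subseteq> Vf \<inter> {v \<in> G. g x + v \<in> V}"
    by (rule T.seminorm_rel_nhd[OF openin_Int[OF expansion_atD(2)[OF ef] openin_translate[OF t u G H V gxG]], of 0])
      (use expansion_atD(3)[OF ef] T.subspace_0[OF G] gUV x in auto)
  have q0D: "v \<in> Vf" "y0 + v \<in> V" if "v \<in> G" "q0 v < 1" for v
    using q0(2) that by (auto simp: y0_def)
  have "\<exists>A. open A \<and> x \<in> A \<and> (\<forall>y\<in>U. y \<in> A \<longrightarrow> g y \<in> {y. q0 (y - y0) < 1/6})"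
  proof (rule g[unfolded continuous_on_topological, THEN bspec, OF x, THEN spec, THEN mp, THEN mp])
    show "open {y. q0 (y - y0) < 1/6}"
      by (intro open_Collect_less continuous_on_compose2[OF cont_seminorm_continuous[OF q0(1)]] continuous_intros) auto
    show "g x \<in> {y. q0 (y - y0) < 1/6}" using T.seminorm_0[OF q0(1)] by (simp add: y0_def)
  qed
  then obtain A where A: "open A" "x \<in> A" "\<And>y. y \<in> U \<Longrightarrow> y \<in> A \<Longrightarrow> q0 (g y - y0) < 1/6" by blast
  obtain q1 where q1: "cont_seminorm s q1" "{y \<in> F. q1 (y - x) < 1} \<subseteq> U \<inter> A"
    by (rule E.seminorm_rel_nhd[of F "U \<inter> A" x]) (use U A x in \<open>auto simp: openin_open\<close>)
  obtain q2 where q2: "cont_seminorm s q2" "{y \<in> F. q2 (y - 0) < 1} \<subseteq> Vg"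
    by (rule E.seminorm_rel_nhd[OF expansion_atD(2,3)[OF eg]]) blast
  \<comment> \<open>Radius \<open>1/2\<close> because the composition theorem needs the line on the
    whole disc of radius 2; there \<open>z v\<close> stays within radius 1.\<close>
  define W where "W = {v \<in> F. q1 v < 1/2 \<and> q2 v < 1/2}"
  have W_open: "openin (top_of_set F) W"
  proof -
    have "W = F \<inter> ({v. q1 v < 1/2} \<inter> {v. q2 v < 1/2})" by (auto simp: W_def)
    then show ?thesis
      by (simp only:) (intro openin_open_Int open_Int E.open_seminorm_ball q1(1) q2(1))
  qed
  have W0: "0 \<in> W" using E.subspace_0[OF F] E.seminorm_0[OF q1(1)] E.seminorm_0[OF q2(1)] by (simp add: W_def)
  have scaled: "s z v \<in> Vg" "x + s z v \<in> U" "q0 (g (x + s z v) - y0) < 1/6" if v: "v \<in> W" and z: "cmod z \<le> 2" for v z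
  proof -
    have vF: "v \<in> F" "s z v \<in> F" using v E.subspace_scale[OF F] by (simp_all add: W_def)
    have "q1 (s z v) \<le> 2 * q1 v" "q2 (s z v) \<le> 2 * q2 v"
      using mult_right_mono[OF z E.seminorm_nonneg[OF q1(1), of v]] mult_right_mono[OF z E.seminorm_nonneg[OF q2(1), of v]]
      by (simp_all add: cont_seminorm_scale[OF q1(1)] cont_seminorm_scale[OF q2(1)])
    then have lt: "q1 ((x + s z v) - x) < 1" "q2 (s z v - 0) < 1" using v by (simp_all add: W_def)
    show "s z v \<in> Vg" using q2(2) vF lt(2) by blast
    have "x + s z v \<in> F" using E.subspace_add[OF F xF vF(2)] .
    then have "x + s z v \<in> U \<inter> A" using q1(2) lt(1) by blast
    then show "x + s z v \<in> U" "q0 (g (x + s z v) - y0) < 1/6" using A(3) by auto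
  qed
  have "\<forall>m. \<exists>\<beta>. multilinear_on t u G H m \<beta> \<and> continuous_on ({..<m} \<rightarrow>\<^sub>E G) \<beta> \<and> (\<forall>v\<in>G. p' m v = \<beta> (\<lambda>i\<in>{..<m}. v))"
    using expansion_atD(1)[OF ef] unfolding homogeneous_polynomial_on_def by blast
  from choice[OF this] obtain \<beta> where \<beta>': "\<forall>m. multilinear_on t u G H m (\<beta> m) \<and> continuous_on ({..<m} \<rightarrow>\<^sub>E G) (\<beta> m) \<and>
      (\<forall>v\<in>G. p' m v = \<beta> m (\<lambda>i\<in>{..<m}. v))" by (rule exE)
  then have \<beta>: "multilinear_on t u G H m (\<beta> m)" "continuous_on ({..<m} \<rightarrow>\<^sub>E G) (\<beta> m)"
    "v \<in> G \<Longrightarrow> p' m v = \<beta> m (\<lambda>i\<in>{..<m}. v)" for m v by blast+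
  define r where "r n v = (\<Sum>m\<le>n. \<Sum>i\<in>compositions n m n. \<beta> m (\<lambda>j\<in>{..<m}. p (i j) v))" for n v
  have pG: "p i v \<in> G" if "v \<in> F" for i v by (rule homogeneous_polynomial_mem[OF expansion_atD(1)[OF eg] that])
  have "homogeneous_polynomial_on s u F H n (r n)" for n
    unfolding r_def
  proof (intro homogeneous_polynomial_sum[OF u H])
    fix m i assume "i \<in> compositions n m n"
    then show "homogeneous_polynomial_on s u F H n (\<lambda>v. \<beta> m (\<lambda>j\<in>{..<m}. p (i j) v))"
      by (intro homogeneous_polynomial_block[OF \<beta>(1,2), where q = "\<lambda>j. p (i j)" and i = i] expansion_atD(1)[OF eg])
        (simp add: compositions_def)
  qed
  moreover have "(\<lambda>n. r n v) sums f (g (x + v))" if v: "v \<in> W" for v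
  proof -
    have vF: "v \<in> F" using v by (simp add: W_def)
    \<comment> \<open>The constant term \<open>g x\<close> is absorbed into the base point of the
      expansion of \<open>f\<close>.\<close>
    define a where "a i = (if i = 0 then 0 else p i v)" for i
    define w where "w z = g (x + s z v) - y0" for z
    have "(\<lambda>n. \<Sum>m\<le>n. \<Sum>i\<in>compositions n m n. \<beta> m (\<lambda>j\<in>{..<m}. a (i j))) sums f (y0 + w 1)"
    proof (rule compose_power_series[OF t u G \<beta>(1) expansion_atD(1)[OF ef] \<beta>(3) q0(1), where f = "\<lambda>w. f (y0 + w)"])
      show "(\<lambda>m. p' m v) sums f (y0 + v)" if "v \<in> G" "q0 v < 1" for v
        using expansion_atD(4)[OF ef q0D(1)[OF that]] by (simp add: y0_def)
      show "continuous_on {v \<in> G. q0 v < 1} (\<lambda>w. f (y0 + w))"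
        by (rule continuous_on_compose2[OF f]) (use q0D(2) in \<open>auto intro!: continuous_intros\<close>)
      show "a 0 = 0" by (simp add: a_def)
      show "a i \<in> G" for i using pG[OF vF] T.subspace_0[OF G] by (simp add: a_def)
      show "continuous_on (cball 0 2) w"
        unfolding w_def
      proof (intro continuous_on_diff continuous_on_const continuous_on_compose2[OF g])
        show "continuous_on (cball 0 2) (\<lambda>z. x + s z v)"
          by (intro continuous_on_add continuous_on_const E.continuous_on_scale continuous_on_id)
        show "(\<lambda>z. x + s z v) ` cball 0 2 \<subseteq> U" using scaled(2)[OF v] by (intro image_subsetI) simp
      qed
      fix z :: complex assume z: "cmod z \<le> 2"
      have "(\<lambda>i. p i (s z v)) sums g (x + s z v)" by (rule expansion_atD(4)[OF eg scaled(1)[OF v z]])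
      from sums_subtract_first[OF this]
      have "(\<lambda>i. if i = 0 then 0 else p i (s z v)) sums w z"
        using expansion_at_0[OF s t F G eg E.subspace_scale[OF F vF]] by (simp add: w_def y0_def)
      moreover have "(if i = 0 then 0 else p i (s z v)) = t (z ^ i) (a i)" for i
        by (simp add: a_def homogeneous_polynomial_scale[OF s t F expansion_atD(1)[OF eg] vF])
      ultimately show "(\<lambda>i. t (z ^ i) (a i)) sums w z" by simp
      have "g (x + s z v) \<in> G" using scaled(2)[OF v z] gUV V openin_imp_subset by blast
      then show "w z \<in> G" using gxG by (simp add: w_def y0_def T.subspace_diff[OF G])
      show "q0 (w z) < 1/6" using scaled(3)[OF v z] by (simp add: w_def)
    qed
    moreover have "y0 + w 1 = g (x + v)" by (simp add: w_def)
    moreover have "(\<Sum>m\<le>n. \<Sum>i\<in>compositions n m n. \<beta> m (\<lambda>j\<in>{..<m}. a (i j))) = r n v" for n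
      unfolding r_def
    proof (intro sum.cong refl arg_cong[where f = "\<beta> _"] restrict_ext)
      fix m i j assume i: "i \<in> compositions n m n" and j: "j \<in> {..<m}"
      have "i j \<in> {1..n}" using i j by (auto simp: compositions_def PiE_iff)
      then show "a (i j) = p (i j) v" by (simp add: a_def)
    qed
    ultimately show ?thesis by simp
  qed
  ultimately have "expansion_at s u F H (\<lambda>x. f (g x)) x r W"
    unfolding expansion_at_def using W_open W0 by blast
  moreover have "x + v \<in> U" if "v \<in> W" for v using scaled(2)[OF that, of 1] by simp
  \<comment> \<open>Total degree 1 is reached only by a single block of size 1: there is no
    composition of 1 into zero parts and exactly one into one part.\<close>
  moreover have "r 1 v = p' 1 (p 1 v)" if v: "v \<in> F" for v
  proof -
    have 0: "compositions 1 0 1 = {}" by (auto simp: compositions_def)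
    have "{..1::nat} = {0, 1}" by auto
    then have "r 1 v = \<beta> 1 (\<lambda>j\<in>{..<1}. p ((\<lambda>j\<in>{..<1}. 1) j) v)"
      unfolding r_def by (simp only: sum.insert finite.intros) (simp add: 0[simplified] compositions_one[simplified])
    also have "(\<lambda>j\<in>{..<1}. p ((\<lambda>j\<in>{..<1}. 1) j) v) = (\<lambda>j\<in>{..<1::nat}. p 1 v)" by (rule restrict_ext) simp
    also have "\<beta> 1 \<dots> = p' 1 (p 1 v)" using \<beta>(3)[OF pG[OF v], of 1] by simp
    finally show ?thesis .
  qed
  ultimately show ?thesis using that by blast
qed

lemma power_series_on_compose:
  fixes s :: "complex \<Rightarrow> 'e::{topological_ab_group_add, t2_space} \<Rightarrow> 'e"
    and t :: "complex \<Rightarrow> 'f::{topological_ab_group_add, t2_space} \<Rightarrow> 'f"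
    and u :: "complex \<Rightarrow> 'h::{topological_ab_group_add, t2_space} \<Rightarrow> 'h"
  assumes s: "locally_convex_space s" and t: "locally_convex_space t" and u: "locally_convex_space u"
    and F: "module.subspace s F" and G: "module.subspace t G" and H: "module.subspace u H"
    and U: "openin (top_of_set F) U" and V: "openin (top_of_set G) V"
    and f: "power_series_on t u G H V f" and g: "power_series_on s t F G U g" and gUV: "g ` U \<subseteq> V"
  shows "power_series_on s u F H U (\<lambda>x. f (g x))"
    and "x \<in> U \<Longrightarrow> v \<in> F \<Longrightarrow> dir_deriv s u (\<lambda>x. f (g x)) x v = dir_deriv t u f (g x) (dir_deriv s t g x v)"
proof -
  note gc = power_series_onD(2)[OF g] and fc = power_series_onD(2)[OF f]
  show "power_series_on s u F H U (\<lambda>x. f (g x))"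
  proof (rule power_series_onI)
    show "(\<lambda>x. f (g x)) ` U \<subseteq> H" using power_series_onD(1)[OF f] gUV by blast
    show "continuous_on U (\<lambda>x. f (g x))" by (rule continuous_on_compose2[OF fc gc gUV])
    fix x assume x: "x \<in> U"
    obtain p Vg where eg: "expansion_at s t F G g x p Vg" using power_series_onD(3)[OF g x] by blast
    have "g x \<in> V" using x gUV by blast
    then obtain p' Vf where ef: "expansion_at t u G H f (g x) p' Vf" using power_series_onD(3)[OF f] by blast
    show "\<exists>p V. expansion_at s u F H (\<lambda>x. f (g x)) x p V \<and> (\<forall>v\<in>V. x + v \<in> U)"
      by (rule expansion_at_compose[OF s t u F G H U V gc fc gUV x eg ef]) blast
  qed
  assume x: "x \<in> U" and v: "v \<in> F"
  obtain p Vg where eg: "expansion_at s t F G g x p Vg" using power_series_onD(3)[OF g x] by blast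
  have "g x \<in> V" using x gUV by blast
  then obtain p' Vf where ef: "expansion_at t u G H f (g x) p' Vf" using power_series_onD(3)[OF f] by blast
  obtain r W where er: "expansion_at s u F H (\<lambda>x. f (g x)) x r W" and r: "\<And>v. v \<in> F \<Longrightarrow> r 1 v = p' 1 (p 1 v)"
    by (rule expansion_at_compose[OF s t u F G H U V gc fc gUV x eg ef]) blast
  have pG: "p 1 v \<in> G" by (rule homogeneous_polynomial_mem[OF expansion_atD(1)[OF eg] v])
  show "dir_deriv s u (\<lambda>x. f (g x)) x v = dir_deriv t u f (g x) (dir_deriv s t g x v)"
    using dir_deriv_eq[OF expansion_at_deriv[OF s u F H er v]] dir_deriv_eq[OF expansion_at_deriv[OF s t F G eg v]]
      dir_deriv_eq[OF expansion_at_deriv[OF t u G H ef pG]] r[OF v] by simp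
qed

section \<open>Complexification and real analytic maps\<close>

lemma complexified_scale_Pair:
  "complexified_scale s z (x, y) = (s (of_real (Re z)) x - s (of_real (Im z)) y,
     s (of_real (Re z)) y + s (of_real (Im z)) x)"
  by (simp add: complexified_scale_def)

text \<open>Convexity involves real coefficients only, and these act on the two components
  separately; products of convex neighbourhoods therefore suffice.\<close>

lemma locally_convex_space_complexified:
  assumes s: "locally_convex_space (s :: 'k::real_or_complex \<Rightarrow> 'e::{topological_ab_group_add, t2_space} \<Rightarrow> 'e)"
  shows "locally_convex_space (complexified_scale s)"
proof -
  interpret E: locally_convex_space s by fact
  interpret vs: vector_space "complexified_scale s"
  proof
    fix a b :: complex and x y :: "'e \<times> 'e"
    obtain x1 x2 y1 y2 where x: "x = (x1, x2)" "y = (y1, y2)" by (cases x, cases y)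
    show "complexified_scale s a (x + y) = complexified_scale s a x + complexified_scale s a y"
      by (simp add: x complexified_scale_Pair E.scale_right_distrib)
    show "complexified_scale s (a + b) x = complexified_scale s a x + complexified_scale s b x"
      by (simp add: x complexified_scale_Pair E.scale_left_distrib)
    show "complexified_scale s a (complexified_scale s b x) = complexified_scale s (a * b) x"
      by (simp add: x complexified_scale_Pair E.scale_left_distrib E.scale_right_distrib
          E.scale_right_diff_distrib E.scale_left_diff_distrib)
    show "complexified_scale s 1 x = x" by (simp add: x complexified_scale_Pair)
  qed
  show ?thesis
  proof
    show "continuous_on UNIV (\<lambda>(c, x). complexified_scale s c x)"
      unfolding complexified_scale_def case_prod_unfold
      by (intro continuous_on_Pair continuous_on_add continuous_on_diff E.continuous_on_scale
          continuous_on_of_real continuous_on_Re continuous_on_Im continuous_on_fst continuous_on_snd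
          continuous_on_id)
    fix U :: "('e \<times> 'e) set" assume U: "open U" "0 \<in> U"
    obtain A B where AB: "open A" "open B" "0 \<in> A \<times> B" "A \<times> B \<subseteq> U"
      by (rule open_prod_elim[OF U]) (rule that)
    have "0 \<in> A" "0 \<in> B" using AB(3) by (simp_all add: zero_prod_def)
    obtain V where V: "open V" "0 \<in> V" "V \<subseteq> A"
      "\<forall>x\<in>V. \<forall>y\<in>V. \<forall>a\<in>{0..1}. s (of_real a) x + s (of_real (1 - a)) y \<in> V"
      using E.convex_neighbourhoods[OF AB(1) \<open>0 \<in> A\<close>] by (elim exE conjE)
    obtain V' where V': "open V'" "0 \<in> V'" "V' \<subseteq> B"
      "\<forall>x\<in>V'. \<forall>y\<in>V'. \<forall>a\<in>{0..1}. s (of_real a) x + s (of_real (1 - a)) y \<in> V'"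
      using E.convex_neighbourhoods[OF AB(2) \<open>0 \<in> B\<close>] by (elim exE conjE)
    have real: "complexified_scale s (of_real a) (x, y) = (s (of_real a) x, s (of_real a) y)" for a :: real and x y
      by (simp add: complexified_scale_Pair)
    show "\<exists>V. open V \<and> 0 \<in> V \<and> V \<subseteq> U \<and> (\<forall>x\<in>V. \<forall>y\<in>V. \<forall>a\<in>{0..1}.
        complexified_scale s (of_real a) x + complexified_scale s (of_real (1 - a)) y \<in> V)"
    proof (intro exI[of _ "V \<times> V'"] conjI ballI)
      show "open (V \<times> V')" by (rule open_Times[OF V(1) V'(1)])
      show "0 \<in> V \<times> V'" using V(2) V'(2) by (simp add: zero_prod_def)
      show "V \<times> V' \<subseteq> U" using V(3) V'(3) AB(4) by blast
      fix x y and a :: real assume xy: "x \<in> V \<times> V'" "y \<in> V \<times> V'" and a: "a \<in> {0..1}"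
      obtain x1 x2 y1 y2 where x: "x = (x1, x2)" "y = (y1, y2)" by (cases x, cases y)
      have "s (of_real a) x1 + s (of_real (1 - a)) y1 \<in> V" using V(4) xy a by (simp add: x)
      moreover have "s (of_real a) x2 + s (of_real (1 - a)) y2 \<in> V'" using V'(4) xy a by (simp add: x)
      ultimately show "complexified_scale s (of_real a) x + complexified_scale s (of_real (1 - a)) y \<in> V \<times> V'"
        unfolding x real by simp
    qed
  qed
qed

lemma subspace_complexified:
  assumes s: "locally_convex_space (s :: 'k::real_or_complex \<Rightarrow> 'e::{topological_ab_group_add, t2_space} \<Rightarrow> 'e)"
    and F: "module.subspace s F"
  shows "module.subspace (complexified_scale s) (F \<times> F)"
proof -
  interpret E: locally_convex_space s by fact
  interpret C: locally_convex_space "complexified_scale s" by (rule locally_convex_space_complexified[OF s])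
  show ?thesis
    by (rule C.subspaceI)
      (auto simp: zero_prod_def complexified_scale_Pair intro!: E.subspace_0[OF F] E.subspace_add[OF F]
        E.subspace_diff[OF F] E.subspace_scale[OF F])
qed

text \<open>A real number that represents a scalar of the abstract type \<open>'k\<close> when all
  its scalars are real. It connects difference quotients over \<open>'k\<close> with those over
  \<open>complex\<close>.\<close>

definition real_coord :: "'k::real_or_complex \<Rightarrow> real" where
  "real_coord c = (SOME r. c = of_real r)"

lemma of_real_real_coord: "real_scalars TYPE('k) \<Longrightarrow> of_real (real_coord c) = (c :: 'k::real_or_complex)"
proof -
  assume "real_scalars TYPE('k)"
  then have "c \<in> \<real>" by (simp add: real_scalars_def)
  then have "\<exists>r. c = of_real r" unfolding Reals_def by blast
  then have "c = of_real (real_coord c)" unfolding real_coord_def by (rule someI_ex)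
  then show ?thesis by simp
qed

text \<open>The coordinate preserves norms, so a limit over nonzero complex scalars can be
  restricted to the scalars of \<open>'k\<close>.\<close>

lemma filterlim_real_coord:
  assumes "real_scalars TYPE('k)"
  shows "filterlim (\<lambda>c::'k::real_or_complex. complex_of_real (real_coord c)) (at 0) (at 0)"
proof (rule filterlim_atI)
  have eq: "norm (complex_of_real (real_coord c)) = norm c" for c :: 'k
  proof -
    have "norm c = norm (of_real (real_coord c) :: 'k)" by (simp only: of_real_real_coord[OF assms])
    then show ?thesis by simp
  qed
  have lim: "((\<lambda>c::'k. norm c) \<longlongrightarrow> 0) (at 0)" using tendsto_norm[OF tendsto_ident_at[of "0::'k" UNIV]] by simp
  show "((\<lambda>c::'k. complex_of_real (real_coord c)) \<longlongrightarrow> 0) (at 0)"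
    by (rule tendsto_norm_zero_cancel) (simp only: eq lim)
  have "complex_of_real (real_coord c) \<noteq> 0" if "c \<noteq> 0" for c :: 'k
    using eq[of c] that by (metis norm_eq_zero)
  then show "eventually (\<lambda>c::'k. complex_of_real (real_coord c) \<noteq> 0) (at 0)"
    by (simp add: eventually_at_filter)
qed

lemma complexified_scale_real_coord:
  assumes s: "locally_convex_space (s :: 'k::real_or_complex \<Rightarrow> 'e::{topological_ab_group_add, t2_space} \<Rightarrow> 'e)"
    and K: "real_scalars TYPE('k)"
  shows "complexified_scale s (of_real (real_coord c)) (x, y) = (s c x, s c y)"
proof -
  interpret E: locally_convex_space s by fact
  show ?thesis by (simp add: complexified_scale_Pair of_real_real_coord[OF K])
qed

section \<open>Real analytic maps through their complex extensions\<close>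

context
  fixes s :: "'k::real_or_complex \<Rightarrow> 'e::{topological_ab_group_add, t2_space} \<Rightarrow> 'e"
    and t :: "'k \<Rightarrow> 'f::{topological_ab_group_add, t2_space} \<Rightarrow> 'f"
    and F :: "'e set" and G :: "'f set"
  assumes s: "locally_convex_space s" and t: "locally_convex_space t"
    and F: "module.subspace s F" and G: "module.subspace t G"
begin

interpretation E: locally_convex_space s by (rule s)
interpretation T: locally_convex_space t by (rule t)

private lemmas sC = locally_convex_space_complexified[OF s]
private lemmas tC = locally_convex_space_complexified[OF t]
private lemmas FC = subspace_complexified[OF s F]
private lemmas GC = subspace_complexified[OF t G]

lemma real_analytic_onE:
  assumes "real_analytic_on s t F G U f" "x \<in> U"
  obtains W g where "openin (top_of_set (F \<times> F)) W" "(x, 0) \<in> W"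
    "power_series_on (complexified_scale s) (complexified_scale t) (F \<times> F) (G \<times> G) W g"
    "\<And>u. (u, 0) \<in> W \<Longrightarrow> u \<in> U" "\<And>u. (u, 0) \<in> W \<Longrightarrow> g (u, 0) = (f u, 0)"
proof -
  from assms obtain W g where "openin (top_of_set (F \<times> F)) W \<and> (x, 0) \<in> W \<and>
    power_series_on (complexified_scale s) (complexified_scale t) (F \<times> F) (G \<times> G) W g \<and>
    (\<forall>u. (u, 0) \<in> W \<longrightarrow> u \<in> U \<and> g (u, 0) = (f u, 0))"
    unfolding real_analytic_on_def by blast
  then show ?thesis using that[of W g] by blast
qed

lemma real_analytic_onI:
  assumes "f ` U \<subseteq> G"
    "\<And>x. x \<in> U \<Longrightarrow> \<exists>W g. openin (top_of_set (F \<times> F)) W \<and> (x, 0) \<in> W \<and>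
        power_series_on (complexified_scale s) (complexified_scale t) (F \<times> F) (G \<times> G) W g \<and>
        (\<forall>u. (u, 0) \<in> W \<longrightarrow> u \<in> U \<and> g (u, 0) = (f u, 0))"
  shows "real_analytic_on s t F G U f"
  unfolding real_analytic_on_def using assms by simp

lemma real_analytic_on_image: "real_analytic_on s t F G U f \<Longrightarrow> f ` U \<subseteq> G"
  by (simp add: real_analytic_on_def)

lemma real_analytic_on_cong:
  assumes f: "real_analytic_on s t F G U f" and eq: "\<And>x. x \<in> U \<Longrightarrow> f x = g x"
  shows "real_analytic_on s t F G U g"
proof (rule real_analytic_onI)
  show "g ` U \<subseteq> G" using real_analytic_on_image[OF f] eq by auto
  fix x assume "x \<in> U"
  then obtain W h where W: "openin (top_of_set (F \<times> F)) W" "(x, 0) \<in> W"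
    "power_series_on (complexified_scale s) (complexified_scale t) (F \<times> F) (G \<times> G) W h"
    "\<And>u. (u, 0) \<in> W \<Longrightarrow> u \<in> U" "\<And>u. (u, 0) \<in> W \<Longrightarrow> h (u, 0) = (f u, 0)"
    by (rule real_analytic_onE[OF f]) (rule that)
  then show "\<exists>W h. openin (top_of_set (F \<times> F)) W \<and> (x, 0) \<in> W \<and>
        power_series_on (complexified_scale s) (complexified_scale t) (F \<times> F) (G \<times> G) W h \<and>
        (\<forall>u. (u, 0) \<in> W \<longrightarrow> u \<in> U \<and> h (u, 0) = (g u, 0))"
    by (intro exI[of _ W] exI[of _ h]) (simp add: eq)
qed

lemma real_analytic_on_subset:
  assumes U: "openin (top_of_set F) U'" "U' \<subseteq> U" and f: "real_analytic_on s t F G U f"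
  shows "real_analytic_on s t F G U' f"
proof (rule real_analytic_onI)
  show "f ` U' \<subseteq> G" using real_analytic_on_image[OF f] U(2) by blast
  fix x assume x: "x \<in> U'"
  then have "x \<in> U" using U(2) by blast
  then obtain W h where W: "openin (top_of_set (F \<times> F)) W" "(x, 0) \<in> W"
    "power_series_on (complexified_scale s) (complexified_scale t) (F \<times> F) (G \<times> G) W h"
    "\<And>u. (u, 0) \<in> W \<Longrightarrow> h (u, 0) = (f u, 0)"
    by (rule real_analytic_onE[OF f]) blast
  have O: "openin (top_of_set (F \<times> F)) (W \<inter> U' \<times> F)"
    by (intro openin_Int W(1) openin_Times U(1) openin_subtopology_self)
  have "power_series_on (complexified_scale s) (complexified_scale t) (F \<times> F) (G \<times> G) (W \<inter> U' \<times> F) h"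
    by (rule power_series_on_subset[OF sC tC FC GC O _ W(3)]) blast
  moreover have "(x, 0) \<in> W \<inter> U' \<times> F" using W(2) x E.subspace_0[OF F] by simp
  ultimately show "\<exists>W h. openin (top_of_set (F \<times> F)) W \<and> (x, 0) \<in> W \<and>
        power_series_on (complexified_scale s) (complexified_scale t) (F \<times> F) (G \<times> G) W h \<and>
        (\<forall>u. (u, 0) \<in> W \<longrightarrow> u \<in> U' \<and> h (u, 0) = (f u, 0))"
    using O W(4) by (intro exI[of _ "W \<inter> U' \<times> F"] exI[of _ h]) simp
qed

lemma real_analytic_on_locally:
  assumes loc: "\<And>x. x \<in> U \<Longrightarrow> \<exists>U'. x \<in> U' \<and> U' \<subseteq> U \<and> real_analytic_on s t F G U' f"
  shows "real_analytic_on s t F G U f"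
proof (rule real_analytic_onI)
  show "f ` U \<subseteq> G" using loc real_analytic_on_image by blast
  fix x assume "x \<in> U"
  then obtain U' where U': "x \<in> U'" "U' \<subseteq> U" "real_analytic_on s t F G U' f" using loc by blast
  obtain W h where W: "openin (top_of_set (F \<times> F)) W" "(x, 0) \<in> W"
    "power_series_on (complexified_scale s) (complexified_scale t) (F \<times> F) (G \<times> G) W h"
    "\<And>u. (u, 0) \<in> W \<Longrightarrow> u \<in> U'" "\<And>u. (u, 0) \<in> W \<Longrightarrow> h (u, 0) = (f u, 0)"
    by (rule real_analytic_onE[OF U'(3,1)]) (rule that)
  then show "\<exists>W h. openin (top_of_set (F \<times> F)) W \<and> (x, 0) \<in> W \<and>
        power_series_on (complexified_scale s) (complexified_scale t) (F \<times> F) (G \<times> G) W h \<and>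
        (\<forall>u. (u, 0) \<in> W \<longrightarrow> u \<in> U \<and> h (u, 0) = (f u, 0))"
    using U'(2) by (intro exI[of _ W] exI[of _ h]) auto
qed

lemma real_analytic_on_add:
  assumes f: "real_analytic_on s t F G U f" and g: "real_analytic_on s t F G U g"
  shows "real_analytic_on s t F G U (\<lambda>x. f x + g x)"
proof (rule real_analytic_onI)
  show "(\<lambda>x. f x + g x) ` U \<subseteq> G"
    using real_analytic_on_image[OF f] real_analytic_on_image[OF g] T.subspace_add[OF G] by blast
  fix x assume x: "x \<in> U"
  obtain W h where W: "openin (top_of_set (F \<times> F)) W" "(x, 0) \<in> W"
    "power_series_on (complexified_scale s) (complexified_scale t) (F \<times> F) (G \<times> G) W h"
    "\<And>u. (u, 0) \<in> W \<Longrightarrow> u \<in> U" "\<And>u. (u, 0) \<in> W \<Longrightarrow> h (u, 0) = (f u, 0)"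
    by (rule real_analytic_onE[OF f x]) (rule that)
  obtain W' h' where W': "openin (top_of_set (F \<times> F)) W'" "(x, 0) \<in> W'"
    "power_series_on (complexified_scale s) (complexified_scale t) (F \<times> F) (G \<times> G) W' h'"
    "\<And>u. (u, 0) \<in> W' \<Longrightarrow> u \<in> U" "\<And>u. (u, 0) \<in> W' \<Longrightarrow> h' (u, 0) = (g u, 0)"
    by (rule real_analytic_onE[OF g x]) (rule that)
  have O: "openin (top_of_set (F \<times> F)) (W \<inter> W')" by (intro openin_Int W(1) W'(1))
  have "power_series_on (complexified_scale s) (complexified_scale t) (F \<times> F) (G \<times> G) (W \<inter> W') (\<lambda>x. h x + h' x)"
    by (intro power_series_on_add[OF sC tC FC GC] power_series_on_subset[OF sC tC FC GC O _ W(3)]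
        power_series_on_subset[OF sC tC FC GC O _ W'(3)]) auto
  then show "\<exists>W h. openin (top_of_set (F \<times> F)) W \<and> (x, 0) \<in> W \<and>
        power_series_on (complexified_scale s) (complexified_scale t) (F \<times> F) (G \<times> G) W h \<and>
        (\<forall>u. (u, 0) \<in> W \<longrightarrow> u \<in> U \<and> h (u, 0) = (f u + g u, 0))"
    using O W(2) W'(2) W(4,5) W'(5) by (intro exI[of _ "W \<inter> W'"] exI[of _ "\<lambda>x. h x + h' x"]) simp
qed

lemma continuous_linear_on_complexified:
  assumes L: "continuous_linear_on s t F G L"
  shows "continuous_linear_on (complexified_scale s) (complexified_scale t) (F \<times> F) (G \<times> G) (map_prod L L)"
proof -
  have Lm: "L v \<in> G" if "v \<in> F" for v using L that by (auto simp: continuous_linear_on_def)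
  have Ladd: "L (x + y) = L x + L y" if "x \<in> F" "y \<in> F" for x y using L that by (auto simp: continuous_linear_on_def)
  have Lsc: "L (s c x) = t c (L x)" if "x \<in> F" for c x using L that by (auto simp: continuous_linear_on_def)
  have Lc: "continuous_on F L" using L by (simp add: continuous_linear_on_def)
  have Ldiff: "L (x - y) = L x - L y" if "x \<in> F" "y \<in> F" for x y
    using Ladd[of "x - y" y] that E.subspace_diff[OF F that] by (simp add: algebra_simps)
  have "continuous_on (F \<times> F) (\<lambda>z. (L (fst z), L (snd z)))"
    by (intro continuous_on_Pair continuous_on_compose2[OF Lc] continuous_intros) auto
  then have "continuous_on (F \<times> F) (map_prod L L)" by (simp add: map_prod_def case_prod_unfold)
  then show ?thesis unfolding continuous_linear_on_def
    using Lm by (auto simp: Ladd complexified_scale_Pair Ldiff Lsc E.subspace_scale[OF F])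
qed

lemma real_analytic_on_linear:
  assumes L: "continuous_linear_on s t F G L" and U: "openin (top_of_set F) U"
  shows "real_analytic_on s t F G U L"
proof (rule real_analytic_onI)
  have UF: "U \<subseteq> F" using U openin_imp_subset by blast
  have Lm: "L v \<in> G" if "v \<in> F" for v using L that by (auto simp: continuous_linear_on_def)
  have Ladd: "L (x + y) = L x + L y" if "x \<in> F" "y \<in> F" for x y using L that by (auto simp: continuous_linear_on_def)
  have L0: "L 0 = 0" using Ladd[of 0 0] E.subspace_0[OF F] by simp
  show "L ` U \<subseteq> G" using Lm UF by blast
  fix x assume x: "x \<in> U"
  have O: "openin (top_of_set (F \<times> F)) (U \<times> F)" by (intro openin_Times U openin_subtopology_self)
  have "power_series_on (complexified_scale s) (complexified_scale t) (F \<times> F) (G \<times> G) (U \<times> F) (map_prod L L)"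
    by (rule power_series_on_linear[OF sC tC FC GC continuous_linear_on_complexified[OF L] O])
  then show "\<exists>W h. openin (top_of_set (F \<times> F)) W \<and> (x, 0) \<in> W \<and>
        power_series_on (complexified_scale s) (complexified_scale t) (F \<times> F) (G \<times> G) W h \<and>
        (\<forall>u. (u, 0) \<in> W \<longrightarrow> u \<in> U \<and> h (u, 0) = (L u, 0))"
    using O x E.subspace_0[OF F] L0 by (intro exI[of _ "U \<times> F"] exI[of _ "map_prod L L"]) simp
qed

lemma real_analytic_on_continuous:
  assumes f: "real_analytic_on s t F G U f" and UF: "U \<subseteq> F"
  shows "continuous_on U f"
proof (rule continuous_on_locally)
  fix x assume x: "x \<in> U"
  obtain W h where W: "openin (top_of_set (F \<times> F)) W" "(x, 0) \<in> W"
    "power_series_on (complexified_scale s) (complexified_scale t) (F \<times> F) (G \<times> G) W h"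
    "\<And>u. (u, 0) \<in> W \<Longrightarrow> h (u, 0) = (f u, 0)"
    by (rule real_analytic_onE[OF f x]) blast
  obtain T where T: "open T" "W = (F \<times> F) \<inter> T" using W(1) by (auto simp: openin_open)
  define T' where "T' = (\<lambda>u. (u, 0::'e)) -` T"
  have "open T'" unfolding T'_def by (intro open_vimage T(1) continuous_intros)
  moreover have "x \<in> T'" using W(2) T(2) by (simp add: T'_def)
  moreover have "continuous_on (F \<inter> T') f"
  proof -
    have sub: "(\<lambda>u. (u, 0)) ` (F \<inter> T') \<subseteq> W" using T(2) E.subspace_0[OF F] by (auto simp: T'_def)
    have "continuous_on (F \<inter> T') (\<lambda>u. fst (h (u, 0)))"
      by (intro continuous_on_fst continuous_on_compose2[OF power_series_onD(2)[OF W(3)] _ sub] continuous_intros)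
    moreover have "fst (h (u, 0)) = f u" if "u \<in> F \<inter> T'" for u
    proof -
      have "(u, 0) \<in> W" using sub that by blast
      then show ?thesis by (simp add: W(4))
    qed
    ultimately show ?thesis by (rule continuous_on_eq)
  qed
  then have "continuous_on (U \<inter> T') f" by (rule continuous_on_subset) (use UF in blast)
  ultimately show "\<exists>T. open T \<and> x \<in> T \<and> continuous_on (U \<inter> T) f" by blast
qed

text \<open>For a real increment in a real direction the difference quotient of the extension is the
  pair of that of \<open>f\<close> and 0. The complex limit therefore computes the derivative of
  \<open>f\<close>, and its imaginary component is a limit of zeros.\<close>

lemma real_analytic_on_deriv:
  assumes K: "real_scalars TYPE('k)" and f: "real_analytic_on s t F G U f" and x: "x \<in> U"
    and W: "openin (top_of_set (F \<times> F)) W" "(x, 0) \<in> W"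
    and g: "power_series_on (complexified_scale s) (complexified_scale t) (F \<times> F) (G \<times> G) W g"
      "\<forall>u. (u, 0) \<in> W \<longrightarrow> g (u, 0) = (f u, 0)"
    and e: "expansion_at (complexified_scale s) (complexified_scale t) (F \<times> F) (G \<times> G) g (x, 0) p V"
    and v: "v \<in> F"
  shows "(diff_quot s t f x v \<longlongrightarrow> fst (p 1 (v, 0))) (at 0)" "snd (p 1 (v, 0)) = 0"
proof -
  have v0: "(v, 0) \<in> F \<times> F" using v E.subspace_0[OF F] by simp
  from filterlim_compose[OF expansion_at_deriv[OF sC tC FC GC e v0] filterlim_real_coord[OF K]]
  have lim: "((\<lambda>c. diff_quot (complexified_scale s) (complexified_scale t) g (x, 0) (v, 0)
      (complex_of_real (real_coord (c::'k)))) \<longlongrightarrow> p 1 (v, 0)) (at 0)" .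
  have scs: "complexified_scale s (of_real (real_coord c)) (v, 0) = (s c v, 0)" for c
    by (simp add: complexified_scale_real_coord[OF s K])
  have tcs: "complexified_scale t (inverse (of_real (real_coord c))) (w, 0) = (t (inverse c) w, 0)" for c w
  proof -
    have "inverse c = of_real (inverse (real_coord c))" by (simp add: of_real_real_coord[OF K])
    moreover have "complexified_scale t (of_real (inverse (real_coord c))) (w, 0) = (t (of_real (inverse (real_coord c))) w, 0)"
      by (simp add: complexified_scale_Pair del: of_real_inverse)
    ultimately show ?thesis by simp
  qed
  have "eventually (\<lambda>h. (x, 0) + complexified_scale s h (v, 0) \<in> W) (at 0)"
    by (rule eventually_in_open_line[OF sC FC W v0])
  from eventually_compose_filterlim[OF this filterlim_real_coord[OF K]]
  have ev: "eventually (\<lambda>c::'k. (x + s c v, 0) \<in> W) (at 0)" by (simp add: scs)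
  then have "eventually (\<lambda>c. diff_quot (complexified_scale s) (complexified_scale t) g (x, 0) (v, 0)
      (complex_of_real (real_coord (c::'k))) = (diff_quot s t f x v c, 0)) (at 0)"
  proof (rule eventually_mono)
    fix c :: 'k assume "(x + s c v, 0) \<in> W"
    then show "diff_quot (complexified_scale s) (complexified_scale t) g (x, 0) (v, 0)
      (complex_of_real (real_coord (c::'k))) = (diff_quot s t f x v c, 0)"
      using g(2)[rule_format, OF W(2)] g(2)[rule_format, of "x + s c v"] by (simp add: diff_quot_def scs tcs)
  qed
  from Lim_transform_eventually[OF lim this]
  have lim2: "((\<lambda>c. (diff_quot s t f x v c, 0)) \<longlongrightarrow> p 1 (v, 0)) (at (0::'k))" .
  show "(diff_quot s t f x v \<longlongrightarrow> fst (p 1 (v, 0))) (at 0)" using tendsto_fst[OF lim2] by simp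
  have "((\<lambda>c::'k. 0) \<longlongrightarrow> snd (p 1 (v, 0))) (at 0)" using tendsto_snd[OF lim2] by simp
  then show "snd (p 1 (v, 0)) = 0" using tendsto_unique[OF at_neq_bot _ tendsto_const] by blast
qed

text \<open>The degree 1 term of the extension is complex linear and continuous. On real vectors its
  imaginary component vanishes, so its real component is linear over \<open>'k\<close>.\<close>

lemma real_analytic_on_deriv_linear:
  assumes K: "real_scalars TYPE('k)" and f: "real_analytic_on s t F G U f" and x: "x \<in> U"
  shows "continuous_linear_on s t F G (dir_deriv s t f x)"
    and "v \<in> F \<Longrightarrow> (diff_quot s t f x v \<longlongrightarrow> dir_deriv s t f x v) (at 0)"
proof -
  obtain W g where W: "openin (top_of_set (F \<times> F)) W" "(x, 0) \<in> W"
    "power_series_on (complexified_scale s) (complexified_scale t) (F \<times> F) (G \<times> G) W g"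
    "\<And>u. (u, 0) \<in> W \<Longrightarrow> g (u, 0) = (f u, 0)"
    by (rule real_analytic_onE[OF f x]) blast
  obtain p V where e: "expansion_at (complexified_scale s) (complexified_scale t) (F \<times> F) (G \<times> G) g (x, 0) p V"
    using power_series_onD(3)[OF W(3,2)] by blast
  have W4: "\<forall>u. (u, 0) \<in> W \<longrightarrow> g (u, 0) = (f u, 0)" using W(4) by blast
  note d = real_analytic_on_deriv[OF K f x W(1,2,3) W4 e]
  note p1 = expansion_atD(1)[OF e, of 1]
  have D: "dir_deriv s t f x v = fst (p 1 (v, 0))" if "v \<in> F" for v by (rule dir_deriv_eq[OF d(1)[OF that]])
  show "v \<in> F \<Longrightarrow> (diff_quot s t f x v \<longlongrightarrow> dir_deriv s t f x v) (at 0)" using d(1) D by simp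
  have v0: "(v, 0) \<in> F \<times> F" if "v \<in> F" for v using that E.subspace_0[OF F] by simp
  show "continuous_linear_on s t F G (dir_deriv s t f x)"
    unfolding continuous_linear_on_def
  proof (intro conjI ballI allI image_subsetI)
    show "dir_deriv s t f x v \<in> G" if "v \<in> F" for v
      using homogeneous_polynomial_mem[OF p1 v0[OF that]] D[OF that] by (simp add: mem_Times_iff)
    have "continuous_on F (\<lambda>v. fst (p 1 (v, 0)))"
      by (intro continuous_on_fst continuous_on_compose2[OF homogeneous_polynomial_continuous[OF p1]] continuous_intros)
        (use v0 in blast)
    then show "continuous_on F (dir_deriv s t f x)" by (rule continuous_on_eq) (simp add: D)
    show "dir_deriv s t f x (v + w) = dir_deriv s t f x v + dir_deriv s t f x w" if "v \<in> F" "w \<in> F" for v w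
      using homogeneous_polynomial_one_add[OF sC FC p1 v0[OF that(1)] v0[OF that(2)]] D that E.subspace_add[OF F that]
      by simp
    show "dir_deriv s t f x (s c v) = t c (dir_deriv s t f x v)" if "v \<in> F" for c v
    proof -
      define w where "w = fst (p 1 (v, 0))"
      have w: "p 1 (v, 0) = (w, 0)" using d(2)[OF that] by (simp add: w_def prod_eq_iff)
      have "p 1 (s c v, 0) = complexified_scale t (of_real (real_coord c)) (w, 0)"
        using homogeneous_polynomial_scale[OF sC tC FC p1 v0[OF that], of "of_real (real_coord c)"]
        by (simp only: w complexified_scale_real_coord[OF s K] E.scale_zero_right power_one_right)
      then show ?thesis
        by (simp only: D[OF that] D[OF E.subspace_scale[OF F that]] w complexified_scale_real_coord[OF t K] fst_conv)
    qed
  qed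
qed

text \<open>\<open>z \<mapsto> p (a + z b)\<close> is a polynomial in \<open>z\<close> whose values
  at real \<open>z\<close> lie in \<open>G' \<times> G'\<close>. Its coefficients are limits through
  real \<open>z\<close> and remain in this closed subspace; evaluation at \<open>z = \<i>\<close>
  then gives the claim at \<open>(a, b)\<close>.\<close>

lemma homogeneous_polynomial_complexified_mem:
  assumes p: "homogeneous_polynomial_on (complexified_scale s) (complexified_scale t) (F \<times> F) (G \<times> G) n p"
    and F': "module.subspace s F'" "F' \<subseteq> F" and G': "module.subspace t G'" "closed G'"
    and real: "\<And>v. v \<in> F' \<Longrightarrow> p (v, 0) \<in> G' \<times> G'" and ab: "a \<in> F'" "b \<in> F'"
  shows "p (a, b) \<in> G' \<times> G'"
proof -
  interpret CS: locally_convex_space "complexified_scale s" by (rule sC)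
  interpret CT: locally_convex_space "complexified_scale t" by (rule tC)
  let ?s = "complexified_scale s" and ?t = "complexified_scale t"
  have G'C: "CT.subspace (G' \<times> G')" "closed (G' \<times> G')"
    using subspace_complexified[OF t G'(1)] G'(2) by (simp_all add: closed_Times)
  obtain \<beta> where \<beta>: "multilinear_on ?s ?t (F \<times> F) (G \<times> G) n \<beta>"
    "\<And>v. v \<in> F \<times> F \<Longrightarrow> p v = \<beta> (\<lambda>i\<in>{..<n}. v)"
    by (rule homogeneous_polynomial_onE[OF p]) blast
  \<comment> \<open>The exponents 0 and 1 of \<open>z\<close> index the two summands of
    \<open>a + z b\<close>, so a choice of summands has its degree in \<open>z\<close> as the sum of
    its values.\<close>
  define w where "w j = (if j = (0::nat) then (a, 0::'e) else (b, 0))" for j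
  have wF: "w j \<in> F \<times> F" for j using ab F'(2) E.subspace_0[OF F] by (auto simp: w_def)
  define P where "P = ({..<n} \<rightarrow>\<^sub>E {0, 1::nat})"
  have finP: "finite P" unfolding P_def by (intro finite_PiE) auto
  define c where "c k = (\<Sum>\<phi>\<in>{\<phi> \<in> P. (\<Sum>i<n. \<phi> i) = k}. \<beta> (\<lambda>i\<in>{..<n}. w (\<phi> i)))" for k
  have poly: "p ((a, 0) + ?s z (b, 0)) = (\<Sum>k\<le>n. ?t (z ^ k) (c k))" for z
  proof -
    have mem: "(a, 0) + ?s z (b, 0) \<in> F \<times> F"
      using wF[of 0] wF[of 1] by (simp add: w_def CS.subspace_add[OF FC] CS.subspace_scale[OF FC])
    have "p ((a, 0) + ?s z (b, 0)) = \<beta> (\<lambda>i\<in>{..<n}. \<Sum>j\<in>{0, 1}. ?s (z ^ j) (w j))"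
      unfolding \<beta>(2)[OF mem] by (simp add: w_def)
    also have "\<dots> = (\<Sum>\<phi>\<in>P. \<beta> (\<lambda>i\<in>{..<n}. ?s (z ^ \<phi> i) (w (\<phi> i))))"
      unfolding P_def by (rule multilinear_expand[OF sC tC FC \<beta>(1)]) (simp_all add: CS.subspace_scale[OF FC] wF)
    also have "\<dots> = (\<Sum>\<phi>\<in>P. ?t (z ^ (\<Sum>i<n. \<phi> i)) (\<beta> (\<lambda>i\<in>{..<n}. w (\<phi> i))))"
    proof (rule sum.cong[OF refl])
      show "\<beta> (\<lambda>i\<in>{..<n}. ?s (z ^ \<phi> i) (w (\<phi> i))) = ?t (z ^ (\<Sum>i<n. \<phi> i)) (\<beta> (\<lambda>i\<in>{..<n}. w (\<phi> i)))" for \<phi>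
        unfolding power_sum by (rule multilinear_scale_all[OF sC tC FC \<beta>(1)]) (rule wF)
    qed
    also have "\<dots> = (\<Sum>k\<le>n. \<Sum>\<phi>\<in>{\<phi> \<in> P. (\<Sum>i<n. \<phi> i) = k}. ?t (z ^ (\<Sum>i<n. \<phi> i)) (\<beta> (\<lambda>i\<in>{..<n}. w (\<phi> i))))"
    proof (rule sum.group[symmetric, OF finP])
      show "(\<lambda>\<phi>. \<Sum>i<n. \<phi> i) ` P \<subseteq> {..n}"
      proof (rule image_subsetI)
        fix \<phi> assume \<phi>: "\<phi> \<in> P"
        have "\<phi> i \<le> 1" if "i < n" for i using PiE_mem[OF \<phi>[unfolded P_def], of i] that by auto
        then have "(\<Sum>i<n. \<phi> i) \<le> (\<Sum>i<n. 1)" by (intro sum_mono) simp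
        then show "(\<Sum>i<n. \<phi> i) \<in> {..n}" by simp
      qed
    qed simp
    also have "\<dots> = (\<Sum>k\<le>n. ?t (z ^ k) (c k))"
      unfolding c_def CT.scale_sum_right by (intro sum.cong refl) auto
    finally show ?thesis .
  qed
  define c' where "c' k = (if k \<le> n then c k else 0)" for k
  have sums: "(\<lambda>k. ?t (z ^ k) (c' k)) sums p ((a, 0) + ?s z (b, 0))" for z
  proof -
    have "(\<lambda>k. ?t (z ^ k) (c' k)) sums (\<Sum>k\<le>n. ?t (z ^ k) (c' k))"
      by (rule sums_finite) (simp_all add: c'_def)
    then show ?thesis by (simp add: poly c'_def)
  qed
  have "c' k \<in> G' \<times> G'" for k
  proof (rule CT.power_series_coeff_closed[OF G'C _ _ zero_less_one])
    \<comment> \<open>Approach to 0 through real numbers, the only ones where membership is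
      known.\<close>
    let ?Fl = "filtermap complex_of_real (at 0)"
    show "?Fl \<noteq> bot" by (simp add: filtermap_bot_iff)
    have "filterlim complex_of_real (at 0) (at 0)"
    proof (rule filterlim_atI)
      have "(complex_of_real \<longlongrightarrow> of_real 0) (at 0)" by (intro tendsto_intros)
      then show "(complex_of_real \<longlongrightarrow> 0) (at 0)" by simp
    qed (simp add: eventually_at_filter)
    then show "?Fl \<le> at 0" by (simp add: filterlim_def)
    show "(\<lambda>k. ?t (z ^ k) (c' k)) sums p ((a, 0) + ?s z (b, 0))" for z by (rule sums)
    have "p ((a, 0) + ?s (of_real r) (b, 0)) \<in> G' \<times> G'" for r
      using real[of "a + s (of_real r) b"] ab E.subspace_add[OF F'(1)] E.subspace_scale[OF F'(1)]
      by (simp add: complexified_scale_Pair)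
    then show "eventually (\<lambda>z. p ((a, 0) + ?s z (b, 0)) \<in> G' \<times> G') ?Fl"
      by (simp add: eventually_filtermap)
  qed
  then have "(\<Sum>k\<le>n. ?t (\<i> ^ k) (c k)) \<in> G' \<times> G'"
    unfolding c'_def by (intro CT.subspace_sum[OF G'C(1)] CT.subspace_scale[OF G'C(1)]) (metis atMost_iff)
  moreover have "(a, 0) + ?s \<i> (b, 0) = (a, b)" by (simp add: complexified_scale_Pair)
  ultimately show ?thesis using poly[of \<i>] by simp
qed

end

text \<open>The extension \<open>g\<close> is known to map into \<open>G' \<times> G'\<close> at
  real points of \<open>F'\<close> only. Its coefficients at real vectors are limits of such values;
  they are propagated to complex vectors as polynomials, and summing the expansion gives the values
  of \<open>g\<close> itself near \<open>(x, 0)\<close>.\<close>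

lemma real_analytic_on_restrict_subspace:
  fixes s :: "'k::real_or_complex \<Rightarrow> 'e::{topological_ab_group_add, t2_space} \<Rightarrow> 'e"
    and t :: "'k \<Rightarrow> 'f::{topological_ab_group_add, t2_space} \<Rightarrow> 'f"
  assumes s: "locally_convex_space s" and t: "locally_convex_space t"
    and F: "module.subspace s F" and G: "module.subspace t G"
    and U: "openin (top_of_set F) U" and f: "real_analytic_on s t F G U f"
    and F': "module.subspace s F'" "F' \<subseteq> F" and G': "module.subspace t G'" "closed G'"
    and im: "f ` (U \<inter> F') \<subseteq> G'"
  shows "real_analytic_on s t F' G' (U \<inter> F') f"
proof (rule real_analytic_onI[OF s t F'(1) G'(1) im])
  interpret E: locally_convex_space s by fact
  interpret T: locally_convex_space t by fact
  note sC = locally_convex_space_complexified[OF s] and tC = locally_convex_space_complexified[OF t]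
  note FC = subspace_complexified[OF s F] and GC = subspace_complexified[OF t G]
  note F'C = subspace_complexified[OF s F'(1)] and G'C = subspace_complexified[OF t G'(1)]
  interpret CS: locally_convex_space "complexified_scale s" by (rule sC)
  interpret CT: locally_convex_space "complexified_scale t" by (rule tC)
  let ?s = "complexified_scale s" and ?t = "complexified_scale t"
  have clG: "closed (G' \<times> G')" using G'(2) by (simp add: closed_Times)
  fix x assume x: "x \<in> U \<inter> F'"
  then have "x \<in> U" by blast
  then obtain W g where W: "openin (top_of_set (F \<times> F)) W" "(x, 0) \<in> W"
    "power_series_on ?s ?t (F \<times> F) (G \<times> G) W g"
    "\<And>u. (u, 0) \<in> W \<Longrightarrow> u \<in> U" "\<And>u. (u, 0) \<in> W \<Longrightarrow> g (u, 0) = (f u, 0)"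
    by (rule real_analytic_onE[OF s t F G f]) (rule that)
  obtain p V where e: "expansion_at ?s ?t (F \<times> F) (G \<times> G) g (x, 0) p V" and V: "\<forall>v\<in>V. (x, 0) + v \<in> W"
    using power_series_onD(3)[OF W(3,2)] by blast
  have F0: "(v, 0) \<in> F \<times> F" "(v, 0) \<in> F' \<times> F'" if "v \<in> F'" for v
    using that F'(2) E.subspace_0[OF F] E.subspace_0[OF F'(1)] by auto
  have real: "p n (v, 0) \<in> G' \<times> G'" if v: "v \<in> F'" for n v
  proof (rule expansion_at_coeff_closed[OF sC tC FC GC e F0(1)[OF v] G'C clG])
    let ?Fl = "filtermap complex_of_real (at 0)"
    show "?Fl \<noteq> bot" by (simp add: filtermap_bot_iff)
    have fl: "filterlim complex_of_real (at 0) (at 0)"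
    proof (rule filterlim_atI)
      have "(complex_of_real \<longlongrightarrow> of_real 0) (at 0)" by (intro tendsto_intros)
      then show "(complex_of_real \<longlongrightarrow> 0) (at 0)" by simp
    qed (simp add: eventually_at_filter)
    then show "?Fl \<le> at 0" by (simp add: filterlim_def)
    have "eventually (\<lambda>z. (x, 0) + ?s z (v, 0) \<in> W) (at 0)"
      by (rule eventually_in_open_line[OF sC FC W(1,2) F0(1)[OF v]])
    from eventually_compose_filterlim[OF this fl]
    have "eventually (\<lambda>r. (x + s (of_real r) v, 0) \<in> W) (at 0)" by (simp add: complexified_scale_Pair)
    then have "eventually (\<lambda>r. g ((x, 0) + ?s (of_real r) (v, 0)) \<in> G' \<times> G') (at 0)"
    proof (rule eventually_mono)
      fix r assume r: "(x + s (of_real r) v, 0) \<in> W"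
      have "x + s (of_real r) v \<in> F'" using x v by (simp add: E.subspace_add[OF F'(1)] E.subspace_scale[OF F'(1)])
      then have "f (x + s (of_real r) v) \<in> G'" using W(4)[OF r] im by blast
      then show "g ((x, 0) + ?s (of_real r) (v, 0)) \<in> G' \<times> G'"
        using W(5)[OF r] T.subspace_0[OF G'(1)] by (simp add: complexified_scale_Pair)
    qed
    then show "eventually (\<lambda>z. g ((x, 0) + ?s z (v, 0)) \<in> G' \<times> G') ?Fl" by (simp add: eventually_filtermap)
  qed
  have pG': "p n v \<in> G' \<times> G'" if "v \<in> F' \<times> F'" for n v
  proof -
    obtain a b where v: "v = (a, b)" by (cases v)
    have ab: "a \<in> F'" "b \<in> F'" using that v by simp_all
    show ?thesis unfolding v
      by (rule homogeneous_polynomial_complexified_mem[OF s t F G expansion_atD(1)[OF e] F' G' real ab])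
  qed
  \<comment> \<open>The sum of the series is a limit of elements of the closed subspace
    \<open>G' \<times> G'\<close>.\<close>
  have gG': "g ((x, 0) + v) \<in> G' \<times> G'" if v: "v \<in> V" "v \<in> F' \<times> F'" for v
  proof -
    have lim: "(\<lambda>N. \<Sum>n<N. p n v) \<longlonglongrightarrow> g ((x, 0) + v)" using expansion_atD(4)[OF e v(1)] by (simp add: sums_def)
    show ?thesis
    proof (rule Lim_in_closed_set[OF clG _ sequentially_bot lim])
      show "eventually (\<lambda>N. (\<Sum>n<N. p n v) \<in> G' \<times> G') sequentially"
        by (intro always_eventually allI CT.subspace_sum[OF G'C] pG' v(2))
    qed
  qed
  \<comment> \<open>The expansion at \<open>(x, 0)\<close> reaches exactly this set, and only there
    the values of \<open>g\<close> have been located.\<close>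
  define W'' where "W'' = {w \<in> F \<times> F. - (x, 0) + w \<in> V}"
  have xF: "- (x, 0) \<in> F \<times> F" using F0(1)[of x] x CS.subspace_neg[OF FC] by blast
  have W''o: "openin (top_of_set (F \<times> F)) W''"
    unfolding W''_def by (rule openin_translate[OF sC tC FC GC expansion_atD(2)[OF e] xF])
  have W''W: "W'' \<subseteq> W"
  proof
    fix w assume "w \<in> W''"
    then have "(x, 0) + (- (x, 0) + w) \<in> W" using V by (simp only: W''_def mem_Collect_eq)
    then show "w \<in> W" by (simp only: add_minus_cancel)
  qed
  have "power_series_on ?s ?t (F \<times> F) (G \<times> G) W'' g"
    by (rule power_series_on_subset[OF sC tC FC GC W''o W''W W(3)])
  moreover have "g ` (W'' \<inter> F' \<times> F') \<subseteq> G' \<times> G'"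
  proof (rule image_subsetI)
    fix w assume w: "w \<in> W'' \<inter> F' \<times> F'"
    have "- (x, 0) + w \<in> F' \<times> F'"
      using w F0(2)[of x] x by (intro CS.subspace_add[OF F'C] CS.subspace_neg[OF F'C]) auto
    moreover have "- (x, 0) + w \<in> V" using w by (simp only: W''_def mem_Collect_eq Int_iff)
    ultimately have "g ((x, 0) + (- (x, 0) + w)) \<in> G' \<times> G'" by (intro gG')
    then show "g w \<in> G' \<times> G'" by (simp only: add_minus_cancel)
  qed
  moreover have "F' \<times> F' \<subseteq> F \<times> F" using F'(2) by blast
  ultimately have ps: "power_series_on ?s ?t (F' \<times> F') (G' \<times> G') (W'' \<inter> F' \<times> F') g"
    using power_series_on_restrict_subspace[OF sC tC FC GC W''o _ F'C _ G'C clG] by blast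
  have o: "openin (top_of_set (F' \<times> F')) (W'' \<inter> F' \<times> F')"
  proof -
    obtain O' where "open O'" "W'' = F \<times> F \<inter> O'" using W''o by (auto simp: openin_open)
    moreover have "F \<times> F \<inter> O' \<inter> F' \<times> F' = F' \<times> F' \<inter> O'" using F'(2) by blast
    ultimately show ?thesis by (auto simp: openin_open)
  qed
  have mem: "(x, 0) \<in> W'' \<inter> F' \<times> F'"
    using F0[of x] x expansion_atD(3)[OF e] by (simp add: W''_def flip: zero_prod_def)
  show "\<exists>W g. openin (top_of_set (F' \<times> F')) W \<and> (x, 0) \<in> W \<and>
        power_series_on ?s ?t (F' \<times> F') (G' \<times> G') W g \<and>
        (\<forall>u. (u, 0) \<in> W \<longrightarrow> u \<in> U \<inter> F' \<and> g (u, 0) = (f u, 0))"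
  proof (intro exI[of _ "W'' \<inter> F' \<times> F'"] exI[of _ g] conjI allI impI)
    fix u assume u: "(u, 0) \<in> W'' \<inter> F' \<times> F'"
    then have uW: "(u, 0) \<in> W" using W''W by blast
    show "u \<in> U \<inter> F'" using W(4)[OF uW] u by blast
    show "g (u, 0) = (f u, 0)" by (rule W(5)[OF uW])
  qed (fact o mem ps)+
qed

text \<open>Local extensions are composed after shrinking the domain of the inner one. Since both
  restrict to the given maps on real points, so does the composite, and the chain rule is read off
  from the degree 1 terms.\<close>

lemma real_analytic_on_compose:
  fixes s :: "'k::real_or_complex \<Rightarrow> 'e::{topological_ab_group_add, t2_space} \<Rightarrow> 'e"
    and t :: "'k \<Rightarrow> 'f::{topological_ab_group_add, t2_space} \<Rightarrow> 'f"
    and u :: "'k \<Rightarrow> 'h::{topological_ab_group_add, t2_space} \<Rightarrow> 'h"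
  assumes s: "locally_convex_space s" and t: "locally_convex_space t" and u: "locally_convex_space u"
    and F: "module.subspace s F" and G: "module.subspace t G" and H: "module.subspace u H"
    and f: "real_analytic_on t u G H V f" and g: "real_analytic_on s t F G U g" and gUV: "g ` U \<subseteq> V"
  shows "real_analytic_on s u F H U (\<lambda>x. f (g x))"
    and "real_scalars TYPE('k) \<Longrightarrow> x \<in> U \<Longrightarrow> v \<in> F \<Longrightarrow>
      dir_deriv s u (\<lambda>x. f (g x)) x v = dir_deriv t u f (g x) (dir_deriv s t g x v)"
proof -
  interpret E: locally_convex_space s by fact
  interpret T: locally_convex_space t by fact
  interpret H: locally_convex_space u by fact
  note sC = locally_convex_space_complexified[OF s] and tC = locally_convex_space_complexified[OF t]
    and uC = locally_convex_space_complexified[OF u]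
  note FC = subspace_complexified[OF s F] and GC = subspace_complexified[OF t G]
    and HC = subspace_complexified[OF u H]
  let ?s = "complexified_scale s" and ?t = "complexified_scale t" and ?u = "complexified_scale u"
  \<comment> \<open>Both conclusions need extensions and expansions of the three maps that fit
    together, so all of them are obtained here at once.\<close>
  have main: "\<exists>W k h p p' r O1 O2 O3. openin (top_of_set (F \<times> F)) W \<and> (x, 0) \<in> W \<and>
        power_series_on ?s ?u (F \<times> F) (H \<times> H) W (\<lambda>x. h (k x)) \<and>
        power_series_on ?s ?t (F \<times> F) (G \<times> G) W k \<and>
        (\<forall>u. (u, 0) \<in> W \<longrightarrow> u \<in> U \<and> k (u, 0) = (g u, 0) \<and> h (g u, 0) = (f (g u), 0)) \<and>
        expansion_at ?s ?t (F \<times> F) (G \<times> G) k (x, 0) p O1 \<and>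
        expansion_at ?t ?u (G \<times> G) (H \<times> H) h (g x, 0) p' O2 \<and>
        expansion_at ?s ?u (F \<times> F) (H \<times> H) (\<lambda>x. h (k x)) (x, 0) r O3 \<and>
        (\<forall>v\<in>F \<times> F. r 1 v = p' 1 (p 1 v)) \<and>
        (\<exists>W'. openin (top_of_set (G \<times> G)) W' \<and> (g x, 0) \<in> W' \<and>
          power_series_on ?t ?u (G \<times> G) (H \<times> H) W' h \<and> (\<forall>u. (u, 0) \<in> W' \<longrightarrow> h (u, 0) = (f u, 0)))"
    if x: "x \<in> U" for x
  proof -
    obtain W k where W: "openin (top_of_set (F \<times> F)) W" "(x, 0) \<in> W"
      "power_series_on ?s ?t (F \<times> F) (G \<times> G) W k"
      "\<And>u. (u, 0) \<in> W \<Longrightarrow> u \<in> U" "\<And>u. (u, 0) \<in> W \<Longrightarrow> k (u, 0) = (g u, 0)"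
      by (rule real_analytic_onE[OF s t F G g x]) (rule that)
    have "g x \<in> V" using gUV x by blast
    then obtain W' h where W': "openin (top_of_set (G \<times> G)) W'" "(g x, 0) \<in> W'"
      "power_series_on ?t ?u (G \<times> G) (H \<times> H) W' h"
      "\<And>u. (u, 0) \<in> W' \<Longrightarrow> h (u, 0) = (f u, 0)"
      by (rule real_analytic_onE[OF t u G H f]) blast
    \<comment> \<open>Away from the real points the inner extension may leave the domain
      \<open>W'\<close> of the outer one; continuity makes the part that stays inside open.\<close>
    define O' where "O' = W \<inter> k -` W'"
    have O: "openin (top_of_set (F \<times> F)) O'"
    proof (rule openin_trans[OF _ W(1)])
      have "k \<in> W \<rightarrow> G \<times> G" using power_series_onD(1)[OF W(3)] by blast
      then show "openin (top_of_set W) O'" unfolding O'_def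
        by (rule continuous_openin_preimage[OF power_series_onD(2)[OF W(3)] _ W'(1)])
    qed
    have x0: "(x, 0) \<in> O'" using W(2,5) W'(2) by (simp add: O'_def)
    have kO: "power_series_on ?s ?t (F \<times> F) (G \<times> G) O' k"
      by (rule power_series_on_subset[OF sC tC FC GC O _ W(3)]) (simp add: O'_def)
    have im: "k ` O' \<subseteq> W'" by (auto simp: O'_def)
    obtain p O1 where e: "expansion_at ?s ?t (F \<times> F) (G \<times> G) k (x, 0) p O1"
      using power_series_onD(3)[OF kO x0] by blast
    have kx: "k (x, 0) = (g x, 0)" by (rule W(5)[OF W(2)])
    obtain p' O2 where e': "expansion_at ?t ?u (G \<times> G) (H \<times> H) h (g x, 0) p' O2"
      using power_series_onD(3)[OF W'(3,2)] by blast
    obtain r O3 where "expansion_at ?s ?u (F \<times> F) (H \<times> H) (\<lambda>x. h (k x)) (x, 0) r O3"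
      "\<And>v. v \<in> F \<times> F \<Longrightarrow> r 1 v = p' 1 (p 1 v)"
      by (rule expansion_at_compose[OF sC tC uC FC GC HC O W'(1) power_series_onD(2)[OF kO] power_series_onD(2)[OF W'(3)]
          im x0 e e'[folded kx]]) blast
    moreover have "power_series_on ?s ?u (F \<times> F) (H \<times> H) O' (\<lambda>x. h (k x))"
      by (rule power_series_on_compose(1)[OF sC tC uC FC GC HC O W'(1) W'(3) kO im])
    moreover have "u \<in> U \<and> k (u, 0) = (g u, 0) \<and> h (g u, 0) = (f (g u), 0)" if "(u, 0) \<in> O'" for u
    proof -
      have uW: "(u, 0) \<in> W" and "k (u, 0) \<in> W'" using that by (simp_all add: O'_def)
      then have "(g u, 0) \<in> W'" using W(5)[OF uW] by simp
      then show ?thesis using W(4)[OF uW] W(5)[OF uW] W'(4) by blast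
    qed
    ultimately show ?thesis using O x0 kO e e' W'
      by (intro exI[of _ O'] exI[of _ k] exI[of _ h] exI[of _ p] exI[of _ p'] exI[of _ r] exI[of _ O1] exI[of _ O2] exI[of _ O3])
        (intro conjI exI[of _ W'], simp_all)
  qed
  show comp: "real_analytic_on s u F H U (\<lambda>x. f (g x))"
  proof (rule real_analytic_onI[OF s u F H])
    show "(\<lambda>x. f (g x)) ` U \<subseteq> H" using real_analytic_on_image[OF t u G H f] gUV by blast
    fix x assume "x \<in> U"
    from main[OF this] obtain W k h p' O2 where "openin (top_of_set (F \<times> F)) W" "(x, 0) \<in> W"
      and "power_series_on ?s ?t (F \<times> F) (G \<times> G) W k"
      and "expansion_at ?t ?u (G \<times> G) (H \<times> H) h (g x, 0) p' O2" and
      "power_series_on ?s ?u (F \<times> F) (H \<times> H) W (\<lambda>x. h (k x))"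
      "\<forall>u. (u, 0) \<in> W \<longrightarrow> u \<in> U \<and> k (u, 0) = (g u, 0) \<and> h (g u, 0) = (f (g u), 0)"
      by (elim exE conjE) (rule that)
    then show "\<exists>W h. openin (top_of_set (F \<times> F)) W \<and> (x, 0) \<in> W \<and>
        power_series_on ?s ?u (F \<times> F) (H \<times> H) W h \<and>
        (\<forall>u. (u, 0) \<in> W \<longrightarrow> u \<in> U \<and> h (u, 0) = (f (g u), 0))"
      by (intro exI[of _ W] exI[of _ "\<lambda>x. h (k x)"]) simp
  qed
  assume K: "real_scalars TYPE('k)" and x: "x \<in> U" and v: "v \<in> F"
  from main[OF x] obtain W k h p p' r O1 O2 O3 W' where W: "openin (top_of_set (F \<times> F)) W" "(x, 0) \<in> W"
    and hk: "power_series_on ?s ?u (F \<times> F) (H \<times> H) W (\<lambda>x. h (k x))"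
    and k: "power_series_on ?s ?t (F \<times> F) (G \<times> G) W k"
    and eq: "\<forall>u. (u, 0) \<in> W \<longrightarrow> u \<in> U \<and> k (u, 0) = (g u, 0) \<and> h (g u, 0) = (f (g u), 0)"
    and e: "expansion_at ?s ?t (F \<times> F) (G \<times> G) k (x, 0) p O1"
    and e': "expansion_at ?t ?u (G \<times> G) (H \<times> H) h (g x, 0) p' O2"
    and er: "expansion_at ?s ?u (F \<times> F) (H \<times> H) (\<lambda>x. h (k x)) (x, 0) r O3"
    and r: "\<forall>v\<in>F \<times> F. r 1 v = p' 1 (p 1 v)"
    and W': "openin (top_of_set (G \<times> G)) W'" "(g x, 0) \<in> W'"
    and h: "power_series_on ?t ?u (G \<times> G) (H \<times> H) W' h"
    and heq: "\<forall>u. (u, 0) \<in> W' \<longrightarrow> h (u, 0) = (f u, 0)"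
    by (elim exE conjE) (rule that)
  have gx: "g x \<in> V" using x gUV by blast
  have v0: "(v, 0) \<in> F \<times> F" using v E.subspace_0[OF F] by simp
  have keq: "\<forall>u. (u, 0) \<in> W \<longrightarrow> k (u, 0) = (g u, 0)" using eq by blast
  note dg = real_analytic_on_deriv[OF s t F G K g x W k keq e v]
  have hkeq: "\<forall>u. (u, 0) \<in> W \<longrightarrow> h (k (u, 0)) = (f (g u), 0)" using eq by simp
  note dfg = real_analytic_on_deriv[OF s u F H K comp x W hk hkeq er v]
  have pv: "fst (p 1 (v, 0)) \<in> G"
    using homogeneous_polynomial_mem[OF expansion_atD(1)[OF e] v0, of 1] by (simp add: mem_Times_iff)
  note df = real_analytic_on_deriv[OF t u G H K f gx W' h heq e' pv]
  have "p 1 (v, 0) = (fst (p 1 (v, 0)), 0)" using dg(2) by (metis prod.collapse)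
  then have "fst (r 1 (v, 0)) = fst (p' 1 (fst (p 1 (v, 0)), 0))" using r v0 by metis
  then show "dir_deriv s u (\<lambda>x. f (g x)) x v = dir_deriv t u f (g x) (dir_deriv s t g x v)"
    using dir_deriv_eq[OF dfg(1)] dir_deriv_eq[OF dg(1)] dir_deriv_eq[OF df(1)] by simp
qed

section \<open>Complex scalars\<close>

text \<open>The class axiom supplies a square root \<open>i\<close> of -1 such that 1 and
  \<open>i\<close> span the scalars, and \<open>\<iota>\<close> sends \<open>a + b \<i>\<close> to
  \<open>a + b i\<close>. It transports the composition theorem, whose proof uses roots of unity,
  from \<open>complex\<close> to \<open>'k\<close>.\<close>

lemma complex_scalarsE:
  assumes "\<not> real_scalars TYPE('k::real_or_complex)"
  obtains \<iota> :: "complex \<Rightarrow> 'k::real_or_complex" where "\<iota> 1 = 1" "\<And>x y. \<iota> (x + y) = \<iota> x + \<iota> y"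
    "\<And>x y. \<iota> (x * y) = \<iota> x * \<iota> y" "\<And>r. \<iota> (of_real r) = of_real r" "surj \<iota>" "continuous_on UNIV \<iota>"
proof -
  have "\<not> (\<forall>z::'k. \<exists>a. z = a *\<^sub>R 1)"
    using assms unfolding real_scalars_def Reals_def of_real_def by blast
  then obtain i :: 'k where i: "i * i = - 1" "\<And>z. \<exists>a b. z = a *\<^sub>R 1 + b *\<^sub>R i"
    using real_or_complex by blast
  define \<iota> where "\<iota> z = of_real (Re z) + of_real (Im z) * i" for z
  show ?thesis
  proof (rule that[of \<iota>])
    show "\<iota> (x * y) = \<iota> x * \<iota> y" for x y
    proof -
      have "\<iota> x * \<iota> y = of_real (Re x) * of_real (Re y) + of_real (Im x) * of_real (Im y) * (i * i)
          + (of_real (Re x) * of_real (Im y) + of_real (Im x) * of_real (Re y)) * i"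
        by (simp add: \<iota>_def algebra_simps)
      then show ?thesis unfolding i(1) by (simp add: \<iota>_def algebra_simps)
    qed
    show "surj \<iota>"
    proof (rule surjI)
      define g where "g z = (SOME w. \<iota> w = z)" for z
      fix z :: 'k
      obtain a b where "z = a *\<^sub>R 1 + b *\<^sub>R i" using i(2) by blast
      then have "\<iota> (Complex a b) = z" by (simp add: \<iota>_def scaleR_conv_of_real)
      then show "\<iota> (g z) = z" unfolding g_def by (rule someI)
    qed
    show "continuous_on UNIV \<iota>" unfolding \<iota>_def by (intro continuous_intros)
  qed (simp_all add: \<iota>_def algebra_simps)
qed

context
  fixes \<iota> :: "complex \<Rightarrow> 'k::real_or_complex"
  assumes \<iota>: "\<iota> 1 = 1" "\<And>x y. \<iota> (x + y) = \<iota> x + \<iota> y"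
    "\<And>x y. \<iota> (x * y) = \<iota> x * \<iota> y" "\<And>r. \<iota> (of_real r) = of_real r" "surj \<iota>" "continuous_on UNIV \<iota>"
begin

lemma locally_convex_space_pullback:
  assumes s: "locally_convex_space (s :: 'k \<Rightarrow> 'e::{topological_ab_group_add, t2_space} \<Rightarrow> 'e)"
  shows "locally_convex_space (\<lambda>z. s (\<iota> z))"
proof -
  interpret E: locally_convex_space s by fact
  show ?thesis
  proof
    show "continuous_on UNIV (\<lambda>(c, x). s (\<iota> c) x)"
      unfolding case_prod_unfold
      by (intro E.continuous_on_scale continuous_on_compose2[OF \<iota>(6)] continuous_on_fst continuous_on_snd
          continuous_on_id) simp
    show "\<exists>V. open V \<and> 0 \<in> V \<and> V \<subseteq> U \<and> (\<forall>x\<in>V. \<forall>y\<in>V. \<forall>a\<in>{0..1}.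
        s (\<iota> (of_real a)) x + s (\<iota> (of_real (1 - a))) y \<in> V)" if "open U" "0 \<in> U" for U
      unfolding \<iota>(4) by (rule E.convex_neighbourhoods[OF that])
  qed (simp_all add: \<iota>(1-3) E.scale_right_distrib E.scale_left_distrib)
qed

lemma subspace_pullback:
  assumes s: "locally_convex_space (s :: 'k \<Rightarrow> 'e::{topological_ab_group_add, t2_space} \<Rightarrow> 'e)"
    and F: "module.subspace s F"
  shows "module.subspace (\<lambda>z. s (\<iota> z)) F"
proof -
  interpret E: locally_convex_space s by fact
  interpret P: locally_convex_space "\<lambda>z. s (\<iota> z)" by (rule locally_convex_space_pullback[OF s])
  show ?thesis using F by (simp add: P.subspace_def E.subspace_def)
qed

text \<open>Since \<open>\<iota>\<close> is surjective, homogeneity for all scalars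
  \<open>\<iota> z\<close> is homogeneity for all scalars; addition and topology are
  untouched.\<close>

lemma homogeneous_polynomial_pullback:
  "homogeneous_polynomial_on (\<lambda>z. s (\<iota> z)) (\<lambda>z. t (\<iota> z)) F G n p \<longleftrightarrow> homogeneous_polynomial_on s t F G n p"
proof -
  have "(\<forall>c. P (\<iota> c)) \<longleftrightarrow> (\<forall>c. P c)" for P using \<iota>(5) by (metis surj_def)
  note * = this[of "\<lambda>c. \<forall>u\<in>F. \<beta> (y(i := s c u)) = t c (\<beta> (y(i := u)))" for \<beta> y i]
  show ?thesis unfolding homogeneous_polynomial_on_def multilinear_on_def * ..
qed

lemma expansion_at_pullback:
  "expansion_at (\<lambda>z. s (\<iota> z)) (\<lambda>z. t (\<iota> z)) F G f x p V \<longleftrightarrow> expansion_at s t F G f x p V"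
  unfolding expansion_at_def homogeneous_polynomial_pullback ..

lemma power_series_on_pullback:
  "power_series_on (\<lambda>z. s (\<iota> z)) (\<lambda>z. t (\<iota> z)) F G U f \<longleftrightarrow> power_series_on s t F G U f"
  unfolding power_series_on_iff expansion_at_pullback ..

end

lemma complex_power_series_on_compose:
  fixes s :: "'k::real_or_complex \<Rightarrow> 'e::{topological_ab_group_add, t2_space} \<Rightarrow> 'e"
    and t :: "'k \<Rightarrow> 'f::{topological_ab_group_add, t2_space} \<Rightarrow> 'f"
    and u :: "'k \<Rightarrow> 'h::{topological_ab_group_add, t2_space} \<Rightarrow> 'h"
  assumes K: "\<not> real_scalars TYPE('k)"
    and s: "locally_convex_space s" and t: "locally_convex_space t" and u: "locally_convex_space u"
    and F: "module.subspace s F" and G: "module.subspace t G" and H: "module.subspace u H"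
    and U: "openin (top_of_set F) U" and V: "openin (top_of_set G) V"
    and f: "power_series_on t u G H V f" and g: "power_series_on s t F G U g" and gUV: "g ` U \<subseteq> V"
  shows "power_series_on s u F H U (\<lambda>x. f (g x))"
    and "x \<in> U \<Longrightarrow> v \<in> F \<Longrightarrow> dir_deriv s u (\<lambda>x. f (g x)) x v = dir_deriv t u f (g x) (dir_deriv s t g x v)"
proof -
  obtain \<iota> :: "complex \<Rightarrow> 'k" where \<iota>: "\<iota> 1 = 1" "\<And>x y. \<iota> (x + y) = \<iota> x + \<iota> y"
    "\<And>x y. \<iota> (x * y) = \<iota> x * \<iota> y" "\<And>r. \<iota> (of_real r) = of_real r" "surj \<iota>" "continuous_on UNIV \<iota>"
    by (rule complex_scalarsE[OF K]) (rule that)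
  note L = locally_convex_space_pullback[OF \<iota>] and S = subspace_pullback[OF \<iota>]
    and e = expansion_at_pullback[OF \<iota>] and p = power_series_on_pullback[OF \<iota>]
  show "power_series_on s u F H U (\<lambda>x. f (g x))"
    using power_series_on_compose(1)[OF L[OF s] L[OF t] L[OF u] S[OF s F] S[OF t G] S[OF u H] U V
        p[THEN iffD2, OF f] p[THEN iffD2, OF g] gUV] unfolding p .
  assume x: "x \<in> U" and v: "v \<in> F"
  obtain q Vg where eg: "expansion_at s t F G g x q Vg" using power_series_onD(3)[OF g x] by blast
  have "g x \<in> V" using x gUV by blast
  then obtain q' Vf where ef: "expansion_at t u G H f (g x) q' Vf" using power_series_onD(3)[OF f] by blast
  obtain r W where er: "expansion_at (\<lambda>z. s (\<iota> z)) (\<lambda>z. u (\<iota> z)) F H (\<lambda>x. f (g x)) x r W"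
    and r: "\<And>v. v \<in> F \<Longrightarrow> r 1 v = q' 1 (q 1 v)"
    by (rule expansion_at_compose[OF L[OF s] L[OF t] L[OF u] S[OF s F] S[OF t G] S[OF u H] U V
        power_series_onD(2)[OF g] power_series_onD(2)[OF f] gUV x e[THEN iffD2, OF eg] e[THEN iffD2, OF ef]]) blast
  have qG: "q 1 v \<in> G" by (rule homogeneous_polynomial_mem[OF expansion_atD(1)[OF eg] v])
  show "dir_deriv s u (\<lambda>x. f (g x)) x v = dir_deriv t u f (g x) (dir_deriv s t g x v)"
    using dir_deriv_eq[OF expansion_at_deriv[OF s u F H er[unfolded e] v]]
      dir_deriv_eq[OF expansion_at_deriv[OF s t F G eg v]]
      dir_deriv_eq[OF expansion_at_deriv[OF t u G H ef qG]] r[OF v] by simp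
qed

section \<open>Maps of class $C^r$\<close>

lemma Cr_on_Finite: "Cr_on (Finite n) s t F G U f \<longleftrightarrow> Ck_on s t F G n U f"
  and Cr_on_Infinite: "Cr_on Infinite s t F G U f \<longleftrightarrow> (\<forall>n. Ck_on s t F G n U f)"
  and Cr_on_Analytic: "Cr_on Analytic s t F G U f \<longleftrightarrow>
    (real_scalars TYPE('k) \<longrightarrow> real_analytic_on s t F G U f) \<and>
    (\<not> real_scalars TYPE('k) \<longrightarrow> power_series_on s t F G U f)"
  for s :: "'k::real_or_complex \<Rightarrow> 'e::{ab_group_add, t2_space} \<Rightarrow> 'e"
    and f :: "'e \<Rightarrow> 'f::{ab_group_add, t2_space}"
  by (simp_all add: Cr_on_def)

lemmas Cr_on_iffs = Cr_on_Finite Cr_on_Infinite Cr_on_Analytic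

context
  fixes s :: "'k::real_or_complex \<Rightarrow> 'e::{topological_ab_group_add, t2_space} \<Rightarrow> 'e"
    and t :: "'k \<Rightarrow> 'f::{topological_ab_group_add, t2_space} \<Rightarrow> 'f"
    and F :: "'e set" and G :: "'f set"
  assumes s: "locally_convex_space s" and t: "locally_convex_space t"
    and F: "module.subspace s F" and G: "module.subspace t G"
begin

interpretation E: locally_convex_space s by (rule s)
interpretation T: locally_convex_space t by (rule t)

lemma Cr_on_continuous:
  assumes f: "Cr_on r s t F G U f" and U: "openin (top_of_set F) U"
  shows "continuous_on U f"
proof -
  have UF: "U \<subseteq> F" using U openin_imp_subset by blast
  have "continuous_on U f" if "Ck_on s t F G n U f" for n
    using Ck_on_continuous[OF that le0, of U "\<lambda>x. x" "\<lambda>_ _. 0"] by (simp add: continuous_on_id)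
  then show ?thesis using f UF
    by (cases r; cases "real_scalars TYPE('k)")
      (auto simp: Cr_on_iffs real_analytic_on_continuous[OF s t F G] power_series_onD(2))
qed

lemma Cr_on_cong:
  assumes f: "Cr_on r s t F G U f" and U: "openin (top_of_set F) U" and eq: "\<And>x. x \<in> U \<Longrightarrow> f x = g x"
  shows "Cr_on r s t F G U g"
proof -
  have "Ck_on s t F G n U g" if "Ck_on s t F G n U f" for n
    using Ck_on_cong[OF s F U that eq] .
  moreover have "real_analytic_on s t F G U g" if "real_analytic_on s t F G U f"
    using real_analytic_on_cong[OF s t F G that eq] .
  moreover have "power_series_on s t F G U g" if "power_series_on s t F G U f"
    using power_series_on_cong[OF s t F G that eq] .
  ultimately show ?thesis using f by (cases r) (simp_all add: Cr_on_iffs)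
qed

lemma Cr_on_subset:
  assumes U: "openin (top_of_set F) U'" "U' \<subseteq> U" and f: "Cr_on r s t F G U f"
  shows "Cr_on r s t F G U' f"
proof -
  have "Ck_on s t F G n U' f" if "Ck_on s t F G n U f" for n
    by (rule Ck_on_subset[OF that U(2)])
  moreover have "real_analytic_on s t F G U' f" if "real_analytic_on s t F G U f"
    by (rule real_analytic_on_subset[OF s t F G U that])
  moreover have "power_series_on s t F G U' f" if "power_series_on s t F G U f"
    by (rule power_series_on_subset[OF s t F G U that])
  ultimately show ?thesis using f by (cases r) (simp_all add: Cr_on_iffs)
qed

lemma Cr_on_locally:
  assumes loc: "\<And>x. x \<in> U \<Longrightarrow> \<exists>U'. openin (top_of_set F) U' \<and> x \<in> U' \<and> U' \<subseteq> U \<and> Cr_on r s t F G U' f"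
    and UF: "U \<subseteq> F"
  shows "Cr_on r s t F G U f"
proof -
  have 1: "Ck_on s t F G n U f"
    if "\<And>U'. Cr_on r s t F G U' f \<Longrightarrow> Ck_on s t F G n U' f" for n
    by (rule Ck_on_locally[OF _ UF]) (use loc that in blast)
  have 2: "real_analytic_on s t F G U f"
    if "\<And>U'. Cr_on r s t F G U' f \<Longrightarrow> real_analytic_on s t F G U' f"
    by (rule real_analytic_on_locally[OF s t F G]) (use loc that in blast)
  have 3: "power_series_on s t F G U f"
    if "\<And>U'. Cr_on r s t F G U' f \<Longrightarrow> power_series_on s t F G U' f"
    by (rule power_series_on_locally[OF s t F G _ UF]) (use loc that in blast)
  show ?thesis
  proof (cases r)
    case (Finite n)
    then show ?thesis using 1[of n] by (simp add: Cr_on_iffs)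
  next
    case Infinite
    then show ?thesis using 1 by (simp add: Cr_on_iffs)
  next
    case Analytic
    then show ?thesis using 2 3 by (simp add: Cr_on_iffs)
  qed
qed

lemma Cr_on_add:
  assumes U: "openin (top_of_set F) U" and f: "Cr_on r s t F G U f" and g: "Cr_on r s t F G U g"
  shows "Cr_on r s t F G U (\<lambda>x. f x + g x)"
proof -
  have "Ck_on s t F G n U (\<lambda>x. f x + g x)" if "Ck_on s t F G n U f" "Ck_on s t F G n U g" for n
    by (rule Ck_on_add[OF s t F U G that])
  moreover have "real_analytic_on s t F G U (\<lambda>x. f x + g x)"
    if "real_analytic_on s t F G U f" "real_analytic_on s t F G U g"
    by (rule real_analytic_on_add[OF s t F G that])
  moreover have "power_series_on s t F G U (\<lambda>x. f x + g x)"
    if "power_series_on s t F G U f" "power_series_on s t F G U g"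
    by (rule power_series_on_add[OF s t F G that])
  ultimately show ?thesis using f g by (cases r) (simp_all add: Cr_on_iffs)
qed

lemma Cr_on_linear:
  assumes L: "continuous_linear_on s t F G L" and U: "openin (top_of_set F) U"
  shows "Cr_on r s t F G U L"
  using Ck_on_linear[OF s t F U G L] real_analytic_on_linear[OF s t F G L U] power_series_on_linear[OF s t F G L U]
  by (cases r) (simp_all add: Cr_on_iffs)

lemma Cr_on_restrict_subspace:
  assumes U: "openin (top_of_set F) U" and f: "Cr_on r s t F G U f"
    and F': "module.subspace s F'" "F' \<subseteq> F" and G': "module.subspace t G'" "closed G'"
    and im: "f ` (U \<inter> F') \<subseteq> G'"
  shows "Cr_on r s t F' G' (U \<inter> F') f"
proof -
  have "Ck_on s t F' G' n (U \<inter> F') f" if "Ck_on s t F G n U f" for n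
    by (rule Ck_on_restrict_subspace[OF s t F U that F' G' im])
  moreover have "real_analytic_on s t F' G' (U \<inter> F') f" if "real_analytic_on s t F G U f"
    by (rule real_analytic_on_restrict_subspace[OF s t F G U that F' G' im])
  moreover have "power_series_on s t F' G' (U \<inter> F') f" if "power_series_on s t F G U f"
    by (rule power_series_on_restrict_subspace[OF s t F G U that F' G' im])
  ultimately show ?thesis using f by (cases r) (simp_all add: Cr_on_iffs)
qed

lemma Cr_on_deriv:
  assumes K: "admissible_regularity TYPE('k) r" and U: "openin (top_of_set F) U"
    and f: "Cr_on r s t F G U f" and x: "x \<in> U"
  shows "continuous_linear_on s t F G (dir_deriv s t f x)" (is ?L)
    and "v \<in> F \<Longrightarrow> (diff_quot s t f x v \<longlongrightarrow> dir_deriv s t f x v) (at 0)"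
proof -
  have C1: "?L \<and> (\<forall>v\<in>F. (diff_quot s t f x v \<longlongrightarrow> dir_deriv s t f x v) (at 0))"
    if C: "Ck_on s t F G n U f" and n: "0 < n" for n
  proof -
    have n1: "1 \<le> n" using n by simp
    have D: "iter_dir_deriv s t 1 f x y = dir_deriv s t f x (y 0)" for y by simp
    have der: "(diff_quot s t f x v \<longlongrightarrow> dir_deriv s t f x v) (at 0)" "dir_deriv s t f x v \<in> G" if "v \<in> F" for v
      using Ck_on_deriv[OF C n x, of "\<lambda>_. v"] that by simp_all
    have 0: "0 \<in> F" by (rule E.subspace_0[OF F])
    have "dir_deriv s t f x (v + w) = dir_deriv s t f x v + dir_deriv s t f x w" if "v \<in> F" "w \<in> F" for v w
      using Ck_on_iter_linear(1)[OF s t F U C n1 x, of 0 "\<lambda>_. 0" v w] that 0 unfolding D by simp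
    moreover have "dir_deriv s t f x (s c v) = t c (dir_deriv s t f x v)" if "v \<in> F" for c v
      using Ck_on_iter_linear(2)[OF s t F U C n1 x, of 0 "\<lambda>_. 0" v 0 c] that 0 unfolding D by simp
    moreover have "continuous_on F (dir_deriv s t f x)"
      using Ck_on_continuous[OF C n1, of F "\<lambda>_. x" "\<lambda>v _. v"] x unfolding D
      by (simp add: continuous_on_id image_subset_iff)
    ultimately show ?thesis using der unfolding continuous_linear_on_def by auto
  qed
  have C2: "?L \<and> (\<forall>v\<in>F. (diff_quot s t f x v \<longlongrightarrow> dir_deriv s t f x v) (at 0))"
    if C: "power_series_on s t F G U f"
  proof -
    obtain p V where e: "expansion_at s t F G f x p V" using power_series_onD(3)[OF C x] by blast
    note p1 = expansion_atD(1)[OF e, of 1]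
    have der: "(diff_quot s t f x v \<longlongrightarrow> p 1 v) (at 0)" if "v \<in> F" for v
      by (rule expansion_at_deriv[OF s t F G e that])
    have D: "dir_deriv s t f x v = p 1 v" if "v \<in> F" for v by (rule dir_deriv_eq[OF der[OF that]])
    have "continuous_on F (dir_deriv s t f x)"
      using homogeneous_polynomial_continuous[OF p1] by (rule continuous_on_eq) (simp add: D)
    moreover have "dir_deriv s t f x (v + w) = dir_deriv s t f x v + dir_deriv s t f x w" if "v \<in> F" "w \<in> F" for v w
      using homogeneous_polynomial_one_add[OF s F p1 that] D that E.subspace_add[OF F that] by simp
    moreover have "dir_deriv s t f x (s c v) = t c (dir_deriv s t f x v)" if "v \<in> F" for c v
      using homogeneous_polynomial_scale[OF s t F p1 that, of c] D that E.subspace_scale[OF F that] by simp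
    moreover have "dir_deriv s t f x v \<in> G" if "v \<in> F" for v
      using homogeneous_polynomial_mem[OF p1 that] D[OF that] by simp
    ultimately show ?thesis using der D unfolding continuous_linear_on_def by auto
  qed
  have C3: "?L \<and> (\<forall>v\<in>F. (diff_quot s t f x v \<longlongrightarrow> dir_deriv s t f x v) (at 0))"
    if "real_scalars TYPE('k)" and C: "real_analytic_on s t F G U f"
    using real_analytic_on_deriv_linear[OF s t F G that x] by blast
  have "?L \<and> (\<forall>v\<in>F. (diff_quot s t f x v \<longlongrightarrow> dir_deriv s t f x v) (at 0))"
  proof (cases r)
    case (Finite n)
    \<comment> \<open>Over real scalars order 0 is excluded, and over complex scalars every finite
      order is; a first derivative thus exists.\<close>
    then have "0 < n" using K by (cases "real_scalars TYPE('k)") (auto simp: admissible_regularity_def)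
    then show ?thesis using C1[of n] f Finite by (simp add: Cr_on_iffs)
  next
    case Infinite
    then show ?thesis using C1[of 1] f by (simp add: Cr_on_iffs)
  next
    case Analytic
    then show ?thesis using C2 C3 f by (cases "real_scalars TYPE('k)") (simp_all add: Cr_on_iffs)
  qed
  then show ?L "v \<in> F \<Longrightarrow> (diff_quot s t f x v \<longlongrightarrow> dir_deriv s t f x v) (at 0)" by blast+
qed

end

lemma Cr_on_compose:
  fixes s :: "'k::real_or_complex \<Rightarrow> 'e::{topological_ab_group_add, t2_space} \<Rightarrow> 'e"
    and t :: "'k \<Rightarrow> 'f::{topological_ab_group_add, t2_space} \<Rightarrow> 'f"
    and u :: "'k \<Rightarrow> 'h::{topological_ab_group_add, t2_space} \<Rightarrow> 'h"
  assumes s: "locally_convex_space s" and t: "locally_convex_space t" and u: "locally_convex_space u"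
    and F: "module.subspace s F" and G: "module.subspace t G" and H: "module.subspace u H"
    and U: "openin (top_of_set F) U" and V: "openin (top_of_set G) V"
    and f: "Cr_on r t u G H V f" and g: "Cr_on r s t F G U g" and gUV: "g ` U \<subseteq> V"
  shows "Cr_on r s u F H U (\<lambda>x. f (g x))"
    and "admissible_regularity TYPE('k) r \<Longrightarrow> x \<in> U \<Longrightarrow> v \<in> F \<Longrightarrow>
      dir_deriv s u (\<lambda>x. f (g x)) x v = dir_deriv t u f (g x) (dir_deriv s t g x v)"
proof -
  note C1 = Ck_on_compose[OF s t u F G H U V _ _ gUV] and C1' = Ck_on_chain_rule[OF s t u F G H U V _ _ gUV]
  note C2 = complex_power_series_on_compose[OF _ s t u F G H U V _ _ gUV]
  note C3 = real_analytic_on_compose[OF s t u F G H _ _ gUV]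
  show "Cr_on r s u F H U (\<lambda>x. f (g x))"
    using f g C1 C2(1) C3(1) by (cases r) (simp_all add: Cr_on_iffs)
  assume K: "admissible_regularity TYPE('k) r" and x: "x \<in> U" and v: "v \<in> F"
  show "dir_deriv s u (\<lambda>x. f (g x)) x v = dir_deriv t u f (g x) (dir_deriv s t g x v)"
  proof (cases r)
    case (Finite n)
    then have "0 < n" using K by (cases "real_scalars TYPE('k)") (auto simp: admissible_regularity_def)
    then show ?thesis using C1'[OF _ _ _ x v, of n] f g Finite by (simp add: Cr_on_iffs)
  next
    case Infinite
    then show ?thesis using C1'[OF _ _ _ x v, of 1] f g by (simp add: Cr_on_iffs)
  next
    case Analytic
    then show ?thesis using C2(2)[OF _ _ _ x v] C3(2)[OF _ _ _ x v] f g
      by (cases "real_scalars TYPE('k)") (simp_all add: Cr_on_iffs)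
  qed
qed

section \<open>Charts\<close>

text \<open>An injective, continuous and open map is a homeomorphism onto its image. Openness is
  tested in \<open>X\<close> and \<open>F\<close> themselves, which spares the passage to the
  subspace topologies of domain and image.\<close>

lemma is_chartI:
  assumes "chart_model c = F" "openin X (chart_dom c)" "inj_on (chart_map c) (chart_dom c)"
    and im: "\<And>Q. openin X Q \<Longrightarrow> Q \<subseteq> chart_dom c \<Longrightarrow> openin (top_of_set F) (chart_map c ` Q)"
    and pre: "\<And>V. openin (top_of_set F) V \<Longrightarrow> openin X {x \<in> chart_dom c. chart_map c x \<in> V}"
  shows "is_chart F X c"
proof -
  have D: "chart_dom c \<subseteq> topspace X" using assms(2) openin_subset by blast
  have I: "openin (top_of_set F) (chart_image c)" unfolding chart_image_def by (rule im[OF assms(2)]) simp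
  have IF: "chart_image c \<subseteq> F" using I openin_imp_subset by blast
  have "homeomorphic_map (subtopology X (chart_dom c)) (top_of_set (chart_image c)) (chart_map c)"
  proof (rule bijective_open_imp_homeomorphic_map)
    show "continuous_map (subtopology X (chart_dom c)) (top_of_set (chart_image c)) (chart_map c)"
      unfolding continuous_map
    proof (intro conjI allI impI)
      show "chart_map c ` topspace (subtopology X (chart_dom c)) \<subseteq> topspace (top_of_set (chart_image c))"
        by (auto simp: chart_image_def)
      fix V assume "openin (top_of_set (chart_image c)) V"
      then have V: "openin (top_of_set F) V" using I by (metis openin_trans)
      have "openin (subtopology X (chart_dom c)) {x \<in> chart_dom c. chart_map c x \<in> V}"
        using pre[OF V] assms(2) by (auto simp: openin_open_subtopology)
      moreover have "{x \<in> topspace (subtopology X (chart_dom c)). chart_map c x \<in> V} = {x \<in> chart_dom c. chart_map c x \<in> V}"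
        using D by auto
      ultimately show "openin (subtopology X (chart_dom c)) {x \<in> topspace (subtopology X (chart_dom c)). chart_map c x \<in> V}"
        by simp
    qed
    show "open_map (subtopology X (chart_dom c)) (top_of_set (chart_image c)) (chart_map c)"
      unfolding open_map_def
    proof (intro allI impI)
      fix Q assume "openin (subtopology X (chart_dom c)) Q"
      then have Q: "openin X Q" "Q \<subseteq> chart_dom c"
        using assms(2) by (simp_all add: openin_open_subtopology)
      have "openin (top_of_set F) (chart_map c ` Q)" by (rule im[OF Q])
      moreover have "chart_map c ` Q \<subseteq> chart_image c" using Q(2) by (auto simp: chart_image_def)
      ultimately show "openin (top_of_set (chart_image c)) (chart_map c ` Q)"
        using IF by (meson openin_subset_trans)
    qed
  qed (use D assms(3) in \<open>auto simp: chart_image_def Int_absorb1\<close>)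
  then show ?thesis using assms(1,2) I by (simp add: is_chart_def)
qed

lemma is_chartD:
  assumes "is_chart F X c"
  shows "chart_model c = F" "openin X (chart_dom c)" "openin (top_of_set F) (chart_image c)"
    "homeomorphic_map (subtopology X (chart_dom c)) (top_of_set (chart_image c)) (chart_map c)"
    "chart_dom c \<subseteq> topspace X" "inj_on (chart_map c) (chart_dom c)"
proof -
  show *: "chart_model c = F" "openin X (chart_dom c)" "openin (top_of_set F) (chart_image c)"
    "homeomorphic_map (subtopology X (chart_dom c)) (top_of_set (chart_image c)) (chart_map c)"
    using assms by (simp_all add: is_chart_def)
  show D: "chart_dom c \<subseteq> topspace X" using *(2) by (rule openin_subset)
  show "inj_on (chart_map c) (chart_dom c)"
    using homeomorphic_imp_injective_map[OF *(4)] D by (simp add: Int_absorb1)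
qed

lemma is_chart_open_image:
  assumes c: "is_chart F X c" and Q: "openin X Q" "Q \<subseteq> chart_dom c"
  shows "openin (top_of_set F) (chart_map c ` Q)"
proof -
  have "openin (subtopology X (chart_dom c)) Q"
    using Q is_chartD(2)[OF c] by (simp add: openin_open_subtopology)
  then have "openin (top_of_set (chart_image c)) (chart_map c ` Q)"
    using homeomorphic_imp_open_map[OF is_chartD(4)[OF c]] by (simp add: open_map_def)
  then show ?thesis using is_chartD(3)[OF c] openin_trans by blast
qed

lemma is_chart_open_preimage:
  assumes c: "is_chart F X c" and V: "openin (top_of_set F) V"
  shows "openin X {x \<in> chart_dom c. chart_map c x \<in> V}"
proof -
  have "openin (top_of_set (chart_image c)) (chart_image c \<inter> V)"
    using V is_chartD(3)[OF c] by (auto simp: openin_open)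
  moreover have "continuous_map (subtopology X (chart_dom c)) (top_of_set (chart_image c)) (chart_map c)"
    by (rule homeomorphic_imp_continuous_map[OF is_chartD(4)[OF c]])
  ultimately have "openin (subtopology X (chart_dom c))
      {x \<in> topspace (subtopology X (chart_dom c)). chart_map c x \<in> chart_image c \<inter> V}"
    by (intro openin_continuous_map_preimage)
  moreover have "{x \<in> topspace (subtopology X (chart_dom c)). chart_map c x \<in> chart_image c \<inter> V} =
      {x \<in> chart_dom c. chart_map c x \<in> V}"
    using is_chartD(5)[OF c] by (auto simp: chart_image_def)
  ultimately show ?thesis using is_chartD(2)[OF c] by (simp add: openin_open_subtopology)
qed

lemma chart_inv_map: "is_chart F X c \<Longrightarrow> x \<in> chart_dom c \<Longrightarrow> chart_inv c (chart_map c x) = x"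
  unfolding chart_inv_def by (rule inv_into_f_f[OF is_chartD(6)])

lemma chart_map_mem: "is_chart F X c \<Longrightarrow> x \<in> chart_dom c \<Longrightarrow> chart_map c x \<in> F"
  using openin_imp_subset[OF is_chartD(3)[of F X c]] unfolding chart_image_def by blast

lemma local_rep_map:
  "is_chart F X c \<Longrightarrow> x \<in> chart_dom c \<Longrightarrow> local_rep c d f (chart_map c x) = chart_map d (f x)"
  by (simp add: local_rep_def chart_inv_map)

lemma is_chart_restrict:
  assumes c: "is_chart F X c" and Q: "openin X Q"
  shows "is_chart F X (Chart F (chart_dom c \<inter> Q) (chart_map c))"
proof (rule is_chartI)
  show "openin X (chart_dom (Chart F (chart_dom c \<inter> Q) (chart_map c)))" using is_chartD(2)[OF c] Q by (simp add: openin_Int)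
  show "openin (top_of_set F) (chart_map (Chart F (chart_dom c \<inter> Q) (chart_map c)) ` O')"
    if "openin X O'" "O' \<subseteq> chart_dom (Chart F (chart_dom c \<inter> Q) (chart_map c))" for O'
    using is_chart_open_image[OF c that(1)] that(2) by simp
  show "openin X {x \<in> chart_dom (Chart F (chart_dom c \<inter> Q) (chart_map c)). chart_map (Chart F (chart_dom c \<inter> Q) (chart_map c)) x \<in> V}"
    if "openin (top_of_set F) V" for V
  proof -
    have "{x \<in> chart_dom c \<inter> Q. chart_map c x \<in> V} = {x \<in> chart_dom c. chart_map c x \<in> V} \<inter> Q" by blast
    then show ?thesis using openin_Int[OF is_chart_open_preimage[OF c that] Q] by simp
  qed
  show "inj_on (chart_map (Chart F (chart_dom c \<inter> Q) (chart_map c))) (chart_dom (Chart F (chart_dom c \<inter> Q) (chart_map c)))"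
    unfolding chart.sel by (rule inj_on_subset[OF is_chartD(6)[OF c]]) simp
qed simp

text \<open>By injectivity, a point of the domain lies in \<open>N\<close> exactly if its image lies
  in \<open>F'\<close>. Hence traces on \<open>N\<close> of open sets correspond to traces on
  \<open>F'\<close>.\<close>

lemma is_chart_adapted:
  assumes c: "is_chart F X c" and F': "F' \<subseteq> F" and N: "N \<subseteq> topspace X"
    and ad: "chart_map c ` (chart_dom c \<inter> N) = chart_image c \<inter> F'"
  shows "is_chart F' (subtopology X N) (Chart F' (chart_dom c \<inter> N) (chart_map c))" (is "is_chart _ _ ?c")
proof (rule is_chartI)
  show "openin (subtopology X N) (chart_dom ?c)"
    using openin_subtopology_Int[OF is_chartD(2)[OF c]] by simp
  show "inj_on (chart_map ?c) (chart_dom ?c)" unfolding chart.sel by (rule inj_on_subset[OF is_chartD(6)[OF c]]) simp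
  show "openin (top_of_set F') (chart_map ?c ` Q)" if Q: "openin (subtopology X N) Q" "Q \<subseteq> chart_dom ?c" for Q
  proof -
    obtain O' where O': "openin X O'" "Q = O' \<inter> N"
      using Q(1)[unfolded openin_subtopology] by (elim exE conjE) (rule that)
    have "chart_map c ` Q = chart_map c ` (O' \<inter> chart_dom c) \<inter> F'"
    proof
      have "Q \<subseteq> chart_dom c \<inter> N" using Q(2) by simp
      then have "chart_map c ` Q \<subseteq> chart_image c \<inter> F'" unfolding ad[symmetric] by blast
      moreover have "Q \<subseteq> O' \<inter> chart_dom c" using Q(2) O'(2) by auto
      ultimately show "chart_map c ` Q \<subseteq> chart_map c ` (O' \<inter> chart_dom c) \<inter> F'" by blast
      show "chart_map c ` (O' \<inter> chart_dom c) \<inter> F' \<subseteq> chart_map c ` Q"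
      proof
        fix y assume "y \<in> chart_map c ` (O' \<inter> chart_dom c) \<inter> F'"
        then obtain x where x: "x \<in> O'" "x \<in> chart_dom c" "y = chart_map c x" "y \<in> F'" by blast
        then have "y \<in> chart_map c ` (chart_dom c \<inter> N)" unfolding ad by (simp add: chart_image_def)
        then obtain x' where "x' \<in> chart_dom c \<inter> N" "y = chart_map c x'" by blast
        then have "x \<in> N" using inj_onD[OF is_chartD(6)[OF c], of x x'] x by auto
        then show "y \<in> chart_map c ` Q" using x O'(2) by blast
      qed
    qed
    moreover have "openin (top_of_set F) (chart_map c ` (O' \<inter> chart_dom c))"
      by (rule is_chart_open_image[OF c openin_Int[OF O'(1) is_chartD(2)[OF c]]]) simp
    then obtain T where "open T" "chart_map c ` (O' \<inter> chart_dom c) = F \<inter> T" unfolding openin_open by (elim exE conjE) (rule that)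
    moreover have "F \<inter> T \<inter> F' = F' \<inter> T" using F' by blast
    ultimately show ?thesis by (simp add: openin_open_Int)
  qed
  show "openin (subtopology X N) {x \<in> chart_dom ?c. chart_map ?c x \<in> V}" if V: "openin (top_of_set F') V" for V
  proof -
    obtain T where T: "open T" "V = F' \<inter> T" using V by (auto simp: openin_open)
    have "openin X {x \<in> chart_dom c. chart_map c x \<in> F \<inter> T}"
      by (rule is_chart_open_preimage[OF c openin_open_Int[OF T(1)]])
    from openin_subtopology_Int[OF this]
    have "openin (subtopology X N) ({x \<in> chart_dom c. chart_map c x \<in> F \<inter> T} \<inter> N)" .
    moreover have "{x \<in> chart_dom ?c. chart_map ?c x \<in> V} = {x \<in> chart_dom c. chart_map c x \<in> F \<inter> T} \<inter> N"
      using T(2) F' ad by auto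
    ultimately show ?thesis by (simp only:)
  qed
qed simp

text \<open>Smoothness in charts on a chosen part \<open>Q\<close> of the natural domain. A
  composite through an intermediate chart is controlled only on such a part, and the parts are
  patched together afterwards.\<close>

definition Cr_between where
  "Cr_between r s t c d f Q \<longleftrightarrow> Q \<subseteq> chart_dom c \<inter> f -` chart_dom d \<and>
     Cr_on r s t (chart_model c) (chart_model d) (chart_map c ` Q) (local_rep c d f)"

lemma Cr_in_charts_iff_between:
  "Cr_in_charts r s t c d f \<longleftrightarrow> Cr_between r s t c d f (chart_dom c \<inter> f -` chart_dom d)"
  by (simp add: Cr_in_charts_def Cr_between_def)

lemma openin_dom_preimage:
  assumes "is_chart F X c" "continuous_map X Y g" "openin Y Q" "openin X O1"
  shows "openin X (O1 \<inter> g -` Q)"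
proof -
  have "O1 \<inter> g -` Q = O1 \<inter> {x \<in> topspace X. g x \<in> Q}" using openin_subset[OF assms(4)] by auto
  then show ?thesis using openin_Int[OF assms(4) openin_continuous_map_preimage[OF assms(2,3)]] by (simp only:)
qed

text \<open>The local representatives compose where \<open>g x\<close> lies in the domain of the
  intermediate chart \<open>d\<close>. The identity holds on an open set, so it also carries over to
  derivatives.\<close>

lemma Cr_between_compose:
  fixes s :: "'k::real_or_complex \<Rightarrow> 'e::{topological_ab_group_add, t2_space} \<Rightarrow> 'e"
    and t :: "'k \<Rightarrow> 'f::{topological_ab_group_add, t2_space} \<Rightarrow> 'f"
    and u :: "'k \<Rightarrow> 'h::{topological_ab_group_add, t2_space} \<Rightarrow> 'h"
  assumes s: "locally_convex_space s" and t: "locally_convex_space t" and u: "locally_convex_space u"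
    and F: "module.subspace s F" and G: "module.subspace t G" and H: "module.subspace u H"
    and c: "is_chart F X c" and d: "is_chart G Y d" and e: "is_chart H Z e"
    and g: "continuous_map X Y g" and O1: "openin X O1" and O2: "openin Y O2"
    and b1: "Cr_between r s t c d g O1" and b2: "Cr_between r t u d e f O2"
  shows "Cr_between r s u c e (f \<circ> g) (O1 \<inter> g -` O2)"
    and "admissible_regularity TYPE('k) r \<Longrightarrow> x \<in> O1 \<Longrightarrow> g x \<in> O2 \<Longrightarrow> v \<in> F \<Longrightarrow>
      dir_deriv s u (local_rep c e (f \<circ> g)) (chart_map c x) v =
      dir_deriv t u (local_rep d e f) (chart_map d (g x)) (dir_deriv s t (local_rep c d g) (chart_map c x) v)"
proof -
  have O1d: "O1 \<subseteq> chart_dom c \<inter> g -` chart_dom d" and O2d: "O2 \<subseteq> chart_dom d \<inter> f -` chart_dom e"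
    using b1 b2 by (simp_all add: Cr_between_def)
  let ?Q = "O1 \<inter> g -` O2"
  have Q: "openin X ?Q" by (rule openin_dom_preimage[OF c g O2 O1])
  define U where "U = chart_map c ` ?Q"
  have U: "openin (top_of_set F) U" unfolding U_def by (rule is_chart_open_image[OF c Q]) (use O1d in blast)
  have V: "openin (top_of_set G) (chart_map d ` O2)" by (rule is_chart_open_image[OF d O2]) (use O2d in blast)
  have m: "chart_model c = F" "chart_model d = G" "chart_model e = H"
    using is_chartD(1)[OF c] is_chartD(1)[OF d] is_chartD(1)[OF e] by simp_all
  have g1: "Cr_on r s t F G U (local_rep c d g)"
    by (rule Cr_on_subset[OF s t F G U, of "chart_map c ` O1"]) (use b1 in \<open>auto simp: U_def Cr_between_def m\<close>)
  have f1: "Cr_on r t u G H (chart_map d ` O2) (local_rep d e f)" using b2 by (simp add: Cr_between_def m)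
  have im: "local_rep c d g ` U \<subseteq> chart_map d ` O2"
    using O1d by (auto simp: U_def local_rep_map[OF c])
  have eq: "local_rep d e f (local_rep c d g y) = local_rep c e (f \<circ> g) y" if y: "y \<in> U" for y
  proof -
    obtain x where x: "x \<in> O1" "g x \<in> O2" "y = chart_map c x" using y by (auto simp: U_def)
    have "x \<in> chart_dom c" "g x \<in> chart_dom d" using x O1d by auto
    then show ?thesis by (simp add: x local_rep_map[OF c] local_rep_map[OF d])
  qed
  note comp = Cr_on_compose[OF s t u F G H U V f1 g1 im]
  have "Cr_on r s u F H U (local_rep c e (f \<circ> g))"
    by (rule Cr_on_cong[OF s u F H comp(1) U eq])
  then show "Cr_between r s u c e (f \<circ> g) ?Q" using O1d O2d by (auto simp: Cr_between_def U_def m)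
  assume K: "admissible_regularity TYPE('k) r" and x: "x \<in> O1" "g x \<in> O2" and v: "v \<in> F"
  have xU: "chart_map c x \<in> U" using x by (auto simp: U_def)
  have xc: "x \<in> chart_dom c" using x O1d by blast
  have "eventually (\<lambda>h. chart_map c x + s h v \<in> U) (at 0)" by (rule eventually_in_open_line[OF s F U xU v])
  then have "eventually (\<lambda>h. local_rep c e (f \<circ> g) (chart_map c x + s h v) =
      local_rep d e f (local_rep c d g (chart_map c x + s h v))) (at 0)"
    by (rule eventually_mono) (simp add: eq)
  from dir_deriv_cong[of "local_rep c e (f \<circ> g)" "chart_map c x" s v "\<lambda>y. local_rep d e f (local_rep c d g y)", OF this eq[OF xU, symmetric]]
  have "dir_deriv s u (local_rep c e (f \<circ> g)) (chart_map c x) v =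
      dir_deriv s u (\<lambda>y. local_rep d e f (local_rep c d g y)) (chart_map c x) v" .
  then show "dir_deriv s u (local_rep c e (f \<circ> g)) (chart_map c x) v =
      dir_deriv t u (local_rep d e f) (chart_map d (g x)) (dir_deriv s t (local_rep c d g) (chart_map c x) v)"
    using comp(2)[OF K xU v] by (simp add: local_rep_map[OF c xc])
qed

lemma Cr_in_charts_locally:
  fixes s :: "'k::real_or_complex \<Rightarrow> 'e::{topological_ab_group_add, t2_space} \<Rightarrow> 'e"
    and t :: "'k \<Rightarrow> 'f::{topological_ab_group_add, t2_space} \<Rightarrow> 'f"
  assumes s: "locally_convex_space s" and t: "locally_convex_space t"
    and F: "module.subspace s F" and G: "module.subspace t G"
    and c: "is_chart F X c" and d: "is_chart G Y d"
    and loc: "\<And>x. x \<in> chart_dom c \<Longrightarrow> f x \<in> chart_dom d \<Longrightarrow> \<exists>Q. openin X Q \<and> x \<in> Q \<and> Cr_between r s t c d f Q"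
  shows "Cr_in_charts r s t c d f"
proof -
  have m: "chart_model c = F" "chart_model d = G" using is_chartD(1)[OF c] is_chartD(1)[OF d] by simp_all
  let ?D = "chart_dom c \<inter> f -` chart_dom d"
  have "Cr_on r s t F G (chart_map c ` ?D) (local_rep c d f)"
  proof (rule Cr_on_locally[OF s t F G])
    show "chart_map c ` ?D \<subseteq> F" using chart_map_mem[OF c] by blast
    fix y assume "y \<in> chart_map c ` ?D"
    then obtain x where x: "x \<in> chart_dom c" "f x \<in> chart_dom d" "y = chart_map c x" by blast
    then obtain Q where Q: "openin X Q" "x \<in> Q" "Cr_between r s t c d f Q" using loc by blast
    have Od: "Q \<subseteq> ?D" using Q(3) by (simp add: Cr_between_def)
    have "openin (top_of_set F) (chart_map c ` Q)" by (rule is_chart_open_image[OF c Q(1)]) (use Od in blast)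
    moreover have "Cr_on r s t F G (chart_map c ` Q) (local_rep c d f)" using Q(3) by (simp add: Cr_between_def m)
    ultimately show "\<exists>U'. openin (top_of_set F) U' \<and> y \<in> U' \<and> U' \<subseteq> chart_map c ` ?D \<and> Cr_on r s t F G U' (local_rep c d f)"
      using Q(2) x(3) Od by (intro exI[of _ "chart_map c ` Q"]) blast
  qed
  then show ?thesis by (simp add: Cr_in_charts_def m)
qed

section \<open>Atlases\<close>

text \<open>An atlas in the usual sense, without maximality. The maximal atlas of a manifold and the
  restricted charts of a submanifold are treated alike in this form.\<close>

definition base_atlas where
  "base_atlas r s F X B \<longleftrightarrow> (\<forall>c\<in>B. is_chart F X c) \<and> (\<forall>c\<in>B. \<forall>d\<in>B. Cr_in_charts r s s c d id) \<and>
     topspace X \<subseteq> (\<Union>c\<in>B. chart_dom c)"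

lemma base_atlas_subset: "base_atlas r s F X B \<Longrightarrow> B \<subseteq> maximal_atlas r s F X B"
  unfolding base_atlas_def maximal_atlas_def compatible_def by blast

lemma maximal_atlasD:
  assumes "c \<in> maximal_atlas r s F X B"
  shows "is_chart F X c" "d \<in> B \<Longrightarrow> Cr_in_charts r s s c d id" "d \<in> B \<Longrightarrow> Cr_in_charts r s s d c id"
  using assms by (simp_all add: maximal_atlas_def compatible_def)

lemma manifold_base_atlas: "manifold r s F X A \<Longrightarrow> base_atlas r s F X A"
proof -
  assume m: "manifold r s F X A"
  then have A: "A = maximal_atlas r s F X A" and cov: "(\<Union>c\<in>A. chart_dom c) = topspace X"
    by (simp_all add: manifold_def)
  have "is_chart F X c" if "c \<in> A" for c
    by (rule maximal_atlasD(1)) (use A that in blast)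
  moreover have "Cr_in_charts r s s c d id" if "c \<in> A" "d \<in> A" for c d
    by (rule maximal_atlasD(2)[of c r s F X A, OF _ that(2)]) (use A that in blast)
  ultimately show ?thesis using cov by (simp add: base_atlas_def)
qed

text \<open>Near each point the representative is factored as
  \<open>c \<rightarrow> c' \<rightarrow> d' \<rightarrow> d\<close>, with transition maps at both
  ends and a known representative of \<open>f\<close> in the middle.\<close>

lemma Cr_in_charts_atlas:
  fixes s :: "'k::real_or_complex \<Rightarrow> 'e::{topological_ab_group_add, t2_space} \<Rightarrow> 'e"
    and t :: "'k \<Rightarrow> 'f::{topological_ab_group_add, t2_space} \<Rightarrow> 'f"
  assumes s: "locally_convex_space s" and t: "locally_convex_space t"
    and F: "module.subspace s F" and G: "module.subspace t G"
    and c: "c \<in> maximal_atlas r s F X B1" and d: "d \<in> maximal_atlas r t G Y B2"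
    and f: "continuous_map X Y f"
    and loc: "\<And>x. x \<in> topspace X \<Longrightarrow> \<exists>c'\<in>B1. \<exists>d'\<in>B2. x \<in> chart_dom c' \<and> f x \<in> chart_dom d' \<and>
        is_chart F X c' \<and> is_chart G Y d' \<and> Cr_in_charts r s t c' d' f"
  shows "Cr_in_charts r s t c d f"
proof (rule Cr_in_charts_locally[OF s t F G maximal_atlasD(1)[OF c] maximal_atlasD(1)[OF d]])
  note cC = maximal_atlasD(1)[OF c] and dC = maximal_atlasD(1)[OF d]
  fix x assume x: "x \<in> chart_dom c" "f x \<in> chart_dom d"
  have "x \<in> topspace X" using is_chartD(5)[OF cC] x by blast
  then obtain c' d' where c': "c' \<in> B1" "x \<in> chart_dom c'" "is_chart F X c'"
    and d': "d' \<in> B2" "f x \<in> chart_dom d'" "is_chart G Y d'" and cd: "Cr_in_charts r s t c' d' f"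
    using loc by blast
  have b1: "Cr_between r s s c c' id (chart_dom c \<inter> id -` chart_dom c')"
    using maximal_atlasD(2)[OF c c'(1)] by (simp only: Cr_in_charts_iff_between)
  have b2: "Cr_between r s t c' d' f (chart_dom c' \<inter> f -` chart_dom d')"
    using cd by (simp only: Cr_in_charts_iff_between)
  have b3: "Cr_between r t t d' d id (chart_dom d' \<inter> id -` chart_dom d)"
    using maximal_atlasD(3)[OF d d'(1)] by (simp only: Cr_in_charts_iff_between)
  have id: "continuous_map Z Z id" for Z :: "'z topology" by simp
  note o1 = openin_dom_preimage[OF cC continuous_map_id is_chartD(2)[OF c'(3)] is_chartD(2)[OF cC]]
  note o2 = openin_dom_preimage[OF c'(3) f is_chartD(2)[OF d'(3)] is_chartD(2)[OF c'(3)]]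
  note o3 = openin_dom_preimage[OF d'(3) continuous_map_id is_chartD(2)[OF dC] is_chartD(2)[OF d'(3)]]
  note b12 = Cr_between_compose(1)[OF s s t F F G cC c'(3) d'(3) continuous_map_id o1 o2 b1 b2]
  note o12 = openin_dom_preimage[OF cC continuous_map_id o2 o1]
  have f12: "continuous_map X Y (f \<circ> id)" using f by simp
  note b123 = Cr_between_compose(1)[OF s t t F G G cC d'(3) dC f12 o12 o3 b12 b3]
  note o123 = openin_dom_preimage[OF cC f12 o3 o12]
  show "\<exists>Q. openin X Q \<and> x \<in> Q \<and> Cr_between r s t c d f Q"
    using o123 b123 x c'(2) d'(2) by (intro exI conjI[OF o123] conjI) auto
qed

lemma maximal_atlas_compatible:
  fixes s :: "'k::real_or_complex \<Rightarrow> 'e::{topological_ab_group_add, t2_space} \<Rightarrow> 'e"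
  assumes s: "locally_convex_space s" and F: "module.subspace s F" and B: "base_atlas r s F X B"
    and c: "c \<in> maximal_atlas r s F X B" "d \<in> maximal_atlas r s F X B"
  shows "Cr_in_charts r s s c d id"
proof (rule Cr_in_charts_atlas[OF s s F F c continuous_map_id])
  fix x assume "x \<in> topspace X"
  then obtain c' where "c' \<in> B" "x \<in> chart_dom c'" using B by (auto simp: base_atlas_def)
  then show "\<exists>c'\<in>B. \<exists>d'\<in>B. x \<in> chart_dom c' \<and> id x \<in> chart_dom d' \<and>
        is_chart F X c' \<and> is_chart F X d' \<and> Cr_in_charts r s s c' d' id"
    using B unfolding base_atlas_def by (intro bexI[of _ c']) auto
qed

text \<open>Compatibility with the single chart \<open>c\<close> suffices if the domain of
  \<open>c'\<close> lies in that of \<open>c\<close>: any other transition from or to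
  \<open>c'\<close> factors through \<open>c\<close> on the whole overlap.\<close>

lemma manifold_chartI:
  fixes s :: "'k::real_or_complex \<Rightarrow> 'e::{topological_ab_group_add, t2_space} \<Rightarrow> 'e"
  assumes s: "locally_convex_space s" and m: "manifold r s F X A" and c: "c \<in> A"
    and c': "is_chart F X c'" "chart_dom c' \<subseteq> chart_dom c"
    and fwd: "Cr_in_charts r s s c' c id" and bwd: "Cr_in_charts r s s c c' id"
  shows "c' \<in> A"
proof -
  have A: "A = maximal_atlas r s F X A" and F: "module.subspace s F" using m by (simp_all add: manifold_def)
  note B = manifold_base_atlas[OF m]
  have ch: "is_chart F X d" if "d \<in> A" for d using B that by (simp add: base_atlas_def)
  have cd: "Cr_in_charts r s s d e id" if "d \<in> A" "e \<in> A" for d e using B that by (simp add: base_atlas_def)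
  have "c' \<in> maximal_atlas r s F X A"
    unfolding maximal_atlas_def compatible_def
  proof (intro CollectI conjI ballI)
    fix d assume d: "d \<in> A"
    have open_Int: "openin X (chart_dom a \<inter> id -` chart_dom b)" if "is_chart F X a" "is_chart F X b" for a b
      by (rule openin_dom_preimage[OF that(1) continuous_map_id is_chartD(2)[OF that(2)] is_chartD(2)[OF that(1)]])
    have "Cr_between r s s c' d (id \<circ> id) (chart_dom c' \<inter> id -` chart_dom c \<inter> id -` (chart_dom c \<inter> id -` chart_dom d))"
      by (rule Cr_between_compose(1)[OF s s s F F F c'(1) ch[OF c] ch[OF d] continuous_map_id
            open_Int[OF c'(1) ch[OF c]] open_Int[OF ch[OF c] ch[OF d]]])
        (use fwd cd[OF c d] in \<open>simp_all only: Cr_in_charts_iff_between\<close>)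
    moreover have "chart_dom c' \<inter> id -` chart_dom c \<inter> id -` (chart_dom c \<inter> id -` chart_dom d) = chart_dom c' \<inter> id -` chart_dom d"
      using c'(2) by auto
    ultimately show "Cr_in_charts r s s c' d id" by (simp add: Cr_in_charts_iff_between)
    have "Cr_between r s s d c' (id \<circ> id) (chart_dom d \<inter> id -` chart_dom c \<inter> id -` (chart_dom c \<inter> id -` chart_dom c'))"
      by (rule Cr_between_compose(1)[OF s s s F F F ch[OF d] ch[OF c] c'(1) continuous_map_id
            open_Int[OF ch[OF d] ch[OF c]] open_Int[OF ch[OF c] c'(1)]])
        (use bwd cd[OF d c] in \<open>simp_all only: Cr_in_charts_iff_between\<close>)
    moreover have "chart_dom d \<inter> id -` chart_dom c \<inter> id -` (chart_dom c \<inter> id -` chart_dom c') = chart_dom d \<inter> id -` chart_dom c'"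
      using c'(2) by auto
    ultimately show "Cr_in_charts r s s d c' id" by (simp add: Cr_in_charts_iff_between)
  qed (rule c'(1))
  then show ?thesis using A by blast
qed

lemma Cr_in_chartsI:
  fixes s :: "'k::real_or_complex \<Rightarrow> 'e::{topological_ab_group_add, t2_space} \<Rightarrow> 'e"
    and t :: "'k \<Rightarrow> 'f::{topological_ab_group_add, t2_space} \<Rightarrow> 'f"
  assumes s: "locally_convex_space s" and t: "locally_convex_space t"
    and F: "module.subspace s F" and G: "module.subspace t G"
    and c: "is_chart F X c" and d: "chart_model d = G" and Q: "openin X (chart_dom c \<inter> f -` chart_dom d)"
    and g: "Cr_on r s t F G (chart_map c ` (chart_dom c \<inter> f -` chart_dom d)) g"
    and eq: "\<And>x. x \<in> chart_dom c \<Longrightarrow> f x \<in> chart_dom d \<Longrightarrow> chart_map d (f x) = g (chart_map c x)"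
  shows "Cr_in_charts r s t c d f"
  unfolding Cr_in_charts_def is_chartD(1)[OF c] d
proof (rule Cr_on_cong[OF s t F G g])
  show "openin (top_of_set F) (chart_map c ` (chart_dom c \<inter> f -` chart_dom d))"
    by (rule is_chart_open_image[OF c Q]) blast
  fix y assume "y \<in> chart_map c ` (chart_dom c \<inter> f -` chart_dom d)"
  then show "g y = local_rep c d f y" using eq by (auto simp: local_rep_map[OF c])
qed

lemma continuous_linear_on_id: "F \<subseteq> G \<Longrightarrow> continuous_linear_on s s F G (\<lambda>x. x)"
  by (auto simp: continuous_linear_on_def continuous_on_id)

lemma manifold_chart_restrict:
  fixes s :: "'k::real_or_complex \<Rightarrow> 'e::{topological_ab_group_add, t2_space} \<Rightarrow> 'e"
  assumes s: "locally_convex_space s" and m: "manifold r s F X A" and c: "c \<in> A" and Q: "openin X Q"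
  shows "Chart F (chart_dom c \<inter> Q) (chart_map c) \<in> A"
proof (rule manifold_chartI[OF s m c])
  have F: "module.subspace s F" using m by (simp add: manifold_def)
  have ch: "is_chart F X c" using manifold_base_atlas[OF m] c by (simp add: base_atlas_def)
  let ?c = "Chart F (chart_dom c \<inter> Q) (chart_map c)"
  show c': "is_chart F X ?c" by (rule is_chart_restrict[OF ch Q])
  show "chart_dom ?c \<subseteq> chart_dom c" by simp
  have lin: "Cr_on r s s F F (chart_map c ` (chart_dom c \<inter> Q)) (\<lambda>x. x)"
    by (rule Cr_on_linear[OF s s F F continuous_linear_on_id[OF order_refl]])
      (use is_chart_open_image[OF c' is_chartD(2)[OF c']] in simp)
  have Q': "openin X (chart_dom c \<inter> Q)" using is_chartD(2)[OF c'] by simp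
  have eqd: "chart_dom ?c \<inter> id -` chart_dom c = chart_dom c \<inter> Q" "chart_dom c \<inter> id -` chart_dom ?c = chart_dom c \<inter> Q" by auto
  show "Cr_in_charts r s s ?c c id"
    by (rule Cr_in_chartsI[OF s s F F c' is_chartD(1)[OF ch], where g = "\<lambda>x. x"]) (use lin Q' eqd in simp_all)
  show "Cr_in_charts r s s c ?c id"
    by (rule Cr_in_chartsI[OF s s F F ch, where g = "\<lambda>x. x"]) (use lin Q' eqd in simp_all)
qed

section \<open>Submanifolds\<close>

context
  fixes r :: regularity and s :: "'k::real_or_complex \<Rightarrow> 'e::{topological_ab_group_add, t2_space} \<Rightarrow> 'e"
    and X :: "'m topology" and A :: "('m, 'e) chart set" and F :: "'e set" and N :: "'m set"
  assumes s: "locally_convex_space s" and m: "manifold r s UNIV X A" and N: "submanifold s X A F N"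
begin

lemma submanifold_subspace: "module.subspace s F" "closed F" "N \<subseteq> topspace X"
  using N by (simp_all add: submanifold_def)

lemma manifold_is_chart: "c \<in> A \<Longrightarrow> is_chart UNIV X c"
  using manifold_base_atlas[OF m] by (simp add: base_atlas_def)

lemma UNIV_subspace: "module.subspace s UNIV"
  using m by (simp add: manifold_def)

lemma restricted_chartsE:
  assumes "c' \<in> restricted_charts A F N"
  obtains c where "c \<in> A" "c' = Chart F (chart_dom c \<inter> N) (chart_map c)"
    "chart_map c ` (chart_dom c \<inter> N) = chart_image c \<inter> F" "is_chart F (subtopology X N) c'"
proof -
  obtain c where c: "c \<in> A" "c' = Chart F (chart_dom c \<inter> N) (chart_map c)"
    "chart_map c ` (chart_dom c \<inter> N) = chart_image c \<inter> F"
    using assms unfolding restricted_charts_def by blast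
  moreover have "is_chart F (subtopology X N) c'"
    unfolding c(2) by (rule is_chart_adapted[OF manifold_is_chart[OF c(1)] _ submanifold_subspace(3) c(3)]) simp
  ultimately show ?thesis using that by blast
qed

text \<open>A transition between restricted charts is an ambient transition restricted to
  \<open>F\<close>. It maps into \<open>F\<close> because membership in \<open>N\<close> does not
  depend on the chart, and it keeps its class because \<open>F\<close> is closed.\<close>

lemma restricted_charts_base: "base_atlas r s F (subtopology X N) (restricted_charts A F N)"
  unfolding base_atlas_def
proof (intro conjI ballI)
  show "is_chart F (subtopology X N) c" if "c \<in> restricted_charts A F N" for c
    using that by (rule restricted_chartsE)
  show "topspace (subtopology X N) \<subseteq> (\<Union>c\<in>restricted_charts A F N. chart_dom c)"
  proof
    fix x assume "x \<in> topspace (subtopology X N)"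
    then have xN: "x \<in> N" by simp
    then obtain c where "c \<in> A" "x \<in> chart_dom c" "chart_map c ` (chart_dom c \<inter> N) = chart_image c \<inter> F"
      using N unfolding submanifold_def by blast
    then have "Chart F (chart_dom c \<inter> N) (chart_map c) \<in> restricted_charts A F N" "x \<in> chart_dom c \<inter> N"
      using xN unfolding restricted_charts_def by blast+
    then show "x \<in> (\<Union>c\<in>restricted_charts A F N. chart_dom c)"
      by (intro UN_I[of "Chart F (chart_dom c \<inter> N) (chart_map c)"]) simp_all
  qed
  fix c' d' assume "c' \<in> restricted_charts A F N" "d' \<in> restricted_charts A F N"
  then obtain c d where c: "c \<in> A" "c' = Chart F (chart_dom c \<inter> N) (chart_map c)"
    "chart_map c ` (chart_dom c \<inter> N) = chart_image c \<inter> F" "is_chart F (subtopology X N) c'"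
    and d: "d \<in> A" "d' = Chart F (chart_dom d \<inter> N) (chart_map d)"
    "chart_map d ` (chart_dom d \<inter> N) = chart_image d \<inter> F" "is_chart F (subtopology X N) d'"
    by (elim restricted_chartsE) blast
  note cC = manifold_is_chart[OF c(1)]
  let ?U = "chart_map c ` (chart_dom c \<inter> chart_dom d)"
  have dom: "chart_dom c' \<inter> id -` chart_dom d' = chart_dom c \<inter> chart_dom d \<inter> N" by (auto simp: c(2) d(2))
  \<comment> \<open>The nontrivial direction uses injectivity of the chart: a point whose image lies
    in \<open>F\<close> shares this image with a point of \<open>N\<close>.\<close>
  have cN: "chart_map c x \<in> F \<longleftrightarrow> x \<in> N" if "x \<in> chart_dom c" for x
  proof
    assume "chart_map c x \<in> F"
    then have "chart_map c x \<in> chart_map c ` (chart_dom c \<inter> N)" unfolding c(3) using that by (simp add: chart_image_def)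
    then obtain x' where "x' \<in> chart_dom c \<inter> N" "chart_map c x = chart_map c x'" by blast
    then show "x \<in> N" using inj_onD[OF is_chartD(6)[OF cC], of x x'] that by auto
  next
    assume "x \<in> N"
    then show "chart_map c x \<in> F" using c(3) that by blast
  qed
  have img: "chart_map c' ` (chart_dom c' \<inter> id -` chart_dom d') = ?U \<inter> F"
    unfolding dom using cN by (auto simp: c(2))
  have U: "openin (top_of_set UNIV) ?U"
    by (rule is_chart_open_image[OF cC]) (use is_chartD(2)[OF cC] is_chartD(2)[OF manifold_is_chart[OF d(1)]] in \<open>auto intro: openin_Int\<close>)
  have "Cr_in_charts r s s c d id" using manifold_base_atlas[OF m] c(1) d(1) by (simp add: base_atlas_def)
  then have "Cr_on r s s UNIV UNIV ?U (local_rep c d id)"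
    by (simp add: Cr_in_charts_def is_chartD(1)[OF cC] is_chartD(1)[OF manifold_is_chart[OF d(1)]])
  then have "Cr_on r s s F F (?U \<inter> F) (local_rep c d id)"
  proof (rule Cr_on_restrict_subspace[OF s s UNIV_subspace UNIV_subspace U _ submanifold_subspace(1) subset_UNIV submanifold_subspace(1,2)])
    show "local_rep c d id ` (?U \<inter> F) \<subseteq> F"
    proof
      fix z assume "z \<in> local_rep c d id ` (?U \<inter> F)"
      then obtain x where x: "x \<in> chart_dom c" "x \<in> chart_dom d" "chart_map c x \<in> F" "z = chart_map d x"
        by (auto simp: local_rep_map[OF cC])
      then have "x \<in> chart_dom d \<inter> N" using cN by simp
      then show "z \<in> F" using d(3) x(4) by blast
    qed
  qed
  then show "Cr_in_charts r s s c' d' id"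
  proof (intro Cr_in_chartsI[OF s s submanifold_subspace(1) submanifold_subspace(1) c(4) is_chartD(1)[OF d(4)], where g = "local_rep c d id"])
    show "openin (subtopology X N) (chart_dom c' \<inter> id -` chart_dom d')"
      by (rule openin_dom_preimage[OF c(4) continuous_map_id is_chartD(2)[OF d(4)] is_chartD(2)[OF c(4)]])
    show "chart_map d' (id x) = local_rep c d id (chart_map c' x)" if "x \<in> chart_dom c'" for x
      using that by (simp add: c(2) d(2) local_rep_map[OF cC])
  qed (simp only: img)
qed

lemma submanifold_atlas_compatible:
  "c \<in> submanifold_atlas r s X A F N \<Longrightarrow> d \<in> submanifold_atlas r s X A F N \<Longrightarrow> Cr_in_charts r s s c d id"
  unfolding submanifold_atlas_def
  by (rule maximal_atlas_compatible[OF s submanifold_subspace(1) restricted_charts_base])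

lemma submanifold_atlas_is_chart: "c \<in> submanifold_atlas r s X A F N \<Longrightarrow> is_chart F (subtopology X N) c"
  unfolding submanifold_atlas_def by (rule maximal_atlasD(1))

lemma restricted_charts_subset: "restricted_charts A F N \<subseteq> submanifold_atlas r s X A F N"
  unfolding submanifold_atlas_def by (rule base_atlas_subset[OF restricted_charts_base])

text \<open>In a restricted chart and the ambient chart it comes from, the inclusion is the linear
  inclusion of \<open>F\<close>; other charts follow by composing with transition maps.\<close>

lemma submanifold_inclusion:
  assumes c: "c \<in> submanifold_atlas r s X A F N" and d: "d \<in> A"
  shows "Cr_in_charts r s s c d id"
proof -
  have d': "d \<in> maximal_atlas r s UNIV X A" using d m by (simp add: manifold_def)
  show ?thesis
  proof (rule Cr_in_charts_atlas[OF s s submanifold_subspace(1) UNIV_subspace c[unfolded submanifold_atlas_def] d'])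
    show "continuous_map (subtopology X N) X id" by (intro continuous_map_from_subtopology continuous_map_id)
    fix x assume "x \<in> topspace (subtopology X N)"
    then obtain c' where c': "c' \<in> restricted_charts A F N" "x \<in> chart_dom c'"
      using restricted_charts_base unfolding base_atlas_def by blast
    obtain e where e: "e \<in> A" "c' = Chart F (chart_dom e \<inter> N) (chart_map e)" "is_chart F (subtopology X N) c'"
      by (rule restricted_chartsE[OF c'(1)]) (rule that)
    have "Cr_in_charts r s s c' e id"
    proof (rule Cr_in_chartsI[OF s s submanifold_subspace(1) UNIV_subspace e(3) is_chartD(1)[OF manifold_is_chart[OF e(1)]], where g = "\<lambda>x. x"])
      have eq: "chart_dom c' \<inter> id -` chart_dom e = chart_dom c'" by (auto simp: e(2))
      show "openin (subtopology X N) (chart_dom c' \<inter> id -` chart_dom e)" unfolding eq by (rule is_chartD(2)[OF e(3)])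
      show "Cr_on r s s F UNIV (chart_map c' ` (chart_dom c' \<inter> id -` chart_dom e)) (\<lambda>x. x)"
        unfolding eq
        by (rule Cr_on_linear[OF s s submanifold_subspace(1) UNIV_subspace continuous_linear_on_id[OF subset_UNIV]
              is_chart_open_image[OF e(3) is_chartD(2)[OF e(3)] order_refl]])
    qed (simp add: e(2))
    moreover have "x \<in> chart_dom e" using c'(2) by (simp add: e(2))
    ultimately show "\<exists>c'\<in>restricted_charts A F N. \<exists>d'\<in>A. x \<in> chart_dom c' \<and> id x \<in> chart_dom d' \<and>
        is_chart F (subtopology X N) c' \<and> is_chart UNIV X d' \<and> Cr_in_charts r s s c' d' id"
      using c' e manifold_is_chart by (intro bexI[of _ c'] bexI[of _ e]) auto
  qed
qed

end

section \<open>Tangent vectors\<close>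

lemma dir_deriv_local_rep_compose:
  fixes s :: "'k::real_or_complex \<Rightarrow> 'e::{topological_ab_group_add, t2_space} \<Rightarrow> 'e"
    and t :: "'k \<Rightarrow> 'f::{topological_ab_group_add, t2_space} \<Rightarrow> 'f"
    and u :: "'k \<Rightarrow> 'h::{topological_ab_group_add, t2_space} \<Rightarrow> 'h"
  assumes K: "admissible_regularity TYPE('k) r"
    and s: "locally_convex_space s" and t: "locally_convex_space t" and u: "locally_convex_space u"
    and F: "module.subspace s F" and G: "module.subspace t G" and H: "module.subspace u H"
    and c: "is_chart F X c" and d: "is_chart G Y d" and e: "is_chart H Z e"
    and g: "continuous_map X Y g" and f: "continuous_map Y Z f"
    and cd: "Cr_in_charts r s t c d g" and de: "Cr_in_charts r t u d e f"
    and x: "x \<in> chart_dom c" "g x \<in> chart_dom d" "f (g x) \<in> chart_dom e" and v: "v \<in> F"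
  shows "dir_deriv s u (local_rep c e (f \<circ> g)) (chart_map c x) v =
      dir_deriv t u (local_rep d e f) (chart_map d (g x)) (dir_deriv s t (local_rep c d g) (chart_map c x) v)"
  by (rule Cr_between_compose(2)[OF s t u F G H c d e g
        openin_dom_preimage[OF c g is_chartD(2)[OF d] is_chartD(2)[OF c]]
        openin_dom_preimage[OF d f is_chartD(2)[OF e] is_chartD(2)[OF d]]
        cd[unfolded Cr_in_charts_iff_between] de[unfolded Cr_in_charts_iff_between] K])
    (use x v in simp_all)

lemma dir_deriv_local_rep:
  fixes s :: "'k::real_or_complex \<Rightarrow> 'e::{topological_ab_group_add, t2_space} \<Rightarrow> 'e"
    and t :: "'k \<Rightarrow> 'f::{topological_ab_group_add, t2_space} \<Rightarrow> 'f"
  assumes K: "admissible_regularity TYPE('k) r"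
    and s: "locally_convex_space s" and t: "locally_convex_space t"
    and F: "module.subspace s F" and G: "module.subspace t G"
    and c: "is_chart F X c" and d: "is_chart G Y d" and g: "continuous_map X Y g"
    and cd: "Cr_in_charts r s t c d g" and x: "x \<in> chart_dom c" "g x \<in> chart_dom d"
  shows "continuous_linear_on s t F G (dir_deriv s t (local_rep c d g) (chart_map c x))"
    and "v \<in> F \<Longrightarrow> (diff_quot s t (local_rep c d g) (chart_map c x) v \<longlongrightarrow>
      dir_deriv s t (local_rep c d g) (chart_map c x) v) (at 0)"
proof -
  let ?Q = "chart_dom c \<inter> g -` chart_dom d"
  have Q: "openin (top_of_set F) (chart_map c ` ?Q)"
    by (rule is_chart_open_image[OF c openin_dom_preimage[OF c g is_chartD(2)[OF d] is_chartD(2)[OF c]]]) blast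
  have C: "Cr_on r s t F G (chart_map c ` ?Q) (local_rep c d g)"
    using cd by (simp add: Cr_in_charts_def is_chartD(1)[OF c] is_chartD(1)[OF d])
  have xQ: "chart_map c x \<in> chart_map c ` ?Q" using x by blast
  show "continuous_linear_on s t F G (dir_deriv s t (local_rep c d g) (chart_map c x))"
    by (rule Cr_on_deriv(1)[OF s t F G K Q C xQ])
  show "v \<in> F \<Longrightarrow> (diff_quot s t (local_rep c d g) (chart_map c x) v \<longlongrightarrow>
      dir_deriv s t (local_rep c d g) (chart_map c x) v) (at 0)"
    by (rule Cr_on_deriv(2)[OF s t F G K Q C xQ])
qed

lemma dir_deriv_local_rep_linear:
  fixes s :: "'k::real_or_complex \<Rightarrow> 'e::{topological_ab_group_add, t2_space} \<Rightarrow> 'e"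
    and t :: "'k \<Rightarrow> 'f::{topological_ab_group_add, t2_space} \<Rightarrow> 'f"
  assumes s: "locally_convex_space s" and t: "locally_convex_space t" and F: "module.subspace s F"
    and c: "is_chart F X c" and L: "continuous_linear_on s t F G L"
    and eq: "\<And>y. y \<in> chart_dom c \<Longrightarrow> chart_map d (f y) = L (chart_map c y)"
    and x: "x \<in> chart_dom c" and v: "v \<in> F"
  shows "dir_deriv s t (local_rep c d f) (chart_map c x) v = L v"
proof (rule dir_deriv_eq)
  interpret E: locally_convex_space s by fact
  interpret T: locally_convex_space t by fact
  have Ladd: "L (a + b) = L a + L b" if "a \<in> F" "b \<in> F" for a b using L that by (simp add: continuous_linear_on_def)
  have Lsc: "L (s k a) = t k (L a)" if "a \<in> F" for k a using L that by (simp add: continuous_linear_on_def)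
  have rep: "local_rep c d f y = L y" if "y \<in> chart_image c" for y
    using that eq by (auto simp: chart_image_def local_rep_map[OF c])
  have xi: "chart_map c x \<in> chart_image c" using x by (simp add: chart_image_def)
  have xF: "chart_map c x \<in> F" by (rule chart_map_mem[OF c x])
  have "eventually (\<lambda>h. chart_map c x + s h v \<in> chart_image c) (at 0)"
    by (rule eventually_in_open_line[OF s F is_chartD(3)[OF c] xi v])
  moreover have "eventually (\<lambda>h::'k. h \<noteq> 0) (at 0)" by (simp add: eventually_at_filter)
  ultimately have "eventually (\<lambda>h. L v = diff_quot s t (local_rep c d f) (chart_map c x) v h) (at 0)"
  proof eventually_elim
    case (elim h)
    then show ?case
      by (simp add: diff_quot_def rep xi Ladd[OF xF E.subspace_scale[OF F v]] Lsc[OF v])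
  qed
  from Lim_transform_eventually[OF tendsto_const this]
  show "(diff_quot s t (local_rep c d f) (chart_map c x) v \<longlongrightarrow> L v) (at 0)" .
qed

text \<open>Only the charts around \<open>x\<close> are constrained. The atlas of a submanifold that
  is not pure mixes model spaces, but those around one point share a single one.\<close>

definition atlas_at where
  "atlas_at r s F X A x \<longleftrightarrow> (\<forall>c\<in>A. x \<in> chart_dom c \<longrightarrow> is_chart F X c) \<and>
     (\<forall>c\<in>A. \<forall>d\<in>A. x \<in> chart_dom c \<longrightarrow> x \<in> chart_dom d \<longrightarrow> Cr_in_charts r s s c d id)"

text \<open>The tangent vector that has the coordinates \<open>v\<close> in the chart
  \<open>c\<close>, listed with its coordinates in all charts around \<open>x\<close>.\<close>

definition tangent_class where
  "tangent_class s A x c v = {(d, w). d \<in> A \<and> x \<in> chart_dom d \<and>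
     w = dir_deriv s s (local_rep c d id) (chart_map c x) v}"

context
  fixes r :: regularity and s :: "'k::real_or_complex \<Rightarrow> 'e::{topological_ab_group_add, t2_space} \<Rightarrow> 'e"
    and F :: "'e set" and X :: "'m topology" and A :: "('m, 'e) chart set" and x :: 'm and c :: "('m, 'e) chart"
  assumes K: "admissible_regularity TYPE('k) r" and s: "locally_convex_space s" and F: "module.subspace s F"
    and A: "atlas_at r s F X A x" and c: "c \<in> A" "x \<in> chart_dom c"
begin

lemma atlas_at_chart: "d \<in> A \<Longrightarrow> x \<in> chart_dom d \<Longrightarrow> is_chart F X d"
  using A by (simp add: atlas_at_def)

lemma atlas_at_compatible:
  "d \<in> A \<Longrightarrow> x \<in> chart_dom d \<Longrightarrow> e \<in> A \<Longrightarrow> x \<in> chart_dom e \<Longrightarrow> Cr_in_charts r s s d e id"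
  using A by (simp add: atlas_at_def)

lemma tangent_class_self:
  assumes "v \<in> F"
  shows "(c, v) \<in> tangent_class s A x c v"
  using dir_deriv_local_rep_linear[OF s s F atlas_at_chart[OF c] continuous_linear_on_id[OF order_refl], of c id x v]
    c assms by (simp add: tangent_class_def)

lemma tangent_class_inj:
  assumes v: "v \<in> F" and w: "w \<in> F" and eq: "tangent_class s A x c v = tangent_class s A x c w"
  shows "v = w"
proof -
  have "(c, v) \<in> tangent_class s A x c w" using tangent_class_self[OF v] eq by simp
  moreover have "(c, w) \<in> tangent_class s A x c w" by (rule tangent_class_self[OF w])
  ultimately show ?thesis by (simp add: tangent_class_def)
qed

lemma tangent_class_mem:
  assumes "(d, w) \<in> tangent_class s A x c v" and v: "v \<in> F"
  shows "d \<in> A" "x \<in> chart_dom d" "w \<in> F" "w = dir_deriv s s (local_rep c d id) (chart_map c x) v"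
proof -
  show d: "d \<in> A" "x \<in> chart_dom d" "w = dir_deriv s s (local_rep c d id) (chart_map c x) v"
    using assms by (simp_all add: tangent_class_def)
  have "continuous_linear_on s s F F (dir_deriv s s (local_rep c d id) (chart_map c x))"
    by (rule dir_deriv_local_rep(1)[OF K s s F F atlas_at_chart[OF c] atlas_at_chart[OF d(1,2)] continuous_map_id
          atlas_at_compatible[OF c d(1,2)]]) (use c d in simp_all)
  then show "w \<in> F" using v d(3) by (auto simp: continuous_linear_on_def)
qed

text \<open>The chain rule for transition maps: the coordinates in a third chart are the same
  whether computed from \<open>c\<close> directly or via \<open>d\<close>.\<close>

lemma tangent_class_change:
  assumes d: "d \<in> A" "x \<in> chart_dom d" and v: "v \<in> F"
  shows "tangent_class s A x c v = tangent_class s A x d (dir_deriv s s (local_rep c d id) (chart_map c x) v)"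
proof -
  have "dir_deriv s s (local_rep c e id) (chart_map c x) v =
      dir_deriv s s (local_rep d e id) (chart_map d x) (dir_deriv s s (local_rep c d id) (chart_map c x) v)"
    if e: "e \<in> A" "x \<in> chart_dom e" for e
    using dir_deriv_local_rep_compose[OF K s s s F F F atlas_at_chart[OF c] atlas_at_chart[OF d] atlas_at_chart[OF e]
        continuous_map_id continuous_map_id atlas_at_compatible[OF c d] atlas_at_compatible[OF d e] c(2) _ _ v]
      d(2) e(2) by simp
  then show ?thesis unfolding tangent_class_def by (intro Collect_cong) auto
qed

end

text \<open>Any one chart around \<open>x\<close> yields coordinates on the whole tangent space, as
  every representative can be moved to that chart by a transition differential.\<close>

lemma tangent_space_eq:
  fixes s :: "'k::real_or_complex \<Rightarrow> 'e::{topological_ab_group_add, t2_space} \<Rightarrow> 'e" and x :: 'm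
  assumes K: "admissible_regularity TYPE('k) r" and s: "locally_convex_space s" and F: "module.subspace s F"
    and A: "atlas_at r s F X A x" and c: "c \<in> A" "x \<in> chart_dom c"
  shows "tangent_space s A x = tangent_class s A x c ` F"
proof -
  note ch = atlas_at_chart[OF K s F A c]
  have model: "chart_model d = F" if "d \<in> A" "x \<in> chart_dom d" for d by (rule is_chartD(1)[OF ch[OF that]])
  have rep: "(d, w) \<in> tangent_rep A x \<longleftrightarrow> d \<in> A \<and> x \<in> chart_dom d \<and> w \<in> F" for d w
    using model by (auto simp: tangent_rep_def)
  have cls: "tangent_rel s A x `` {(d, w)} = tangent_class s A x d w" if d: "d \<in> A" "x \<in> chart_dom d" and w: "w \<in> F" for d w
  proof (intro set_eqI)
    fix z :: "('m, 'e) chart \<times> 'e"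
    obtain e u where z: "z = (e, u)" by (cases z)
    have "z \<in> tangent_rel s A x `` {(d, w)} \<longleftrightarrow> e \<in> A \<and> x \<in> chart_dom e \<and> u \<in> F \<and>
        u = dir_deriv s s (local_rep d e id) (chart_map d x) w"
      using d w by (auto simp: tangent_rel_def rep z)
    also have "\<dots> \<longleftrightarrow> z \<in> tangent_class s A x d w"
      using tangent_class_mem(3)[OF K s F A d, of e u w] w by (auto simp: tangent_class_def z)
    finally show "z \<in> tangent_rel s A x `` {(d, w)} \<longleftrightarrow> z \<in> tangent_class s A x d w" .
  qed
  have "tangent_space s A x = {tangent_rel s A x `` {(d, w)} |d w. d \<in> A \<and> x \<in> chart_dom d \<and> w \<in> F}"
    unfolding tangent_space_def quotient_def using rep by auto
  also have "\<dots> = {tangent_class s A x d w |d w. d \<in> A \<and> x \<in> chart_dom d \<and> w \<in> F}"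
    by (rule Collect_cong) (metis cls)
  also have "\<dots> = tangent_class s A x c ` F"
  proof
    show "tangent_class s A x c ` F \<subseteq> {tangent_class s A x d w |d w. d \<in> A \<and> x \<in> chart_dom d \<and> w \<in> F}"
      using c by blast
    show "{tangent_class s A x d w |d w. d \<in> A \<and> x \<in> chart_dom d \<and> w \<in> F} \<subseteq> tangent_class s A x c ` F"
    proof safe
      fix d w assume d: "d \<in> A" "x \<in> chart_dom d" and w: "w \<in> F"
      have "(c, dir_deriv s s (local_rep d c id) (chart_map d x) w) \<in> tangent_class s A x d w"
        using c by (simp add: tangent_class_def)
      then have "dir_deriv s s (local_rep d c id) (chart_map d x) w \<in> F"
        by (rule tangent_class_mem(3)[OF K s F A d _ w])
      then show "tangent_class s A x d w \<in> tangent_class s A x c ` F"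
        using tangent_class_change[OF K s F A d c w] by blast
    qed
  qed
  finally show ?thesis .
qed

text \<open>By the chain rule at both ends, the image does not depend on the representing charts. It
  is therefore the class of the derivative computed in one fixed pair of charts.\<close>

lemma tangent_map_class:
  fixes s :: "'k::real_or_complex \<Rightarrow> 'e::{topological_ab_group_add, t2_space} \<Rightarrow> 'e"
    and t :: "'k \<Rightarrow> 'f::{topological_ab_group_add, t2_space} \<Rightarrow> 'f"
    and x :: 'm and g :: "'m \<Rightarrow> 'n"
  assumes K: "admissible_regularity TYPE('k) r"
    and s: "locally_convex_space s" and t: "locally_convex_space t"
    and F: "module.subspace s F" and G: "module.subspace t G"
    and A: "atlas_at r s F X A x" and c: "c \<in> A" "x \<in> chart_dom c"
    and B: "atlas_at r t G Y B (g x)" and d: "d \<in> B" "g x \<in> chart_dom d"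
    and g: "continuous_map X Y g"
    and Cr: "\<And>c d. c \<in> A \<Longrightarrow> x \<in> chart_dom c \<Longrightarrow> d \<in> B \<Longrightarrow> g x \<in> chart_dom d \<Longrightarrow> Cr_in_charts r s t c d g"
    and v: "v \<in> F"
  shows "tangent_map s t B g x (tangent_class s A x c v) =
    tangent_class t B (g x) d (dir_deriv s t (local_rep c d g) (chart_map c x) v)"
proof -
  note chA = atlas_at_chart[OF K s F A c] and chB = atlas_at_chart[OF K t G B d]
  note coA = atlas_at_compatible[OF K s F A c] and coB = atlas_at_compatible[OF K t G B d]
  have D1: "dir_deriv s t (local_rep c' e g) (chart_map c' x) (dir_deriv s s (local_rep c c' id) (chart_map c x) v) =
      dir_deriv s t (local_rep c e g) (chart_map c x) v"
    if "c' \<in> A" "x \<in> chart_dom c'" "e \<in> B" "g x \<in> chart_dom e" for c' e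
    using dir_deriv_local_rep_compose[OF K s s t F F G chA[OF c] chA[OF that(1,2)] chB[OF that(3,4)]
        continuous_map_id g coA[OF c that(1,2)] Cr[OF that] c(2) _ _ v] that by simp
  have D2: "dir_deriv t t (local_rep d e id) (chart_map d (g x)) (dir_deriv s t (local_rep c d g) (chart_map c x) v) =
      dir_deriv s t (local_rep c e g) (chart_map c x) v"
    if "e \<in> B" "g x \<in> chart_dom e" for e
    using dir_deriv_local_rep_compose[OF K s t t F G G chA[OF c] chB[OF d] chB[OF that]
        g continuous_map_id Cr[OF c d] coB[OF d that] c(2) d(2) _ v] that by simp
  have mem: "dir_deriv s t (local_rep c e g) (chart_map c x) v \<in> G" if "e \<in> B" "g x \<in> chart_dom e" for e
    using dir_deriv_local_rep(1)[OF K s t F G chA[OF c] chB[OF that] g Cr[OF c that] c(2) that(2)] v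
    by (auto simp: continuous_linear_on_def)
  have rep: "(e, w) \<in> tangent_rep B (g x) \<longleftrightarrow> e \<in> B \<and> g x \<in> chart_dom e \<and> w \<in> G" for e w
    using is_chartD(1)[OF chB] by (auto simp: tangent_rep_def)
  show ?thesis
  proof (intro set_eqI)
    fix z :: "('n, 'f) chart \<times> 'f"
    obtain e w where z: "z = (e, w)" by (cases z)
    show "z \<in> tangent_map s t B g x (tangent_class s A x c v) \<longleftrightarrow>
        z \<in> tangent_class t B (g x) d (dir_deriv s t (local_rep c d g) (chart_map c x) v)"
    proof
      assume "z \<in> tangent_map s t B g x (tangent_class s A x c v)"
      then obtain c' v' where e: "e \<in> B" "g x \<in> chart_dom e" and c': "(c', v') \<in> tangent_class s A x c v"
        and w: "w = dir_deriv s t (local_rep c' e g) (chart_map c' x) v'"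
        unfolding tangent_map_def z rep by blast
      have "w = dir_deriv s t (local_rep c e g) (chart_map c x) v"
        using D1[OF tangent_class_mem(1,2)[OF K s F A c c' v] e] tangent_class_mem(4)[OF K s F A c c' v] w by simp
      then show "z \<in> tangent_class t B (g x) d (dir_deriv s t (local_rep c d g) (chart_map c x) v)"
        using e D2[OF e] by (simp add: tangent_class_def z)
    next
      assume "z \<in> tangent_class t B (g x) d (dir_deriv s t (local_rep c d g) (chart_map c x) v)"
      then have e: "e \<in> B" "g x \<in> chart_dom e" and w: "w = dir_deriv s t (local_rep c e g) (chart_map c x) v"
        using D2 by (simp_all add: tangent_class_def z)
      then show "z \<in> tangent_map s t B g x (tangent_class s A x c v)"
        using mem[OF e] tangent_class_self[OF K s F A c v] unfolding tangent_map_def z rep by blast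
    qed
  qed
qed

section \<open>Submersions and submanifolds in adapted charts\<close>

text \<open>The pair \<open>c\<close>, \<open>d\<close> exhibits \<open>f\<close> as
  \<open>\<pi>\<close> and \<open>S\<close> as \<open>G\<close> simultaneously. The linear maps are
  taken on the full spaces, on which \<open>M\<close> and \<open>N\<close> are modelled;
  restrictions to subspaces come later.\<close>

definition adapted where
  "adapted sE sF A B f S G c d \<pi> \<sigma> \<longleftrightarrow> c \<in> A \<and> d \<in> B \<and> f ` chart_dom c \<subseteq> chart_dom d \<and>
     continuous_linear_on sE sF UNIV UNIV \<pi> \<and> continuous_linear_on sF sE UNIV UNIV \<sigma> \<and> (\<forall>w. \<pi> (\<sigma> w) = w) \<and>
     (\<forall>x\<in>chart_dom c. chart_map d (f x) = \<pi> (chart_map c x)) \<and>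
     chart_map d ` (chart_dom d \<inter> S) = chart_image d \<inter> G"

lemma continuous_linear_onD:
  assumes "continuous_linear_on s t F G p"
  shows "x \<in> F \<Longrightarrow> p x \<in> G" "continuous_on F p" "x \<in> F \<Longrightarrow> y \<in> F \<Longrightarrow> p (x + y) = p x + p y"
    "x \<in> F \<Longrightarrow> p (s c x) = t c (p x)"
  using assms by (auto simp: continuous_linear_on_def)

lemma continuous_linear_on_compose:
  assumes "continuous_linear_on s t F G p" "continuous_linear_on t u G H q"
  shows "continuous_linear_on s u F H (\<lambda>x. q (p x))"
  using continuous_linear_onD[OF assms(1)] continuous_linear_onD[OF assms(2)]
    continuous_on_compose2[OF continuous_linear_onD(2)[OF assms(2)] continuous_linear_onD(2)[OF assms(1)]]
  by (simp add: continuous_linear_on_def image_subset_iff)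

lemma continuous_linear_on_minus:
  fixes s :: "'k::real_or_complex \<Rightarrow> 'e::{topological_ab_group_add, t2_space} \<Rightarrow> 'e"
    and t :: "'k \<Rightarrow> 'f::{topological_ab_group_add, t2_space} \<Rightarrow> 'f"
  assumes s: "locally_convex_space s" and t: "locally_convex_space t"
    and p: "continuous_linear_on s t UNIV UNIV p" and q: "continuous_linear_on s t UNIV UNIV q"
  shows "continuous_linear_on s t UNIV UNIV (\<lambda>x. p x - q x)"
proof -
  interpret T: locally_convex_space t by fact
  show ?thesis
    unfolding continuous_linear_on_def
    using continuous_linear_onD[OF p] continuous_linear_onD[OF q]
    by (auto simp: T.scale_right_diff_distrib intro!: continuous_on_diff)
qed

lemma continuous_linear_on_diff:
  fixes s :: "'k::real_or_complex \<Rightarrow> 'e::{topological_ab_group_add, t2_space} \<Rightarrow> 'e"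
    and t :: "'k \<Rightarrow> 'f::{topological_ab_group_add, t2_space} \<Rightarrow> 'f"
  assumes p: "continuous_linear_on s t UNIV UNIV p"
  shows "p (x - y) = p x - p y"
proof -
  have "p (x - y) + p y = p (x - y + y)" by (rule continuous_linear_onD(3)[OF p, symmetric]) simp_all
  then show ?thesis by (simp add: algebra_simps)
qed

text \<open>Composing a chart with a topological linear automorphism stays in the maximal atlas.
  This is what allows the subspace to which the preimage is straightened to be changed.\<close>

lemma manifold_chart_transform:
  fixes s :: "'k::real_or_complex \<Rightarrow> 'e::{topological_ab_group_add, t2_space} \<Rightarrow> 'e"
  assumes s: "locally_convex_space s" and m: "manifold r s UNIV X A" and c: "c \<in> A"
    and \<alpha>: "continuous_linear_on s s UNIV UNIV \<alpha>" and \<alpha>': "continuous_linear_on s s UNIV UNIV \<alpha>'"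
    and inv: "\<And>x. \<alpha>' (\<alpha> x) = x" "\<And>x. \<alpha> (\<alpha>' x) = x"
  shows "Chart UNIV (chart_dom c) (\<lambda>x. \<alpha> (chart_map c x)) \<in> A" (is "?c \<in> A")
proof -
  have F: "module.subspace s UNIV" using m by (simp add: manifold_def)
  have ch: "is_chart UNIV X c" using manifold_base_atlas[OF m] c by (simp add: base_atlas_def)
  have vim: "\<alpha> ` V = \<alpha>' -` V" for V using inv by (auto simp: image_iff) metis
  have c': "is_chart UNIV X ?c"
  proof (rule is_chartI)
    show "inj_on (chart_map ?c) (chart_dom ?c)"
      unfolding chart.sel
    proof (rule inj_onI)
      fix x y assume xy: "x \<in> chart_dom c" "y \<in> chart_dom c" "\<alpha> (chart_map c x) = \<alpha> (chart_map c y)"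
      then have "chart_map c x = chart_map c y" using inv(1) by metis
      then show "x = y" using inj_onD[OF is_chartD(6)[OF ch]] xy by blast
    qed
    show "openin (top_of_set UNIV) (chart_map ?c ` Q)" if "openin X Q" "Q \<subseteq> chart_dom ?c" for Q
    proof -
      have "open (chart_map c ` Q)" using is_chart_open_image[OF ch that(1)] that(2) by simp
      then have "open (\<alpha>' -` (chart_map c ` Q))"
        using continuous_linear_onD(2)[OF \<alpha>'] by (rule open_vimage)
      moreover have "chart_map ?c ` Q = \<alpha>' -` (chart_map c ` Q)" unfolding vim[symmetric] by (simp add: image_image)
      ultimately show ?thesis by simp
    qed
    show "openin X {x \<in> chart_dom ?c. chart_map ?c x \<in> V}" if "openin (top_of_set UNIV) V" for V
    proof -
      have "open (\<alpha> -` V)" using that continuous_linear_onD(2)[OF \<alpha>] by (intro open_vimage) simp_all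
      then show ?thesis using is_chart_open_preimage[OF ch, of "\<alpha> -` V"] by simp
    qed
  qed (use is_chartD(2)[OF ch] in simp_all)
  show ?thesis
  proof (rule manifold_chartI[OF s m c c'])
    show "chart_dom ?c \<subseteq> chart_dom c" by simp
    have eqd: "chart_dom ?c \<inter> id -` chart_dom c = chart_dom c" "chart_dom c \<inter> id -` chart_dom ?c = chart_dom c" by auto
    show "Cr_in_charts r s s ?c c id"
    proof (rule Cr_in_chartsI[OF s s F F c' is_chartD(1)[OF ch], where g = \<alpha>'])
      show "openin X (chart_dom ?c \<inter> id -` chart_dom c)" unfolding eqd by (rule is_chartD(2)[OF ch])
      show "Cr_on r s s UNIV UNIV (chart_map ?c ` (chart_dom ?c \<inter> id -` chart_dom c)) \<alpha>'"
        unfolding eqd by (rule Cr_on_linear[OF s s F F \<alpha>' is_chart_open_image[OF c' is_chartD(2)[OF ch]]]) simp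
    qed (simp add: inv)
    show "Cr_in_charts r s s c ?c id"
    proof (rule Cr_in_chartsI[OF s s F F ch is_chartD(1)[OF c'], where g = \<alpha>])
      show "openin X (chart_dom c \<inter> id -` chart_dom ?c)" unfolding eqd by (rule is_chartD(2)[OF ch])
      show "Cr_on r s s UNIV UNIV (chart_map c ` (chart_dom c \<inter> id -` chart_dom ?c)) \<alpha>"
        unfolding eqd by (rule Cr_on_linear[OF s s F F \<alpha> is_chart_open_image[OF ch is_chartD(2)[OF ch]]]) simp
    qed simp
  qed
qed

section \<open>Adapted charts for a submersion and a submanifold of its target\<close>

locale submersion_preimage =
  fixes sE :: "'k::real_or_complex \<Rightarrow> 'e::{topological_ab_group_add, t2_space} \<Rightarrow> 'e"
    and sF :: "'k \<Rightarrow> 'f::{topological_ab_group_add, t2_space} \<Rightarrow> 'f"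
    and r :: regularity
    and M :: "'m topology" and A :: "('m, 'e) chart set"
    and N :: "'n topology" and B :: "('n, 'f) chart set"
    and f :: "'m \<Rightarrow> 'n" and S :: "'n set" and G :: "'f set"
  assumes K: "admissible_regularity TYPE('k) r"
    and sE: "locally_convex_space sE" and sF: "locally_convex_space sF"
    and M: "manifold r sE UNIV M A" and N: "manifold r sF UNIV N B"
    and f: "submersion r sE M A sF N B f" and S: "submanifold sF N B G S"
begin

interpretation E: locally_convex_space sE by (rule sE)
interpretation F: locally_convex_space sF by (rule sF)


lemma chart_A: "c \<in> A \<Longrightarrow> is_chart UNIV M c"
  using manifold_base_atlas[OF M] by (simp add: base_atlas_def)

lemma chart_B: "c \<in> B \<Longrightarrow> is_chart UNIV N c"
  using manifold_base_atlas[OF N] by (simp add: base_atlas_def)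

lemma compatible_A: "c \<in> A \<Longrightarrow> d \<in> A \<Longrightarrow> Cr_in_charts r sE sE c d id"
  using manifold_base_atlas[OF M] by (simp add: base_atlas_def)

lemma compatible_B: "c \<in> B \<Longrightarrow> d \<in> B \<Longrightarrow> Cr_in_charts r sF sF c d id"
  using manifold_base_atlas[OF N] by (simp add: base_atlas_def)

lemma subspace_UNIV_E: "module.subspace sE UNIV"
  using M by (simp add: manifold_def)

lemma subspace_UNIV_F: "module.subspace sF UNIV"
  using N by (simp add: manifold_def)

lemma f_continuous: "continuous_map M N f"
  using f by (simp add: submersion_def Cr_map_def)

lemma f_Cr: "c \<in> A \<Longrightarrow> d \<in> B \<Longrightarrow> Cr_in_charts r sE sF c d f"
  using f by (simp add: submersion_def Cr_map_def)

text \<open>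
  The change of coordinates in \<open>E = ker \<pi> \<oplus> \<sigma>(F)\<close> that is a transition map of \<open>N\<close> in the second
  component.
\<close>

lemma Cr_on_shear:
  assumes \<pi>: "continuous_linear_on sE sF UNIV UNIV \<pi>" and \<sigma>: "continuous_linear_on sF sE UNIV UNIV \<sigma>"
    and d: "d \<in> B" "d' \<in> B" and U: "open U" and im: "\<pi> ` U \<subseteq> chart_map d ` (chart_dom d \<inter> chart_dom d')"
  shows "Cr_on r sE sE UNIV UNIV U (\<lambda>e. e - \<sigma> (\<pi> e) + \<sigma> (local_rep d d' id (\<pi> e)))"
proof -
  note UE = subspace_UNIV_E and UF = subspace_UNIV_F
  let ?V = "chart_map d ` (chart_dom d \<inter> chart_dom d')"
  have U': "openin (top_of_set UNIV) U" using U by simp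
  have Q: "openin N (chart_dom d \<inter> chart_dom d')"
    by (rule openin_Int[OF is_chartD(2)[OF chart_B[OF d(1)]] is_chartD(2)[OF chart_B[OF d(2)]]])
  have V: "openin (top_of_set UNIV) ?V" by (rule is_chart_open_image[OF chart_B[OF d(1)] Q]) simp
  have t: "Cr_on r sF sF UNIV UNIV ?V (local_rep d d' id)"
    using compatible_B[OF d] by (simp add: Cr_in_charts_def is_chartD(1)[OF chart_B[OF d(1)]] is_chartD(1)[OF chart_B[OF d(2)]])
  have "Cr_on r sE sF UNIV UNIV U \<pi>" by (rule Cr_on_linear[OF sE sF UE UF \<pi> U'])
  from Cr_on_compose(1)[OF sE sF sF UE UF UF U' V t this im]
  have 1: "Cr_on r sE sF UNIV UNIV U (\<lambda>e. local_rep d d' id (\<pi> e))" .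
  have O: "openin (top_of_set UNIV) (UNIV :: 'f set)" by simp
  have "Cr_on r sF sE UNIV UNIV UNIV \<sigma>" by (rule Cr_on_linear[OF sF sE UF UE \<sigma> O])
  from Cr_on_compose(1)[OF sE sF sE UE UF UE U' O this 1 subset_UNIV]
  have 2: "Cr_on r sE sE UNIV UNIV U (\<lambda>e. \<sigma> (local_rep d d' id (\<pi> e)))" .
  have "Cr_on r sE sE UNIV UNIV U (\<lambda>e. e - \<sigma> (\<pi> e))"
    by (rule Cr_on_linear[OF sE sE UE UE continuous_linear_on_minus[OF sE sE continuous_linear_on_id[OF order_refl]
            continuous_linear_on_compose[OF \<pi> \<sigma>]] U'])
  from Cr_on_add[OF sE sE UE UE U' this 2] show ?thesis .
qed

text \<open>The charts of the submersion and the chart straightening \<open>S\<close> are given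
  independently. The chart of \<open>M\<close> is altered in the direction of
  \<open>\<sigma>\<close> alone, so as to absorb the transition from \<open>d\<close> to
  \<open>d'\<close>.\<close>

lemma adapted_exists:
  assumes x: "x \<in> topspace M" "f x \<in> S"
  obtains c d \<pi> \<sigma> where "adapted sE sF A B f S G c d \<pi> \<sigma>" "x \<in> chart_dom c"
proof -
  note UE = subspace_UNIV_E and UF = subspace_UNIV_F
  obtain c d \<pi> \<sigma> where c: "c \<in> A" and d: "d \<in> B" and xc: "x \<in> chart_dom c" "f x \<in> chart_dom d"
    and fc: "f ` chart_dom c \<subseteq> chart_dom d"
    and \<pi>': "continuous_linear_on sE sF (chart_model c) (chart_model d) \<pi>"
    and \<sigma>': "continuous_linear_on sF sE (chart_model d) (chart_model c) \<sigma>"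
    and \<pi>\<sigma>': "\<forall>w\<in>chart_model d. \<pi> (\<sigma> w) = w" and rep: "\<forall>v\<in>chart_image c. local_rep c d f v = \<pi> v"
    using f x(1) unfolding submersion_def by blast
  have "\<exists>d'\<in>B. f x \<in> chart_dom d' \<and> chart_map d' ` (chart_dom d' \<inter> S) = chart_image d' \<inter> G"
    using S x(2) by (simp add: submanifold_def)
  then obtain d' where d': "d' \<in> B" "f x \<in> chart_dom d'" "chart_map d' ` (chart_dom d' \<inter> S) = chart_image d' \<inter> G"
    by blast
  note cC = chart_A[OF c] and dC = chart_B[OF d] and d'C = chart_B[OF d'(1)]
  have \<pi>: "continuous_linear_on sE sF UNIV UNIV \<pi>" and \<sigma>: "continuous_linear_on sF sE UNIV UNIV \<sigma>"
    and \<pi>\<sigma>: "\<And>w. \<pi> (\<sigma> w) = w"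
    using \<pi>' \<sigma>' \<pi>\<sigma>' is_chartD(1)[OF cC] is_chartD(1)[OF dC] by simp_all
  note \<pi>add = continuous_linear_onD(3)[OF \<pi> UNIV_I UNIV_I] and \<sigma>add = continuous_linear_onD(3)[OF \<sigma> UNIV_I UNIV_I]
    and \<pi>diff = continuous_linear_on_diff[OF \<pi>] and \<sigma>diff = continuous_linear_on_diff[OF \<sigma>]
  have rep': "chart_map d (f m) = \<pi> (chart_map c m)" if "m \<in> chart_dom c" for m
    using rep that by (metis chart_image_def image_eqI local_rep_map[OF cC])
  define Q where "Q = chart_dom c \<inter> f -` chart_dom d'"
  have Q: "openin M Q" unfolding Q_def by (rule openin_dom_preimage[OF cC f_continuous is_chartD(2)[OF d'C] is_chartD(2)[OF cC]])
  have Qc: "Q \<subseteq> chart_dom c" by (simp add: Q_def)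
  \<comment> \<open>The component \<open>\<sigma> (\<pi> _)\<close> of the old chart is replaced by
    \<open>\<sigma>\<close> of the new coordinate of \<open>f m\<close>, so that applying
    \<open>\<pi>\<close> gives \<open>chart_map d' (f m)\<close>.\<close>
  define \<psi> where "\<psi> m = chart_map c m - \<sigma> (\<pi> (chart_map c m)) + \<sigma> (chart_map d' (f m))" for m
  define c' where "c' = Chart UNIV Q \<psi>"
  \<comment> \<open>\<open>\<Psi>\<close> is the transition from \<open>c\<close> to the new chart,
    and \<open>\<Theta>\<close>, with \<open>d\<close> and \<open>d'\<close> exchanged, is the
    transition back.\<close>
  define \<Psi> where "\<Psi> e = e - \<sigma> (\<pi> e) + \<sigma> (local_rep d d' id (\<pi> e))" for e
  define \<Theta> where "\<Theta> e = e - \<sigma> (\<pi> e) + \<sigma> (local_rep d' d id (\<pi> e))" for e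
  have Qf: "m \<in> chart_dom c" "f m \<in> chart_dom d" "f m \<in> chart_dom d'" if "m \<in> Q" for m
    using that fc by (auto simp: Q_def)
  have \<pi>\<psi>: "\<pi> (\<psi> m) = chart_map d' (f m)" for m by (simp add: \<psi>_def \<pi>add \<pi>diff \<pi>\<sigma>)
  have \<Psi>_eq: "\<Psi> (chart_map c m) = \<psi> m" if "m \<in> Q" for m
    using local_rep_map[OF dC Qf(2)[OF that], of d' id] rep'[OF Qf(1)[OF that]]
    by (simp add: \<Psi>_def \<psi>_def)
  have \<Theta>_eq: "\<Theta> (\<psi> m) = chart_map c m" if "m \<in> Q" for m
    using local_rep_map[OF d'C Qf(3)[OF that], of d id] rep'[OF Qf(1)[OF that]]
    unfolding \<Theta>_def \<pi>\<psi> by (simp add: \<psi>_def)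
  \<comment> \<open>The natural open domain of \<open>\<Theta>\<close>. It may exceed the image of
    the new chart.\<close>
  define W where "W = \<pi> -` (chart_map d' ` (chart_dom d' \<inter> chart_dom d))"
  have W: "open W" unfolding W_def
  proof (rule open_vimage)
    show "open (chart_map d' ` (chart_dom d' \<inter> chart_dom d))"
      using is_chart_open_image[OF d'C openin_Int[OF is_chartD(2)[OF d'C] is_chartD(2)[OF dC]]] by simp
  qed (rule continuous_linear_onD(2)[OF \<pi>])
  have \<Theta>_Cr: "Cr_on r sE sE UNIV UNIV W \<Theta>"
    unfolding \<Theta>_def by (rule Cr_on_shear[OF \<pi> \<sigma> d'(1) d W]) (auto simp: W_def)
  have cQ: "open (chart_map c ` Q)" using is_chart_open_image[OF cC Q Qc] by simp
  have \<Psi>_Cr: "Cr_on r sE sE UNIV UNIV (chart_map c ` Q) \<Psi>"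
    unfolding \<Psi>_def
  proof (rule Cr_on_shear[OF \<pi> \<sigma> d d'(1) cQ])
    show "\<pi> ` chart_map c ` Q \<subseteq> chart_map d ` (chart_dom d \<inter> chart_dom d')"
    proof (intro image_subsetI)
      fix y assume "y \<in> chart_map c ` Q"
      then obtain m where m: "m \<in> Q" "y = chart_map c m" by blast
      then have "\<pi> y = chart_map d (f m)" using rep'[OF Qf(1)] by simp
      then show "\<pi> y \<in> chart_map d ` (chart_dom d \<inter> chart_dom d')" using Qf[OF m(1)] by blast
    qed
  qed
  \<comment> \<open>Images under \<open>\<psi>\<close> become preimages under the continuous
    \<open>\<Theta>\<close> and are thus open. For the harder inclusion, injectivity of
    \<open>d\<close> identifies the point \<open>n\<close> behind \<open>\<pi> e\<close> with
    \<open>f m\<close>.\<close>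
  have img: "\<psi> ` Q' = {e \<in> W. \<Theta> e \<in> chart_map c ` Q'}" if Q': "Q' \<subseteq> Q" for Q'
  proof
    show "\<psi> ` Q' \<subseteq> {e \<in> W. \<Theta> e \<in> chart_map c ` Q'}"
      using Qf Q' \<Theta>_eq by (auto simp: W_def \<pi>\<psi> subset_iff)
    show "{e \<in> W. \<Theta> e \<in> chart_map c ` Q'} \<subseteq> \<psi> ` Q'"
    proof
      fix e assume "e \<in> {e \<in> W. \<Theta> e \<in> chart_map c ` Q'}"
      then obtain m n where m: "m \<in> Q'" "\<Theta> e = chart_map c m" and n: "n \<in> chart_dom d'" "n \<in> chart_dom d" "\<pi> e = chart_map d' n"
        by (auto simp: W_def)
      have mQ: "m \<in> Q" using m(1) Q' by blast
      have l: "local_rep d' d id (\<pi> e) = chart_map d n" unfolding n(3) using local_rep_map[OF d'C n(1), of d id] by simp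
      have "\<pi> (\<Theta> e) = chart_map d n" by (simp add: \<Theta>_def \<pi>add \<pi>diff \<pi>\<sigma> l)
      then have "chart_map d n = chart_map d (f m)" unfolding m(2) rep'[OF Qf(1)[OF mQ]] by simp
      then have nf: "n = f m" using inj_onD[OF is_chartD(6)[OF dC]] n(2) Qf(2)[OF mQ] by blast
      have "\<psi> m = \<Theta> e - \<sigma> (\<pi> (\<Theta> e)) + \<sigma> (\<pi> e)" by (simp add: \<psi>_def m(2) n(3) nf)
      also have "\<dots> = e" unfolding \<open>\<pi> (\<Theta> e) = chart_map d n\<close> by (simp add: \<Theta>_def l)
      finally show "e \<in> \<psi> ` Q'" using m(1) by blast
    qed
  qed
  have c'C: "is_chart UNIV M c'"
  proof (rule is_chartI)
    show "openin M (chart_dom c')" using Q by (simp add: c'_def)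
    show "inj_on (chart_map c') (chart_dom c')"
      unfolding c'_def chart.sel
    proof (rule inj_onI)
      fix m m' assume m: "m \<in> Q" "m' \<in> Q" "\<psi> m = \<psi> m'"
      then have "chart_map c m = chart_map c m'" using \<Theta>_eq by metis
      then show "m = m'" using inj_onD[OF is_chartD(6)[OF cC]] m Qf(1) by blast
    qed
    show "openin (top_of_set UNIV) (chart_map c' ` Q')" if "openin M Q'" "Q' \<subseteq> chart_dom c'" for Q'
    proof -
      have Q'Q: "Q' \<subseteq> Q" using that(2) by (simp add: c'_def)
      have "open (chart_map c ` Q')" using is_chart_open_image[OF cC that(1)] Q'Q Qc by simp
      then have "open (W \<inter> \<Theta> -` (chart_map c ` Q'))"
        using Cr_on_continuous[OF sE sE UE UE \<Theta>_Cr] W by (simp add: continuous_on_open_vimage Int_commute)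
      moreover have "chart_map c' ` Q' = W \<inter> \<Theta> -` (chart_map c ` Q')"
        unfolding c'_def chart.sel img[OF Q'Q] by blast
      ultimately show ?thesis by simp
    qed
    show "openin M {m \<in> chart_dom c'. chart_map c' m \<in> V}" if "openin (top_of_set UNIV) V" for V
    proof -
      have "open (chart_map c ` Q \<inter> \<Psi> -` V)"
        using Cr_on_continuous[OF sE sE UE UE \<Psi>_Cr] cQ that by (simp add: continuous_on_open_vimage Int_commute)
      then have "openin M {m \<in> chart_dom c. chart_map c m \<in> chart_map c ` Q \<inter> \<Psi> -` V}"
        by (intro is_chart_open_preimage[OF cC]) simp
      moreover have "{m \<in> chart_dom c. chart_map c m \<in> chart_map c ` Q \<inter> \<Psi> -` V} = {m \<in> chart_dom c'. chart_map c' m \<in> V}"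
      proof -
        have "m \<in> Q" if "m \<in> chart_dom c" "chart_map c m \<in> chart_map c ` Q" for m
          using inj_on_image_mem_iff[OF is_chartD(6)[OF cC] that(1) Qc] that(2) by simp
        then have "{m \<in> chart_dom c. chart_map c m \<in> chart_map c ` Q \<inter> \<Psi> -` V} = {m \<in> Q. \<Psi> (chart_map c m) \<in> V}"
          using Qc by blast
        then show ?thesis using \<Psi>_eq by (auto simp: c'_def)
      qed
      ultimately show ?thesis by simp
    qed
  qed (simp add: c'_def)
  have "c' \<in> A"
  proof (rule manifold_chartI[OF sE M c c'C])
    show "chart_dom c' \<subseteq> chart_dom c" using Qc by (simp add: c'_def)
    have eqd: "chart_dom c' \<inter> id -` chart_dom c = Q" "chart_dom c \<inter> id -` chart_dom c' = Q" using Qc by (auto simp: c'_def)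
    show "Cr_in_charts r sE sE c' c id"
    proof (rule Cr_in_chartsI[OF sE sE UE UE c'C is_chartD(1)[OF cC], where g = \<Theta>])
      show "openin M (chart_dom c' \<inter> id -` chart_dom c)" unfolding eqd by (rule Q)
      have o: "openin (top_of_set UNIV) (\<psi> ` Q)" using is_chart_open_image[OF c'C Q] by (simp add: c'_def)
      have "Cr_on r sE sE UNIV UNIV (\<psi> ` Q) \<Theta>"
        by (rule Cr_on_subset[OF sE sE UE UE o _ \<Theta>_Cr]) (use img[OF order_refl] in blast)
      then show "Cr_on r sE sE UNIV UNIV (chart_map c' ` (chart_dom c' \<inter> id -` chart_dom c)) \<Theta>"
        unfolding eqd by (simp add: c'_def)
      show "chart_map c (id m) = \<Theta> (chart_map c' m)" if "m \<in> chart_dom c'" for m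
        using that \<Theta>_eq by (simp add: c'_def)
    qed
    show "Cr_in_charts r sE sE c c' id"
    proof (rule Cr_in_chartsI[OF sE sE UE UE cC is_chartD(1)[OF c'C], where g = \<Psi>])
      show "openin M (chart_dom c \<inter> id -` chart_dom c')" unfolding eqd by (rule Q)
      show "Cr_on r sE sE UNIV UNIV (chart_map c ` (chart_dom c \<inter> id -` chart_dom c')) \<Psi>"
        unfolding eqd by (rule \<Psi>_Cr)
      show "chart_map c' (id m) = \<Psi> (chart_map c m)" if "id m \<in> chart_dom c'" for m
        using that \<Psi>_eq by (simp add: c'_def)
    qed
  qed
  moreover have "f ` chart_dom c' \<subseteq> chart_dom d'" by (auto simp: c'_def Q_def)
  ultimately have "adapted sE sF A B f S G c' d' \<pi> \<sigma>"
    unfolding adapted_def using d' \<pi> \<sigma> \<pi>\<sigma> \<pi>\<psi> by (simp add: c'_def)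
  moreover have "x \<in> chart_dom c'" using xc d'(2) by (simp add: c'_def Q_def)
  ultimately show ?thesis by (rule that)
qed

abbreviation "adapt \<equiv> adapted sE sF A B f S G"

definition "preim = {x \<in> topspace M. f x \<in> S}"

lemma adaptD:
  assumes "adapt c d \<pi> \<sigma>"
  shows "c \<in> A" "d \<in> B" "f ` chart_dom c \<subseteq> chart_dom d" "continuous_linear_on sE sF UNIV UNIV \<pi>"
    "continuous_linear_on sF sE UNIV UNIV \<sigma>" "\<pi> (\<sigma> w) = w"
    "x \<in> chart_dom c \<Longrightarrow> chart_map d (f x) = \<pi> (chart_map c x)"
    "chart_map d ` (chart_dom d \<inter> S) = chart_image d \<inter> G"
    "is_chart UNIV M c" "is_chart UNIV N d" "x \<in> chart_dom c \<Longrightarrow> x \<in> topspace M"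
proof -
  show *: "c \<in> A" "d \<in> B" "f ` chart_dom c \<subseteq> chart_dom d" "continuous_linear_on sE sF UNIV UNIV \<pi>"
    "continuous_linear_on sF sE UNIV UNIV \<sigma>" "\<pi> (\<sigma> w) = w"
    "x \<in> chart_dom c \<Longrightarrow> chart_map d (f x) = \<pi> (chart_map c x)"
    "chart_map d ` (chart_dom d \<inter> S) = chart_image d \<inter> G"
    using assms by (simp_all add: adapted_def)
  show c: "is_chart UNIV M c" by (rule chart_A[OF *(1)])
  show "is_chart UNIV N d" by (rule chart_B[OF *(2)])
  show "x \<in> chart_dom c \<Longrightarrow> x \<in> topspace M" using is_chartD(5)[OF c] by blast
qed

lemma G_subspace: "module.subspace sF G" "closed G"
  using S by (simp_all add: submanifold_def)

lemma adapted_mem_iff: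
  assumes a: "adapt c d \<pi> \<sigma>" and y: "y \<in> chart_dom c"
  shows "y \<in> preim \<longleftrightarrow> \<pi> (chart_map c y) \<in> G"
proof -
  have fy: "f y \<in> chart_dom d" using adaptD(3)[OF a] y by blast
  have "f y \<in> S \<longleftrightarrow> chart_map d (f y) \<in> G"
  proof
    assume "f y \<in> S"
    then show "chart_map d (f y) \<in> G" using adaptD(8)[OF a] fy by blast
  next
    assume "chart_map d (f y) \<in> G"
    then have "chart_map d (f y) \<in> chart_map d ` (chart_dom d \<inter> S)"
      unfolding adaptD(8)[OF a] using fy by (simp add: chart_image_def)
    then obtain z where z: "z \<in> chart_dom d \<inter> S" "chart_map d (f y) = chart_map d z" by blast
    then have "f y = z" using inj_onD[OF is_chartD(6)[OF adaptD(10)[OF a]] z(2) fy] by blast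
    then show "f y \<in> S" using z(1) by blast
  qed
  then show ?thesis using adaptD(7)[OF a y] adaptD(11)[OF a y] by (simp add: preim_def)
qed

lemma adapted_image:
  assumes a: "adapt c d \<pi> \<sigma>"
  shows "chart_map c ` (chart_dom c \<inter> preim) = chart_image c \<inter> \<pi> -` G"
  using adapted_mem_iff[OF a] by (auto simp: chart_image_def)

lemma adapted_restrict:
  assumes a: "adapt c d \<pi> \<sigma>" and Q: "openin M Q"
  shows "adapt (Chart UNIV (chart_dom c \<inter> Q) (chart_map c)) d \<pi> \<sigma>"
  using a manifold_chart_restrict[OF sE M adaptD(1)[OF a] Q] by (auto simp: adapted_def)

text \<open>The automorphism is compensated in \<open>\<pi>\<close> and \<open>\<sigma>\<close>; the
  straightened subspace becomes its image under \<open>\<alpha>\<close>.\<close>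

lemma adapted_transform:
  assumes a: "adapt c d \<pi> \<sigma>"
    and \<alpha>: "continuous_linear_on sE sE UNIV UNIV \<alpha>" and \<alpha>': "continuous_linear_on sE sE UNIV UNIV \<alpha>'"
    and inv: "\<And>x. \<alpha>' (\<alpha> x) = x" "\<And>x. \<alpha> (\<alpha>' x) = x"
  shows "adapt (Chart UNIV (chart_dom c) (\<lambda>x. \<alpha> (chart_map c x))) d (\<lambda>x. \<pi> (\<alpha>' x)) (\<lambda>w. \<alpha> (\<sigma> w))"
  unfolding adapted_def
  using adaptD[OF a] manifold_chart_transform[OF sE M adaptD(1)[OF a] \<alpha> \<alpha>' inv]
    continuous_linear_on_compose[OF \<alpha>' adaptD(4)[OF a]] continuous_linear_on_compose[OF adaptD(5)[OF a] \<alpha>]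
  by (simp add: inv)

lemma adapted_subspace:
  assumes a: "adapt c d \<pi> \<sigma>"
  shows "module.subspace sE (\<pi> -` G)" "closed (\<pi> -` G)"
proof -
  note \<pi> = continuous_linear_onD[OF adaptD(4)[OF a]]
  have "\<pi> 0 = 0" using \<pi>(3)[of 0 0] by simp
  then show "module.subspace sE (\<pi> -` G)"
    using F.subspace_add[OF G_subspace(1)] F.subspace_scale[OF G_subspace(1)] F.subspace_0[OF G_subspace(1)]
    by (intro E.subspaceI) (simp_all add: \<pi>(3,4))
  show "closed (\<pi> -` G)" using G_subspace(2) \<pi>(2) by (rule closed_vimage)
qed

definition "transition c1 c2 y = dir_deriv sE sE (local_rep c1 c2 id) (chart_map c1 y)"

lemma transition_linear:
  assumes "c1 \<in> A" "c2 \<in> A" "y \<in> chart_dom c1" "y \<in> chart_dom c2"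
  shows "continuous_linear_on sE sE UNIV UNIV (transition c1 c2 y)"
  unfolding transition_def
  by (rule dir_deriv_local_rep(1)[OF K sE sE subspace_UNIV_E subspace_UNIV_E chart_A[OF assms(1)] chart_A[OF assms(2)]
        continuous_map_id compatible_A[OF assms(1,2)] assms(3)]) (simp add: assms)

text \<open>The chain rule applied to the factorization of the identity through the second
  chart.\<close>

lemma transition_inverse:
  assumes "c1 \<in> A" "c2 \<in> A" "y \<in> chart_dom c1" "y \<in> chart_dom c2"
  shows "transition c2 c1 y (transition c1 c2 y v) = v"
proof -
  note U = subspace_UNIV_E and C = chart_A[OF assms(1)] chart_A[OF assms(2)]
  have "dir_deriv sE sE (local_rep c1 c1 (id \<circ> id)) (chart_map c1 y) v = transition c2 c1 y (transition c1 c2 y v)"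
    unfolding transition_def
    using dir_deriv_local_rep_compose[OF K sE sE sE U U U C(1) C(2) C(1) continuous_map_id continuous_map_id
        compatible_A[OF assms(1,2)] compatible_A[OF assms(2,1)] assms(3)] assms by simp
  moreover have "dir_deriv sE sE (local_rep c1 c1 (id \<circ> id)) (chart_map c1 y) v = v"
    by (rule dir_deriv_local_rep_linear[OF sE sE U C(1) continuous_linear_on_id[OF order_refl] _ assms(3)]) simp_all
  ultimately show ?thesis by simp
qed

text \<open>
  Difference quotients of the transition map along the model space of one chart stay in the model
  space of the other, which is closed.
\<close>

lemma transition_models:
  assumes a1: "adapt c1 d1 \<pi>1 \<sigma>1" and a2: "adapt c2 d2 \<pi>2 \<sigma>2"
    and y: "y \<in> chart_dom c1" "y \<in> chart_dom c2" "y \<in> preim" and v: "\<pi>1 v \<in> G"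
  shows "\<pi>2 (transition c1 c2 y v) \<in> G"
proof -
  note U = subspace_UNIV_E and C1 = adaptD(9)[OF a1] and C2 = adaptD(9)[OF a2]
  note lin1 = continuous_linear_onD[OF adaptD(4)[OF a1]]
  let ?W = "chart_map c1 ` (chart_dom c1 \<inter> chart_dom c2)"
  note S2 = adapted_subspace[OF a2]
  have W: "openin (top_of_set UNIV) ?W"
    by (rule is_chart_open_image[OF C1 openin_Int[OF is_chartD(2)[OF C1] is_chartD(2)[OF C2]]]) simp
  have yW: "chart_map c1 y \<in> ?W" using y by blast
  have y2: "chart_map c2 y \<in> \<pi>2 -` G" and y1: "\<pi>1 (chart_map c1 y) \<in> G"
    using adapted_mem_iff[OF a2 y(2)] adapted_mem_iff[OF a1 y(1)] y(3) by simp_all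
  have "(diff_quot sE sE (local_rep c1 c2 id) (chart_map c1 y) v \<longlongrightarrow> transition c1 c2 y v) (at 0)"
    unfolding transition_def
    by (rule dir_deriv_local_rep(2)[OF K sE sE U U C1 C2 continuous_map_id compatible_A[OF adaptD(1)[OF a1] adaptD(1)[OF a2]] y(1)])
      (use y in simp_all)
  moreover have "eventually (\<lambda>h. diff_quot sE sE (local_rep c1 c2 id) (chart_map c1 y) v h \<in> \<pi>2 -` G) (at 0)"
  proof -
    have "eventually (\<lambda>h. chart_map c1 y + sE h v \<in> ?W) (at 0)"
      by (rule eventually_in_open_line[OF sE U W yW]) simp
    then show ?thesis
    proof eventually_elim
      case (elim h)
      then obtain z where z: "z \<in> chart_dom c1" "z \<in> chart_dom c2" "chart_map c1 y + sE h v = chart_map c1 z" by blast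
      have "\<pi>1 (chart_map c1 z) \<in> G"
        unfolding z(3)[symmetric] using y1 v F.subspace_add[OF G_subspace(1)] F.subspace_scale[OF G_subspace(1)]
        by (simp add: lin1(3,4))
      then have "chart_map c2 z \<in> \<pi>2 -` G" using adapted_mem_iff[OF a1 z(1)] adapted_mem_iff[OF a2 z(2)] by simp
      then have "sE (inverse h) (chart_map c2 z - chart_map c2 y) \<in> \<pi>2 -` G"
        by (intro E.subspace_scale[OF S2(1)] E.subspace_diff[OF S2(1)] y2)
      then show ?case
        unfolding diff_quot_def z(3) local_rep_map[OF C1 z(1)] local_rep_map[OF C1 y(1)] by simp
    qed
  qed
  ultimately have "transition c1 c2 y v \<in> \<pi>2 -` G"
    by (intro Lim_in_closed_set[OF S2(2)]) (simp_all add: trivial_limit_at)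
  then show ?thesis by simp
qed

section \<open>One model space for each component of the preimage\<close>

definition "models y F' \<longleftrightarrow> (\<exists>c d \<pi> \<sigma>. adapt c d \<pi> \<sigma> \<and> y \<in> chart_dom c \<and> \<pi> -` G = F')"

lemma models_exists:
  assumes "y \<in> preim"
  shows "\<exists>F'. models y F'"
proof -
  obtain c d \<pi> \<sigma> where "adapt c d \<pi> \<sigma>" "y \<in> chart_dom c"
    using assms adapted_exists[of y] unfolding preim_def by blast
  then show ?thesis unfolding models_def by blast
qed

text \<open>
  The differential at \<open>y\<close> of a transition map carries one model space onto the other. Composed
  with it, a chart at \<open>z\<close> modelled on the first becomes a chart modelled on the second.
\<close>

lemma models_transfer:
  assumes y: "y \<in> preim" and 1: "models y F1" and 2: "models y F2" and 3: "models z F1"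
  shows "models z F2"
proof -
  obtain c1 d1 \<pi>1 \<sigma>1 where a1: "adapt c1 d1 \<pi>1 \<sigma>1" "y \<in> chart_dom c1" "\<pi>1 -` G = F1" using 1 unfolding models_def by blast
  obtain c2 d2 \<pi>2 \<sigma>2 where a2: "adapt c2 d2 \<pi>2 \<sigma>2" "y \<in> chart_dom c2" "\<pi>2 -` G = F2" using 2 unfolding models_def by blast
  obtain c3 d3 \<pi>3 \<sigma>3 where a3: "adapt c3 d3 \<pi>3 \<sigma>3" "z \<in> chart_dom c3" "\<pi>3 -` G = F1" using 3 unfolding models_def by blast
  note cA = adaptD(1)[OF a1(1)] adaptD(1)[OF a2(1)]
  let ?T = "transition c1 c2 y" and ?T' = "transition c2 c1 y"
  have inv: "?T' (?T x) = x" "?T (?T' x) = x" for x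
    by (rule transition_inverse[OF cA a1(2) a2(2)], rule transition_inverse[OF cA(2,1) a2(2) a1(2)])
  have "?T' w \<in> F1 \<longleftrightarrow> w \<in> F2" for w
    using transition_models[OF a1(1) a2(1) a1(2) a2(2) y, of "?T' w"] transition_models[OF a2(1) a1(1) a2(2) a1(2) y, of w]
      a1(3) a2(3) by (auto simp: inv)
  then have "(\<lambda>x. \<pi>3 (?T' x)) -` G = F2" using a3(3) by blast
  moreover have "adapt (Chart UNIV (chart_dom c3) (\<lambda>x. ?T (chart_map c3 x))) d3 (\<lambda>x. \<pi>3 (?T' x)) (\<lambda>w. ?T (\<sigma>3 w))"
    by (rule adapted_transform[OF a3(1) transition_linear[OF cA a1(2) a2(2)] transition_linear[OF cA(2,1) a2(2) a1(2)] inv])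
  moreover have "z \<in> chart_dom (Chart UNIV (chart_dom c3) (\<lambda>x. ?T (chart_map c3 x)))" using a3(2) by simp
  ultimately show ?thesis unfolding models_def by blast
qed

text \<open>A relative seminorm ball in the model space is star-shaped about its centre, hence
  connected, and an adapted chart carries it back to the preimage.\<close>

lemma connected_nhd:
  assumes y: "y \<in> preim"
  obtains W where "openin (subtopology M preim) W" "y \<in> W" "connectedin (subtopology M preim) W"
proof -
  let ?X = "subtopology M preim"
  obtain c d \<pi> \<sigma> where a: "adapt c d \<pi> \<sigma>" "y \<in> chart_dom c"
    using y adapted_exists[of y] unfolding preim_def by blast
  define F' where "F' = \<pi> -` G"
  define c' where "c' = Chart F' (chart_dom c \<inter> preim) (chart_map c)"
  have c': "is_chart F' ?X c'"
    unfolding c'_def F'_def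
    by (rule is_chart_adapted[OF adaptD(9)[OF a(1)] subset_UNIV _ adapted_image[OF a(1)]]) (auto simp: preim_def)
  have F': "module.subspace sE F'" unfolding F'_def by (rule adapted_subspace[OF a(1)])
  have yc: "y \<in> chart_dom c'" using a(2) y by (simp add: c'_def)
  define w0 where "w0 = chart_map c' y"
  have w0: "w0 \<in> F'" "w0 \<in> chart_image c'"
    using chart_map_mem[OF c' yc] yc by (simp_all add: w0_def chart_image_def)
  obtain q where q: "cont_seminorm sE q" "{w \<in> F'. q (w - w0) < 1} \<subseteq> chart_image c'"
    using E.seminorm_rel_nhd[OF is_chartD(3)[OF c'] w0(2)] by blast
  define V where "V = {w \<in> F'. q (w - w0) < 1}"
  have "open {w. q (w - w0) < 1}"
    by (intro open_Collect_less continuous_intros continuous_on_compose2[OF cont_seminorm_continuous[OF q(1)]] subset_UNIV)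
  then have V: "openin (top_of_set F') V" by (auto simp: V_def openin_open)
  have w0V: "w0 \<in> V" using w0 E.seminorm_0[OF q(1)] by (simp add: V_def)
  \<comment> \<open>The segments from the centre \<open>w0\<close> all share that point, so their
    union, the ball, is connected.\<close>
  define seg where "seg w = (\<lambda>a::real. w0 + sE (of_real a) (w - w0)) ` {0..1}" for w
  have seg: "connected (seg w)" "w0 \<in> seg w" "w \<in> seg w" "seg w \<subseteq> V" if w: "w \<in> V" for w
  proof -
    show "connected (seg w)" unfolding seg_def
      by (intro connected_continuous_image E.continuous_on_scale continuous_intros) simp
    show "w0 \<in> seg w" unfolding seg_def by (rule image_eqI[of _ _ 0]) simp_all
    show "w \<in> seg w" unfolding seg_def by (rule image_eqI[of _ _ 1]) simp_all
    show "seg w \<subseteq> V" unfolding seg_def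
    proof (intro image_subsetI)
      fix a :: real assume a: "a \<in> {0..1}"
      have "a * q (w - w0) \<le> 1 * q (w - w0)" using a E.seminorm_nonneg[OF q(1)] by (intro mult_right_mono) auto
      moreover have "q (sE (of_real a) (w - w0)) = a * q (w - w0)" using a by (simp add: cont_seminorm_scale[OF q(1)])
      moreover have "w0 + sE (of_real a) (w - w0) \<in> F'"
        using w w0(1) by (intro E.subspace_add[OF F'] E.subspace_scale[OF F'] E.subspace_diff[OF F']) (simp_all add: V_def)
      ultimately show "w0 + sE (of_real a) (w - w0) \<in> V" using w by (simp add: V_def)
    qed
  qed
  have "connected (\<Union>(seg ` V))"
  proof (rule connected_Union)
    show "\<Inter>(seg ` V) \<noteq> {}" using seg(2) w0V by blast
  qed (use seg(1) in blast)
  moreover have "\<Union>(seg ` V) = V" using seg(3,4) by blast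
  ultimately have "connected V" by simp
  define W where "W = {x \<in> chart_dom c'. chart_map c' x \<in> V}"
  have W: "openin ?X W" unfolding W_def by (rule is_chart_open_preimage[OF c' V])
  have VI: "V \<subseteq> chart_image c'" using q(2) by (simp add: V_def)
  have "chart_map c' ` W = V" using VI by (auto simp: W_def chart_image_def)
  then have "connectedin (top_of_set (chart_image c')) (chart_map c' ` W)"
    using \<open>connected V\<close> VI by (simp add: connectedin_subtopology)
  moreover have "W \<subseteq> topspace (subtopology ?X (chart_dom c'))"
    using is_chartD(5)[OF c'] by (auto simp: W_def)
  ultimately have "connectedin (subtopology ?X (chart_dom c')) W"
    using homeomorphic_map_connectedness[OF is_chartD(4)[OF c']] by blast
  then have "connectedin ?X W" by (simp add: connectedin_subtopology)
  moreover have "y \<in> W" using yc w0V by (simp add: W_def w0_def)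
  ultimately show ?thesis using W that by blast
qed

lemma component_open:
  assumes C: "C \<in> connected_components_of (subtopology M preim)"
  shows "openin (subtopology M preim) C"
proof (subst openin_subopen, intro ballI)
  fix y assume y: "y \<in> C"
  then have "y \<in> preim" using connected_components_of_subset[OF C] by auto
  then obtain W where W: "openin (subtopology M preim) W" "y \<in> W" "connectedin (subtopology M preim) W"
    by (rule connected_nhd)
  have "W \<subseteq> C" by (rule connected_components_of_maximal[OF C W(3)]) (use W(2) y in \<open>auto simp: disjnt_def\<close>)
  then show "\<exists>T. openin (subtopology M preim) T \<and> y \<in> T \<and> T \<subseteq> C" using W by blast
qed

text \<open>In the connected set \<open>C\<close>, the points that admit the model \<open>F0\<close>
  form an open set, and so do the others; one point admits \<open>F0\<close>, hence all do.\<close>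

lemma component_models:
  assumes C: "C \<in> connected_components_of (subtopology M preim)"
  shows "\<exists>F'. \<forall>y\<in>C. models y F'"
proof -
  let ?X = "subtopology M preim"
  have CP: "C \<subseteq> preim" using connected_components_of_subset[OF C] by auto
  obtain y0 where y0: "y0 \<in> C" using nonempty_connected_components_of[OF C] by blast
  obtain F0 where F0: "models y0 F0" using models_exists y0 CP by blast
  let ?U = "{y \<in> C. models y F0}" and ?U' = "{y \<in> C. \<not> models y F0}"
  have nhd: "openin ?X (C \<inter> chart_dom c)" if "adapt c d \<pi> \<sigma>" for c d \<pi> \<sigma>
  proof -
    have "C \<inter> chart_dom c = C \<inter> (chart_dom c \<inter> preim)" using CP by blast
    then show ?thesis
      using openin_Int[OF component_open[OF C] openin_subtopology_Int[OF is_chartD(2)[OF adaptD(9)[OF that]], of preim]]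
      by (simp only:)
  qed
  have U: "openin ?X ?U"
  proof (subst openin_subopen, intro ballI)
    fix y assume "y \<in> ?U"
    then obtain c d \<pi> \<sigma> where a: "adapt c d \<pi> \<sigma>" "y \<in> chart_dom c" "\<pi> -` G = F0" and y: "y \<in> C" unfolding models_def by blast
    have "C \<inter> chart_dom c \<subseteq> ?U" using a unfolding models_def by blast
    then show "\<exists>T. openin ?X T \<and> y \<in> T \<and> T \<subseteq> ?U" using nhd[OF a(1)] a(2) y by blast
  qed
  \<comment> \<open>If \<open>y\<close> does not admit \<open>F0\<close>, take a model
    \<open>F1\<close> at \<open>y\<close>; it also serves nearby points \<open>z\<close>. Were
    \<open>F0\<close> a model at such a \<open>z\<close> as well, transfer from \<open>F1\<close> to
    \<open>F0\<close> at \<open>z\<close> would make \<open>F0\<close> a model at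
    \<open>y\<close>.\<close>
  have U': "openin ?X ?U'"
  proof (subst openin_subopen, intro ballI)
    fix y assume y: "y \<in> ?U'"
    then obtain F1 where F1: "models y F1" using models_exists CP by blast
    then obtain c d \<pi> \<sigma> where a: "adapt c d \<pi> \<sigma>" "y \<in> chart_dom c" "\<pi> -` G = F1" unfolding models_def by blast
    have "C \<inter> chart_dom c \<subseteq> ?U'"
    proof
      fix z assume z: "z \<in> C \<inter> chart_dom c"
      then have "models z F1" using a unfolding models_def by blast
      moreover have "z \<in> preim" using z CP by blast
      ultimately have "\<not> models z F0" using models_transfer[of z F1 F0 y] models_transfer[of z F0 F1 y] F1 y by blast
      then show "z \<in> ?U'" using z by blast
    qed
    then show "\<exists>T. openin ?X T \<and> y \<in> T \<and> T \<subseteq> ?U'" using nhd[OF a(1)] a(2) y by blast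
  qed
  have "connectedin ?X C" by (rule connectedin_connected_components_of[OF C])
  moreover have "C \<subseteq> ?U \<union> ?U'" "?U \<inter> ?U' \<inter> C = {}" by blast+
  moreover have "?U \<inter> C \<noteq> {}" using y0 F0 by blast
  ultimately have "?U' \<inter> C = {}" using U U' unfolding connectedin by meson
  then show ?thesis by blast
qed

definition "model_space C = (SOME F'. \<forall>y\<in>C. models y F')"

text \<open>As \<open>C\<close> is open in the preimage, the chart can be shrunk so that its domain
  meets no other component; straightening the preimage then means straightening
  \<open>C\<close>.\<close>

lemma component_chart:
  assumes C: "C \<in> connected_components_of (subtopology M preim)" and y: "y \<in> C"
  obtains c d \<pi> \<sigma> where "adapt c d \<pi> \<sigma>" "y \<in> chart_dom c" "\<pi> -` G = model_space C"
    "chart_dom c \<inter> preim = chart_dom c \<inter> C"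
proof -
  have "\<forall>y\<in>C. models y (model_space C)" unfolding model_space_def by (rule someI_ex[OF component_models[OF C]])
  then obtain c d \<pi> \<sigma> where a: "adapt c d \<pi> \<sigma>" "y \<in> chart_dom c" "\<pi> -` G = model_space C"
    using y unfolding models_def by blast
  obtain Q where Q: "openin M Q" "C = Q \<inter> preim"
    using component_open[OF C, unfolded openin_subtopology] by (elim exE conjE) (rule that)
  show ?thesis
    by (rule that[OF adapted_restrict[OF a(1) Q(1)]]) (use a y Q(2) in auto)
qed

end

text \<open>In a restricted chart the inclusion has the inclusion of \<open>F\<close> as its
  differential. The atlas \<open>A'\<close> may contain further charts elsewhere, as does the atlas
  of a submanifold with several components; only its charts around \<open>x\<close> enter.\<close>

lemma embedded_tangent_space_eq:
  fixes s :: "'k::real_or_complex \<Rightarrow> 'e::{topological_ab_group_add, t2_space} \<Rightarrow> 'e" and x :: 'm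
  assumes K: "admissible_regularity TYPE('k) r" and s: "locally_convex_space s"
    and m: "manifold r s UNIV X A" and N: "submanifold s X A F N"
    and A': "\<And>c. c \<in> A' \<Longrightarrow> x \<in> chart_dom c \<Longrightarrow> c \<in> submanifold_atlas r s X A F N"
    and c: "c \<in> A" "Chart F (chart_dom c \<inter> N) (chart_map c) \<in> A'" "x \<in> chart_dom c" "x \<in> N"
  shows "embedded_tangent_space s A A' x = tangent_class s A x c ` F"
proof -
  let ?c = "Chart F (chart_dom c \<inter> N) (chart_map c)"
  note F = submanifold_subspace(1)[OF s m N] and U = UNIV_subspace[OF s m N]
  have aA: "atlas_at r s UNIV X A x"
    using manifold_base_atlas[OF m] by (simp add: atlas_at_def base_atlas_def)
  have aA': "atlas_at r s F (subtopology X N) A' x"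
    unfolding atlas_at_def using submanifold_atlas_is_chart[OF s m N] submanifold_atlas_compatible[OF s m N] A' by blast
  have xc: "x \<in> chart_dom ?c" using c by simp
  have chc: "is_chart F (subtopology X N) ?c" by (rule submanifold_atlas_is_chart[OF s m N A'[OF c(2) xc]])
  have "tangent_map s s A id x (tangent_class s A' x ?c v) = tangent_class s A x c v" if v: "v \<in> F" for v
  proof -
    have "tangent_map s s A id x (tangent_class s A' x ?c v) =
        tangent_class s A (id x) c (dir_deriv s s (local_rep ?c c id) (chart_map ?c x) v)"
    proof (rule tangent_map_class[OF K s s F U aA' c(2) xc _ c(1) _ _ _ v])
      show "atlas_at r s UNIV X A (id x)" "id x \<in> chart_dom c" using aA c by simp_all
      show "continuous_map (subtopology X N) X id" by (intro continuous_map_from_subtopology continuous_map_id)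
      show "Cr_in_charts r s s d e id" if "d \<in> A'" "x \<in> chart_dom d" "e \<in> A" for d e
        by (rule submanifold_inclusion[OF s m N A'[OF that(1,2)] that(3)])
    qed
    also have "dir_deriv s s (local_rep ?c c id) (chart_map ?c x) v = v"
      by (rule dir_deriv_local_rep_linear[OF s s F chc continuous_linear_on_id[OF order_refl] _ xc v]) simp
    finally show ?thesis unfolding id_apply .
  qed
  then show ?thesis
    unfolding embedded_tangent_space_def tangent_space_eq[OF K s F aA' c(2) xc] by (auto simp: image_image)
qed

context submersion_preimage
begin

interpretation E: locally_convex_space sE by (rule sE)
interpretation F: locally_convex_space sF by (rule sF)

section \<open>Structure of the preimage: submersion, tangent spaces, codimension, splitting\<close>

lemma component_submanifold:
  assumes C: "C \<in> connected_components_of (subtopology M preim)"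
  shows "submanifold sE M A (model_space C) C"
proof -
  have CP: "C \<subseteq> preim" using connected_components_of_subset[OF C] by auto
  obtain y0 where y0: "y0 \<in> C" using nonempty_connected_components_of[OF C] by blast
  obtain c0 d0 \<pi>0 \<sigma>0 where a0: "adapt c0 d0 \<pi>0 \<sigma>0" "y0 \<in> chart_dom c0" "\<pi>0 -` G = model_space C"
    "chart_dom c0 \<inter> preim = chart_dom c0 \<inter> C" by (rule component_chart[OF C y0])
  show ?thesis
    unfolding submanifold_def
  proof (intro conjI ballI)
    show "C \<subseteq> topspace M" using CP by (auto simp: preim_def)
    show "module.subspace sE (model_space C)" "closed (model_space C)"
      using adapted_subspace[OF a0(1)] a0(3) by simp_all
    fix y assume "y \<in> C"
    then obtain c d \<pi> \<sigma> where a: "adapt c d \<pi> \<sigma>" "y \<in> chart_dom c" "\<pi> -` G = model_space C"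
      "chart_dom c \<inter> preim = chart_dom c \<inter> C" by (rule component_chart[OF C])
    show "\<exists>c\<in>A. y \<in> chart_dom c \<and> chart_map c ` (chart_dom c \<inter> C) = chart_image c \<inter> model_space C"
      using adaptD(1)[OF a(1)] a(2) adapted_image[OF a(1)] unfolding a(3,4) by blast
  qed
qed

lemma preim_np_submanifold: "np_submanifold sE M A model_space preim"
  unfolding np_submanifold_def using component_open component_submanifold by (auto simp: preim_def)

abbreviation "A\<^sub>P \<equiv> np_submanifold_atlas r sE M A model_space preim"
abbreviation "B\<^sub>S \<equiv> submanifold_atlas r sF N B G S"

text \<open>An adapted pair restricts to charts of the component and of \<open>S\<close>. The map
  \<open>\<pi>\<close> takes its preimage of \<open>G\<close> into \<open>G\<close>, and
  \<open>\<sigma>\<close> maps \<open>G\<close> back because \<open>\<pi> (\<sigma> w) = w\<close>;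
  the linear splitting is thus inherited.\<close>

lemma preim_chart:
  assumes C: "C \<in> connected_components_of (subtopology M preim)" and y: "y \<in> C"
  obtains c d \<pi> \<sigma> where "adapt c d \<pi> \<sigma>" "y \<in> chart_dom c" "\<pi> -` G = model_space C"
    "Chart (model_space C) (chart_dom c \<inter> C) (chart_map c) \<in> restricted_charts A (model_space C) C"
    "Chart G (chart_dom d \<inter> S) (chart_map d) \<in> restricted_charts B G S"
    "f ` (chart_dom c \<inter> C) \<subseteq> chart_dom d \<inter> S"
    "continuous_linear_on sE sF (model_space C) G \<pi>" "continuous_linear_on sF sE G (model_space C) \<sigma>"
proof -
  have CP: "C \<subseteq> preim" using connected_components_of_subset[OF C] by auto
  obtain c d \<pi> \<sigma> where a: "adapt c d \<pi> \<sigma>" "y \<in> chart_dom c" "\<pi> -` G = model_space C"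
    "chart_dom c \<inter> preim = chart_dom c \<inter> C" by (rule component_chart[OF C y])
  note \<pi> = continuous_linear_onD[OF adaptD(4)[OF a(1)]] and \<sigma> = continuous_linear_onD[OF adaptD(5)[OF a(1)]]
  show ?thesis
  proof (rule that[OF a(1-3)])
    show "Chart (model_space C) (chart_dom c \<inter> C) (chart_map c) \<in> restricted_charts A (model_space C) C"
      using adaptD(1)[OF a(1)] adapted_image[OF a(1)] unfolding a(3,4) restricted_charts_def by blast
    show "Chart G (chart_dom d \<inter> S) (chart_map d) \<in> restricted_charts B G S"
      using adaptD(2,8)[OF a(1)] unfolding restricted_charts_def by blast
    show "f ` (chart_dom c \<inter> C) \<subseteq> chart_dom d \<inter> S" using adaptD(3)[OF a(1)] CP by (auto simp: preim_def)
    show "continuous_linear_on sE sF (model_space C) G \<pi>"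
      unfolding continuous_linear_on_def a(3)[symmetric]
      using \<pi>(3,4) continuous_on_subset[OF \<pi>(2) subset_UNIV] by auto
    show "continuous_linear_on sF sE G (model_space C) \<sigma>"
      unfolding continuous_linear_on_def a(3)[symmetric]
      using \<sigma>(3,4) adaptD(6)[OF a(1)] continuous_on_subset[OF \<sigma>(2) subset_UNIV] by auto
  qed
qed

lemma preim_component:
  assumes "x \<in> preim"
  obtains C where "C \<in> connected_components_of (subtopology M preim)" "x \<in> C"
proof -
  have "x \<in> \<Union>(connected_components_of (subtopology M preim))"
    unfolding Union_connected_components_of using assms by (simp add: preim_def)
  then show ?thesis using that by blast
qed

lemma f_restricted_continuous:
  assumes "C \<subseteq> preim"
  shows "continuous_map (subtopology M C) (subtopology N S) f"
  using assms by (intro continuous_map_into_subtopology continuous_map_from_subtopology f_continuous) (auto simp: preim_def)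

text \<open>In the restricted adapted charts \<open>f\<close> is the restriction of
  \<open>\<pi>\<close>, which gives both smoothness, after changing charts, and the normal form
  required of a submersion.\<close>

lemma preim_submersion: "submersion r sE (subtopology M preim) A\<^sub>P sF (subtopology N S) B\<^sub>S f"
  unfolding submersion_def Cr_map_def
proof (intro conjI ballI)
  show "continuous_map (subtopology M preim) (subtopology N S) f" by (rule f_restricted_continuous) simp
next
  fix c d assume c: "c \<in> A\<^sub>P" and d: "d \<in> B\<^sub>S"
  obtain C where C: "C \<in> connected_components_of (subtopology M preim)" and cC: "c \<in> submanifold_atlas r sE M A (model_space C) C"
    using c unfolding np_submanifold_atlas_def by blast
  have CP: "C \<subseteq> preim" using connected_components_of_subset[OF C] by auto
  note sub = component_submanifold[OF C]
  note \<Phi> = submanifold_subspace(1)[OF sE M sub]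
  show "Cr_in_charts r sE sF c d f"
  proof (rule Cr_in_charts_atlas[OF sE sF \<Phi> G_subspace(1)
        cC[unfolded submanifold_atlas_def] d[unfolded submanifold_atlas_def] f_restricted_continuous[OF CP]])
    fix x assume "x \<in> topspace (subtopology M C)"
    then have x: "x \<in> C" by simp
    then obtain c d \<pi> \<sigma> where a: "adapt c d \<pi> \<sigma>" "x \<in> chart_dom c" "\<pi> -` G = model_space C"
      and c': "Chart (model_space C) (chart_dom c \<inter> C) (chart_map c) \<in> restricted_charts A (model_space C) C" (is "?c \<in> _")
      and d': "Chart G (chart_dom d \<inter> S) (chart_map d) \<in> restricted_charts B G S" (is "?d \<in> _")
      and fd: "f ` (chart_dom c \<inter> C) \<subseteq> chart_dom d \<inter> S"
      and \<pi>: "continuous_linear_on sE sF (model_space C) G \<pi>"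
      by (rule preim_chart[OF C])
    have cc: "is_chart (model_space C) (subtopology M C) ?c" using c' by (rule restricted_chartsE[OF sE M sub])
    have cd: "is_chart G (subtopology N S) ?d" using d' by (rule restricted_chartsE[OF sF N S])
    have eq: "chart_dom ?c \<inter> f -` chart_dom ?d = chart_dom ?c" using fd by auto
    have "Cr_in_charts r sE sF ?c ?d f"
    proof (rule Cr_in_chartsI[OF sE sF \<Phi> G_subspace(1) cc is_chartD(1)[OF cd]])
      show "openin (subtopology M C) (chart_dom ?c \<inter> f -` chart_dom ?d)" unfolding eq by (rule is_chartD(2)[OF cc])
      show "Cr_on r sE sF (model_space C) G (chart_map ?c ` (chart_dom ?c \<inter> f -` chart_dom ?d)) \<pi>"
        unfolding eq by (rule Cr_on_linear[OF sE sF \<Phi> G_subspace(1) \<pi> is_chart_open_image[OF cc is_chartD(2)[OF cc] order_refl]])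
    qed (simp add: adaptD(7)[OF a(1)])
    moreover have "x \<in> chart_dom ?c" "f x \<in> chart_dom ?d" using x a(2) fd by auto
    ultimately show "\<exists>c'\<in>restricted_charts A (model_space C) C. \<exists>d'\<in>restricted_charts B G S.
        x \<in> chart_dom c' \<and> f x \<in> chart_dom d' \<and> is_chart (model_space C) (subtopology M C) c' \<and>
        is_chart G (subtopology N S) d' \<and> Cr_in_charts r sE sF c' d' f"
      using c' d' cc cd by blast
  qed
next
  fix x assume "x \<in> topspace (subtopology M preim)"
  then have "x \<in> preim" by simp
  then obtain C where C: "C \<in> connected_components_of (subtopology M preim)" "x \<in> C" by (rule preim_component)
  note sub = component_submanifold[OF C(1)]
  obtain c d \<pi> \<sigma> where a: "adapt c d \<pi> \<sigma>" "x \<in> chart_dom c" "\<pi> -` G = model_space C"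
    and c': "Chart (model_space C) (chart_dom c \<inter> C) (chart_map c) \<in> restricted_charts A (model_space C) C" (is "?c \<in> _")
    and d': "Chart G (chart_dom d \<inter> S) (chart_map d) \<in> restricted_charts B G S" (is "?d \<in> _")
    and fd: "f ` (chart_dom c \<inter> C) \<subseteq> chart_dom d \<inter> S"
    and lin: "continuous_linear_on sE sF (model_space C) G \<pi>" "continuous_linear_on sF sE G (model_space C) \<sigma>"
    by (rule preim_chart[OF C])
  have cc: "is_chart (model_space C) (subtopology M C) ?c" using c' by (rule restricted_chartsE[OF sE M sub])
  have "?c \<in> A\<^sub>P"
    unfolding np_submanifold_atlas_def using C(1) c' restricted_charts_subset[OF sE M sub] by blast
  moreover have "?d \<in> B\<^sub>S" using d' restricted_charts_subset[OF sF N S] by blast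
  moreover have "x \<in> chart_dom ?c" "f x \<in> chart_dom ?d" "f ` chart_dom ?c \<subseteq> chart_dom ?d"
    using C(2) a(2) fd by auto
  moreover have "\<forall>v\<in>chart_image ?c. local_rep ?c ?d f v = \<pi> v"
  proof
    fix v assume "v \<in> chart_image ?c"
    then obtain y where y: "y \<in> chart_dom ?c" "v = chart_map ?c y" by (auto simp: chart_image_def)
    show "local_rep ?c ?d f v = \<pi> v"
      unfolding y(2) local_rep_map[OF cc y(1)] using y(1) by (simp add: adaptD(7)[OF a(1)])
  qed
  moreover have "\<forall>w\<in>G. \<pi> (\<sigma> w) = w" using adaptD(6)[OF a(1)] by simp
  ultimately show "\<exists>c\<in>A\<^sub>P. \<exists>d\<in>B\<^sub>S. x \<in> chart_dom c \<and> f x \<in> chart_dom d \<and> f ` chart_dom c \<subseteq> chart_dom d \<and>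
      (\<exists>\<pi> \<sigma>. continuous_linear_on sE sF (chart_model c) (chart_model d) \<pi> \<and>
        continuous_linear_on sF sE (chart_model d) (chart_model c) \<sigma> \<and> (\<forall>w\<in>chart_model d. \<pi> (\<sigma> w) = w) \<and>
        (\<forall>v\<in>chart_image c. local_rep c d f v = \<pi> v))"
    using lin by (intro bexI[of _ ?c] bexI[of _ ?d] conjI exI[of _ \<pi>] exI[of _ \<sigma>]) (simp_all only: chart.sel)
qed

lemma preim_tangent_space:
  assumes x: "x \<in> preim"
  shows "embedded_tangent_space sE A A\<^sub>P x =
    {\<tau> \<in> tangent_space sE A x. tangent_map sE sF B f x \<tau> \<in> embedded_tangent_space sF B B\<^sub>S (f x)}"
proof -
  obtain C where C: "C \<in> connected_components_of (subtopology M preim)" "x \<in> C" using x by (rule preim_component)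
  note sub = component_submanifold[OF C(1)] and UE = subspace_UNIV_E and UF = subspace_UNIV_F
  obtain c d \<pi> \<sigma> where a: "adapt c d \<pi> \<sigma>" "x \<in> chart_dom c" "\<pi> -` G = model_space C"
    and c': "Chart (model_space C) (chart_dom c \<inter> C) (chart_map c) \<in> restricted_charts A (model_space C) C" (is "?c \<in> _")
    and d': "Chart G (chart_dom d \<inter> S) (chart_map d) \<in> restricted_charts B G S" (is "?d \<in> _")
    and fd: "f ` (chart_dom c \<inter> C) \<subseteq> chart_dom d \<inter> S"
    by (rule preim_chart[OF C])
  have fx: "f x \<in> chart_dom d" "f x \<in> S" using fd a(2) C(2) by blast+
  \<comment> \<open>Charts from other components do not contain \<open>x\<close>, since distinct
    components are disjoint.\<close>
  have A': "e \<in> submanifold_atlas r sE M A (model_space C) C" if e: "e \<in> A\<^sub>P" "x \<in> chart_dom e" for e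
  proof -
    obtain C' where C': "C' \<in> connected_components_of (subtopology M preim)" "e \<in> submanifold_atlas r sE M A (model_space C') C'"
      using e(1) unfolding np_submanifold_atlas_def by blast
    have "x \<in> C'"
      using is_chartD(5)[OF submanifold_atlas_is_chart[OF sE M component_submanifold[OF C'(1)] C'(2)]] e(2) by auto
    then have "\<not> disjnt C' C" using C(2) by (auto simp: disjnt_def)
    then have "C' = C" using pairwiseD[OF pairwise_disjoint_connected_components_of C'(1) C(1)] by blast
    then show ?thesis using C'(2) by simp
  qed
  have cA: "?c \<in> A\<^sub>P"
    unfolding np_submanifold_atlas_def using C(1) c' restricted_charts_subset[OF sE M sub] by blast
  have dB: "?d \<in> B\<^sub>S" using d' restricted_charts_subset[OF sF N S] by blast
  have 1: "embedded_tangent_space sE A A\<^sub>P x = tangent_class sE A x c ` model_space C"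
    by (rule embedded_tangent_space_eq[OF K sE M sub A' adaptD(1)[OF a(1)] cA a(2) C(2)])
  have 2: "embedded_tangent_space sF B B\<^sub>S (f x) = tangent_class sF B (f x) d ` G"
    by (rule embedded_tangent_space_eq[OF K sF N S _ adaptD(2)[OF a(1)] dB fx])
  have aA: "atlas_at r sE UNIV M A x"
    using manifold_base_atlas[OF M] by (simp add: atlas_at_def base_atlas_def)
  have aB: "atlas_at r sF UNIV N B (f x)"
    using manifold_base_atlas[OF N] by (simp add: atlas_at_def base_atlas_def)
  have 3: "tangent_space sE A x = range (tangent_class sE A x c)"
    by (rule tangent_space_eq[OF K sE UE aA adaptD(1)[OF a(1)] a(2)])
  have 4: "tangent_map sE sF B f x (tangent_class sE A x c v) = tangent_class sF B (f x) d (\<pi> v)" for v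
  proof -
    have "tangent_map sE sF B f x (tangent_class sE A x c v) =
        tangent_class sF B (f x) d (dir_deriv sE sF (local_rep c d f) (chart_map c x) v)"
      by (rule tangent_map_class[OF K sE sF UE UF aA adaptD(1)[OF a(1)] a(2) aB adaptD(2)[OF a(1)] fx(1) f_continuous f_Cr UNIV_I])
    also have "dir_deriv sE sF (local_rep c d f) (chart_map c x) v = \<pi> v"
      by (rule dir_deriv_local_rep_linear[OF sE sF UE adaptD(9)[OF a(1)] adaptD(4)[OF a(1)] adaptD(7)[OF a(1)] a(2) UNIV_I])
    finally show ?thesis .
  qed
  \<comment> \<open>A tangent vector has unique coordinates in a fixed chart, so membership of the
    class can be tested on the coordinates.\<close>
  have 5: "tangent_class sF B (f x) d w \<in> tangent_class sF B (f x) d ` G \<longleftrightarrow> w \<in> G" for w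
    using tangent_class_inj[OF K sF UF aB adaptD(2)[OF a(1)] fx(1) UNIV_I UNIV_I] by blast
  have 6: "tangent_map sE sF B f x (tangent_class sE A x c v) \<in> tangent_class sF B (f x) d ` G \<longleftrightarrow>
      v \<in> model_space C" for v
    unfolding 4 5 a(3)[symmetric] by simp
  have "T ` V = {\<tau> \<in> range T. \<tau> \<in> Y}" if "\<And>v. T v \<in> Y \<longleftrightarrow> v \<in> V" for T :: "'e \<Rightarrow> (('m, 'e) chart \<times> 'e) set" and V Y
    using that by auto
  from this[of "tangent_class sE A x c" "{\<tau>. tangent_map sE sF B f x \<tau> \<in> tangent_class sF B (f x) d ` G}", unfolded mem_Collect_eq, OF 6]
  show ?thesis unfolding 1 2 3 .
qed

lemma adapted_codim:
  assumes a: "adapt c d \<pi> \<sigma>" and k: "has_codim sF G k"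
  shows "has_codim sE (\<pi> -` G) k"
proof -
  obtain b where b: "finite b" "card b = k" "\<And>c. (\<Sum>x\<in>b. sF (c x) x) \<in> G \<Longrightarrow> \<forall>x\<in>b. c x = 0"
    "\<And>x. \<exists>c. x - (\<Sum>y\<in>b. sF (c y) y) \<in> G"
    using k unfolding has_codim_def by blast
  note \<pi> = continuous_linear_onD[OF adaptD(4)[OF a]] and \<pi>\<sigma> = adaptD(6)[OF a]
  have inj: "inj_on \<sigma> b" by (rule inj_on_inverseI[of _ \<pi>]) (rule \<pi>\<sigma>)
  have \<pi>0: "\<pi> 0 = 0" using \<pi>(3)[of 0 0] by simp
  have \<pi>sum: "\<pi> (sum g I) = (\<Sum>i\<in>I. \<pi> (g i))" for g :: "'e \<Rightarrow> 'e" and I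
    by (induction I rule: infinite_finite_induct) (simp_all add: \<pi>0 \<pi>(3))
  have sum_eq: "\<pi> (\<Sum>x\<in>\<sigma> ` b. sE (c x) x) = (\<Sum>x\<in>b. sF (c (\<sigma> x)) x)" for c
    unfolding \<pi>sum by (simp add: sum.reindex[OF inj] \<pi>(4) \<pi>\<sigma>)
  show ?thesis
    unfolding has_codim_def
  proof (intro exI[of _ "\<sigma> ` b"] conjI allI impI)
    show "finite (\<sigma> ` b)" "card (\<sigma> ` b) = k" using b(1,2) inj by (simp_all add: card_image)
    fix c assume "(\<Sum>x\<in>\<sigma> ` b. sE (c x) x) \<in> \<pi> -` G"
    then show "\<forall>x\<in>\<sigma> ` b. c x = 0" using b(3)[of "\<lambda>x. c (\<sigma> x)"] by (simp add: sum_eq)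
  next
    fix x
    obtain c where c: "\<pi> x - (\<Sum>y\<in>b. sF (c y) y) \<in> G" using b(4) by blast
    have "x - (\<Sum>y\<in>\<sigma> ` b. sE (c (\<pi> y)) y) \<in> \<pi> -` G"
      using c by (simp add: continuous_linear_on_diff[OF adaptD(4)[OF a]] sum_eq \<pi>\<sigma>)
    then show "\<exists>c. x - (\<Sum>y\<in>\<sigma> ` b. sE (c y) y) \<in> \<pi> -` G" by (rule exI[of _ "\<lambda>y. c (\<pi> y)"])
  qed
qed

text \<open>If \<open>C\<close> is a complement of \<open>G\<close>, then \<open>\<sigma>\<close>
  C\<open>is one of\<close>\<pi> -\<open>G\<close>: the kernel of \<open>\<pi>\<close> already lies
  in the latter, and \<open>\<sigma>\<close> embeds what is missing.\<close>

lemma adapted_complemented: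
  assumes a: "adapt c d \<pi> \<sigma>" and G: "complemented sF G"
  shows "complemented sE (\<pi> -` G)"
proof -
  obtain C where C: "module.subspace sF C" "homeomorphic_map (top_of_set (G \<times> C)) euclidean (\<lambda>(x, y). x + y)"
    using G unfolding complemented_def by blast
  obtain g where g: "homeomorphic_maps (top_of_set (G \<times> C)) euclidean (\<lambda>(x, y). x + y) g"
    using C(2) unfolding homeomorphic_map_maps by blast
  note \<pi> = continuous_linear_onD[OF adaptD(4)[OF a]] and \<sigma> = continuous_linear_onD[OF adaptD(5)[OF a]]
    and \<pi>\<sigma> = adaptD(6)[OF a]
  have gc: "continuous_on UNIV g" and gmem: "g w \<in> G \<times> C" and gsum: "fst (g w) + snd (g w) = w" for w
    using g by (auto simp: homeomorphic_maps_def continuous_map_in_subtopology case_prod_unfold Pi_iff)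
  have ginv: "g (x + y) = (x, y)" if "x \<in> G" "y \<in> C" for x y
    using g that by (auto simp: homeomorphic_maps_def)
  \<comment> \<open>The continuous projection onto the new complement: \<open>\<pi> e\<close> is
    decomposed along \<open>G\<close> and \<open>C\<close>, and its component in \<open>C\<close> is
    lifted.\<close>
  define p where "p e = \<sigma> (snd (g (\<pi> e)))" for e
  have p: "continuous_on UNIV p" unfolding p_def
    by (intro continuous_on_compose2[OF \<sigma>(2)] continuous_on_snd continuous_on_compose2[OF gc] \<pi>(2)) simp_all
  have pmem: "p e \<in> \<sigma> ` C" "\<pi> (e - p e) \<in> G" for e
  proof -
    show "p e \<in> \<sigma> ` C" using gmem[of "\<pi> e"] by (auto simp: p_def mem_Times_iff)
    have "\<pi> (e - p e) = fst (g (\<pi> e))"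
      using gsum[of "\<pi> e"] by (simp add: p_def continuous_linear_on_diff[OF adaptD(4)[OF a]] \<pi>\<sigma> algebra_simps)
    then show "\<pi> (e - p e) \<in> G" using gmem[of "\<pi> e"] by (simp add: mem_Times_iff)
  qed
  have peq: "p (x + \<sigma> y) = \<sigma> y" if "\<pi> x \<in> G" "y \<in> C" for x y
    using ginv[OF that] by (simp add: p_def \<pi>(3) \<pi>\<sigma>)
  have \<sigma>0: "\<sigma> 0 = 0" using \<sigma>(3)[of 0 0] by simp
  have "module.subspace sE (\<sigma> ` C)"
  proof (rule E.subspaceI)
    show "0 \<in> \<sigma> ` C" using F.subspace_0[OF C(1)] \<sigma>0 by force
    show "x + y \<in> \<sigma> ` C" if "x \<in> \<sigma> ` C" "y \<in> \<sigma> ` C" for x y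
      using that F.subspace_add[OF C(1)] \<sigma>(3) by (force intro: rev_image_eqI)
    show "sE k x \<in> \<sigma> ` C" if "x \<in> \<sigma> ` C" for k x
      using that F.subspace_scale[OF C(1)] \<sigma>(4) by (force intro: rev_image_eqI)
  qed
  moreover have "homeomorphic_maps (top_of_set (\<pi> -` G \<times> \<sigma> ` C)) euclidean (\<lambda>(x, y). x + y) (\<lambda>e. (e - p e, p e))"
    unfolding homeomorphic_maps_def
  proof (intro conjI ballI)
    show "continuous_map (top_of_set (\<pi> -` G \<times> \<sigma> ` C)) euclidean (\<lambda>(x, y). x + y)"
      by (simp add: case_prod_unfold) (intro continuous_intros)
    show "continuous_map euclidean (top_of_set (\<pi> -` G \<times> \<sigma> ` C)) (\<lambda>e. (e - p e, p e))"
      using pmem by (simp add: continuous_map_in_subtopology) (intro continuous_intros p)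
  qed (auto simp: peq)
  ultimately show ?thesis unfolding complemented_def homeomorphic_map_maps
    by (intro exI[of _ "\<sigma> ` C"] exI[of _ "\<lambda>e. (e - p e, p e)"] conjI)
qed

lemma component_model_space:
  assumes C: "C \<in> connected_components_of (subtopology M preim)"
  shows "\<exists>c d \<pi> \<sigma>. adapt c d \<pi> \<sigma> \<and> \<pi> -` G = model_space C"
proof -
  obtain y where y: "y \<in> C" using nonempty_connected_components_of[OF C] by blast
  obtain c d \<pi> \<sigma> where "adapt c d \<pi> \<sigma>" "y \<in> chart_dom c" "\<pi> -` G = model_space C"
    "chart_dom c \<inter> preim = chart_dom c \<inter> C" by (rule component_chart[OF C y])
  then show ?thesis by blast
qed

lemma component_codim:
  assumes "C \<in> connected_components_of (subtopology M preim)" "has_codim sF G k"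
  shows "has_codim sE (model_space C) k"
  using component_model_space[OF assms(1)] adapted_codim[OF _ assms(2)] by metis

lemma component_complemented:
  assumes "C \<in> connected_components_of (subtopology M preim)" "complemented sF G"
  shows "complemented sE (model_space C)"
  using component_model_space[OF assms(1)] adapted_complemented[OF _ assms(2)] by metis

end

theorem theoremC:
  fixes sE :: "'k::real_or_complex \<Rightarrow> 'e::{topological_ab_group_add, t2_space} \<Rightarrow> 'e"
    and sF :: "'k \<Rightarrow> 'f::{topological_ab_group_add, t2_space} \<Rightarrow> 'f"
    and r :: regularity
    and M :: "'m topology" and A :: "('m, 'e) chart set"
    and N :: "'n topology" and B :: "('n, 'f) chart set"
    and f :: "'m \<Rightarrow> 'n" and S :: "'n set" and G :: "'f set"
  assumes "admissible_regularity TYPE('k) r"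
    and "locally_convex_space sE" and "locally_convex_space sF"
    and "manifold r sE UNIV M A" and "manifold r sF UNIV N B"
    and "submersion r sE M A sF N B f"
    and "submanifold sF N B G S"
  shows "let P = {x \<in> topspace M. f x \<in> S};
             B\<^sub>S = submanifold_atlas r sF N B G S
         in \<exists>\<Phi>. np_submanifold sE M A \<Phi> P \<and>
           (let A\<^sub>P = np_submanifold_atlas r sE M A \<Phi> P in
             submersion r sE (subtopology M P) A\<^sub>P sF (subtopology N S) B\<^sub>S f \<and>
             (\<forall>x\<in>P. embedded_tangent_space sE A A\<^sub>P x =
               {\<tau> \<in> tangent_space sE A x.
                  tangent_map sE sF B f x \<tau> \<in> embedded_tangent_space sF B B\<^sub>S (f x)})) \<and>
           (\<forall>k. has_codim sF G k \<longrightarrow>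
             (\<forall>C\<in>connected_components_of (subtopology M P). has_codim sE (\<Phi> C) k)) \<and>
           (complemented sF G \<longrightarrow>
             (\<forall>C\<in>connected_components_of (subtopology M P). complemented sE (\<Phi> C)))"
proof -
  interpret P: submersion_preimage sE sF r M A N B f S G
    by (intro submersion_preimage.intro assms)
  show ?thesis
    unfolding Let_def P.preim_def[symmetric]
    by (intro exI[of _ P.model_space] conjI allI impI ballI P.preim_np_submanifold P.preim_submersion
        P.preim_tangent_space P.component_codim P.component_complemented)
qed

end
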